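(* Let $\kappa \in \mathbb{Z}$, $\kappa<0$, let $c\in(\kappa,0)$, and let $\lambda_0\in\mathbb{R}$. Let $H_0$ be the distinguished self-adjoint realisation in $L^2((0,\infty))^2$ of the Coulomb-Dirac operator $$H_0=-i\sigma_2\frac{d}{dr}+\sigma_3+\frac{\kappa}{r}\sigma_1+\frac{c}{r},$$ and for $a<0$ let $H_a$ be the unique self-adjoint realisation in $L^2((0,\infty))^2$ of $$H_a=-i\sigma_2\frac{d}{dr}+\sigma_3+\Big(\frac{\kappa}{r}+\frac{a}{r^2}\Big)\sigma_1+\frac{c}{r}.$$ Let $0<\varepsilon<\tfrac12\operatorname{dist}(\lambda_0,\sigma(H_0)\setminus\{\lambda_0\})$. Then there is $\delta>0$ such that for all $a\in(-\delta,0)$: (i) if $\lambda_0$ is an eigenvalue of $H_0$, then $H_a$ has exactly one eigenvalue in $(\lambda_0-\varepsilon,\lambda_0+\varepsilon)$; (ii) if $\lambda_0$ is not an eigenvalue of $H_0$, then $H_a$ has no eigenvalue in $(\lambda_0-\varepsilon,\lambda_0+\varepsilon)$.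
   Context: $\sigma_1=\begin{pmatrix}0&1\\1&0\end{pmatrix}$, $\sigma_2=\begin{pmatrix}0&-i\\i&0\end{pmatrix}$, $\sigma_3=\begin{pmatrix}1&0\\0&-1\end{pmatrix}$ are the Pauli matrices; scalar terms such as $c/r$ are multiplied by the $2\times2$ identity matrix. $\sigma(H_0)$ denotes the spectrum of $H_0$. For $a\ne0$ the differential expression $H_a$ is essentially self-adjoint on $C_0^\infty((0,\infty))^2$ (known fact), and $H_a$ denotes its unique self-adjoint realisation (the closure). For $a=0$ and $c^2<\kappa^2$, put $s=\sqrt{\kappa^2-c^2}>0$. The eigenvalue equation $H_0u=\lambda u$ (as an ordinary differential system, $\lambda$ real) has, up to constant multiples, a unique nontrivial solution $u$ with $|u(r)|\sim \mathrm{const}\cdot r^{s}$ as $r\to0$, called the principal solution at $0$, while all solutions that are not multiples of it satisfy $|v(r)|\sim\mathrm{const}\cdot r^{-s}$. The distinguished self-adjoint realisation of $H_0$ is the one whose domain consists of the functions $f=(f_1,f_2)\in L^2((0,\infty))^2$, locally absolutely continuous, with $H_0f\in L^2((0,\infty))^2$, which behave like the principal solution at $0$, i.e. $\lim_{r\to0}(f_1u_2-f_2u_1)(r)=0$ for a (real-valued) principal solution $u=(u_1,u_2)$ at $0$. (If $c^2\le\kappa^2-\frac14$, this boundary condition is automatically satisfied and $H_0$ is essentially self-adjoint on $C_0^\infty((0,\infty))^2$.) *)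

theory Defs
  imports "HOL-Analysis.Analysis" "HOL-Library.Landau_Symbols"
begin

section \<open>The Hilbert space of square-integrable spinors on the half-line\<close>

text \<open>
  Elements of $L^2((0,\infty))^2$ are represented by functions, considered modulo equality
  almost everywhere on $(0,\infty)$; values at $r \le 0$ are irrelevant.
\<close>

type_synonym spinor = "real \<Rightarrow> complex ^ 2"

abbreviation half_line :: "real measure" where
  "half_line \<equiv> lebesgue_on {0<..}"

definition L2_space :: "spinor set" where
  "L2_space = {f. f \<in> borel_measurable half_line \<and> integrable half_line (\<lambda>r. (norm (f r))\<^sup>2)}"

definition L2_norm :: "spinor \<Rightarrow> real" where
  "L2_norm f = sqrt (integral\<^sup>L half_line (\<lambda>r. (norm (f r))\<^sup>2))"

section \<open>Unbounded operators, eigenvalues, spectrum\<close>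

text \<open>
  An operator is represented by its graph: \<open>(f, g) \<in> T\<close> means that \<open>f\<close> lies in the domain
  of \<open>T\<close> and that \<open>T f = g\<close> almost everywhere.
\<close>

type_synonym operator = "(spinor \<times> spinor) set"

definition eigenvalue :: "operator \<Rightarrow> complex \<Rightarrow> bool" where
  "eigenvalue T z \<longleftrightarrow>
     (\<exists>(f, g) \<in> T. \<not> (AE r in half_line. f r = 0) \<and> (AE r in half_line. g r = z *s f r))"

text \<open>
  \<open>T - z\<close> is required to be a bijection from the domain onto the whole space with bounded
  inverse; injectivity is contained in the norm estimate.
\<close>

definition resolvent_set :: "operator \<Rightarrow> complex set" where
  "resolvent_set T = {z.
     (\<forall>h \<in> L2_space. \<exists>(f, g) \<in> T. AE r in half_line. g r - z *s f r = h r) \<and>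
     (\<exists>C. \<forall>(f, g) \<in> T. L2_norm f \<le> C * L2_norm (\<lambda>r. g r - z *s f r))}"

definition spectrum :: "operator \<Rightarrow> complex set" where
  "spectrum T = - resolvent_set T"

definition closure_op :: "operator \<Rightarrow> operator" where
  "closure_op T = {(f, g). f \<in> L2_space \<and> g \<in> L2_space \<and>
     (\<exists>\<phi> \<psi>. (\<forall>n::nat. (\<phi> n, \<psi> n) \<in> T) \<and>
        (\<lambda>n. L2_norm (\<lambda>r. \<phi> n r - f r)) \<longlonglongrightarrow> 0 \<and>
        (\<lambda>n. L2_norm (\<lambda>r. \<psi> n r - g r)) \<longlonglongrightarrow> 0)}"

section \<open>The Dirac differential expression\<close>

definition pauli1 :: "complex ^ 2 ^ 2" where
  "pauli1 = vector [vector [0, 1], vector [1, 0]]"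

definition pauli2 :: "complex ^ 2 ^ 2" where
  "pauli2 = vector [vector [0, - \<i>], vector [\<i>, 0]]"

definition pauli3 :: "complex ^ 2 ^ 2" where
  "pauli3 = vector [vector [1, 0], vector [0, - 1]]"

definition dirac_expr :: "real \<Rightarrow> real \<Rightarrow> real \<Rightarrow> spinor \<Rightarrow> spinor" where
  "dirac_expr \<kappa> c a u r =
     (- \<i>) *s (pauli2 *v vector_derivative u (at r))
     + pauli3 *v u r
     + complex_of_real (\<kappa> / r + a / r\<^sup>2) *s (pauli1 *v u r)
     + complex_of_real (c / r) *s u r"

lemma dirac_expr_components:
  "dirac_expr \<kappa> c a u r $ 1 = - (vector_derivative u (at r) $ 2) + u r $ 1
     + complex_of_real (\<kappa> / r + a / r\<^sup>2) * u r $ 2 + complex_of_real (c / r) * u r $ 1"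
  "dirac_expr \<kappa> c a u r $ 2 = vector_derivative u (at r) $ 1 - u r $ 2
     + complex_of_real (\<kappa> / r + a / r\<^sup>2) * u r $ 1 + complex_of_real (c / r) * u r $ 2"
  by (simp_all add: dirac_expr_def pauli1_def pauli2_def pauli3_def
      matrix_vector_mult_def sum_2 distrib_right flip: mult.assoc)

section \<open>The self-adjoint realisations\<close>

definition smooth_fun :: "spinor \<Rightarrow> bool" where
  "smooth_fun \<phi> \<longleftrightarrow>
     (\<forall>n r. (((\<lambda>f t. vector_derivative f (at t)) ^^ n) \<phi>) differentiable (at r))"

text \<open>
  Functions in $C_0^\infty((0,\infty))^2$, extended by zero to the real line.
\<close>

definition test_functions :: "spinor set" where
  "test_functions = {\<phi>. smooth_fun \<phi> \<and>
     compact (closure {r. \<phi> r \<noteq> 0}) \<and> closure {r. \<phi> r \<noteq> 0} \<subseteq> {0<..}}"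

text \<open>
  The realisation for \<open>a \<noteq> 0\<close>, where the differential expression is essentially self-adjoint
  on the test functions.
\<close>

definition dirac_op :: "real \<Rightarrow> real \<Rightarrow> real \<Rightarrow> operator" where
  "dirac_op \<kappa> c a = closure_op {(\<phi>, dirac_expr \<kappa> c a \<phi>) |\<phi>. \<phi> \<in> test_functions}"

definition abs_continuous_on_interval :: "real \<Rightarrow> real \<Rightarrow> (real \<Rightarrow> 'a::real_normed_vector) \<Rightarrow> bool" where
  "abs_continuous_on_interval a b f \<longleftrightarrow>
     (\<forall>e>0. \<exists>d>0. \<forall>D :: (real \<times> real) set.
        finite D \<and> (\<forall>(x, y) \<in> D. a \<le> x \<and> x \<le> y \<and> y \<le> b) \<and>
        disjoint_family_on (\<lambda>(x, y). {x<..<y}) D \<and> (\<Sum>(x, y) \<in> D. y - x) < d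
        \<longrightarrow> (\<Sum>(x, y) \<in> D. norm (f y - f x)) < e)"

definition loc_abs_continuous :: "spinor \<Rightarrow> bool" where
  "loc_abs_continuous f \<longleftrightarrow> (\<forall>a b. 0 < a \<and> a \<le> b \<longrightarrow> abs_continuous_on_interval a b f)"

definition principal_solution :: "real \<Rightarrow> real \<Rightarrow> real \<Rightarrow> spinor \<Rightarrow> bool" where
  "principal_solution \<kappa> c l u \<longleftrightarrow>
     (\<forall>r>0. u differentiable (at r) \<and> dirac_expr \<kappa> c 0 u r = complex_of_real l *s u r) \<and>
     (\<exists>C>0. (\<lambda>r. norm (u r)) \<sim>[at_right 0] (\<lambda>r. C * r powr sqrt (\<kappa>\<^sup>2 - c\<^sup>2)))"

definition real_valued :: "spinor \<Rightarrow> bool" where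
  "real_valued u \<longleftrightarrow> (\<forall>r>0. \<forall>i. u r $ i \<in> \<real>)"

text \<open>
  The distinguished realisation for \<open>a = 0\<close> and $c^2 < \kappa^2$.  The function \<open>h\<close> is the locally
  absolutely continuous representative of the class of \<open>f\<close>.  The boundary condition does not
  depend on the choice of the spectral parameter \<open>l\<close> or of the principal solution \<open>u\<close>.
\<close>

definition dirac_op_dist :: "real \<Rightarrow> real \<Rightarrow> operator" where
  "dirac_op_dist \<kappa> c = {(f, g). f \<in> L2_space \<and> g \<in> L2_space \<and>
     (\<exists>h. (AE r in half_line. f r = h r) \<and> loc_abs_continuous h \<and>
        (AE r in half_line. g r = dirac_expr \<kappa> c 0 h r) \<and>
        (\<exists>l u. principal_solution \<kappa> c l u \<and> real_valued u \<and>
           ((\<lambda>r. h r $ 1 * u r $ 2 - h r $ 2 * u r $ 1) \<longlongrightarrow> 0) (at_right 0)))}"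

end

theory Submission
  imports Defs "HOL-Real_Asymp.Real_Asymp"
begin

text \<open>
  In polar coordinates \<open>u = \<rho> (cos x, sin x)\<close> and with \<open>t = ln r\<close>, the eigenvalue equation becomes
  the first-order equation \<open>x' = c + (\<kappa> + a e\<^sup>-\<^sup>t) sin 2x + e\<^sup>t (cos 2x - l)\<close> for the Pruefer angle \<open>x\<close>.
  Near \<open>r = 0\<close>, the flow contracts a band \<open>[-\<beta>, 0]\<close> of angles that does not depend on \<open>a \<le> 0\<close>,
  so that exactly one solution stays in it as \<open>t \<rightarrow> -\<infinity>\<close>; it belongs to the spinor that
  is recessive at \<open>0\<close>, and for \<open>a = 0\<close> to the principal solution.  The flow reversed from \<open>\<infinity>\<close> likewise yields the
  square-integrable spinor if \<open>\<bar>l\<bar> < 1\<close>.  The difference \<open>\<Theta>(l, a)\<close> of the two angles at \<open>r = 1\<close> is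
  jointly continuous up to \<open>a = 0\<close>, although the perturbation \<open>a / r\<^sup>2\<close> is singular, and strictly
  decreasing in \<open>l\<close>; moreover \<open>l\<close> is an eigenvalue if and only if \<open>\<Theta>(l, a) \<in> \<pi>\<int>\<close>.  Since \<open>\<Theta>(\<sqdot>, 0)\<close> meets
  \<open>\<pi>\<int>\<close> on \<open>[l\<^sub>0 - \<epsilon>, l\<^sub>0 + \<epsilon>]\<close> at most at \<open>l\<^sub>0\<close>, the values of \<open>\<Theta>(\<sqdot>, a)\<close> at the end points determine, for
  small \<open>a\<close>, the number of eigenvalues in between.  Energies with \<open>\<bar>l\<bar> \<ge> 1\<close> do not occur in this
  interval, because singular sequences show that they belong to the spectrum of \<open>H\<^sub>0\<close>.
\<close>

section \<open>Scalar ordinary differential equations\<close>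

text \<open>However small \<open>a\<close> is, \<open>a * exp (- t)\<close> is unbounded as t tends
  to minus infinity, so near r = 0 the perturbation is never uniformly small. What replaces
  smallness is the sign of a, the same as that of \<kappa>: the singular term pushes angles into the
  band and strengthens the contraction there. A trapped angle therefore forgets its past
  exponentially fast, and two equations need to be compared only on a compact interval of times,
  where the term is small. The two realisations call for different arguments. For a < 0 an
  eigenfunction is known only as an L2 limit of test functions, so Wronskians are estimated along
  the approximating sequence. For a = 0 it has an absolutely continuous representative that solves
  the equation almost everywhere and meets a boundary condition stated with a principal solution for
  some spectral parameter, possibly another one than the eigenvalue. There the delicate points are
  the default value of \<open>vector_derivative\<close> where no derivative exists, and the
  comparison of principal solutions for different parameters.\<close>

lemma continuous_antiderivative:
  fixes f :: "real \<Rightarrow> real"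
  assumes "continuous_on UNIV f"
  obtains G where "G t0 = 0" "\<And>t. (G has_real_derivative f t) (at t)"
proof (rule that[of "\<lambda>u. LBINT y=ereal t0..ereal u. f y"])
  let ?G = "\<lambda>u. LBINT y=ereal t0..ereal u. f y"
  show "?G t0 = 0" by simp
  fix t
  define a b where "a = min t t0 - 1" and "b = max t t0 + 1"
  have "(?G has_vector_derivative f t) (at t within {a..b})"
    using interval_integral_FTC2[of a t0 b f t] continuous_on_subset[OF assms]
    by (auto simp: a_def b_def)
  moreover have "at t within {a..b} = at t"
    by (rule at_within_Icc_at) (auto simp: a_def b_def)
  ultimately show "(?G has_real_derivative f t) (at t)"
    by (simp add: has_real_derivative_iff_has_vector_derivative)
qed

lemma nondecreasing_if_deriv_nonneg:
  fixes f :: "real \<Rightarrow> real"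
  assumes "a \<le> b" "\<And>x. a \<le> x \<Longrightarrow> x \<le> b \<Longrightarrow> (f has_real_derivative f' x) (at x)"
    "\<And>x. a \<le> x \<Longrightarrow> x \<le> b \<Longrightarrow> 0 \<le> f' x"
  shows "f a \<le> f b"
  using assms DERIV_nonneg_imp_nondecreasing[of a b f] by blast

lemma nonincreasing_if_deriv_nonpos:
  fixes f :: "real \<Rightarrow> real"
  assumes "a \<le> b" "\<And>x. a \<le> x \<Longrightarrow> x \<le> b \<Longrightarrow> (f has_real_derivative f' x) (at x)"
    "\<And>x. a \<le> x \<Longrightarrow> x \<le> b \<Longrightarrow> f' x \<le> 0"
  shows "f b \<le> f a"
  using assms DERIV_nonpos_imp_nonincreasing[of a b f] by blast

text \<open>Away from \<open>t0\<close> the weight has logarithmic slope 2K, so integrating K times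
  the weight costs a factor 1/2. That factor is the contraction constant of the Picard map below.
  Both signs of \<open>G\<close> are treated at once through \<open>z\<close>.\<close>

lemma exponential_weight_bound:
  fixes M K f G :: "real \<Rightarrow> real"
  assumes dM: "\<And>t. (M has_real_derivative K t) (at t)" and K0: "\<And>t. 0 \<le> K t"
    and dG: "\<And>t. (G has_real_derivative f t) (at t)" and G0: "G t0 = 0"
    and f: "\<And>t. \<bar>f t\<bar> \<le> d * (K t * exp (2 * \<bar>M t - M t0\<bar>))" and d: "0 \<le> d"
  shows "\<bar>G t\<bar> \<le> d / 2 * exp (2 * \<bar>M t - M t0\<bar>)"
proof (cases "t0 \<le> t")
  case True
  have mono: "M t0 \<le> M s" if "t0 \<le> s" for s
    by (rule nondecreasing_if_deriv_nonneg[OF that dM K0])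
  have *: "d / 2 * exp (2 * (M t0 - M t0)) + z * G t0 \<le> d / 2 * exp (2 * (M t - M t0)) + z * G t"
    if z: "\<bar>z\<bar> = 1" for z
  proof (rule nondecreasing_if_deriv_nonneg[OF True])
    fix s assume s: "t0 \<le> s" "s \<le> t"
    show "((\<lambda>s. d / 2 * exp (2 * (M s - M t0)) + z * G s) has_real_derivative
        d * (K s * exp (2 * (M s - M t0))) + z * f s) (at s)"
      by (auto intro!: derivative_eq_intros dM dG)
    have "- (z * f s) \<le> \<bar>f s\<bar>" using z by (metis abs_mult abs_ge_minus_self mult_1)
    then show "0 \<le> d * (K s * exp (2 * (M s - M t0))) + z * f s"
      using f[of s] mono[OF s(1)] by simp
  qed
  from *[of 1] *[of "-1"] show ?thesis using mono[OF True] G0 d by simp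
next
  case False
  then have le: "t \<le> t0" by simp
  have mono: "M s \<le> M t0" if "s \<le> t0" for s
    by (rule nondecreasing_if_deriv_nonneg[OF that dM K0])
  have *: "d / 2 * exp (2 * (M t0 - M t0)) + z * G t0 \<le> d / 2 * exp (2 * (M t0 - M t)) + z * G t"
    if z: "\<bar>z\<bar> = 1" for z
  proof (rule nonincreasing_if_deriv_nonpos[OF le])
    fix s assume s: "t \<le> s" "s \<le> t0"
    show "((\<lambda>s. d / 2 * exp (2 * (M t0 - M s)) + z * G s) has_real_derivative
        - d * (K s * exp (2 * (M t0 - M s))) + z * f s) (at s)"
      by (auto intro!: derivative_eq_intros dM dG)
    have "z * f s \<le> \<bar>f s\<bar>" using z by (metis abs_mult abs_ge_self mult_1)
    then show "- d * (K s * exp (2 * (M t0 - M s))) + z * f s \<le> 0"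
      using f[of s] mono[OF s(2)] by simp
  qed
  from *[of 1] *[of "-1"] show ?thesis using mono[OF le] G0 d by simp
qed

text \<open>Picard iteration in a weighted sup norm on the whole line (Bielecki's trick). The
  Lipschitz function \<open>K\<close> may be unbounded; the weight built from its primitive
  \<open>M\<close> makes the map a contraction globally, so local solutions never have to be
  continued.\<close>

lemma scalar_ode_exists:
  fixes F :: "real \<Rightarrow> real \<Rightarrow> real"
  assumes contF: "continuous_on UNIV (\<lambda>(t, x). F t x)"
    and dM: "\<And>t. (M has_real_derivative K t) (at t)" and K0: "\<And>t. 0 \<le> K t"
    and lip: "\<And>t x y. \<bar>F t x - F t y\<bar> \<le> K t * \<bar>x - y\<bar>"
    and F0: "\<And>t. \<bar>F t 0\<bar> \<le> K t"
  obtains x where "x t0 = x0" "\<And>t. (x has_real_derivative F t (x t)) (at t)"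
proof -
  define w where "w t = exp (2 * \<bar>M t - M t0\<bar>)" for t
  have contM: "continuous_on UNIV M"
    using dM by (meson DERIV_continuous continuous_at_imp_continuous_on)
  have wpos: "w t > 0" and w1: "w t \<ge> 1" for t by (auto simp: w_def)
  have contw: "continuous_on UNIV w" unfolding w_def by (intro continuous_intros contM)
  have contFc: "continuous_on UNIV (\<lambda>s. F s (w s * apply_bcontfun y s))" for y :: "real \<Rightarrow>\<^sub>C real"
    using continuous_on_compose2[OF contF, of UNIV "\<lambda>s. (s, w s * apply_bcontfun y s)"]
    by (simp add: continuous_on_Pair continuous_on_mult contw continuous_on_id)
  \<comment> \<open>The integral operator is represented by a chosen antiderivative
    \<open>G y\<close> that vanishes at \<open>t0\<close>.\<close>
  have "\<exists>G. G t0 = 0 \<and> (\<forall>t. (G has_real_derivative F t (w t * apply_bcontfun y t)) (at t))"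
    for y :: "real \<Rightarrow>\<^sub>C real"
    using continuous_antiderivative[OF contFc] by metis
  then obtain G where G0: "\<And>y. G y t0 = 0"
    and dG: "\<And>y t. (G y has_real_derivative F t (w t * apply_bcontfun y t)) (at t)" by metis
  \<comment> \<open>This keeps the Picard map inside the bounded continuous functions; the 1 in
    \<open>1 + norm y\<close> comes from the bound on \<open>F t 0\<close>.\<close>
  have Gbound: "\<bar>G y t\<bar> \<le> (1 + norm y) / 2 * w t" for y t
    unfolding w_def
  proof (rule exponential_weight_bound[OF dM K0 dG G0])
    fix t
    have "\<bar>F t (w t * apply_bcontfun y t)\<bar> \<le> \<bar>F t 0\<bar> + K t * \<bar>w t * apply_bcontfun y t - 0\<bar>"
      using lip[of t "w t * apply_bcontfun y t" 0] by linarith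
    also have "\<dots> \<le> K t * w t + K t * (w t * norm y)"
      using F0[of t] K0[of t] w1[of t] wpos[of t] norm_bounded[of y t]
      by (intro add_mono mult_left_mono) (auto simp: abs_mult intro: order_trans[OF _ mult_left_mono[of 1]])
    finally show "\<bar>F t (w t * apply_bcontfun y t)\<bar> \<le> (1 + norm y) * (K t * exp (2 * \<bar>M t - M t0\<bar>))"
      by (simp add: w_def algebra_simps)
  qed auto
  have Gdiff: "\<bar>G y t - G z t\<bar> \<le> dist y z / 2 * w t" for y z t
    unfolding w_def
  proof (rule exponential_weight_bound[OF dM K0, where G="\<lambda>t. G y t - G z t"])
    fix t
    show "((\<lambda>t. G y t - G z t) has_real_derivative
        F t (w t * apply_bcontfun y t) - F t (w t * apply_bcontfun z t)) (at t)"
      by (intro derivative_intros dG)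
    have "\<bar>F t (w t * apply_bcontfun y t) - F t (w t * apply_bcontfun z t)\<bar>
        \<le> K t * (w t * dist (apply_bcontfun y t) (apply_bcontfun z t))"
      using lip[of t "w t * apply_bcontfun y t" "w t * apply_bcontfun z t"] wpos[of t]
      by (simp add: dist_real_def abs_mult flip: right_diff_distrib)
    also have "\<dots> \<le> K t * (w t * dist y z)"
      using K0[of t] wpos[of t] dist_bounded[of y t z] by (intro mult_left_mono) auto
    finally show "\<bar>F t (w t * apply_bcontfun y t) - F t (w t * apply_bcontfun z t)\<bar>
        \<le> dist y z * (K t * exp (2 * \<bar>M t - M t0\<bar>))"
      by (simp add: w_def algebra_simps)
  qed (use G0 in auto)
  have contG: "continuous_on UNIV (G y)" for y
    using dG by (meson DERIV_continuous continuous_at_imp_continuous_on)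
  \<comment> \<open>The fixed point is the solution divided by the weight \<open>w\<close>, which
    makes it bounded on the line.\<close>
  define P where "P y = Bcontfun (\<lambda>t. (x0 + G y t) / w t)" for y
  have P: "apply_bcontfun (P y) t = (x0 + G y t) / w t" for y t
  proof -
    have "(\<lambda>t. (x0 + G y t) / w t) \<in> bcontfun"
    proof (rule bcontfun_normI)
      show "continuous_on UNIV (\<lambda>t. (x0 + G y t) / w t)"
        using wpos by (intro continuous_intros contG contw) (metis less_irrefl)
      fix t
      have "\<bar>x0 + G y t\<bar> \<le> \<bar>x0\<bar> * w t + (1 + norm y) / 2 * w t"
        using Gbound[of y t] w1[of t] mult_left_mono[of 1 "w t" "\<bar>x0\<bar>"] by linarith
      then show "norm ((x0 + G y t) / w t) \<le> \<bar>x0\<bar> + (1 + norm y) / 2"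
        using wpos[of t] by (simp add: divide_simps algebra_simps)
    qed
    then show ?thesis unfolding P_def by (simp add: Bcontfun_inverse)
  qed
  have "\<exists>!y. P y = y"
  proof (rule banach_fix_type[of "1/2"])
    show "\<forall>y z. dist (P y) (P z) \<le> 1 / 2 * dist y z"
    proof (intro allI)
      fix y z
      show "dist (P y) (P z) \<le> 1 / 2 * dist y z"
      proof (rule dist_bound)
        fix t
        have "dist (P y t) (P z t) = \<bar>G y t - G z t\<bar> / w t"
          using wpos[of t] by (simp add: P dist_real_def flip: diff_divide_distrib)
        also have "\<dots> \<le> 1 / 2 * dist y z"
          using Gdiff[of y t z] wpos[of t] by (simp add: divide_simps)
        finally show "dist (P y t) (P z t) \<le> 1 / 2 * dist y z" .
      qed
    qed
  qed auto
  then obtain y where y: "P y = y" by blast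
  have eq: "w t * apply_bcontfun y t = x0 + G y t" for t
    using P[of y t] y wpos[of t] by (simp add: field_simps)
  show thesis
  proof
    show "x0 + G y t0 = x0" by (simp add: G0)
    show "((\<lambda>t. x0 + G y t) has_real_derivative F t (x0 + G y t)) (at t)" for t
      using dG[of y t] by (auto intro!: derivative_eq_intros simp: eq)
  qed
qed

section \<open>Comparison and Gronwall arguments\<close>

lemma has_real_derivative_negative_part_squared:
  "((\<lambda>x::real. (min x 0)\<^sup>2) has_real_derivative 2 * min x 0) (at x)"
proof -
  consider "x < 0" | "x = 0" | "x > 0" by linarith
  then show ?thesis
  proof cases
    case 1
    have "((\<lambda>x::real. x\<^sup>2) has_real_derivative 2 * min x 0) (at x)"
      using 1 by (auto intro!: derivative_eq_intros)
    then show ?thesis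
      by (rule has_field_derivative_transform_within_open[of _ _ _ "{..<0}"]) (use 1 in auto)
  next
    case 2
    have "(\<lambda>h::real. (min h 0)\<^sup>2 / h) = (\<lambda>h. min h 0)"
      by (auto simp: min_def power2_eq_square)
    moreover have "((\<lambda>h::real. min h 0) \<longlongrightarrow> min 0 0) (at 0)"
      by (intro tendsto_intros)
    ultimately show ?thesis using 2 by (simp add: has_field_derivative_iff)
  next
    case 3
    have "((\<lambda>x::real. 0) has_real_derivative 2 * min x 0) (at x)"
      using 3 by auto
    then show ?thesis
      by (rule has_field_derivative_transform_within_open[of _ _ _ "{0<..}"]) (use 3 in auto)
  qed
qed

text \<open>The square of the negative part is continuously differentiable, so that Gronwall's argument
  applies to it.\<close>

lemma comparison_nonneg:
  fixes d :: "real \<Rightarrow> real"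
  assumes dM: "\<And>t. (M has_real_derivative K t) (at t)"
    and dd: "\<And>t. a \<le> t \<Longrightarrow> t \<le> b \<Longrightarrow> (d has_real_derivative d' t) (at t)"
    and ge: "\<And>t. a \<le> t \<Longrightarrow> t \<le> b \<Longrightarrow> - K t * \<bar>d t\<bar> \<le> d' t"
    and le: "a \<le> b" and pos: "0 \<le> d a"
  shows "0 \<le> d b"
proof -
  let ?n = "\<lambda>t. (min (d t) 0)\<^sup>2 * exp (- 2 * M t)"
  have "?n b \<le> ?n a"
  proof (rule nonincreasing_if_deriv_nonpos[OF le])
    fix t assume t: "a \<le> t" "t \<le> b"
    have 1: "((\<lambda>t. (min (d t) 0)\<^sup>2) has_real_derivative 2 * min (d t) 0 * d' t) (at t)"
      by (rule DERIV_chain2[OF has_real_derivative_negative_part_squared dd[OF t]])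
    have 2: "((\<lambda>t. exp (- 2 * M t)) has_real_derivative exp (- 2 * M t) * (- 2 * K t)) (at t)"
      by (auto intro!: derivative_eq_intros dM)
    show "(?n has_real_derivative
        2 * (min (d t) 0 * d' t - K t * (min (d t) 0)\<^sup>2) * exp (- 2 * M t)) (at t)"
      by (rule DERIV_cong[OF DERIV_mult[OF 1 2]]) (simp add: algebra_simps)
    have "min (d t) 0 * d' t \<le> min (d t) 0 * (- K t * \<bar>d t\<bar>)"
      using ge[OF t] by (intro mult_left_mono_neg) auto
    also have "\<dots> = K t * (min (d t) 0)\<^sup>2"
      by (auto simp: min_def power2_eq_square)
    finally show "2 * (min (d t) 0 * d' t - K t * (min (d t) 0)\<^sup>2) * exp (- 2 * M t) \<le> 0"
      by (simp add: mult_nonpos_nonneg)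
  qed
  then have "(min (d b) 0)\<^sup>2 \<le> 0" using pos by (simp add: mult_le_0_iff)
  then show ?thesis by (simp add: min_def split: if_splits)
qed

text \<open>The rate k may have either sign. It is applied with k negative where the flow contracts,
  and with k positive on the compact interval that remains, where distances grow at most by a fixed
  factor.\<close>

lemma gronwall_const:
  fixes D :: "real \<Rightarrow> real"
  assumes dD: "\<And>t. a \<le> t \<Longrightarrow> t \<le> b \<Longrightarrow> (D has_real_derivative D' t) (at t)"
    and le: "\<And>t. a \<le> t \<Longrightarrow> t \<le> b \<Longrightarrow> D' t \<le> k * D t + n" and ab: "a \<le> b" and k: "k \<noteq> 0"
  shows "D b + n / k \<le> exp (k * (b - a)) * (D a + n / k)"
proof -
  have "(D b + n / k) * exp (- k * b) \<le> (D a + n / k) * exp (- k * a)"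
  proof (rule nonincreasing_if_deriv_nonpos[OF ab])
    fix t assume t: "a \<le> t" "t \<le> b"
    show "((\<lambda>t. (D t + n / k) * exp (- k * t)) has_real_derivative
        (D' t - (k * D t + n)) * exp (- k * t)) (at t)"
      using k by (auto intro!: derivative_eq_intros dD[OF t] simp: field_simps)
    show "(D' t - (k * D t + n)) * exp (- k * t) \<le> 0"
      using le[OF t] by (simp add: mult_nonpos_nonneg)
  qed
  then have "(D b + n / k) * exp (- k * b) * exp (k * b) \<le> (D a + n / k) * exp (- k * a) * exp (k * b)"
    by (rule mult_right_mono) simp
  then show ?thesis
    by (simp add: mult.assoc right_diff_distrib flip: exp_add) (simp add: mult.commute algebra_simps)
qed

section \<open>Ordering, trapping and stability for a globally Lipschitz scalar equation\<close>

locale lipschitz_ode =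
  fixes F :: "real \<Rightarrow> real \<Rightarrow> real" and M K :: "real \<Rightarrow> real"
  assumes contF: "continuous_on UNIV (\<lambda>(t, x). F t x)"
    and dM: "\<And>t. (M has_real_derivative K t) (at t)" and contK: "continuous_on UNIV K"
    and K0: "\<And>t. 0 \<le> K t"
    and lip: "\<And>t x y. \<bar>F t x - F t y\<bar> \<le> K t * \<bar>x - y\<bar>"
    and F0: "\<And>t. \<bar>F t 0\<bar> \<le> K t"
begin

definition solution :: "(real \<Rightarrow> real) \<Rightarrow> bool" where
  "solution x \<longleftrightarrow> (\<forall>t. (x has_real_derivative F t (x t)) (at t))"

lemma solutionD: "solution x \<Longrightarrow> (x has_real_derivative F t (x t)) (at t)"
  by (simp add: solution_def)

lemma solution_exists: obtains x where "solution x" "x t0 = x0"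
  using scalar_ode_exists[OF contF dM K0 lip F0] unfolding solution_def by metis

text \<open>Scalar solutions cannot cross. Forward in time the Lipschitz bound gives the comparison
  inequality for the difference; backward in time the same argument runs for the reflected
  difference. Applied in both directions it yields uniqueness.\<close>

lemma solution_order:
  assumes x: "solution x" and y: "solution y" and le: "x t0 \<le> y t0"
  shows "x t \<le> y t"
proof (cases "t0 \<le> t")
  case True
  have "0 \<le> y t - x t"
  proof (rule comparison_nonneg[where a=t0 and b=t and d="\<lambda>t. y t - x t", OF dM])
    show "((\<lambda>t. y t - x t) has_real_derivative F t (y t) - F t (x t)) (at t)" for t
      by (intro derivative_intros solutionD x y)
    show "- K t * \<bar>y t - x t\<bar> \<le> F t (y t) - F t (x t)" for t
      using lip[of t "y t" "x t"] by linarith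
  qed (use le True in auto)
  then show ?thesis by simp
next
  case False
  have M': "((\<lambda>s. - M (- s)) has_real_derivative K (- s)) (at s)" for s
    by (auto intro!: derivative_eq_intros DERIV_chain2[OF dM])
  have "0 \<le> y (- (- t)) - x (- (- t))"
  proof (rule comparison_nonneg[where a="-t0" and b="-t" and d="\<lambda>s. y (- s) - x (- s)", OF M'])
    show "((\<lambda>s. y (- s) - x (- s)) has_real_derivative - F (- s) (y (- s)) + F (- s) (x (- s))) (at s)" for s
      by (auto intro!: derivative_eq_intros DERIV_chain2[OF solutionD[OF x]] DERIV_chain2[OF solutionD[OF y]])
    show "- K (- s) * \<bar>y (- s) - x (- s)\<bar> \<le> - F (- s) (y (- s)) + F (- s) (x (- s))" for s
      using lip[of "-s" "y (-s)" "x (-s)"] by linarith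
  qed (use le False in auto)
  then show ?thesis by simp
qed

lemma solution_below_barrier:
  assumes x: "solution x" and hi: "\<And>t. t0 \<le> t \<Longrightarrow> t \<le> t1 \<Longrightarrow> F t hi \<le> 0"
    and "x t0 \<le> hi" "t0 \<le> t1"
  shows "x t1 \<le> hi"
proof -
  have "0 \<le> hi - x t1"
  proof (rule comparison_nonneg[where a=t0 and b=t1 and d="\<lambda>t. hi - x t", OF dM])
    show "((\<lambda>t. hi - x t) has_real_derivative - F t (x t)) (at t)" for t
      by (auto intro!: derivative_eq_intros solutionD x)
    show "- K t * \<bar>hi - x t\<bar> \<le> - F t (x t)" if "t0 \<le> t" "t \<le> t1" for t
      using lip[of t "hi" "x t"] hi[OF that] by linarith
  qed (use assms in auto)
  then show ?thesis by simp
qed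

lemma solution_above_barrier:
  assumes x: "solution x" and lo: "\<And>t. t0 \<le> t \<Longrightarrow> t \<le> t1 \<Longrightarrow> 0 \<le> F t lo"
    and "lo \<le> x t0" "t0 \<le> t1"
  shows "lo \<le> x t1"
proof -
  have "0 \<le> x t1 - lo"
  proof (rule comparison_nonneg[where a=t0 and b=t1 and d="\<lambda>t. x t - lo", OF dM])
    show "((\<lambda>t. x t - lo) has_real_derivative F t (x t)) (at t)" for t
      by (auto intro!: derivative_eq_intros solutionD x)
    show "- K t * \<bar>x t - lo\<bar> \<le> F t (x t)" if "t0 \<le> t" "t \<le> t1" for t
      using lip[of t "x t" lo] lo[OF that] by linarith
  qed (use assms in auto)
  then show ?thesis by simp
qed

text \<open>The trapped solution is the lower envelope of solutions released from the upper edge at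
  the times T - n, which stay in the band from their release up to T. The infimum of their values at
  T selects it; the argument uses only order and barriers.\<close>

lemma band_solution_exists:
  assumes lo: "\<And>t. t \<le> T \<Longrightarrow> 0 \<le> F t lo" and hi: "\<And>t. t \<le> T \<Longrightarrow> F t hi \<le> 0" and lh: "lo \<le> hi"
  obtains x where "solution x" "\<And>t. t \<le> T \<Longrightarrow> lo \<le> x t \<and> x t \<le> hi"
proof -
  have "\<exists>x. solution x \<and> x (T - real n) = hi" for n using solution_exists by metis
  then obtain X where X: "\<And>n. solution (X n)" "\<And>n. X n (T - real n) = hi" by metis
  have Xhi: "X n t \<le> hi" and Xlo: "lo \<le> X n t" if "T - real n \<le> t" "t \<le> T" for n t
    using solution_below_barrier[OF X(1), of "T - real n" t hi n] X(2)[of n]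
      solution_above_barrier[OF X(1), of "T - real n" t lo n] hi lo lh that by auto
  define p where "p = (INF n. X n T)"
  have bdd: "bdd_below (range (\<lambda>n. X n T))" by (rule bdd_belowI[of _ lo]) (auto intro: Xlo)
  obtain x where x: "solution x" "x T = p" using solution_exists by metis
  have "lo \<le> x t \<and> x t \<le> hi" if t: "t \<le> T" for t
  proof
    obtain n where n: "T - t \<le> real n" using real_arch_simple by blast
    have "x T \<le> X n T" unfolding x(2) p_def by (rule cINF_lower[OF bdd]) simp
    then have "x t \<le> X n t" by (rule solution_order[OF x(1) X(1)])
    with Xhi[of n t] n t show "x t \<le> hi" by linarith
    \<comment> \<open>Lower bound: at time T the solution \<open>z\<close> through \<open>lo\<close>
      at time t lies below every released solution. If the release was before t, compare at t; if it
      was after t, compare at the release time, when \<open>z\<close> is still below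
      \<open>hi\<close>.\<close>
    obtain z where z: "solution z" "z t = lo" using solution_exists by metis
    have "z T \<le> X n T" for n
    proof (cases "T - real n \<le> t")
      case True
      then show ?thesis using Xlo[OF True t] z(2) solution_order[OF z(1) X(1), of t] by simp
    next
      case False
      have "z (T - real n) \<le> hi"
        by (rule solution_below_barrier[OF z(1), of t]) (use False hi z(2) lh in auto)
      then show ?thesis using X(2) solution_order[OF z(1) X(1), of "T - real n"] by simp
    qed
    then have "z T \<le> x T" unfolding x(2) p_def by (intro cINF_greatest) auto
    then show "lo \<le> x t" using solution_order[OF z(1) x(1)] z(2) by metis
  qed
  with x(1) show thesis using that by blast
qed

text \<open>Solutions that stay bounded in an attracting band as \<open>t \<rightarrow> -\<infinity>\<close> depend strictly
  monotonically on the right-hand side.\<close>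

lemma band_solution_strict_mono:
  assumes x: "solution x" and y: "\<And>t. (y has_real_derivative G t (y t)) (at t)"
    and FG: "\<And>t. G t (y t) < F t (y t)"
    and g: "0 < g" and contr: "\<And>t. t \<le> T \<Longrightarrow> (F t (x t) - F t (y t)) * (x t - y t) \<le> - g * (x t - y t)\<^sup>2"
    and b: "\<And>t. t \<le> T \<Longrightarrow> \<bar>x t - y t\<bar> \<le> b"
  shows "y t < x t"
proof -
  define d where "d t = x t - y t" for t
  have dd: "(d has_real_derivative (F t (x t) - F t (y t)) + (F t (y t) - G t (y t))) (at t)" for t
    unfolding d_def by (auto intro!: derivative_eq_intros solutionD[OF x] y)
  have nonneg: "0 \<le> d t" for t
  proof (rule ccontr)
    assume "\<not> 0 \<le> d t"
    \<comment> \<open>A negative difference at t was negative at all earlier times, because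
      nonnegativity propagates forward.\<close>
    have neg: "d s < 0" if "s \<le> t" for s
    proof (rule ccontr)
      assume "\<not> d s < 0"
      have "0 \<le> d t"
      proof (rule comparison_nonneg[where a=s and b=t and d=d, OF dM dd])
        show "- K t * \<bar>d t\<bar> \<le> (F t (x t) - F t (y t)) + (F t (y t) - G t (y t))" for t
          using FG[of t] lip[of t "x t" "y t"] unfolding d_def by linarith
      qed (use that \<open>\<not> d s < 0\<close> in simp_all)
      with \<open>\<not> 0 \<le> d t\<close> show False by simp
    qed
    define t1 where "t1 = min t T"
    \<comment> \<open>While the difference is negative, contraction makes this product
      nondecreasing. It is bounded below by \<open>- b * exp (g * s)\<close>, which tends to 0 at
      minus infinity, so it cannot be negative at \<open>t1\<close>.\<close>
    have *: "d s * exp (g * s) \<le> d t1 * exp (g * t1)" if "s \<le> t1" for s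
    proof (rule nondecreasing_if_deriv_nonneg[OF that])
      fix u assume u: "s \<le> u" "u \<le> t1"
      show "((\<lambda>u. d u * exp (g * u)) has_real_derivative
          ((F u (x u) - F u (y u)) + (F u (y u) - G u (y u)) + g * d u) * exp (g * u)) (at u)"
        by (rule derivative_eq_intros dd refl | simp add: algebra_simps)+
      have "(F u (x u) - F u (y u)) * d u \<le> - g * d u * d u"
        using contr[of u] u by (simp add: d_def t1_def power2_eq_square)
      then have "- g * d u \<le> F u (x u) - F u (y u)"
        using neg[of u] u mult_le_cancel_right[of "F u (x u) - F u (y u)" "d u" "- g * d u"]
        by (simp only: t1_def)
      then show "0 \<le> ((F u (x u) - F u (y u)) + (F u (y u) - G u (y u)) + g * d u) * exp (g * u)"
        using FG[of u] by simp
    qed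
    have "((\<lambda>s. - b * exp (g * s)) \<longlongrightarrow> - b * 0) at_bot"
      using g by (intro tendsto_intros filterlim_compose[OF exp_at_bot]
          filterlim_tendsto_pos_mult_at_bot[OF tendsto_const]) (auto simp: filterlim_ident)
    moreover have "\<forall>\<^sub>F s in at_bot. - b * exp (g * s) \<le> d t1 * exp (g * t1)"
      using eventually_le_at_bot[of t1]
    proof eventually_elim
      case (elim s)
      have "- b * exp (g * s) \<le> d s * exp (g * s)"
        using b[of s] elim by (intro mult_right_mono) (auto simp: d_def t1_def)
      with *[OF elim] show ?case by linarith
    qed
    ultimately have "- b * 0 \<le> d t1 * exp (g * t1)"
      by (rule tendsto_upperbound) simp
    with neg[of t1] show False by (simp add: t1_def zero_le_mult_iff)
  qed
  \<comment> \<open>A zero of the nonnegative difference is a minimum, so its derivative would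
    vanish there; but that derivative is the positive gap between F and G.\<close>
  have "d t \<noteq> 0"
  proof
    assume "d t = 0"
    with DERIV_local_min[OF dd[of t], of 1] nonneg have
      "(F t (x t) - F t (y t)) + (F t (y t) - G t (y t)) = 0" by auto
    with \<open>d t = 0\<close> FG[of t] show False by (simp add: d_def)
  qed
  with nonneg[of t] show ?thesis by (simp add: d_def)
qed

text \<open>The perturbation has to be small only on [t0, t1], with t0 fixed before the competitor
  is known: contraction from t0 to T damps the a priori distance b, whatever happened earlier. A
  perturbation that is unbounded at minus infinity requires this form.\<close>

lemma band_solution_stable:
  assumes x: "solution x" and g: "0 < g" and \<eta>: "0 < \<eta>" and Tt: "T \<le> t1" and b0: "0 \<le> b"
  obtains \<epsilon> t0 where "0 < \<epsilon>" "t0 \<le> T"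
    "\<And>G y. \<lbrakk>\<And>t. (y has_real_derivative G t (y t)) (at t);
        \<And>t. t \<le> T \<Longrightarrow> \<bar>x t - y t\<bar> \<le> b;
        \<And>t. t \<le> T \<Longrightarrow> (F t (x t) - F t (y t)) * (x t - y t) \<le> - g * (x t - y t)\<^sup>2;
        \<And>t. t0 \<le> t \<Longrightarrow> t \<le> t1 \<Longrightarrow> \<bar>F t (y t) - G t (y t)\<bar> \<le> \<epsilon>\<rbrakk>
      \<Longrightarrow> \<bar>x t1 - y t1\<bar> < \<eta>"
proof -
  have "compact (K ` {T..t1})"
    by (intro compact_continuous_image continuous_on_subset[OF contK]) auto
  then have "bdd_above (K ` {T..t1})" by (simp add: bounded_imp_bdd_above compact_imp_bounded)
  then obtain k where k: "\<And>t. T \<le> t \<Longrightarrow> t \<le> t1 \<Longrightarrow> K t \<le> k"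
    unfolding bdd_above_def by (meson atLeastAtMost_iff imageI)
  have k0: "0 \<le> k" using k[of T] K0[of T] Tt by simp
  \<comment> \<open>Twice the Lipschitz bound plus 1; the 1 absorbs the cross term with \<epsilon>
    after T by Young's inequality.\<close>
  define k' where "k' = 2 * k + 1"
  define A where "A = exp (k' * (t1 - T))"
  have k': "0 < k'" using k0 by (simp add: k'_def)
  have A: "0 < A" by (simp add: A_def)
  \<comment> \<open>\<open>A\<close> bounds the growth of the squared distance from T to
    \<open>t1\<close>. The time t0 is taken so early that by time T the initial b^2 has shrunk below
    the share \<eta>^2/(4A).\<close>
  have "((\<lambda>t0. exp (- g * (T - t0)) * b\<^sup>2) \<longlongrightarrow> 0 * b\<^sup>2) at_bot"
    using g by real_asymp
  then have "\<forall>\<^sub>F t0 in at_bot. exp (- g * (T - t0)) * b\<^sup>2 < \<eta>\<^sup>2 / (4 * A)"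
    using \<eta> A by (intro order_tendstoD) auto
  then have "\<forall>\<^sub>F t0 in at_bot. exp (- g * (T - t0)) * b\<^sup>2 < \<eta>\<^sup>2 / (4 * A) \<and> t0 \<le> T"
    using eventually_le_at_bot[of T] by eventually_elim simp
  then obtain t0 where t0: "exp (- g * (T - t0)) * b\<^sup>2 < \<eta>\<^sup>2 / (4 * A)" "t0 \<le> T"
    using eventually_happens by fastforce
  \<comment> \<open>\<open>B\<close> collects the contributions 1/g^2 and 1/k' of the perturbation
    before and after T. The value of \<epsilon> makes them amount to another \<eta>^2/(4A), so that
    at most \<eta>^2/2 arrives at \<open>t1\<close>.\<close>
  define B where "B = 1 / g\<^sup>2 + 1 / k'"
  have B: "0 < B" using g k' by (simp add: B_def add_pos_pos)
  define \<epsilon> where "\<epsilon> = \<eta> / (2 * sqrt (A * B))"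
  have \<epsilon>: "0 < \<epsilon>" using \<eta> A B by (simp add: \<epsilon>_def)
  have \<epsilon>2: "\<epsilon>\<^sup>2 * B = \<eta>\<^sup>2 / (4 * A)"
    using A B by (simp add: \<epsilon>_def power_divide power_mult_distrib)
  show thesis
  proof (rule that[OF \<epsilon> t0(2)])
    fix G y
    assume y: "\<And>t. (y has_real_derivative G t (y t)) (at t)"
      and b: "\<And>t. t \<le> T \<Longrightarrow> \<bar>x t - y t\<bar> \<le> b"
      and contr: "\<And>t. t \<le> T \<Longrightarrow> (F t (x t) - F t (y t)) * (x t - y t) \<le> - g * (x t - y t)\<^sup>2"
      and FG: "\<And>t. t0 \<le> t \<Longrightarrow> t \<le> t1 \<Longrightarrow> \<bar>F t (y t) - G t (y t)\<bar> \<le> \<epsilon>"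
    define D where "D t = (x t - y t)\<^sup>2" for t
    define D' where "D' t = 2 * ((F t (x t) - F t (y t)) * (x t - y t))
      + 2 * ((F t (y t) - G t (y t)) * (x t - y t))" for t
    have dD: "(D has_real_derivative D' t) (at t)" for t
      unfolding D_def D'_def
      by (auto intro!: derivative_eq_intros solutionD[OF x] y simp: algebra_simps)
    have pert: "2 * ((F t (y t) - G t (y t)) * (x t - y t)) \<le> 2 * \<epsilon> * \<bar>x t - y t\<bar>"
      if "t0 \<le> t" "t \<le> t1" for t
    proof -
      have "(F t (y t) - G t (y t)) * (x t - y t) \<le> \<bar>F t (y t) - G t (y t)\<bar> * \<bar>x t - y t\<bar>"
        by (metis abs_ge_self abs_mult)
      also have "\<dots> \<le> \<epsilon> * \<bar>x t - y t\<bar>" using FG[OF that] by (intro mult_right_mono) auto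
      finally show ?thesis by (simp only: mult.assoc mult_le_cancel_left_pos zero_less_numeral)
    qed
    have "D T + \<epsilon>\<^sup>2 / g / - g \<le> exp (- g * (T - t0)) * (D t0 + \<epsilon>\<^sup>2 / g / - g)"
    proof (rule gronwall_const[OF dD])
      fix t assume t: "t0 \<le> t" "t \<le> T"
      \<comment> \<open>Young's inequality spends half of the contraction on the
        perturbation.\<close>
      have "0 \<le> (sqrt g * \<bar>x t - y t\<bar> - \<epsilon> / sqrt g)\<^sup>2" by simp
      then have "2 * \<epsilon> * \<bar>x t - y t\<bar> \<le> g * (x t - y t)\<^sup>2 + \<epsilon>\<^sup>2 / g"
        using g by (simp add: power2_diff power_mult_distrib power_divide ac_simps)
      then show "D' t \<le> - g * D t + \<epsilon>\<^sup>2 / g"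
        using pert[of t] contr[of t] t Tt by (simp add: D_def D'_def)
    qed (use t0 g in auto)
    also have "\<dots> \<le> exp (- g * (T - t0)) * b\<^sup>2"
    proof (rule mult_left_mono)
      have "D t0 \<le> b\<^sup>2" unfolding D_def
        using b[OF t0(2)] b0 by (metis abs_le_square_iff abs_of_nonneg)
      moreover have "\<epsilon>\<^sup>2 / g / - g \<le> 0" using g by (simp add: divide_nonneg_nonpos)
      ultimately show "D t0 + \<epsilon>\<^sup>2 / g / - g \<le> b\<^sup>2" by linarith
    qed simp
    also have "\<dots> < \<eta>\<^sup>2 / (4 * A)" by (rule t0)
    finally have DT: "D T < \<eta>\<^sup>2 / (4 * A) + \<epsilon>\<^sup>2 / g\<^sup>2" by (simp add: power2_eq_square)
    have "D t1 + \<epsilon>\<^sup>2 / k' \<le> A * (D T + \<epsilon>\<^sup>2 / k')"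
      unfolding A_def
    proof (rule gronwall_const[OF dD])
      fix t assume t: "T \<le> t" "t \<le> t1"
      have "(F t (x t) - F t (y t)) * (x t - y t) \<le> \<bar>F t (x t) - F t (y t)\<bar> * \<bar>x t - y t\<bar>"
        by (metis abs_ge_self abs_mult)
      also have "\<dots> \<le> (k * \<bar>x t - y t\<bar>) * \<bar>x t - y t\<bar>"
        using lip[of t "x t" "y t"] mult_right_mono[OF k[OF t], of "\<bar>x t - y t\<bar>"]
        by (intro mult_right_mono) auto
      finally have "(F t (x t) - F t (y t)) * (x t - y t) \<le> k * (x t - y t)\<^sup>2"
        by (simp add: power2_eq_square mult.assoc)
      moreover have "2 * \<epsilon> * \<bar>x t - y t\<bar> \<le> (x t - y t)\<^sup>2 + \<epsilon>\<^sup>2"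
        using zero_le_power2[of "\<bar>x t - y t\<bar> - \<epsilon>"] by (simp add: power2_diff ac_simps)
      ultimately show "D' t \<le> k' * D t + \<epsilon>\<^sup>2"
        using pert[of t] t t0 by (simp add: D_def D'_def k'_def algebra_simps)
    qed (use k' Tt in auto)
    also have "\<dots> < A * (\<eta>\<^sup>2 / (4 * A) + \<epsilon>\<^sup>2 / g\<^sup>2 + \<epsilon>\<^sup>2 / k')"
      using DT A by simp
    also have "\<epsilon>\<^sup>2 / g\<^sup>2 + \<epsilon>\<^sup>2 / k' = \<eta>\<^sup>2 / (4 * A)"
      using \<epsilon>2 by (simp add: B_def algebra_simps)
    then have "A * (\<eta>\<^sup>2 / (4 * A) + \<epsilon>\<^sup>2 / g\<^sup>2 + \<epsilon>\<^sup>2 / k') = \<eta>\<^sup>2 / 2"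
      using A by (simp add: add.assoc)
    finally have "D t1 + \<epsilon>\<^sup>2 / k' < \<eta>\<^sup>2 / 2" .
    moreover have "0 \<le> \<epsilon>\<^sup>2 / k'" "0 < \<eta>\<^sup>2" using k' \<eta> by auto
    ultimately have "D t1 < \<eta>\<^sup>2" by linarith
    then have "\<bar>x t1 - y t1\<bar>\<^sup>2 < \<eta>\<^sup>2" by (simp add: D_def)
    then show "\<bar>x t1 - y t1\<bar> < \<eta>" by (rule power_less_imp_less_base) (use \<eta> in simp)
  qed
qed

end

text \<open>Packages existence, stability and monotonicity of trapped solutions over a parameter
  set, for use once at the origin and, with time reversed, once at infinity. The factor
  \<open>exp (- t)\<close> in the closeness assumption has the size of the singular term.\<close>

lemma band_family:
  fixes F :: "'p \<Rightarrow> real \<Rightarrow> real \<Rightarrow> real" and \<Delta> :: "'p \<Rightarrow> 'p \<Rightarrow> real"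
  assumes ode: "\<And>p. p \<in> I \<Longrightarrow> lipschitz_ode (F p) (M p) (K p)"
    and T: "T \<le> 0" and lh: "lo \<le> hi" and g: "0 < g"
    and lo: "\<And>p t. p \<in> I \<Longrightarrow> t \<le> T \<Longrightarrow> 0 \<le> F p t lo"
    and hi: "\<And>p t. p \<in> I \<Longrightarrow> t \<le> T \<Longrightarrow> F p t hi \<le> 0"
    and contr: "\<And>p t x y. p \<in> I \<Longrightarrow> t \<le> T \<Longrightarrow> lo \<le> x \<Longrightarrow> x \<le> hi \<Longrightarrow> lo \<le> y \<Longrightarrow> y \<le> hi \<Longrightarrow>
      (F p t x - F p t y) * (x - y) \<le> - g * (x - y)\<^sup>2"
    and close: "\<And>p q t x. p \<in> I \<Longrightarrow> q \<in> I \<Longrightarrow> t \<le> 0 \<Longrightarrow> \<bar>F p t x - F q t x\<bar> \<le> exp (- t) * \<Delta> p q"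
  obtains X where
    "\<And>p t. p \<in> I \<Longrightarrow> (X p has_real_derivative F p t (X p t)) (at t)"
    "\<And>p t. p \<in> I \<Longrightarrow> t \<le> T \<Longrightarrow> lo \<le> X p t \<and> X p t \<le> hi"
    "\<And>p \<eta>. p \<in> I \<Longrightarrow> 0 < \<eta> \<Longrightarrow>
      \<exists>\<delta>>0. \<forall>q\<in>I. \<Delta> p q < \<delta> \<longrightarrow> \<bar>X p 0 - X q 0\<bar> < \<eta>"
    "\<And>p q t. p \<in> I \<Longrightarrow> q \<in> I \<Longrightarrow> (\<And>t y. F q t y < F p t y) \<Longrightarrow> X q t < X p t"
proof -
  have "\<exists>x. p \<in> I \<longrightarrow> lipschitz_ode.solution (F p) x \<and> (\<forall>t\<le>T. lo \<le> x t \<and> x t \<le> hi)" for p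
    using lipschitz_ode.band_solution_exists[OF ode, of p T lo hi] lo hi lh by metis
  then obtain X where X: "\<And>p. p \<in> I \<Longrightarrow> lipschitz_ode.solution (F p) (X p)"
    and band: "\<And>p t. p \<in> I \<Longrightarrow> t \<le> T \<Longrightarrow> lo \<le> X p t \<and> X p t \<le> hi" by metis
  have dX: "(X p has_real_derivative F p t (X p t)) (at t)" if "p \<in> I" for p t
    using X[OF that] lipschitz_ode.solutionD[OF ode[OF that]] by blast
  have width: "\<bar>X p t - X q t\<bar> \<le> hi - lo" if "p \<in> I" "q \<in> I" "t \<le> T" for p q t
    using band[of p t] band[of q t] that by (auto simp: abs_le_iff)
  show thesis
  proof (rule that[of X, OF dX band])
    fix p and \<eta> :: real assume p: "p \<in> I" and \<eta>: "0 < \<eta>"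
    interpret lipschitz_ode "F p" "M p" "K p" by (rule ode[OF p])
    obtain \<epsilon> t0 where \<epsilon>: "0 < \<epsilon>" and t0: "t0 \<le> T" and st:
      "\<And>G y. \<lbrakk>\<And>t. (y has_real_derivative G t (y t)) (at t);
        \<And>t. t \<le> T \<Longrightarrow> \<bar>X p t - y t\<bar> \<le> hi - lo;
        \<And>t. t \<le> T \<Longrightarrow> (F p t (X p t) - F p t (y t)) * (X p t - y t) \<le> - g * (X p t - y t)\<^sup>2;
        \<And>t. t0 \<le> t \<Longrightarrow> t \<le> 0 \<Longrightarrow> \<bar>F p t (y t) - G t (y t)\<bar> \<le> \<epsilon>\<rbrakk>
      \<Longrightarrow> \<bar>X p 0 - y 0\<bar> < \<eta>"
      using band_solution_stable[OF X[OF p] g \<eta> T, of "hi - lo"] lh by (metis diff_ge_0_iff_ge)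
    show "\<exists>\<delta>>0. \<forall>q\<in>I. \<Delta> p q < \<delta> \<longrightarrow> \<bar>X p 0 - X q 0\<bar> < \<eta>"
    proof (intro exI conjI ballI impI)
      \<comment> \<open>On [t0, 0] the factor \<open>exp (- t)\<close> is at most
        \<open>exp (- t0)\<close>, whence this choice of \<delta>.\<close>
      show "0 < \<epsilon> * exp t0" using \<epsilon> by simp
      fix q assume q: "q \<in> I" and d: "\<Delta> p q < \<epsilon> * exp t0"
      show "\<bar>X p 0 - X q 0\<bar> < \<eta>"
      proof (rule st[of "X q" "F q", OF dX[OF q] width[OF p q]])
        fix t assume t: "t0 \<le> t" "t \<le> 0"
        have "0 \<le> \<Delta> p q" using close[OF p q, of 0 0] by simp
        then have "exp (- t) * \<Delta> p q \<le> exp (- t0) * (\<epsilon> * exp t0)"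
          using t d by (intro mult_mono) auto
        also have "\<dots> = \<epsilon>" by (simp add: exp_minus)
        finally show "\<bar>F p t (X q t) - F q t (X q t)\<bar> \<le> \<epsilon>"
          using close[OF p q t(2), of "X q t"] by linarith
      qed (use contr[OF p] band p q in auto)
    qed
  next
    fix p q t assume p: "p \<in> I" and q: "q \<in> I" and less: "\<And>t y. F q t y < F p t y"
    show "X q t < X p t"
      by (rule lipschitz_ode.band_solution_strict_mono[where F="F p" and G="F q" and T=T and b="hi - lo",
          OF ode[OF p] X[OF p] dX[OF q] less g])
        (use contr[OF p] band width p q in auto)
  qed auto
qed

section \<open>Elementary estimates for contraction and for trigonometric differences\<close>

lemma contraction_if_deriv_le:
  fixes f :: "real \<Rightarrow> real"
  assumes df: "\<And>z. lo \<le> z \<Longrightarrow> z \<le> hi \<Longrightarrow> (f has_real_derivative f' z) (at z)"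
    and le: "\<And>z. lo \<le> z \<Longrightarrow> z \<le> hi \<Longrightarrow> f' z \<le> - g"
    and "lo \<le> x" "x \<le> hi" "lo \<le> y" "y \<le> hi"
  shows "(f x - f y) * (x - y) \<le> - g * (x - y)\<^sup>2"
proof -
  have *: "(f u - f v) * (u - v) \<le> - g * (u - v)\<^sup>2" if uv: "v < u" "lo \<le> v" "u \<le> hi" for u v
  proof -
    obtain z where z: "v < z" "z < u" "f u - f v = (u - v) * f' z"
      using MVT2[OF uv(1), of f f'] df uv by (metis order_trans)
    then have "(f u - f v) * (u - v) = f' z * (u - v)\<^sup>2" by (simp add: power2_eq_square)
    also have "\<dots> \<le> - g * (u - v)\<^sup>2" using le[of z] z uv by (intro mult_right_mono) auto
    finally show ?thesis .
  qed
  have sw: "(f x - f y) * (x - y) = (f y - f x) * (y - x)" by (simp add: algebra_simps)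
  consider "x < y" | "x = y" | "y < x" by linarith
  then show ?thesis
  proof cases
    case 1
    then show ?thesis using *[OF 1] assms sw by (simp add: power2_commute)
  qed (use * assms in auto)
qed

lemma abs_sin_double_diff_le: "\<bar>sin (2 * x) - sin (2 * y)\<bar> \<le> 2 * \<bar>x - y\<bar>" for x y :: real
proof -
  have half: "(2 * x - 2 * y) / 2 = x - y" "(2 * x + 2 * y) / 2 = x + y" by simp_all
  have "\<bar>sin (2 * x) - sin (2 * y)\<bar> = 2 * (\<bar>sin (x - y)\<bar> * \<bar>cos (x + y)\<bar>)"
    by (simp only: sin_diff_sin[of "2 * x" "2 * y"] half abs_mult abs_numeral mult.assoc)
  also have "\<dots> \<le> 2 * (\<bar>x - y\<bar> * 1)"
    by (intro mult_left_mono mult_mono abs_sin_x_le_abs_x) auto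
  finally show ?thesis by simp
qed

lemma abs_cos_double_diff_le: "\<bar>cos (2 * x) - cos (2 * y)\<bar> \<le> 2 * \<bar>x - y\<bar>" for x y :: real
proof -
  have half: "(2 * y - 2 * x) / 2 = y - x" "(2 * x + 2 * y) / 2 = x + y" by simp_all
  have "\<bar>cos (2 * x) - cos (2 * y)\<bar> = 2 * (\<bar>sin (x + y)\<bar> * \<bar>sin (y - x)\<bar>)"
    by (simp only: cos_diff_cos[of "2 * x" "2 * y"] half abs_mult abs_numeral mult.assoc)
  also have "\<dots> \<le> 2 * (1 * \<bar>y - x\<bar>)"
    by (intro mult_left_mono mult_mono abs_sin_x_le_abs_x) auto
  finally show ?thesis by (simp add: abs_minus_commute)
qed

section \<open>The Pruefer angle of the Coulomb-Dirac system\<close>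

text \<open>
  In the variable \<open>t = ln r\<close>, a real solution \<open>\<rho> (cos x, sin x)\<close> of the eigenvalue equation satisfies
  \<open>x' = prufer l a t x\<close> and \<open>(ln \<rho>)' = prufer_rate a t x\<close>.
\<close>

locale coulomb_dirac =
  fixes \<kappa> c :: real
  assumes \<kappa>c: "\<kappa> < c" and c0: "c < 0"
begin

definition prufer :: "real \<Rightarrow> real \<Rightarrow> real \<Rightarrow> real \<Rightarrow> real" where
  "prufer l a t x = c + (\<kappa> + a * exp (- t)) * sin (2 * x) + exp t * (cos (2 * x) - l)"

definition prufer_rate :: "real \<Rightarrow> real \<Rightarrow> real \<Rightarrow> real" where
  "prufer_rate a t x = - (\<kappa> + a * exp (- t)) * cos (2 * x) + exp t * sin (2 * x)"

text \<open>One function dominates both the Lipschitz constant in the angle and the value at angle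
  0, as \<open>lipschitz_ode\<close> demands; \<open>3 + \<bar>l\<bar>\<close> covers the
  coefficient 2 of the former and 1 + |l| of the latter.\<close>

definition lip_const :: "real \<Rightarrow> real \<Rightarrow> real \<Rightarrow> real" where
  "lip_const l a t = 2 * \<bar>\<kappa>\<bar> + \<bar>c\<bar> + 2 * \<bar>a\<bar> * exp (- t) + (3 + \<bar>l\<bar>) * exp t"

definition lip_prim :: "real \<Rightarrow> real \<Rightarrow> real \<Rightarrow> real" where
  "lip_prim l a t = (2 * \<bar>\<kappa>\<bar> + \<bar>c\<bar>) * t - 2 * \<bar>a\<bar> * exp (- t) + (3 + \<bar>l\<bar>) * exp t"

lemma \<kappa>0: "\<kappa> < 0" using \<kappa>c c0 by simp

lemma abs_prufer_diff_le: "\<bar>prufer l a t x - prufer l a t y\<bar> \<le> lip_const l a t * \<bar>x - y\<bar>"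
proof -
  have "prufer l a t x - prufer l a t y
      = (\<kappa> + a * exp (- t)) * (sin (2 * x) - sin (2 * y)) + exp t * (cos (2 * x) - cos (2 * y))"
    by (simp add: prufer_def algebra_simps)
  also have "\<bar>\<dots>\<bar> \<le> (\<bar>\<kappa>\<bar> + \<bar>a\<bar> * exp (- t)) * (2 * \<bar>x - y\<bar>) + exp t * (2 * \<bar>x - y\<bar>)"
    unfolding abs_mult[symmetric]
    by (intro order_trans[OF abs_triangle_ineq] add_mono)
      (auto simp: abs_mult intro!: mult_mono abs_sin_double_diff_le abs_cos_double_diff_le
        intro: order_trans[OF abs_triangle_ineq])
  also have "\<dots> \<le> lip_const l a t * \<bar>x - y\<bar>"
    by (simp add: lip_const_def algebra_simps)
  finally show ?thesis .
qed

lemma abs_prufer_0_le: "\<bar>prufer l a t 0\<bar> \<le> lip_const l a t"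
proof -
  have "\<bar>prufer l a t 0\<bar> \<le> \<bar>c\<bar> + exp t * \<bar>1 - l\<bar>"
    unfolding prufer_def by (simp add: order_trans[OF abs_triangle_ineq] abs_mult)
  also have "\<dots> \<le> \<bar>c\<bar> + exp t * (3 + \<bar>l\<bar>)" by (intro add_left_mono mult_left_mono) auto
  also have "\<dots> \<le> lip_const l a t"
    by (simp add: lip_const_def mult.commute)
  finally show ?thesis .
qed

lemma lipschitz_ode_prufer: "lipschitz_ode (prufer l a) (lip_prim l a) (lip_const l a)"
proof
  show "continuous_on UNIV (\<lambda>(t, x). prufer l a t x)"
    unfolding prufer_def case_prod_unfold by (intro continuous_intros)
  show "(lip_prim l a has_real_derivative lip_const l a t) (at t)" for t
    unfolding lip_prim_def lip_const_def by (auto intro!: derivative_eq_intros)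
  show "continuous_on UNIV (lip_const l a)"
    unfolding lip_const_def by (intro continuous_intros)
  show "0 \<le> lip_const l a t" for t unfolding lip_const_def by simp
qed (rule abs_prufer_diff_le abs_prufer_0_le)+

text \<open>Reversed time turns the angle that is recessive at infinity into one trapped at minus
  infinity, so the theory of bands serves both ends.\<close>

lemma lipschitz_ode_prufer_reversed:
  "lipschitz_ode (\<lambda>t x. - prufer l a (- t) x) (\<lambda>t. - lip_prim l a (- t)) (\<lambda>t. lip_const l a (- t))"
proof
  show "continuous_on UNIV (\<lambda>(t, x). - prufer l a (- t) x)"
    unfolding prufer_def case_prod_unfold by (intro continuous_intros)
  show "((\<lambda>t. - lip_prim l a (- t)) has_real_derivative lip_const l a (- t)) (at t)" for t
    unfolding lip_prim_def lip_const_def by (auto intro!: derivative_eq_intros)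
  show "continuous_on UNIV (\<lambda>t. lip_const l a (- t))"
    unfolding lip_const_def by (intro continuous_intros)
  show "0 \<le> lip_const l a (- t)" for t unfolding lip_const_def by simp
  show "\<bar>- prufer l a (- t) x - - prufer l a (- t) y\<bar> \<le> lip_const l a (- t) * \<bar>x - y\<bar>" for t x y
    using abs_prufer_diff_le[of l a "-t" x y] by linarith
  show "\<bar>- prufer l a (- t) 0\<bar> \<le> lip_const l a (- t)" for t
    using abs_prufer_0_le[of l a "-t"] by simp
qed

lemma prufer_deriv_angle:
  "((\<lambda>x. prufer l a t x) has_real_derivative
    2 * (\<kappa> + a * exp (- t)) * cos (2 * x) - 2 * exp t * sin (2 * x)) (at x)"
  unfolding prufer_def by (auto intro!: derivative_eq_intros simp: algebra_simps)

lemma abs_prufer_param_diff_le: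
  "\<bar>prufer l a t x - prufer l' a' t x\<bar> \<le> exp (- t) * \<bar>a - a'\<bar> + exp t * \<bar>l - l'\<bar>"
proof -
  have "prufer l a t x - prufer l' a' t x = exp (- t) * ((a - a') * sin (2 * x)) - exp t * (l - l')"
    by (simp add: prufer_def algebra_simps)
  also have "\<bar>\<dots>\<bar> \<le> exp (- t) * (\<bar>a - a'\<bar> * \<bar>sin (2 * x)\<bar>) + exp t * \<bar>l - l'\<bar>"
    by (intro order_trans[OF abs_triangle_ineq4]) (simp add: abs_mult)
  also have "\<dots> \<le> exp (- t) * \<bar>a - a'\<bar> + exp t * \<bar>l - l'\<bar>"
    by (intro add_mono mult_left_mono mult_left_le) auto
  finally show ?thesis .
qed

text \<open>The sine of 2\<beta> is the midpoint of c/\<kappa> and 1. Hence -\<beta> lies below the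
  stationary angle of \<open>c + \<kappa> * sin (2 * x)\<close> and above -pi/4, where cos 2x would
  vanish.\<close>

definition band_angle :: real ("\<beta>") where
  "\<beta> = arcsin ((c / \<kappa> + 1) / 2) / 2"

lemma coupling_ratio: "0 < c / \<kappa>" "c / \<kappa> < 1"
  using \<kappa>c c0 by (auto simp: divide_simps)

lemma sin_double_band_angle: "sin (2 * \<beta>) = (c / \<kappa> + 1) / 2"
  using coupling_ratio by (simp add: band_angle_def)

lemma band_angle_bounds: "0 < \<beta>" "\<beta> < pi / 4"
proof -
  have "arcsin 0 < arcsin ((c / \<kappa> + 1) / 2)" "arcsin ((c / \<kappa> + 1) / 2) < arcsin 1"
    using coupling_ratio by (intro arcsin_less_arcsin; simp)+
  then show "0 < \<beta>" "\<beta> < pi / 4" by (auto simp: band_angle_def)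
qed

lemma cos_double_band_angle_pos: "0 < cos (2 * \<beta>)"
  using band_angle_bounds by (intro cos_gt_zero) auto

lemma cos_double_ge_in_band:
  assumes "- \<beta> \<le> x" "x \<le> 0"
  shows "cos (2 * \<beta>) \<le> cos (2 * x)"
proof -
  have "cos (2 * \<beta>) \<le> cos (2 * (- x))"
    using assms band_angle_bounds by (intro cos_monotone_0_pi_le) auto
  then show ?thesis by simp
qed

lemma eventually_at_bot_le_obtain:
  assumes "eventually P (at_bot :: real filter)"
  obtains T where "T \<le> 0" "\<And>t. t \<le> T \<Longrightarrow> P t"
  using assms unfolding eventually_at_bot_linorder by (metis min.cobounded1 min.cobounded2 order_trans)

text \<open>For a <= 0 the singular term helps everywhere: at -\<beta> it is nonnegative since the
  sine is negative there, at 0 it vanishes, and in between it lowers the slope since cos 2x > 0. So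
  T and g do not depend on a. The remaining leading part is (c - \<kappa>)/2 > 0 at -\<beta> and c <
  0 at 0.\<close>

lemma left_band:
  obtains T g where "T \<le> 0" "0 < g"
    "\<And>l a t. \<bar>l\<bar> \<le> L \<Longrightarrow> a \<le> 0 \<Longrightarrow> t \<le> T \<Longrightarrow> 0 \<le> prufer l a t (- \<beta>)"
    "\<And>l a t. \<bar>l\<bar> \<le> L \<Longrightarrow> a \<le> 0 \<Longrightarrow> t \<le> T \<Longrightarrow> prufer l a t 0 \<le> 0"
    "\<And>a t x. a \<le> 0 \<Longrightarrow> t \<le> T \<Longrightarrow> - \<beta> \<le> x \<Longrightarrow> x \<le> 0 \<Longrightarrow>
      2 * (\<kappa> + a * exp (- t)) * cos (2 * x) - 2 * exp t * sin (2 * x) \<le> - g"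
proof -
  \<comment> \<open>The leading part contributes at most -2C to the slope and the other term less
    than C once \<open>exp t < C / 2\<close>, so that \<open>g = C\<close> remains.\<close>
  define C where "C = - \<kappa> * cos (2 * \<beta>)"
  have C: "0 < C" using \<kappa>0 cos_double_band_angle_pos by (simp add: C_def mult_neg_pos)
  have lim: "((\<lambda>t. exp t * (1 + L)) \<longlongrightarrow> 0) (at_bot :: real filter)"
    by (rule tendsto_mult_left_zero[OF exp_at_bot])
  have 1: "\<forall>\<^sub>F t :: real in at_bot. exp t * (1 + L) < (c - \<kappa>) / 2"
    and 2: "\<forall>\<^sub>F t :: real in at_bot. exp t * (1 + L) < - c"
    by (rule order_tendstoD(2)[OF lim]; use \<kappa>c c0 in simp)+
  have 3: "\<forall>\<^sub>F t :: real in at_bot. exp t < C / 2"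
    by (rule order_tendstoD(2)[OF exp_at_bot]) (use C in simp)
  from 1 2 3 have "\<forall>\<^sub>F t :: real in at_bot. exp t * (1 + L) < (c - \<kappa>) / 2 \<and>
      exp t * (1 + L) < - c \<and> exp t < C / 2" by eventually_elim simp
  then obtain T where T: "T \<le> 0" and T': "\<And>t. t \<le> T \<Longrightarrow> exp t * (1 + L) < (c - \<kappa>) / 2 \<and>
      exp t * (1 + L) < - c \<and> exp t < C / 2" by (rule eventually_at_bot_le_obtain) blast
  show thesis
  proof (rule that[OF T C])
    fix l a t assume l: "\<bar>l\<bar> \<le> L" and a: "a \<le> (0::real)" and t: "t \<le> T"
    have e: "exp t * (cos (2 * x) - l) \<le> exp t * (1 + L)" "- (exp t * (1 + L)) \<le> exp t * (cos (2 * x) - l)" for x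
    proof -
      have "cos (2 * x) - l \<le> 1 + L" "- (1 + L) \<le> cos (2 * x) - l"
        using l cos_le_one[of "2 * x"] cos_ge_minus_one[of "2 * x"] by linarith+
      then show "exp t * (cos (2 * x) - l) \<le> exp t * (1 + L)"
        and "- (exp t * (1 + L)) \<le> exp t * (cos (2 * x) - l)"
        using mult_left_mono[of _ _ "exp t"] by (auto simp flip: mult_minus_right)
    qed
    have "prufer l a t 0 = c + exp t * (cos (2 * 0) - l)" by (simp add: prufer_def)
    then show "prufer l a t 0 \<le> 0" using e(1)[of 0] T'[OF t] by linarith
    have "- \<kappa> * sin (2 * \<beta>) \<le> - (\<kappa> + a * exp (- t)) * sin (2 * \<beta>)"
      using a coupling_ratio by (intro mult_right_mono) (auto simp: sin_double_band_angle mult_nonpos_nonneg)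
    moreover have "- \<kappa> * sin (2 * \<beta>) = - (c + \<kappa>) / 2"
      using \<kappa>0 by (simp add: sin_double_band_angle field_simps)
    ultimately show "0 \<le> prufer l a t (- \<beta>)"
      using e(2)[of "- \<beta>"] T'[OF t] by (simp add: prufer_def field_simps)
  next
    fix a t x assume a: "a \<le> (0::real)" and t: "t \<le> T" and x: "- \<beta> \<le> x" "x \<le> 0"
    have "(\<kappa> + a * exp (- t)) * cos (2 * x) \<le> \<kappa> * cos (2 * \<beta>)"
    proof -
      have "(\<kappa> + a * exp (- t)) * cos (2 * x) \<le> \<kappa> * cos (2 * x)"
        using a cos_double_ge_in_band[OF x] cos_double_band_angle_pos
        by (intro mult_right_mono) (auto simp: mult_nonpos_nonneg)
      also have "\<dots> \<le> \<kappa> * cos (2 * \<beta>)" using \<kappa>0 cos_double_ge_in_band[OF x] by (intro mult_left_mono_neg) auto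
      finally show ?thesis .
    qed
    moreover have "- (exp t * sin (2 * x)) \<le> exp t"
      using mult_left_mono[of "- sin (2 * x)" 1 "exp t"] sin_ge_minus_one[of "2 * x"] by simp
    moreover have "exp t < C / 2" using T'[OF t] by simp
    ultimately show "2 * (\<kappa> + a * exp (- t)) * cos (2 * x) - 2 * exp t * sin (2 * x) \<le> - C"
      unfolding C_def mult.assoc[of 2] by linarith
  qed
qed

text \<open>At infinity \<open>exp t * (cos (2 * x) - l)\<close> dominates, and |l| <= L < 1 gives
  it opposite signs at the two edges. The range of a bounds the remaining coefficient uniformly.
  Time is reversed here. The rate -2 means decay like r^(-2), enough for square integrability at
  infinity.\<close>

lemma right_band:
  assumes L: "0 \<le> L" "L < 1"
  obtains T \<eta> where "T \<le> 0" "0 < \<eta>" "\<eta> < pi / 4"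
    "\<And>l a t. \<bar>l\<bar> \<le> L \<Longrightarrow> -1 \<le> a \<Longrightarrow> a \<le> 0 \<Longrightarrow> t \<le> T \<Longrightarrow> 0 \<le> - prufer l a (- t) (- (pi / 2) + \<eta>)"
    "\<And>l a t. \<bar>l\<bar> \<le> L \<Longrightarrow> -1 \<le> a \<Longrightarrow> a \<le> 0 \<Longrightarrow> t \<le> T \<Longrightarrow> - prufer l a (- t) (- \<eta>) \<le> 0"
    "\<And>a t x. -1 \<le> a \<Longrightarrow> a \<le> 0 \<Longrightarrow> t \<le> T \<Longrightarrow> - (pi / 2) + \<eta> \<le> x \<Longrightarrow> x \<le> - \<eta> \<Longrightarrow>
      - (2 * (\<kappa> + a * exp t) * cos (2 * x) - 2 * exp (- t) * sin (2 * x)) \<le> - 1"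
    "\<And>a t x. -1 \<le> a \<Longrightarrow> a \<le> 0 \<Longrightarrow> t \<le> T \<Longrightarrow> - (pi / 2) + \<eta> \<le> x \<Longrightarrow> x \<le> - \<eta> \<Longrightarrow>
      prufer_rate a (- t) x \<le> - 2"
proof -
  \<comment> \<open>\<open>cos (2 * \<eta>)\<close> is the midpoint of L and 1, so cos 2x - l is at
    least (1 - L)/2 at the upper edge and at most its negative at the lower one.\<close>
  define \<eta> where "\<eta> = arccos ((1 + L) / 2) / 2"
  have cos\<eta>: "cos (2 * \<eta>) = (1 + L) / 2" using L by (simp add: \<eta>_def)
  have "arccos 1 < arccos ((1 + L) / 2)" "arccos ((1 + L) / 2) < arccos 0"
    using L by (intro arccos_less_arccos; simp)+
  then have \<eta>: "0 < \<eta>" "\<eta> < pi / 4" by (auto simp: \<eta>_def)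
  define S where "S = sin (2 * \<eta>)"
  have S: "0 < S" using \<eta> by (auto simp: S_def intro!: sin_gt_zero)
  define B where "B = \<bar>c\<bar> + \<bar>\<kappa>\<bar> + 1"
  have B: "0 < B" by (simp add: B_def)
  have lim: "filterlim (\<lambda>t. exp (- t)) at_top (at_bot :: real filter)" by real_asymp
  have 1: "\<forall>\<^sub>F t :: real in at_bot. 2 * B / (1 - L) \<le> exp (- t)"
    and 2: "\<forall>\<^sub>F t :: real in at_bot. (B + 2) / S \<le> exp (- t)"
    using lim by (auto simp: filterlim_at_top)
  from 1 2 have "\<forall>\<^sub>F t :: real in at_bot. 2 * B / (1 - L) \<le> exp (- t) \<and> (B + 2) / S \<le> exp (- t)"
    by eventually_elim simp
  then obtain T where T: "T \<le> 0" and
    T': "\<And>t. t \<le> T \<Longrightarrow> 2 * B / (1 - L) \<le> exp (- t) \<and> (B + 2) / S \<le> exp (- t)"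
    by (rule eventually_at_bot_le_obtain) blast
  \<comment> \<open>\<open>T1\<close> lets the exponential term beat the bounded ones at the edges;
    \<open>T2\<close> does so inside the band, the extra 2 being the decay rate.\<close>
  have T1: "B \<le> exp (- t) * ((1 - L) / 2)" and T2: "B + 2 \<le> exp (- t) * S" if "t \<le> T" for t
    using T'[OF that] L S by (auto simp: field_simps)
  have coef: "\<bar>(\<kappa> + a * exp t) * z\<bar> \<le> \<bar>\<kappa>\<bar> + 1"
    if "-1 \<le> a" "a \<le> 0" "t \<le> T" "\<bar>z\<bar> \<le> 1" for a t z
  proof -
    have "\<bar>a\<bar> * exp t \<le> 1 * 1" using that T by (intro mult_mono) auto
    then have "\<bar>\<kappa> + a * exp t\<bar> \<le> \<bar>\<kappa>\<bar> + 1"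
      by (intro order_trans[OF abs_triangle_ineq]) (simp add: abs_mult)
    then have "\<bar>\<kappa> + a * exp t\<bar> * \<bar>z\<bar> \<le> (\<bar>\<kappa>\<bar> + 1) * 1" using that by (intro mult_mono) auto
    then show ?thesis by (simp add: abs_mult)
  qed
  have sin_le: "sin (2 * x) \<le> - S" if x: "- (pi / 2) + \<eta> \<le> x" "x \<le> - \<eta>" for x
  proof -
    have "S \<le> sin (- 2 * x)"
    proof (cases "- 2 * x \<le> pi / 2")
      case True
      then show ?thesis unfolding S_def using x \<eta> by (intro sin_monotone_2pi_le) auto
    next
      case False
      have "sin (2 * \<eta>) \<le> sin (pi + 2 * x)"
        using x \<eta> False by (intro sin_monotone_2pi_le) auto
      then show ?thesis by (simp add: S_def sin_add)
    qed
    then show ?thesis by simp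
  qed
  show thesis
  proof (rule that[OF T \<eta>])
    fix l a t assume l: "\<bar>l\<bar> \<le> L" and a: "-1 \<le> a" "a \<le> (0::real)" and t: "t \<le> T"
    have b: "\<bar>c + (\<kappa> + a * exp t) * sin z\<bar> \<le> B" for z
      using coef[OF a t, of "sin z"] by (simp add: B_def)
    have P: "prufer l a (- t) x = c + (\<kappa> + a * exp t) * sin (2 * x) + exp (- t) * (cos (2 * x) - l)" for x
      by (simp add: prufer_def)
    have lo: "cos (2 * (- (pi / 2) + \<eta>)) = - (1 + L) / 2" and hi: "cos (2 * (- \<eta>)) = (1 + L) / 2"
      using cos\<eta> by (simp_all add: cos_add algebra_simps)
    have "exp (- t) * (- (1 + L) / 2 - l) \<le> exp (- t) * (- ((1 - L) / 2))"
      using l by (intro mult_left_mono) (auto simp: field_simps)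
    then show "0 \<le> - prufer l a (- t) (- (pi / 2) + \<eta>)"
      using b[of "2 * (- (pi / 2) + \<eta>)"] T1[OF t] unfolding P lo by linarith
    have "exp (- t) * ((1 - L) / 2) \<le> exp (- t) * ((1 + L) / 2 - l)"
      using l by (intro mult_left_mono) (auto simp: field_simps)
    then show "- prufer l a (- t) (- \<eta>) \<le> 0"
      using b[of "2 * (- \<eta>)"] T1[OF t] unfolding P hi by linarith
  next
    fix a t x assume a: "-1 \<le> a" "a \<le> (0::real)" and t: "t \<le> T"
      and x: "- (pi / 2) + \<eta> \<le> x" "x \<le> - \<eta>"
    have b: "\<bar>(\<kappa> + a * exp t) * cos (2 * x)\<bar> \<le> B"
      using coef[OF a t, of "cos (2 * x)"] by (simp add: B_def)
    have e: "exp (- t) * sin (2 * x) \<le> - (exp (- t) * S)"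
      using mult_left_mono[OF sin_le[OF x], of "exp (- t)"] by simp
    show "- (2 * (\<kappa> + a * exp t) * cos (2 * x) - 2 * exp (- t) * sin (2 * x)) \<le> - 1"
    proof -
      have "- (2 * (\<kappa> + a * exp t) * cos (2 * x) - 2 * exp (- t) * sin (2 * x))
          = 2 * (exp (- t) * sin (2 * x)) - 2 * ((\<kappa> + a * exp t) * cos (2 * x))"
        by (simp only: mult.assoc minus_diff_eq)
      then show ?thesis using b e T2[OF t] by linarith
    qed
    show "prufer_rate a (- t) x \<le> - 2"
    proof -
      have "prufer_rate a (- t) x = exp (- t) * sin (2 * x) - (\<kappa> + a * exp t) * cos (2 * x)"
        by (simp add: prufer_rate_def algebra_simps)
      then show ?thesis using b e T2[OF t] by linarith
    qed
  qed
qed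

text \<open>
  The angles of the solutions that are recessive at \<open>0\<close> and at \<open>\<infinity>\<close>, respectively.
\<close>

lemma prufer_angles:
  assumes L: "0 \<le> L" "L < 1"
  obtains XL XR T where
    "\<And>l a t. \<bar>l\<bar> \<le> L \<Longrightarrow> -1 \<le> a \<Longrightarrow> a \<le> 0 \<Longrightarrow> (XL l a has_real_derivative prufer l a t (XL l a t)) (at t)"
    "\<And>l a t. \<bar>l\<bar> \<le> L \<Longrightarrow> -1 \<le> a \<Longrightarrow> a \<le> 0 \<Longrightarrow> (XR l a has_real_derivative prufer l a t (XR l a t)) (at t)"
    "\<And>l a t. \<bar>l\<bar> \<le> L \<Longrightarrow> -1 \<le> a \<Longrightarrow> a \<le> 0 \<Longrightarrow> t \<le> - T \<Longrightarrow> - \<beta> \<le> XL l a t \<and> XL l a t \<le> 0"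
    "\<And>l a t. \<bar>l\<bar> \<le> L \<Longrightarrow> -1 \<le> a \<Longrightarrow> a \<le> 0 \<Longrightarrow> T \<le> t \<Longrightarrow> prufer_rate a t (XR l a t) \<le> - 2"
    "\<And>l l' a. \<bar>l\<bar> \<le> L \<Longrightarrow> \<bar>l'\<bar> \<le> L \<Longrightarrow> -1 \<le> a \<Longrightarrow> a \<le> 0 \<Longrightarrow> l < l' \<Longrightarrow>
      XL l' a 0 - XR l' a 0 < XL l a 0 - XR l a 0"
    "\<And>l a e. \<bar>l\<bar> \<le> L \<Longrightarrow> -1 \<le> a \<Longrightarrow> a \<le> 0 \<Longrightarrow> 0 < e \<Longrightarrow>
      \<exists>d>0. \<forall>l' a'. \<bar>l'\<bar> \<le> L \<longrightarrow> -1 \<le> a' \<longrightarrow> a' \<le> 0 \<longrightarrow> \<bar>l - l'\<bar> + \<bar>a - a'\<bar> < d \<longrightarrow>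
        \<bar>(XL l a 0 - XR l a 0) - (XL l' a' 0 - XR l' a' 0)\<bar> < e"
proof -
  define I where "I = {p :: real \<times> real. \<bar>fst p\<bar> \<le> L \<and> -1 \<le> snd p \<and> snd p \<le> 0}"
  define \<Delta> where "\<Delta> p q = \<bar>fst p - fst q\<bar> + \<bar>snd p - snd q\<bar>" for p q :: "real \<times> real"
  \<comment> \<open>\<open>exp \<bar>t\<bar>\<close> suits the original equation and the reversed
    one alike.\<close>
  have close: "\<bar>prufer (fst p) (snd p) t x - prufer (fst q) (snd q) t x\<bar> \<le> exp \<bar>t\<bar> * \<Delta> p q" for p q t x
  proof -
    have "exp (- t) * \<bar>snd p - snd q\<bar> + exp t * \<bar>fst p - fst q\<bar> \<le> exp \<bar>t\<bar> * \<bar>snd p - snd q\<bar> + exp \<bar>t\<bar> * \<bar>fst p - fst q\<bar>"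
      by (intro add_mono mult_right_mono) auto
    with abs_prufer_param_diff_le[of "fst p" "snd p" t x "fst q" "snd q"] show ?thesis
      by (simp add: \<Delta>_def algebra_simps)
  qed
  obtain T1 g where T1: "T1 \<le> 0" and g: "0 < g" and left:
    "\<And>l a t. \<bar>l\<bar> \<le> L \<Longrightarrow> a \<le> 0 \<Longrightarrow> t \<le> T1 \<Longrightarrow> 0 \<le> prufer l a t (- \<beta>)"
    "\<And>l a t. \<bar>l\<bar> \<le> L \<Longrightarrow> a \<le> 0 \<Longrightarrow> t \<le> T1 \<Longrightarrow> prufer l a t 0 \<le> 0"
    "\<And>a t x. a \<le> 0 \<Longrightarrow> t \<le> T1 \<Longrightarrow> - \<beta> \<le> x \<Longrightarrow> x \<le> 0 \<Longrightarrow>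
      2 * (\<kappa> + a * exp (- t)) * cos (2 * x) - 2 * exp t * sin (2 * x) \<le> - g"
    by (rule left_band[of L]) blast
  obtain X1 where
    X1: "\<And>p t. p \<in> I \<Longrightarrow> (X1 p has_real_derivative prufer (fst p) (snd p) t (X1 p t)) (at t)"
      "\<And>p t. p \<in> I \<Longrightarrow> t \<le> T1 \<Longrightarrow> - \<beta> \<le> X1 p t \<and> X1 p t \<le> 0"
      "\<And>p \<eta>. p \<in> I \<Longrightarrow> 0 < \<eta> \<Longrightarrow>
        \<exists>\<delta>>0. \<forall>q\<in>I. \<Delta> p q < \<delta> \<longrightarrow> \<bar>X1 p 0 - X1 q 0\<bar> < \<eta>"
      "\<And>p q t. p \<in> I \<Longrightarrow> q \<in> I \<Longrightarrow>
        (\<And>t y. prufer (fst q) (snd q) t y < prufer (fst p) (snd p) t y) \<Longrightarrow> X1 q t < X1 p t"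
  proof (rule band_family[of I "\<lambda>p. prufer (fst p) (snd p)" "\<lambda>p. lip_prim (fst p) (snd p)"
        "\<lambda>p. lip_const (fst p) (snd p)" T1 "- \<beta>" 0 g \<Delta>])
    show "lipschitz_ode (prufer (fst p) (snd p)) (lip_prim (fst p) (snd p)) (lip_const (fst p) (snd p))" for p
      by (rule lipschitz_ode_prufer)
    show "- \<beta> \<le> 0" using band_angle_bounds by simp
    show "(prufer (fst p) (snd p) t x - prufer (fst p) (snd p) t y) * (x - y) \<le> - g * (x - y)\<^sup>2"
      if "p \<in> I" "t \<le> T1" "- \<beta> \<le> x" "x \<le> 0" "- \<beta> \<le> y" "y \<le> 0" for p t x y
      using that left(3)[of "snd p" t]
      by (intro contraction_if_deriv_le[where f="prufer (fst p) (snd p) t", OF prufer_deriv_angle])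
        (auto simp: I_def)
    show "\<bar>prufer (fst p) (snd p) t x - prufer (fst q) (snd q) t x\<bar> \<le> exp (- t) * \<Delta> p q"
      if "t \<le> 0" for p q t x
      using close[of p t x q] that by simp
  qed (use T1 g left in \<open>auto simp: I_def\<close>)
  obtain T2 \<eta> where T2: "T2 \<le> 0" and \<eta>: "0 < \<eta>" "\<eta> < pi / 4" and right:
    "\<And>l a t. \<bar>l\<bar> \<le> L \<Longrightarrow> -1 \<le> a \<Longrightarrow> a \<le> 0 \<Longrightarrow> t \<le> T2 \<Longrightarrow> 0 \<le> - prufer l a (- t) (- (pi / 2) + \<eta>)"
    "\<And>l a t. \<bar>l\<bar> \<le> L \<Longrightarrow> -1 \<le> a \<Longrightarrow> a \<le> 0 \<Longrightarrow> t \<le> T2 \<Longrightarrow> - prufer l a (- t) (- \<eta>) \<le> 0"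
    "\<And>a t x. -1 \<le> a \<Longrightarrow> a \<le> 0 \<Longrightarrow> t \<le> T2 \<Longrightarrow> - (pi / 2) + \<eta> \<le> x \<Longrightarrow> x \<le> - \<eta> \<Longrightarrow>
      - (2 * (\<kappa> + a * exp t) * cos (2 * x) - 2 * exp (- t) * sin (2 * x)) \<le> - 1"
    "\<And>a t x. -1 \<le> a \<Longrightarrow> a \<le> 0 \<Longrightarrow> t \<le> T2 \<Longrightarrow> - (pi / 2) + \<eta> \<le> x \<Longrightarrow> x \<le> - \<eta> \<Longrightarrow>
      prufer_rate a (- t) x \<le> - 2"
    by (rule right_band[OF L]) blast
  obtain X2 where
    X2: "\<And>p t. p \<in> I \<Longrightarrow> (X2 p has_real_derivative - prufer (fst p) (snd p) (- t) (X2 p t)) (at t)"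
      "\<And>p t. p \<in> I \<Longrightarrow> t \<le> T2 \<Longrightarrow> - (pi / 2) + \<eta> \<le> X2 p t \<and> X2 p t \<le> - \<eta>"
      "\<And>p \<eta>. p \<in> I \<Longrightarrow> 0 < \<eta> \<Longrightarrow>
        \<exists>\<delta>>0. \<forall>q\<in>I. \<Delta> p q < \<delta> \<longrightarrow> \<bar>X2 p 0 - X2 q 0\<bar> < \<eta>"
      "\<And>p q t. p \<in> I \<Longrightarrow> q \<in> I \<Longrightarrow>
        (\<And>t y. - prufer (fst q) (snd q) (- t) y < - prufer (fst p) (snd p) (- t) y) \<Longrightarrow> X2 q t < X2 p t"
  proof (rule band_family[of I "\<lambda>p t x. - prufer (fst p) (snd p) (- t) x" "\<lambda>p t. - lip_prim (fst p) (snd p) (- t)"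
        "\<lambda>p t. lip_const (fst p) (snd p) (- t)" T2 "- (pi / 2) + \<eta>" "- \<eta>" 1 \<Delta>])
    show "lipschitz_ode (\<lambda>t x. - prufer (fst p) (snd p) (- t) x) (\<lambda>t. - lip_prim (fst p) (snd p) (- t))
        (\<lambda>t. lip_const (fst p) (snd p) (- t))" for p
      by (rule lipschitz_ode_prufer_reversed)
    show "- (pi / 2) + \<eta> \<le> - \<eta>" using \<eta> by simp
    show "(- prufer (fst p) (snd p) (- t) x - - prufer (fst p) (snd p) (- t) y) * (x - y) \<le> - 1 * (x - y)\<^sup>2"
      if "p \<in> I" "t \<le> T2" "- (pi / 2) + \<eta> \<le> x" "x \<le> - \<eta>" "- (pi / 2) + \<eta> \<le> y" "y \<le> - \<eta>" for p t x y
      using that right(3)[of "snd p" t]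
      by (intro contraction_if_deriv_le[where f="\<lambda>x. - prufer (fst p) (snd p) (- t) x", OF DERIV_minus[OF prufer_deriv_angle]])
        (auto simp: I_def)
    show "\<bar>- prufer (fst p) (snd p) (- t) x - - prufer (fst q) (snd q) (- t) x\<bar> \<le> exp (- t) * \<Delta> p q"
      if "t \<le> 0" for p q t x
      using close[of p "-t" x q] that by simp
  qed (use T2 right in \<open>auto simp: I_def\<close>)
  define XL where "XL l a = X1 (l, a)" for l a
  define XR where "XR l a t = X2 (l, a) (- t)" for l a t
  define T where "T = max (- T1) (- T2)"
  have pI: "(l, a) \<in> I" if "\<bar>l\<bar> \<le> L" "-1 \<le> a" "a \<le> 0" for l a using that by (simp add: I_def)
  show thesis
  proof (rule that[of XL XR T])
    fix l a t :: real assume la: "\<bar>l\<bar> \<le> L" "-1 \<le> a" "a \<le> 0"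
    note p = pI[OF la]
    show "(XL l a has_real_derivative prufer l a t (XL l a t)) (at t)"
      using X1(1)[OF p] by (simp add: XL_def)
    have "((\<lambda>t. X2 (l, a) (- t)) has_real_derivative - prufer l a (- (- t)) (X2 (l, a) (- t)) * - 1) (at t)"
      using X2(1)[OF p, of "-t"] by (intro DERIV_chain2[where g="\<lambda>t. - t"]) (auto intro!: derivative_eq_intros)
    then show "(XR l a has_real_derivative prufer l a t (XR l a t)) (at t)"
      by (simp add: XR_def[abs_def])
    show "- \<beta> \<le> XL l a t \<and> XL l a t \<le> 0" if "t \<le> - T"
      using X1(2)[OF p, of t] that by (simp add: XL_def T_def)
    show "prufer_rate a t (XR l a t) \<le> - 2" if "T \<le> t"
      using X2(2)[OF p, of "-t"] that right(4)[OF la(2,3), of "-t"] by (simp add: XR_def T_def)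
  next
    fix l l' a :: real assume l: "\<bar>l\<bar> \<le> L" "\<bar>l'\<bar> \<le> L" and a: "-1 \<le> a" "a \<le> 0" and less: "l < l'"
    have p: "(l, a) \<in> I" "(l', a) \<in> I" using l a by (auto intro: pI)
    \<comment> \<open>Raising l lowers the right-hand side and raises the reversed one, so
      \<open>XL\<close> decreases while \<open>XR\<close> increases.\<close>
    have *: "prufer l' a t y < prufer l a t y" for t y using less by (simp add: prufer_def)
    show "XL l' a 0 - XR l' a 0 < XL l a 0 - XR l a 0"
      using X1(4)[OF p, of 0] X2(4)[OF p(2,1), of 0] * by (simp add: XL_def XR_def)
  next
    fix l a e :: real assume la: "\<bar>l\<bar> \<le> L" "-1 \<le> a" "a \<le> 0" and e: "0 < e"
    note p = pI[OF la]
    obtain d1 where d1: "0 < d1" "\<And>q. q \<in> I \<Longrightarrow> \<Delta> (l, a) q < d1 \<Longrightarrow> \<bar>X1 (l, a) 0 - X1 q 0\<bar> < e / 2"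
      using X1(3)[OF p, of "e / 2"] e by auto
    obtain d2 where d2: "0 < d2" "\<And>q. q \<in> I \<Longrightarrow> \<Delta> (l, a) q < d2 \<Longrightarrow> \<bar>X2 (l, a) 0 - X2 q 0\<bar> < e / 2"
      using X2(3)[OF p, of "e / 2"] e by auto
    show "\<exists>d>0. \<forall>l' a'. \<bar>l'\<bar> \<le> L \<longrightarrow> -1 \<le> a' \<longrightarrow> a' \<le> 0 \<longrightarrow> \<bar>l - l'\<bar> + \<bar>a - a'\<bar> < d \<longrightarrow>
        \<bar>(XL l a 0 - XR l a 0) - (XL l' a' 0 - XR l' a' 0)\<bar> < e"
    proof (intro exI[of _ "min d1 d2"] conjI allI impI)
      show "0 < min d1 d2" using d1 d2 by simp
      fix l' a' :: real assume *: "\<bar>l'\<bar> \<le> L" "-1 \<le> a'" "a' \<le> 0" "\<bar>l - l'\<bar> + \<bar>a - a'\<bar> < min d1 d2"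
      show "\<bar>(XL l a 0 - XR l a 0) - (XL l' a' 0 - XR l' a' 0)\<bar> < e"
        using d1(2)[OF pI[OF *(1-3)], unfolded \<Delta>_def fst_conv snd_conv]
          d2(2)[OF pI[OF *(1-3)], unfolded \<Delta>_def fst_conv snd_conv] *(4)
        unfolding XL_def XR_def minus_zero by linarith
    qed
  qed
qed

end

section \<open>Bounds and limits of functions on half-lines\<close>

lemma bounded_above_left_half_line:
  fixes f :: "real \<Rightarrow> real"
  assumes df: "\<And>t. (f has_real_derivative f' t) (at t)" and T: "\<And>t. t \<le> T \<Longrightarrow> 0 \<le> f' t"
  obtains C where "\<And>t. t \<le> t1 \<Longrightarrow> f t \<le> C"
proof -
  have "continuous_on {T..t1} f"
    using df by (meson DERIV_continuous continuous_at_imp_continuous_on)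
  then have "bdd_above (f ` {T..t1})"
    by (intro bounded_imp_bdd_above compact_imp_bounded compact_continuous_image) auto
  then obtain B where B: "\<And>t. T \<le> t \<Longrightarrow> t \<le> t1 \<Longrightarrow> f t \<le> B"
    unfolding bdd_above_def by (meson atLeastAtMost_iff imageI)
  have "f t \<le> max B (f T)" if "t \<le> t1" for t
  proof (cases "T \<le> t")
    case True
    with B[OF True that] show ?thesis by simp
  next
    case False
    then have "f t \<le> f T" by (intro nondecreasing_if_deriv_nonneg[OF _ df T]) auto
    then show ?thesis by simp
  qed
  with that show thesis by blast
qed

lemma bounded_above_right_half_line:
  fixes f :: "real \<Rightarrow> real"
  assumes df: "\<And>t. (f has_real_derivative f' t) (at t)" and T: "\<And>t. T \<le> t \<Longrightarrow> f' t \<le> 0"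
  obtains C where "\<And>t. t1 \<le> t \<Longrightarrow> f t \<le> C"
proof -
  have "((\<lambda>t. f (- t)) has_real_derivative - f' (- t)) (at t)" for t
  proof -
    have "((\<lambda>t::real. - t) has_real_derivative - 1) (at t)" by (auto intro!: derivative_eq_intros)
    from DERIV_chain2[where f=f and g="\<lambda>t. - t", OF df[of "- t"] this] show ?thesis by simp
  qed
  then obtain C where "\<And>t. t \<le> - t1 \<Longrightarrow> f (- t) \<le> C"
    by (rule bounded_above_left_half_line[of "\<lambda>t. f (- t)" "\<lambda>t. - f' (- t)" "- T"]) (use T in auto)
  then have "f t \<le> C" if "t1 \<le> t" for t using that by (metis minus_minus neg_le_iff_le)
  with that show thesis by blast
qed

lemma mono_bounded_tendsto_at_bot:
  fixes z :: "real \<Rightarrow> real"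
  assumes mono: "\<And>s t. s \<le> t \<Longrightarrow> t \<le> T \<Longrightarrow> z s \<le> z t" and B: "\<And>t. t \<le> T \<Longrightarrow> B \<le> z t"
  obtains K where "(z \<longlongrightarrow> K) at_bot"
proof -
  define K where "K = Inf (z ` {..T})"
  have bdd: "bdd_below (z ` {..T})" using B by (intro bdd_belowI[of _ B]) auto
  have lower: "K \<le> z t" if "t \<le> T" for t
    unfolding K_def using that by (intro cInf_lower[OF _ bdd]) auto
  have "(z \<longlongrightarrow> K) at_bot"
  proof (rule order_tendstoI)
    fix a assume "a < K"
    show "\<forall>\<^sub>F t in at_bot. a < z t"
      using eventually_le_at_bot[of T] by eventually_elim (use lower \<open>a < K\<close> in fastforce)
  next
    fix a assume "K < a"
    then obtain t1 where t1: "t1 \<le> T" "z t1 < a"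
      unfolding K_def using cInf_less_iff[OF _ bdd, of a] by auto
    show "\<forall>\<^sub>F t in at_bot. z t < a"
      using eventually_le_at_bot[of t1] by eventually_elim (use mono t1 in fastforce)
  qed
  with that show thesis by blast
qed

section \<open>Real solutions and Wronskians\<close>

definition wronskian :: "spinor \<Rightarrow> (real \<Rightarrow> real) \<Rightarrow> (real \<Rightarrow> real) \<Rightarrow> real \<Rightarrow> complex" where
  "wronskian h v w r = h r $ 1 * complex_of_real (w r) - h r $ 2 * complex_of_real (v r)"

definition real_spinor :: "(real \<Rightarrow> real) \<Rightarrow> (real \<Rightarrow> real) \<Rightarrow> spinor" where
  "real_spinor v w r = v r *\<^sub>R axis 1 1 + w r *\<^sub>R axis 2 1"

lemma real_spinor_nth [simp]:
  "real_spinor v w r $ 1 = complex_of_real (v r)" "real_spinor v w r $ 2 = complex_of_real (w r)"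
  by (simp_all add: real_spinor_def axis_def complex_eq_iff)

lemma norm_complex2_sq: "(norm (x :: complex ^ 2))\<^sup>2 = (norm (x $ 1))\<^sup>2 + (norm (x $ 2))\<^sup>2"
  by (simp add: norm_vec_def L2_set_def sum_2)

lemma norm_real_spinor: "norm (real_spinor v w r) = sqrt ((v r)\<^sup>2 + (w r)\<^sup>2)"
proof -
  have "(norm (real_spinor v w r))\<^sup>2 = (v r)\<^sup>2 + (w r)\<^sup>2" by (simp add: norm_complex2_sq)
  then show ?thesis by (metis norm_ge_zero real_sqrt_unique)
qed

lemma real_spinor_has_vector_derivative:
  assumes "(v has_real_derivative v') (at r)" "(w has_real_derivative w') (at r)"
  shows "(real_spinor v w has_vector_derivative v' *\<^sub>R axis 1 1 + w' *\<^sub>R axis 2 1) (at r)"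
  unfolding real_spinor_def[abs_def]
  by (auto intro!: derivative_eq_intros assms)

text \<open>The eigenvalue equation for \<open>dirac_expr \<kappa> c a\<close>, solved for the
  derivatives of two real components.\<close>

definition real_solution :: "real \<Rightarrow> real \<Rightarrow> real \<Rightarrow> real \<Rightarrow> (real \<Rightarrow> real) \<Rightarrow> (real \<Rightarrow> real) \<Rightarrow> bool" where
  "real_solution \<kappa> c l a v w \<longleftrightarrow> (\<forall>r>0.
     (v has_real_derivative - (\<kappa> / r + a / r\<^sup>2) * v r + (1 + l - c / r) * w r) (at r) \<and>
     (w has_real_derivative (1 - l + c / r) * v r + (\<kappa> / r + a / r\<^sup>2) * w r) (at r))"

lemma real_solution_dirac_expr:
  assumes "real_solution \<kappa> c l a v w" "0 < r"
  shows "dirac_expr \<kappa> c a (real_spinor v w) r = complex_of_real l *s real_spinor v w r"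
    and "real_spinor v w differentiable (at r)"
proof -
  let ?D = "(- (\<kappa> / r + a / r\<^sup>2) * v r + (1 + l - c / r) * w r) *\<^sub>R axis 1 1
      + ((1 - l + c / r) * v r + (\<kappa> / r + a / r\<^sup>2) * w r) *\<^sub>R axis 2 (1 :: complex)"
  have D: "(real_spinor v w has_vector_derivative ?D) (at r)"
    using assms unfolding real_solution_def by (intro real_spinor_has_vector_derivative) auto
  then show "real_spinor v w differentiable (at r)" by (rule differentiableI_vector)
  have vd: "vector_derivative (real_spinor v w) (at r)
      = real_spinor (\<lambda>r. - (\<kappa> / r + a / r\<^sup>2) * v r + (1 + l - c / r) * w r)
          (\<lambda>r. (1 - l + c / r) * v r + (\<kappa> / r + a / r\<^sup>2) * w r) r"
    using vector_derivative_at[OF D] by (simp add: real_spinor_def)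
  show "dirac_expr \<kappa> c a (real_spinor v w) r = complex_of_real l *s real_spinor v w r"
    unfolding vec_eq_iff forall_2 dirac_expr_components vd
    by (simp add: algebra_simps)
qed

text \<open>Lagrange's identity: the derivative is the bilinear pairing of (H - l)h with the real
  solution. It needs differentiability at a single point only and so serves test functions and
  absolutely continuous functions alike.\<close>

lemma wronskian_has_vector_derivative:
  assumes rs: "real_solution \<kappa> c l a v w" and r: "0 < r" and h: "(h has_vector_derivative h') (at r)"
  shows "(wronskian h v w has_vector_derivative
    (dirac_expr \<kappa> c a h r - complex_of_real l *s h r) $ 1 * complex_of_real (v r)
    + (dirac_expr \<kappa> c a h r - complex_of_real l *s h r) $ 2 * complex_of_real (w r)) (at r)"
proof -
  have h12: "((\<lambda>r. h r $ i) has_vector_derivative h' $ i) (at r)" for i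
    using bounded_linear.has_vector_derivative[OF bounded_linear_vec_nth h] .
  let ?v' = "- (\<kappa> / r + a / r\<^sup>2) * v r + (1 + l - c / r) * w r"
  let ?w' = "(1 - l + c / r) * v r + (\<kappa> / r + a / r\<^sup>2) * w r"
  have vw: "(v has_real_derivative ?v') (at r)" "(w has_real_derivative ?w') (at r)"
    using rs r by (auto simp: real_solution_def)
  note v = has_vector_derivative_of_real[OF vw(1)] and w = has_vector_derivative_of_real[OF vw(2)]
  have vd: "vector_derivative h (at r) = h'" by (rule vector_derivative_at[OF h])
  have "(wronskian h v w has_vector_derivative
      (h r $ 1 * complex_of_real ?w' + h' $ 1 * complex_of_real (w r))
      - (h r $ 2 * complex_of_real ?v' + h' $ 2 * complex_of_real (v r))) (at r)"
    unfolding wronskian_def[abs_def]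
    by (intro has_vector_derivative_diff has_vector_derivative_mult h12 v w)
  then show ?thesis
    by (rule has_vector_derivative_eq_rhs)
      (simp add: dirac_expr_components vd algebra_simps)
qed

text \<open>The coefficient matrix of the first-order system has trace zero.\<close>

lemma real_wronskian_constant:
  assumes "real_solution \<kappa> c l a v w" "real_solution \<kappa> c l a v' w'" "0 < r" "0 < s"
  shows "v r * w' r - w r * v' r = v s * w' s - w s * v' s"
proof -
  have d: "((\<lambda>r. v r * w' r - w r * v' r) has_real_derivative 0) (at r)" if "0 < r" for r
    using assms(1,2) that unfolding real_solution_def
    by (auto intro!: derivative_eq_intros simp: algebra_simps)
  have "\<exists>k. \<forall>r\<in>{0<..}. v r * w' r - w r * v' r = k"
    by (rule has_field_derivative_zero_constant) (auto intro: has_field_derivative_at_within d)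
  then show ?thesis using assms(3,4) by (metis greaterThan_iff)
qed

section \<open>From angle and radius back to spinors\<close>

context coulomb_dirac
begin

definition polar_solution :: "real \<Rightarrow> real \<Rightarrow> (real \<Rightarrow> real) \<Rightarrow> (real \<Rightarrow> real) \<Rightarrow> bool" where
  "polar_solution l a X R \<longleftrightarrow>
     (\<forall>t. (X has_real_derivative prufer l a t (X t)) (at t)) \<and>
     (\<forall>t. (R has_real_derivative prufer_rate a t (X t)) (at t))"

lemma polar_solution_exists:
  assumes X: "\<And>t. (X has_real_derivative prufer l a t (X t)) (at t)"
  obtains R where "polar_solution l a X R"
proof -
  have "continuous_on UNIV X" using X by (meson DERIV_continuous continuous_at_imp_continuous_on)
  then have "continuous_on UNIV (\<lambda>t. prufer_rate a t (X t))"
    unfolding prufer_rate_def by (intro continuous_intros)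
  then obtain R where "\<And>t. (R has_real_derivative prufer_rate a t (X t)) (at t)"
    by (rule continuous_antiderivative[of _ 0]) blast
  with X that show thesis unfolding polar_solution_def by blast
qed

definition pcos :: "(real \<Rightarrow> real) \<Rightarrow> (real \<Rightarrow> real) \<Rightarrow> real \<Rightarrow> real" where
  "pcos X R r = exp (R (ln r)) * cos (X (ln r))"

definition psin :: "(real \<Rightarrow> real) \<Rightarrow> (real \<Rightarrow> real) \<Rightarrow> real \<Rightarrow> real" where
  "psin X R r = exp (R (ln r)) * sin (X (ln r))"

text \<open>With t = ln r every derivative acquires a factor 1/r, which turns \<open>exp t\<close>
  and \<open>a * exp (- t)\<close> into the coefficients of the spinor equation. The double angles
  disappear through the addition theorems for 2x - x.\<close>

lemma real_solution_polar:
  assumes "polar_solution l a X R"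
  shows "real_solution \<kappa> c l a (pcos X R) (psin X R)"
  unfolding real_solution_def
proof (intro allI impI conjI)
  fix r :: real assume r: "0 < r"
  define x where "x = X (ln r)"
  define e where "e = exp (R (ln r))"
  define k where "k = \<kappa> + a / r"
  have X: "(X has_real_derivative c + k * sin (2 * x) + r * (cos (2 * x) - l)) (at (ln r))"
    and R: "(R has_real_derivative - k * cos (2 * x) + r * sin (2 * x)) (at (ln r))"
  proof -
    have "(X has_real_derivative prufer l a (ln r) x) (at (ln r))"
      "(R has_real_derivative prufer_rate a (ln r) x) (at (ln r))"
      using assms by (auto simp: polar_solution_def x_def)
    then show "(X has_real_derivative c + k * sin (2 * x) + r * (cos (2 * x) - l)) (at (ln r))"
      "(R has_real_derivative - k * cos (2 * x) + r * sin (2 * x)) (at (ln r))"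
      using r by (simp_all add: prufer_def prufer_rate_def k_def exp_minus divide_inverse)
  qed
  have dX: "((\<lambda>r. X (ln r)) has_real_derivative (c + k * sin (2 * x) + r * (cos (2 * x) - l)) * (1 / r)) (at r)"
    and dR: "((\<lambda>r. R (ln r)) has_real_derivative (- k * cos (2 * x) + r * sin (2 * x)) * (1 / r)) (at r)"
    using DERIV_chain2[where f=X and g=ln, OF X] DERIV_chain2[where f=R and g=ln, OF R] DERIV_ln_divide[OF r]
    by blast+
  have id1: "cos (2 * x) * cos x + sin (2 * x) * sin x = cos x"
    using cos_diff[of "2 * x" x] by simp
  have id2: "sin (2 * x) * cos x - cos (2 * x) * sin x = sin x"
    using sin_diff[of "2 * x" x] by simp
  have k: "\<kappa> / r + a / r\<^sup>2 = k / r" using r by (simp add: k_def field_simps power2_eq_square)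
  have "(pcos X R has_real_derivative
      e * ((- k * cos (2 * x) + r * sin (2 * x)) * (1 / r)) * cos x
      - e * (sin x * ((c + k * sin (2 * x) + r * (cos (2 * x) - l)) * (1 / r)))) (at r)"
    unfolding pcos_def[abs_def]
    by (auto intro!: derivative_eq_intros dX dR simp: x_def[symmetric] e_def[symmetric])
  also have "e * ((- k * cos (2 * x) + r * sin (2 * x)) * (1 / r)) * cos x
      - e * (sin x * ((c + k * sin (2 * x) + r * (cos (2 * x) - l)) * (1 / r)))
      = e * (- k * (cos (2 * x) * cos x + sin (2 * x) * sin x)
        + r * (sin (2 * x) * cos x - cos (2 * x) * sin x) + (r * l - c) * sin x) / r"
    using r by (simp add: field_simps)
  also have "\<dots> = - (\<kappa> / r + a / r\<^sup>2) * pcos X R r + (1 + l - c / r) * psin X R r"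
    unfolding id1 id2 k pcos_def psin_def x_def[symmetric] e_def[symmetric]
    using r by (simp add: field_simps)
  finally show "(pcos X R has_real_derivative
      - (\<kappa> / r + a / r\<^sup>2) * pcos X R r + (1 + l - c / r) * psin X R r) (at r)" .
  have "(psin X R has_real_derivative
      e * ((- k * cos (2 * x) + r * sin (2 * x)) * (1 / r)) * sin x
      + e * (cos x * ((c + k * sin (2 * x) + r * (cos (2 * x) - l)) * (1 / r)))) (at r)"
    unfolding psin_def[abs_def]
    by (auto intro!: derivative_eq_intros dX dR simp: x_def[symmetric] e_def[symmetric])
  also have "e * ((- k * cos (2 * x) + r * sin (2 * x)) * (1 / r)) * sin x
      + e * (cos x * ((c + k * sin (2 * x) + r * (cos (2 * x) - l)) * (1 / r)))
      = e * (k * (sin (2 * x) * cos x - cos (2 * x) * sin x)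
        + r * (cos (2 * x) * cos x + sin (2 * x) * sin x) + (c - r * l) * cos x) / r"
    using r by (simp add: field_simps)
  also have "\<dots> = (1 - l + c / r) * pcos X R r + (\<kappa> / r + a / r\<^sup>2) * psin X R r"
    unfolding id1 id2 k pcos_def psin_def x_def[symmetric] e_def[symmetric]
    using r by (simp add: field_simps)
  finally show "(psin X R has_real_derivative
      (1 - l + c / r) * pcos X R r + (\<kappa> / r + a / r\<^sup>2) * psin X R r) (at r)" .
qed

lemma norm_polar: "norm (real_spinor (pcos X R) (psin X R) r) = exp (R (ln r))"
proof -
  have "(pcos X R r)\<^sup>2 + (psin X R r)\<^sup>2 = (exp (R (ln r)))\<^sup>2 * ((cos (X (ln r)))\<^sup>2 + (sin (X (ln r)))\<^sup>2)"
    by (simp only: pcos_def psin_def power_mult_distrib distrib_left)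
  then show ?thesis by (simp add: norm_real_spinor)
qed

lemma prufer_add_pi: "prufer l a t (x + of_int n * pi) = prufer l a t x"
    "prufer_rate a t (x + of_int n * pi) = prufer_rate a t x"
proof -
  have "sin (2 * (x + of_int n * pi)) = sin (2 * x)" "cos (2 * (x + of_int n * pi)) = cos (2 * x)"
    using sin_cos_eq_iff[of "2 * (x + of_int n * pi)" "2 * x"] by (auto simp: algebra_simps)
  then show "prufer l a t (x + of_int n * pi) = prufer l a t x"
    "prufer_rate a t (x + of_int n * pi) = prufer_rate a t x"
    by (simp_all only: prufer_def prufer_rate_def)
qed

text \<open>A shift by a multiple of pi leaves the angle equation invariant, so by uniqueness the
  shift persists at all times. The radial rates then coincide, and the two spinors are
  proportional.\<close>

lemma polar_solution_matching:
  assumes 1: "polar_solution l a X R" and 2: "polar_solution l a X' R'" and n: "X 0 - X' 0 = of_int n * pi"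
  obtains k where "\<And>t. R t = R' t + k"
proof -
  interpret lipschitz_ode "prufer l a" "lip_prim l a" "lip_const l a" by (rule lipschitz_ode_prufer)
  have X: "solution X" using 1 by (simp add: solution_def polar_solution_def)
  have X': "solution (\<lambda>t. X' t + of_int n * pi)"
    using 2 unfolding solution_def polar_solution_def prufer_add_pi
    by (auto intro!: derivative_eq_intros)
  have eq: "X t = X' t + of_int n * pi" for t
    using solution_order[OF X X', of 0 t] solution_order[OF X' X, of 0 t] n by simp
  have "((\<lambda>t. R t - R' t) has_real_derivative 0) (at t)" for t
    using 1 2 unfolding polar_solution_def
    by (auto intro!: derivative_eq_intros simp: eq prufer_add_pi)
  then have "R t - R' t = R 0 - R' 0" for t
    using DERIV_isconst_all[of "\<lambda>t. R t - R' t"] by blast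
  then have "R t = R' t + (R 0 - R' 0)" for t by (metis add.commute diff_add_cancel)
  with that show thesis by blast
qed

lemma polar_wronskian:
  "pcos X R r * psin X' R' r - psin X R r * pcos X' R' r =
    - exp (R (ln r)) * exp (R' (ln r)) * sin (X (ln r) - X' (ln r))"
  by (simp add: pcos_def psin_def sin_diff algebra_simps)

subsection \<open>Growth of the recessive solutions\<close>

text \<open>The radial rate exceeds \<open>B * exp (- t) - exp t\<close> and tends to infinity; only
  rate 1 is retained, that is, |u| <= C r. This is what compensates for the 1/r in the derivative of
  the cut-offs below.\<close>

lemma polar_growth_0:
  assumes a: "a < 0" and p: "polar_solution l a X R"
    and band: "\<And>t. t \<le> T \<Longrightarrow> - \<beta> \<le> X t \<and> X t \<le> 0"
  obtains C where "\<And>t. t \<le> t1 \<Longrightarrow> R t \<le> C + t"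
proof -
  define B where "B = - a * cos (2 * \<beta>)"
  have "0 < B" using a cos_double_band_angle_pos by (simp add: B_def mult_neg_pos)
  then have "filterlim (\<lambda>t. B * exp (- t) - exp t) at_top (at_bot :: real filter)" by real_asymp
  then have "\<forall>\<^sub>F t :: real in at_bot. 1 \<le> B * exp (- t) - exp t"
    by (simp add: filterlim_at_top)
  then have "\<forall>\<^sub>F t :: real in at_bot. 1 \<le> B * exp (- t) - exp t \<and> t \<le> T"
    using eventually_le_at_bot[of T] by eventually_elim simp
  then obtain T' where T': "\<And>t. t \<le> T' \<Longrightarrow> 1 \<le> B * exp (- t) - exp t \<and> t \<le> T"
    by (rule eventually_at_bot_le_obtain) blast
  have "\<And>t. ((\<lambda>t. R t - t) has_real_derivative prufer_rate a t (X t) - 1) (at t)"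
    using p unfolding polar_solution_def by (auto intro!: derivative_eq_intros)
  then obtain C where C: "\<And>t. t \<le> t1 \<Longrightarrow> R t - t \<le> C"
  proof (rule bounded_above_left_half_line[where T=T'])
    fix t assume t: "t \<le> T'"
    have b: "- \<beta> \<le> X t" "X t \<le> 0" using band[of t] T'[OF t] by auto
    have "B * exp (- t) = (- a * exp (- t)) * cos (2 * \<beta>)" by (simp add: B_def)
    also have "\<dots> \<le> - (\<kappa> + a * exp (- t)) * cos (2 * X t)"
      using \<kappa>0 cos_double_ge_in_band[OF b] cos_double_band_angle_pos mult_pos_pos[of "- a" "exp (- t)"] a
      by (intro mult_mono) auto
    finally have "B * exp (- t) \<le> - (\<kappa> + a * exp (- t)) * cos (2 * X t)" .
    moreover have "- exp t \<le> exp t * sin (2 * X t)"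
      using mult_left_mono[OF sin_ge_minus_one[of "2 * X t"], of "exp t"] by simp
    ultimately show "0 \<le> prufer_rate a t (X t) - 1"
      using T'[OF t] by (simp add: prufer_rate_def)
  qed blast
  have "R t \<le> C + t" if "t \<le> t1" for t using C[OF that] by simp
  with that show thesis by blast
qed

lemma polar_growth_infinity:
  assumes p: "polar_solution l a X R" and T: "\<And>t. T \<le> t \<Longrightarrow> prufer_rate a t (X t) \<le> - 2"
  obtains C where "\<And>t. t1 \<le> t \<Longrightarrow> R t \<le> C - 2 * t"
proof -
  have "\<And>t. ((\<lambda>t. R t + 2 * t) has_real_derivative prufer_rate a t (X t) + 2) (at t)"
    using p unfolding polar_solution_def by (auto intro!: derivative_eq_intros)
  then obtain C where C: "\<And>t. t1 \<le> t \<Longrightarrow> R t + 2 * t \<le> C"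
  proof (rule bounded_above_right_half_line[where T=T])
    show "prufer_rate a t (X t) + 2 \<le> 0" if "T \<le> t" for t using T[OF that] by simp
  qed blast
  have "R t \<le> C - 2 * t" if "t1 \<le> t" for t using C[OF that] by simp
  with that show thesis by blast
qed

section \<open>Asymptotics at the origin of the unperturbed recessive solution\<close>

definition limit_angle :: real ("\<theta>\<^sub>0") where
  "\<theta>\<^sub>0 = - arcsin (c / \<kappa>) / 2"

definition exponent :: real where
  "exponent = sqrt (\<kappa>\<^sup>2 - c\<^sup>2)"

lemma exponent_pos: "0 < exponent"
proof -
  have "c\<^sup>2 < \<kappa>\<^sup>2" using \<kappa>c c0 power_strict_mono[of "- c" "- \<kappa>" 2] by simp
  then show ?thesis by (simp add: exponent_def)
qed

text \<open>The limit angle is the stationary point of \<open>c + \<kappa> * sin (2 * x)\<close> in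
  the band, and the leading radial rate \<open>- \<kappa> * cos (2 * x)\<close> at it is the
  exponent of the principal solution.\<close>

lemma limit_angle_trig: "sin (2 * \<theta>\<^sub>0) = - (c / \<kappa>)" "\<kappa> * cos (2 * \<theta>\<^sub>0) = - exponent"
proof -
  show "sin (2 * \<theta>\<^sub>0) = - (c / \<kappa>)" using coupling_ratio by (simp add: limit_angle_def)
  have "cos (2 * \<theta>\<^sub>0) = sqrt (1 - (c / \<kappa>)\<^sup>2)"
    using coupling_ratio by (simp add: limit_angle_def cos_arcsin)
  also have "\<dots> = sqrt ((\<kappa>\<^sup>2 - c\<^sup>2) / \<kappa>\<^sup>2)" using \<kappa>0 by (simp add: field_simps)
  also have "\<dots> = exponent / \<bar>\<kappa>\<bar>" by (simp add: exponent_def real_sqrt_divide)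
  finally show "\<kappa> * cos (2 * \<theta>\<^sub>0) = - exponent" using \<kappa>0 by simp
qed

lemma limit_angle_in_band: "- \<beta> \<le> \<theta>\<^sub>0" "\<theta>\<^sub>0 \<le> 0"
proof -
  have "arcsin u \<le> arcsin ((u + 1) / 2)" "arcsin 0 \<le> arcsin u" if "0 < u" "u < 1" for u :: real
    using that by (intro arcsin_le_arcsin; simp)+
  from this[OF coupling_ratio] show "- \<beta> \<le> \<theta>\<^sub>0" "\<theta>\<^sub>0 \<le> 0" by (auto simp: limit_angle_def band_angle_def)
qed

text \<open>The order e^t matters: it makes the error of the radial rate integrable at minus
  infinity, and it lets principal directions for different l agree up to O(r). The excess
  \<open>E\<close> of the squared deviation over a multiple of e^(2t) would grow exponentially
  backward in time if it were ever positive, but the band bounds it.\<close>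

lemma angle_near_limit:
  assumes X: "\<And>t. (X has_real_derivative prufer l 0 t (X t)) (at t)"
    and band: "\<And>t. t \<le> T \<Longrightarrow> - \<beta> \<le> X t \<and> X t \<le> 0"
  obtains C T' where "T' \<le> 0" "0 \<le> C" "\<And>t. t \<le> T' \<Longrightarrow> \<bar>X t - \<theta>\<^sub>0\<bar> \<le> C * exp t"
proof -
  obtain T1 g where T1: "T1 \<le> 0" and g: "0 < g" and
    contr: "\<And>t x. t \<le> T1 \<Longrightarrow> - \<beta> \<le> x \<Longrightarrow> x \<le> 0 \<Longrightarrow>
      2 * (\<kappa> + 0 * exp (- t)) * cos (2 * x) - 2 * exp t * sin (2 * x) \<le> - g"
    by (rule left_band[of 0]) blast
  define T' where "T' = min T T1"
  define C where "C = 1 + \<bar>l\<bar>"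
  \<comment> \<open>Young's inequality with half of the contraction turns a forcing of size
    \<open>C * exp t\<close> into \<open>C1 * exp (2 * t)\<close>.\<close>
  define C1 where "C1 = C\<^sup>2 / g"
  have C: "0 < C" by (simp add: C_def)
  have C1: "0 \<le> C1" using g by (simp add: C1_def)
  define E where "E t = (X t - \<theta>\<^sub>0)\<^sup>2 - C1 * exp (2 * t)" for t
  have E': "2 * prufer l 0 t (X t) * (X t - \<theta>\<^sub>0) - 2 * C1 * exp (2 * t) \<le> - g * E t" if t: "t \<le> T'" for t
  proof -
    have "(prufer l 0 t (X t) - prufer l 0 t \<theta>\<^sub>0) * (X t - \<theta>\<^sub>0) \<le> - g * (X t - \<theta>\<^sub>0)\<^sup>2"
      using t band[of t] limit_angle_in_band
      by (intro contraction_if_deriv_le[OF prufer_deriv_angle contr]) (auto simp: T'_def)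
    moreover have "prufer l 0 t \<theta>\<^sub>0 * (X t - \<theta>\<^sub>0) \<le> C * exp t * \<bar>X t - \<theta>\<^sub>0\<bar>"
    proof -
      have "prufer l 0 t \<theta>\<^sub>0 = exp t * (cos (2 * \<theta>\<^sub>0) - l)"
        using \<kappa>0 by (simp add: prufer_def limit_angle_trig)
      moreover have "\<bar>cos (2 * \<theta>\<^sub>0) - l\<bar> \<le> C"
        using abs_cos_le_one[of "2 * \<theta>\<^sub>0"] unfolding C_def by linarith
      ultimately have "\<bar>prufer l 0 t \<theta>\<^sub>0\<bar> \<le> C * exp t" by (simp add: abs_mult mult.commute)
      then have "\<bar>prufer l 0 t \<theta>\<^sub>0\<bar> * \<bar>X t - \<theta>\<^sub>0\<bar> \<le> C * exp t * \<bar>X t - \<theta>\<^sub>0\<bar>" by (rule mult_right_mono) simp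
      then show ?thesis by (metis abs_ge_self abs_mult order_trans)
    qed
    moreover have "2 * (C * exp t * \<bar>X t - \<theta>\<^sub>0\<bar>) \<le> g * (X t - \<theta>\<^sub>0)\<^sup>2 + C1 * exp (2 * t)"
    proof -
      define d where "d = \<bar>X t - \<theta>\<^sub>0\<bar>"
      have d2: "(X t - \<theta>\<^sub>0)\<^sup>2 = d\<^sup>2" by (simp add: d_def)
      have "0 \<le> (sqrt g * d - C * exp t / sqrt g)\<^sup>2" by simp
      also have "\<dots> = g * d\<^sup>2 - 2 * (C * exp t * d) + C1 * exp (2 * t)"
        unfolding exp_double using g by (simp add: power2_diff C1_def power_mult_distrib power_divide ac_simps)
      finally show ?thesis unfolding d2 d_def[symmetric] by simp
    qed
    moreover have "0 \<le> g * (C1 * exp (2 * t))" "0 \<le> C1 * exp (2 * t)" using g C1 by auto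
    ultimately show ?thesis unfolding E_def by (simp only: left_diff_distrib right_diff_distrib mult.assoc)
  qed
  have "E t \<le> 0" if t: "t \<le> T'" for t
  proof -
    have *: "E t * exp (g * t) \<le> E s * exp (g * s)" if s: "s \<le> t" for s
    proof (rule nonincreasing_if_deriv_nonpos[OF s])
      fix u assume u: "s \<le> u" "u \<le> t"
      show "((\<lambda>u. E u * exp (g * u)) has_real_derivative
          ((2 * prufer l 0 u (X u) * (X u - \<theta>\<^sub>0) - 2 * C1 * exp (2 * u)) - (- g * E u)) * exp (g * u)) (at u)"
        unfolding E_def by (rule derivative_eq_intros X refl | simp add: algebra_simps)+
      show "((2 * prufer l 0 u (X u) * (X u - \<theta>\<^sub>0) - 2 * C1 * exp (2 * u)) - (- g * E u)) * exp (g * u) \<le> 0"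
        using E'[of u] u t by (intro mult_nonpos_nonneg) auto
    qed
    have "((\<lambda>s. \<beta>\<^sup>2 * exp (g * s)) \<longlongrightarrow> 0) at_bot" using g by real_asymp
    moreover have "\<forall>\<^sub>F s in at_bot. E t * exp (g * t) \<le> \<beta>\<^sup>2 * exp (g * s)"
      using eventually_le_at_bot[of t]
    proof eventually_elim
      case (elim s)
      have "\<bar>X s - \<theta>\<^sub>0\<bar> \<le> \<beta>" using band[of s] elim t limit_angle_in_band by (auto simp: T'_def abs_le_iff)
      then have "(X s - \<theta>\<^sub>0)\<^sup>2 \<le> \<beta>\<^sup>2" by (metis abs_ge_zero power2_abs power_mono)
      moreover have "0 \<le> C1 * exp (2 * s)" using C1 by simp
      ultimately have "E s \<le> \<beta>\<^sup>2" unfolding E_def by linarith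
      then have "E s * exp (g * s) \<le> \<beta>\<^sup>2 * exp (g * s)" by (rule mult_right_mono) simp
      with *[OF elim] show ?case by linarith
    qed
    ultimately have "E t * exp (g * t) \<le> 0" by (rule tendsto_lowerbound) simp
    then show ?thesis by (simp add: mult_le_0_iff)
  qed
  then have "\<bar>X t - \<theta>\<^sub>0\<bar> \<le> sqrt C1 * exp t" if "t \<le> T'" for t
  proof -
    have "(X t - \<theta>\<^sub>0)\<^sup>2 \<le> C1 * exp (2 * t)" using \<open>\<And>t. t \<le> T' \<Longrightarrow> E t \<le> 0\<close>[OF that] by (simp add: E_def)
    also have "\<dots> = (sqrt C1 * exp t)\<^sup>2" using C1 by (simp add: power_mult_distrib exp_double)
    finally show ?thesis using C1 by (metis abs_le_square_iff abs_of_nonneg mult_nonneg_nonneg real_sqrt_ge_zero exp_ge_zero)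
  qed
  with that[of T' "sqrt C1"] T1 C1 show thesis by (simp add: T'_def)
qed

text \<open>The derivative of \<open>R t - exponent * t\<close> is O(e^t). Adding
  \<open>B * exp t\<close> makes the function nondecreasing, subtracting it makes it nonincreasing;
  the second fact bounds the first function from below, so the limit exists.\<close>

lemma polar_asymptotics_0:
  assumes p: "polar_solution l 0 X R" and band: "\<And>t. t \<le> T \<Longrightarrow> - \<beta> \<le> X t \<and> X t \<le> 0"
  obtains K where "((\<lambda>t. R t - exponent * t) \<longlongrightarrow> K) at_bot"
proof -
  have X: "\<And>t. (X has_real_derivative prufer l 0 t (X t)) (at t)"
    and R: "\<And>t. (R has_real_derivative prufer_rate 0 t (X t)) (at t)"
    using p unfolding polar_solution_def by auto
  obtain C T' where C: "0 \<le> C" "\<And>t. t \<le> T' \<Longrightarrow> \<bar>X t - \<theta>\<^sub>0\<bar> \<le> C * exp t"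
    using angle_near_limit[OF X band] by metis
  define B where "B = 2 * \<bar>\<kappa>\<bar> * C + 1"
  define y where "y t = R t - exponent * t" for t
  have dy: "(y has_real_derivative prufer_rate 0 t (X t) - exponent) (at t)" for t
    unfolding y_def by (auto intro!: derivative_eq_intros R)
  have B: "\<bar>prufer_rate 0 t (X t) - exponent\<bar> \<le> B * exp t" if t: "t \<le> T'" for t
  proof -
    have "prufer_rate 0 t (X t) - exponent = - \<kappa> * (cos (2 * X t) - cos (2 * \<theta>\<^sub>0)) + exp t * sin (2 * X t)"
      using limit_angle_trig(2) by (simp add: prufer_rate_def algebra_simps)
    also have "\<bar>\<dots>\<bar> \<le> \<bar>\<kappa>\<bar> * \<bar>cos (2 * X t) - cos (2 * \<theta>\<^sub>0)\<bar> + exp t * \<bar>sin (2 * X t)\<bar>"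
      by (rule order_trans[OF abs_triangle_ineq]) (simp add: abs_mult)
    also have "\<dots> \<le> \<bar>\<kappa>\<bar> * (2 * (C * exp t)) + exp t * 1"
      using abs_cos_double_diff_le[of "X t" "\<theta>\<^sub>0"] C(2)[OF t]
      by (intro add_mono mult_left_mono) auto
    finally show ?thesis by (simp add: B_def algebra_simps)
  qed
  have up: "y s + B * exp s \<le> y t + B * exp t" if "s \<le> t" "t \<le> T'" for s t
  proof (rule nondecreasing_if_deriv_nonneg[OF that(1)])
    fix u assume u: "s \<le> u" "u \<le> t"
    show "((\<lambda>u. y u + B * exp u) has_real_derivative prufer_rate 0 u (X u) - exponent + B * exp u) (at u)"
      by (auto intro!: derivative_eq_intros dy)
    show "0 \<le> prufer_rate 0 u (X u) - exponent + B * exp u" using B[of u] u that by (simp add: abs_le_iff)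
  qed
  have down: "y t - B * exp t \<le> y s - B * exp s" if "s \<le> t" "t \<le> T'" for s t
  proof (rule nonincreasing_if_deriv_nonpos[OF that(1)])
    fix u assume u: "s \<le> u" "u \<le> t"
    show "((\<lambda>u. y u - B * exp u) has_real_derivative prufer_rate 0 u (X u) - exponent - B * exp u) (at u)"
      by (auto intro!: derivative_eq_intros dy)
    show "prufer_rate 0 u (X u) - exponent - B * exp u \<le> 0" using B[of u] u that by (simp add: abs_le_iff)
  qed
  have B0: "0 \<le> B" using C by (simp add: B_def)
  obtain K where K: "((\<lambda>t. y t + B * exp t) \<longlongrightarrow> K) at_bot"
  proof (rule mono_bounded_tendsto_at_bot[OF up])
    show "y T' - B * exp T' \<le> y t + B * exp t" if "t \<le> T'" for t
      using down[OF that] B0 by (smt (verit) exp_ge_zero mult_nonneg_nonneg)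
  qed auto
  have "((\<lambda>t. (y t + B * exp t) - B * exp t) \<longlongrightarrow> K - B * 0) at_bot"
    by (intro tendsto_intros K exp_at_bot)
  then have "((\<lambda>t. R t - exponent * t) \<longlongrightarrow> K) at_bot" by (simp add: y_def[abs_def])
  with that show thesis by blast
qed

end

section \<open>Square-integrable spinors\<close>

lemma half_line_sets [simp, measurable]: "{0::real<..} \<in> sets lebesgue"
  by (simp add: sets_completionI_sets)

lemma L2_norm_sq: "(L2_norm f)\<^sup>2 = (LINT r|half_line. (norm (f r))\<^sup>2)"
  unfolding L2_norm_def by (simp add: real_sqrt_pow2)

lemma L2_norm_nonneg: "0 \<le> L2_norm f"
  unfolding L2_norm_def by simp

lemma L2_spaceD:
  assumes "f \<in> L2_space"
  shows "f \<in> borel_measurable half_line" "integrable half_line (\<lambda>r. (norm (f r))\<^sup>2)"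
  using assms by (auto simp: L2_space_def)

lemma norm_add_sq_le: "(norm (x + y))\<^sup>2 \<le> 2 * (norm x)\<^sup>2 + 2 * (norm y)\<^sup>2"
  for x y :: "'a::real_normed_vector"
proof -
  have "(norm (x + y))\<^sup>2 \<le> (norm x + norm y)\<^sup>2" by (intro power_mono norm_triangle_ineq) simp
  also have "\<dots> \<le> 2 * (norm x)\<^sup>2 + 2 * (norm y)\<^sup>2"
    using zero_le_power2[of "norm x - norm y"] by (simp add: power2_sum power2_diff)
  finally show ?thesis .
qed

lemma norm_diff_sq_le: "(norm (x - y))\<^sup>2 \<le> 2 * (norm x)\<^sup>2 + 2 * (norm y)\<^sup>2"
  for x y :: "'a::real_normed_vector"
  using norm_add_sq_le[of x "- y"] by simp

lemma norm_vector_scalar_mult: "norm (z *s x) = norm z * norm x" for x :: "complex ^ 2"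
proof -
  have "(norm (z *s x))\<^sup>2 = (norm z * norm x)\<^sup>2"
    unfolding power_mult_distrib norm_complex2_sq by (simp add: norm_mult power_mult_distrib distrib_left)
  then show ?thesis by (simp add: power2_eq_iff_nonneg)
qed

lemma borel_measurable_vector_scalar_mult:
  fixes f :: "'a \<Rightarrow> complex ^ 2"
  assumes "f \<in> borel_measurable M"
  shows "(\<lambda>r. z *s f r) \<in> borel_measurable M"
proof -
  have "linear (\<lambda>x :: complex ^ 2. z *s x)"
    by (intro linearI) (simp_all add: vec_eq_iff algebra_simps)
  then have "continuous_on UNIV (\<lambda>x :: complex ^ 2. z *s x)"
    using linear_continuous_on linear_conv_bounded_linear by blast
  then show ?thesis using assms borel_measurable_continuous_on by blast
qed

lemma L2_space_diff:
  assumes f: "f \<in> L2_space" and g: "g \<in> L2_space"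
  shows "(\<lambda>r. f r - g r) \<in> L2_space"
proof -
  have m: "(\<lambda>r. f r - g r) \<in> borel_measurable half_line"
    using L2_spaceD[OF f] L2_spaceD[OF g] by (intro borel_measurable_diff) auto
  have "integrable half_line (\<lambda>r. (norm (f r - g r))\<^sup>2)"
  proof (rule Bochner_Integration.integrable_bound)
    show "integrable half_line (\<lambda>r. 2 * (norm (f r))\<^sup>2 + 2 * (norm (g r))\<^sup>2)"
      using L2_spaceD[OF f] L2_spaceD[OF g] by auto
    show "(\<lambda>r. (norm (f r - g r))\<^sup>2) \<in> borel_measurable half_line"
      using m by measurable
  qed (auto intro: norm_diff_sq_le)
  with m show ?thesis by (simp add: L2_space_def)
qed

lemma L2_space_scale:
  assumes f: "f \<in> L2_space" shows "(\<lambda>r. z *s f r) \<in> L2_space"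
  using L2_spaceD[OF f] borel_measurable_vector_scalar_mult
  by (auto simp: L2_space_def norm_vector_scalar_mult power_mult_distrib)

text \<open>The common majorant for membership in L2 and for dominated convergence; its primitive is
  the arctangent.\<close>

lemma integrable_inverse_1_plus_sq: "integrable half_line (\<lambda>r. C / (1 + r\<^sup>2))"
proof -
  let ?h = "\<lambda>r::real. inverse (1 + r\<^sup>2)"
  have nz: "1 + r\<^sup>2 \<noteq> 0" for r :: real by (metis add_pos_nonneg less_irrefl zero_le_power2 zero_less_one)
  have I: "(?h has_integral (arctan y - arctan 0)) {0..y}" if "0 \<le> y" for y
    by (rule fundamental_theorem_of_calculus[OF that])
      (auto intro!: has_field_derivative_at_within DERIV_arctan simp flip: has_real_derivative_iff_has_vector_derivative)
  have "(?h has_integral pi / 2) {0..}"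
  proof (rule has_integral_to_inf)
    show "?h integrable_on {0..y}" for y
      by (intro integrable_continuous_interval continuous_intros) (use nz in auto)
    have "\<forall>\<^sub>F y in at_top. arctan y = integral {0..y} ?h"
      using eventually_ge_at_top[of 0]
    proof eventually_elim
      case (elim y)
      then show ?case using integral_unique[OF I[OF elim]] by simp
    qed
    then show "((\<lambda>y. integral {0..y} ?h) \<longlongrightarrow> pi / 2) at_top"
      by (rule Lim_transform_eventually[OF tendsto_arctan_at_top])
  qed auto
  then have "?h absolutely_integrable_on {0..}"
    by (intro nonnegative_absolutely_integrable_1) (auto simp: has_integral_integrable)
  then have "?h absolutely_integrable_on {0<..}"
    by (rule set_integrable_subset) auto
  then have "integrable half_line ?h" by (rule absolutely_integrable_imp_integrable) simp
  then show ?thesis unfolding divide_inverse by (rule integrable_mult_right)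
qed

lemma L2_spaceI:
  assumes c: "continuous_on {0<..} f" and b: "\<And>r. 0 < r \<Longrightarrow> (norm (f r))\<^sup>2 \<le> C / (1 + r\<^sup>2)"
  shows "f \<in> L2_space"
proof -
  have m: "f \<in> borel_measurable half_line" by (rule continuous_imp_measurable_on_sets_lebesgue[OF c]) simp
  have "integrable half_line (\<lambda>r. (norm (f r))\<^sup>2)"
  proof (rule Bochner_Integration.integrable_bound[OF integrable_inverse_1_plus_sq[of C]])
    show "(\<lambda>r. (norm (f r))\<^sup>2) \<in> borel_measurable half_line" using m by measurable
    show "AE r in half_line. norm ((norm (f r))\<^sup>2) \<le> norm (C / (1 + r\<^sup>2))"
    proof (rule AE_I2)
      fix r assume "r \<in> space half_line"
      then have "0 < r" by (simp add: space_restrict_space)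
      then show "norm ((norm (f r))\<^sup>2) \<le> norm (C / (1 + r\<^sup>2))"
        using b[of r] abs_ge_self[of "C / (1 + r\<^sup>2)"] by (simp del: abs_divide)
    qed
  qed
  with m show ?thesis by (simp add: L2_space_def)
qed

lemma L2_spaceI_compact_support:
  assumes c: "continuous_on {0<..} f" and p: "0 < p" and z: "\<And>r. 0 < r \<Longrightarrow> r < p \<or> q < r \<Longrightarrow> f r = 0"
  shows "f \<in> L2_space"
proof -
  have "compact ((\<lambda>r. (norm (f r))\<^sup>2 * (1 + r\<^sup>2)) ` {p..q})"
    using p by (intro compact_continuous_image continuous_intros continuous_on_subset[OF c]) auto
  then have "bdd_above ((\<lambda>r. (norm (f r))\<^sup>2 * (1 + r\<^sup>2)) ` {p..q})"
    by (simp add: bounded_imp_bdd_above compact_imp_bounded)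
  then obtain B where B: "\<And>r. p \<le> r \<Longrightarrow> r \<le> q \<Longrightarrow> (norm (f r))\<^sup>2 * (1 + r\<^sup>2) \<le> B"
    unfolding bdd_above_def by (meson atLeastAtMost_iff imageI)
  show ?thesis
  proof (rule L2_spaceI[OF c])
    fix r :: real assume r: "0 < r"
    have "(norm (f r))\<^sup>2 * (1 + r\<^sup>2) \<le> max B 0"
      using B[of r] z[OF r] by (cases "p \<le> r \<and> r \<le> q") (auto simp: not_le)
    then show "(norm (f r))\<^sup>2 \<le> max B 0 / (1 + r\<^sup>2)"
      by (simp add: pos_le_divide_eq add_pos_nonneg)
  qed
qed

text \<open>Passes from the Bochner integral over the half-line, in which \<open>L2_norm\<close> is
  defined, to the gauge integral on intervals, to which the fundamental theorem applies.\<close>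

lemma integral_interval_le_L2_norm:
  assumes e: "e \<in> L2_space" and p: "0 < p"
  shows "integral {p..q} (\<lambda>r. (norm (e r))\<^sup>2) \<le> (L2_norm e)\<^sup>2"
    and "(\<lambda>r. (norm (e r))\<^sup>2) integrable_on {p..q}"
proof -
  let ?n = "\<lambda>r. (norm (e r))\<^sup>2"
  have i: "?n integrable_on {0<..}" by (rule integrable_on_lebesgue_on[OF L2_spaceD(2)[OF e]]) simp
  have "?n absolutely_integrable_on {0<..}" by (rule nonnegative_absolutely_integrable_1[OF i]) simp
  then have "?n absolutely_integrable_on {p..q}" by (rule set_integrable_subset) (use p in auto)
  then show i': "?n integrable_on {p..q}" by (rule set_lebesgue_integral_eq_integral)
  have "integral {p..q} ?n \<le> integral {0<..} ?n"
    by (rule integral_subset_le[OF _ i' i]) (use p in auto)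
  also have "\<dots> = (L2_norm e)\<^sup>2"
    unfolding L2_norm_sq by (rule lebesgue_integral_eq_integral[symmetric, OF L2_spaceD(2)[OF e]]) simp
  finally show "integral {p..q} ?n \<le> (L2_norm e)\<^sup>2" .
qed

section \<open>Test functions\<close>

lemma test_function_continuous_derivative:
  assumes "\<phi> \<in> test_functions"
  shows "(\<phi> has_vector_derivative vector_derivative \<phi> (at r)) (at r)"
    and "continuous_on UNIV \<phi>" and "continuous_on UNIV (\<lambda>r. vector_derivative \<phi> (at r))"
proof -
  have s: "(((\<lambda>f t. vector_derivative f (at t)) ^^ n) \<phi>) differentiable (at r)" for n r
    using assms by (simp add: test_functions_def smooth_fun_def)
  have 0: "\<phi> differentiable (at r)" for r using s[of 0] by simp
  then show "(\<phi> has_vector_derivative vector_derivative \<phi> (at r)) (at r)"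
    by (simp add: vector_derivative_works)
  show "continuous_on UNIV \<phi>" using 0
    by (meson continuous_at_imp_continuous_on differentiable_imp_continuous_within)
  have "(\<lambda>r. vector_derivative \<phi> (at r)) differentiable (at r)" for r using s[of 1] by simp
  then show "continuous_on UNIV (\<lambda>r. vector_derivative \<phi> (at r))"
    by (meson continuous_at_imp_continuous_on differentiable_imp_continuous_within)
qed

text \<open>The derivative vanishes outside as well, because the complement of the closed support is
  open. An empty support is covered too.\<close>

lemma test_function_support:
  assumes "\<phi> \<in> test_functions"
  obtains p q where "0 < p" "p < q" "\<And>r. r < p \<or> q < r \<Longrightarrow> \<phi> r = 0 \<and> vector_derivative \<phi> (at r) = 0"
proof -
  let ?S = "closure {r. \<phi> r \<noteq> 0}"
  have S: "compact ?S" "?S \<subseteq> {0<..}" using assms by (auto simp: test_functions_def)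
  have out: "\<phi> r = 0 \<and> vector_derivative \<phi> (at r) = 0" if "r \<notin> ?S" for r
  proof
    show "\<phi> r = 0" using that closure_subset[of "{r. \<phi> r \<noteq> 0}"] by auto
    have "(\<phi> has_vector_derivative 0) (at r)"
    proof (rule has_vector_derivative_transform_within_open[of "\<lambda>_. 0" _ _ "- ?S"])
      show "0 = \<phi> x" if "x \<in> - ?S" for x
        using that closure_subset[of "{r. \<phi> r \<noteq> 0}"] by auto
    qed (use that in auto)
    then show "vector_derivative \<phi> (at r) = 0" by (rule vector_derivative_at)
  qed
  obtain p where p: "0 < p" "\<And>r. r \<in> ?S \<Longrightarrow> p \<le> r"
  proof (cases "?S = {}")
    case False
    obtain x where "x \<in> ?S" "\<And>r. r \<in> ?S \<Longrightarrow> x \<le> r"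
      using compact_attains_inf[OF S(1) False] by blast
    with that[of x] S(2) show ?thesis by auto
  qed (use that[of 1] in auto)
  obtain q where q: "\<And>r. r \<in> ?S \<Longrightarrow> r \<le> q"
    using compact_imp_bounded[OF S(1)] bounded_imp_bdd_above unfolding bdd_above_def by blast
  have "\<phi> r = 0 \<and> vector_derivative \<phi> (at r) = 0" if "r < p \<or> max q (p + 1) < r" for r
    by (rule out) (use p(2)[of r] q[of r] that in auto)
  with p(1) that[of p "max q (p + 1)"] show thesis by auto
qed

lemma dirac_expr_eq_0: "\<phi> r = 0 \<Longrightarrow> vector_derivative \<phi> (at r) = 0 \<Longrightarrow> dirac_expr \<kappa> c a \<phi> r = 0"
  by (simp add: dirac_expr_def)

lemma continuous_on_dirac_expr:
  assumes "continuous_on S u" "continuous_on S (\<lambda>r. vector_derivative u (at r))" "S \<subseteq> {0<..}"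
  shows "continuous_on S (dirac_expr \<kappa> c a u)"
proof -
  have n: "continuous_on S (\<lambda>r. u r $ i)" "continuous_on S (\<lambda>r. vector_derivative u (at r) $ i)" for i
    using assms by (auto intro!: continuous_intros)
  have "continuous_on S (\<lambda>r. \<chi> i. dirac_expr \<kappa> c a u r $ i)"
  proof (rule continuous_on_vec_lambda)
    fix i :: 2
    show "continuous_on S (\<lambda>r. dirac_expr \<kappa> c a u r $ i)"
    proof (cases "i = 1")
      case True
      show ?thesis unfolding True dirac_expr_components
        by (intro continuous_intros n) (use assms(3) in auto)
    next
      case False
      then have i: "i = 2" using exhaust_2[of i] by simp
      show ?thesis unfolding i dirac_expr_components
        by (intro continuous_intros n) (use assms(3) in auto)
    qed
  qed
  then show ?thesis by simp
qed

lemma test_function_L2: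
  assumes "\<phi> \<in> test_functions"
  shows "\<phi> \<in> L2_space" "dirac_expr \<kappa> c a \<phi> \<in> L2_space"
    and "continuous_on {0<..} (dirac_expr \<kappa> c a \<phi>)"
proof -
  obtain p q where pq: "0 < p" "p < q" "\<And>r. r < p \<or> q < r \<Longrightarrow> \<phi> r = 0 \<and> vector_derivative \<phi> (at r) = 0"
    using test_function_support[OF assms] by metis
  note c = test_function_continuous_derivative(2,3)[OF assms]
  show "\<phi> \<in> L2_space"
    by (rule L2_spaceI_compact_support[OF continuous_on_subset[OF c(1)] pq(1)]) (use pq in auto)
  show d: "continuous_on {0<..} (dirac_expr \<kappa> c a \<phi>)"
    by (rule continuous_on_dirac_expr) (use c continuous_on_subset in blast)+
  show "dirac_expr \<kappa> c a \<phi> \<in> L2_space"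
    by (rule L2_spaceI_compact_support[OF d pq(1), of q]) (use pq(3) dirac_expr_eq_0 in blast)
qed

section \<open>Eigenfunctions of the closure\<close>

text \<open>Lagrange's identity integrated from p to q. Young's inequality with a free \<delta>
  takes the place of the Cauchy-Schwarz inequality.\<close>

lemma wronskian_difference_bound:
  assumes \<phi>: "\<phi> \<in> test_functions" and rs: "real_solution \<kappa> c l a v w"
    and p: "0 < p" "p \<le> q" and \<delta>: "0 < \<delta>"
    and V: "integral {p..q} (\<lambda>r. (v r)\<^sup>2 + (w r)\<^sup>2) \<le> V"
  defines "e \<equiv> \<lambda>r. dirac_expr \<kappa> c a \<phi> r - complex_of_real l *s \<phi> r"
  shows "norm (wronskian \<phi> v w q - wronskian \<phi> v w p) \<le> (\<delta> * V + (L2_norm e)\<^sup>2 / \<delta>) / 2"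
proof -
  have e: "e \<in> L2_space"
    unfolding e_def by (intro L2_space_diff L2_space_scale test_function_L2[OF \<phi>])
  let ?W = "\<lambda>r. e r $ 1 * complex_of_real (v r) + e r $ 2 * complex_of_real (w r)"
  have cv: "continuous_on {p..q} v" and cw: "continuous_on {p..q} w"
    using rs p unfolding real_solution_def
    by (meson DERIV_continuous atLeastAtMost_iff continuous_at_imp_continuous_on less_le_trans)+
  have "(?W has_integral wronskian \<phi> v w q - wronskian \<phi> v w p) {p..q}"
  proof (rule fundamental_theorem_of_calculus[OF p(2)])
    fix r assume "r \<in> {p..q}"
    then have r: "0 < r" using p by simp
    show "(wronskian \<phi> v w has_vector_derivative ?W r) (at r within {p..q})"
      unfolding e_def
      by (rule has_vector_derivative_at_within[OF wronskian_has_vector_derivative[OF rs r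
            test_function_continuous_derivative(1)[OF \<phi>]]])
  qed
  then have W: "?W integrable_on {p..q}" "integral {p..q} ?W = wronskian \<phi> v w q - wronskian \<phi> v w p"
    by (auto simp: integral_unique has_integral_integrable)
  let ?G = "\<lambda>r. \<delta> / 2 * ((v r)\<^sup>2 + (w r)\<^sup>2) + 1 / (2 * \<delta>) * (norm (e r))\<^sup>2"
  have ii: "(\<lambda>r. (v r)\<^sup>2 + (w r)\<^sup>2) integrable_on {p..q}"
    by (intro integrable_continuous_interval continuous_intros cv cw)
  note ie = integral_interval_le_L2_norm[OF e p(1)]
  have iG: "?G integrable_on {p..q}"
    by (rule integrable_add[OF integrable_on_mult_right[OF ii] integrable_on_mult_right[OF ie(2)]])
  have young: "x * y \<le> \<delta> / 2 * y\<^sup>2 + 1 / (2 * \<delta>) * x\<^sup>2" for x y :: real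
  proof -
    have "0 \<le> (sqrt \<delta> * y - x / sqrt \<delta>)\<^sup>2" by simp
    also have "\<dots> = \<delta> * y\<^sup>2 - 2 * (x * y) + x\<^sup>2 / \<delta>"
      using \<delta> by (simp add: power2_diff power_mult_distrib power_divide)
    finally show ?thesis using \<delta> by (simp add: field_simps)
  qed
  have "norm (integral {p..q} ?W) \<le> integral {p..q} ?G"
  proof (rule integral_norm_bound_integral[OF W(1) iG])
    fix r
    have "norm (?W r) \<le> norm (e r $ 1) * \<bar>v r\<bar> + norm (e r $ 2) * \<bar>w r\<bar>"
      by (intro norm_triangle_le) (simp add: norm_mult)
    also have "\<dots> \<le> (\<delta> / 2 * \<bar>v r\<bar>\<^sup>2 + 1 / (2 * \<delta>) * (norm (e r $ 1))\<^sup>2)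
        + (\<delta> / 2 * \<bar>w r\<bar>\<^sup>2 + 1 / (2 * \<delta>) * (norm (e r $ 2))\<^sup>2)"
      by (intro add_mono young)
    also have "\<dots> = ?G r" by (simp add: norm_complex2_sq algebra_simps)
    finally show "norm (?W r) \<le> ?G r" .
  qed
  also have "integral {p..q} ?G = \<delta> / 2 * integral {p..q} (\<lambda>r. (v r)\<^sup>2 + (w r)\<^sup>2)
      + 1 / (2 * \<delta>) * integral {p..q} (\<lambda>r. (norm (e r))\<^sup>2)"
    using Henstock_Kurzweil_Integration.integral_add[OF integrable_on_mult_right[OF ii, of "\<delta> / 2"] integrable_on_mult_right[OF ie(2), of "1 / (2 * \<delta>)"]]
    by simp
  also have "\<dots> \<le> \<delta> / 2 * V + 1 / (2 * \<delta>) * (L2_norm e)\<^sup>2"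
    using V ie(1) \<delta> by (intro add_mono mult_left_mono) auto
  finally show ?thesis unfolding W(2) using \<delta> by (simp add: field_simps)
qed

text \<open>Along the approximating graph elements (H - l)\<phi> tends to 0, since it differs from g
  - l f = 0 by two small terms. A subsequence also converges almost everywhere, so that Wronskians
  pass to the limit at single points.\<close>

lemma closure_eigenfunction_approx:
  assumes fg: "(f, g) \<in> dirac_op \<kappa> c a" and eig: "AE r in half_line. g r = complex_of_real l *s f r"
  obtains \<phi> where "\<And>n. \<phi> n \<in> test_functions"
    "(\<lambda>n. (L2_norm (\<lambda>r. dirac_expr \<kappa> c a (\<phi> n) r - complex_of_real l *s \<phi> n r))\<^sup>2) \<longlonglongrightarrow> 0"
    "AE r in half_line. (\<lambda>n. \<phi> n r) \<longlonglongrightarrow> f r"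
proof -
  have f: "f \<in> L2_space" and g: "g \<in> L2_space" using fg by (auto simp: dirac_op_def closure_op_def)
  obtain \<phi>' \<psi> where T: "\<And>n :: nat. (\<phi>' n, \<psi> n) \<in> {(\<phi>, dirac_expr \<kappa> c a \<phi>) |\<phi>. \<phi> \<in> test_functions}"
    and l1: "(\<lambda>n. L2_norm (\<lambda>r. \<phi>' n r - f r)) \<longlonglongrightarrow> 0"
    and l2: "(\<lambda>n. L2_norm (\<lambda>r. \<psi> n r - g r)) \<longlonglongrightarrow> 0"
    using fg unfolding dirac_op_def closure_op_def by blast
  have t: "\<phi>' n \<in> test_functions" and \<psi>: "\<psi> n = dirac_expr \<kappa> c a (\<phi>' n)" for n using T[of n] by auto
  have d1: "(\<lambda>r. \<phi>' n r - f r) \<in> L2_space" and d2: "(\<lambda>r. \<psi> n r - g r) \<in> L2_space" for n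
    using test_function_L2[OF t] f g by (auto simp: \<psi> intro!: L2_space_diff)
  let ?e = "\<lambda>n r. dirac_expr \<kappa> c a (\<phi>' n) r - complex_of_real l *s \<phi>' n r"
  have eL2: "?e n \<in> L2_space" for n
    by (intro L2_space_diff L2_space_scale test_function_L2[OF t])
  have bound: "(L2_norm (?e n))\<^sup>2 \<le>
      2 * (L2_norm (\<lambda>r. \<psi> n r - g r))\<^sup>2 + 2 * (l\<^sup>2 * (L2_norm (\<lambda>r. \<phi>' n r - f r))\<^sup>2)" for n
  proof -
    have "(L2_norm (?e n))\<^sup>2 \<le> (LINT r|half_line. 2 * (norm (\<psi> n r - g r))\<^sup>2
        + 2 * (l\<^sup>2 * (norm (\<phi>' n r - f r))\<^sup>2))"
      unfolding L2_norm_sq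
    proof (rule integral_mono_AE)
      show "AE r in half_line. (norm (?e n r))\<^sup>2 \<le> 2 * (norm (\<psi> n r - g r))\<^sup>2
          + 2 * (l\<^sup>2 * (norm (\<phi>' n r - f r))\<^sup>2)"
        using eig
      proof eventually_elim
        case (elim r)
        have E: "?e n r = (\<psi> n r - g r) - complex_of_real l *s (\<phi>' n r - f r)"
          using elim by (simp add: \<psi> vec_eq_iff algebra_simps)
        have "(norm (?e n r))\<^sup>2 \<le> 2 * (norm (\<psi> n r - g r))\<^sup>2
            + 2 * (norm (complex_of_real l *s (\<phi>' n r - f r)))\<^sup>2"
          unfolding E by (rule norm_diff_sq_le)
        moreover have "(norm (complex_of_real l *s (\<phi>' n r - f r)))\<^sup>2 = l\<^sup>2 * (norm (\<phi>' n r - f r))\<^sup>2"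
          unfolding norm_vector_scalar_mult power_mult_distrib by simp
        ultimately show ?case by simp
      qed
    qed (use L2_spaceD[OF eL2] L2_spaceD[OF d1] L2_spaceD[OF d2] in auto)
    also have "\<dots> = 2 * (L2_norm (\<lambda>r. \<psi> n r - g r))\<^sup>2 + 2 * (l\<^sup>2 * (L2_norm (\<lambda>r. \<phi>' n r - f r))\<^sup>2)"
      unfolding L2_norm_sq using L2_spaceD[OF d1] L2_spaceD[OF d2]
      by (subst Bochner_Integration.integral_add) auto
    finally show ?thesis .
  qed
  have "(\<lambda>n. 2 * (L2_norm (\<lambda>r. \<psi> n r - g r))\<^sup>2 + 2 * (l\<^sup>2 * (L2_norm (\<lambda>r. \<phi>' n r - f r))\<^sup>2))
      \<longlonglongrightarrow> 2 * 0\<^sup>2 + 2 * (l\<^sup>2 * 0\<^sup>2)"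
    by (intro tendsto_intros l1 l2)
  then have lim0: "(\<lambda>n. (L2_norm (?e n))\<^sup>2) \<longlonglongrightarrow> 0"
    by (intro tendsto_sandwich[OF always_eventually always_eventually tendsto_const, of _ "\<lambda>n. (L2_norm (?e n))\<^sup>2"])
      (use bound in auto)
  have "(\<lambda>n. LINT r|half_line. norm ((norm (\<phi>' n r - f r))\<^sup>2)) \<longlonglongrightarrow> 0"
    using tendsto_power[OF l1, of 2] by (simp add: L2_norm_sq)
  then obtain s :: "nat \<Rightarrow> nat" where s: "strict_mono s"
    and ae: "AE r in half_line. (\<lambda>n. (norm (\<phi>' (s n) r - f r))\<^sup>2) \<longlonglongrightarrow> 0"
    using tendsto_L1_AE_subseq[of half_line "\<lambda>n r. (norm (\<phi>' n r - f r))\<^sup>2"] L2_spaceD[OF d1] by auto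
  show thesis
  proof (rule that[of "\<lambda>n. \<phi>' (s n)", OF t])
    show "(\<lambda>n. (L2_norm (?e (s n)))\<^sup>2) \<longlonglongrightarrow> 0"
      using LIMSEQ_subseq_LIMSEQ[OF lim0 s] by (simp add: o_def)
    show "AE r in half_line. (\<lambda>n. \<phi>' (s n) r) \<longlonglongrightarrow> f r"
      using ae
    proof eventually_elim
      case (elim r)
      then have "(\<lambda>n. sqrt ((norm (\<phi>' (s n) r - f r))\<^sup>2)) \<longlonglongrightarrow> sqrt 0" by (rule tendsto_real_sqrt)
      then have "(\<lambda>n. norm (\<phi>' (s n) r - f r)) \<longlonglongrightarrow> 0" by simp
      then have "(\<lambda>n. \<phi>' (s n) r - f r) \<longlonglongrightarrow> 0" by (rule tendsto_norm_zero_cancel)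
      then show ?case by (rule LIM_zero_cancel)
    qed
  qed
qed

text \<open>The choice of \<delta> is the square root of \<open>E n\<close>; the summand 1/(n + 1)
  keeps it positive when \<open>E n = 0\<close>.\<close>

lemma tendsto_0_if_young_bound:
  fixes x :: "nat \<Rightarrow> 'a::real_normed_vector"
  assumes b: "\<And>n \<delta>. 0 < \<delta> \<Longrightarrow> norm (x n) \<le> (\<delta> * V + E n / \<delta>) / 2" and E: "E \<longlonglongrightarrow> 0" and E0: "\<And>n. 0 \<le> E n"
  shows "x \<longlonglongrightarrow> 0"
proof (rule Lim_null_comparison)
  define \<delta> where "\<delta> n = sqrt (E n) + inverse (real (Suc n))" for n
  have \<delta>: "0 < \<delta> n" for n using E0[of n] by (simp add: \<delta>_def add_nonneg_pos)
  show "\<forall>\<^sub>F n in sequentially. norm (x n) \<le> (\<delta> n * V + sqrt (E n)) / 2"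
  proof (intro always_eventually allI)
    fix n
    have "E n = sqrt (E n) * sqrt (E n)" using E0 by simp
    also have "\<dots> \<le> sqrt (E n) * \<delta> n" using E0 by (intro mult_left_mono) (auto simp: \<delta>_def)
    finally have "E n / \<delta> n \<le> sqrt (E n)" using \<delta>[of n] by (simp add: divide_le_eq)
    with b[OF \<delta>, of n n] show "norm (x n) \<le> (\<delta> n * V + sqrt (E n)) / 2" by simp
  qed
  have "(\<lambda>n. ((sqrt (E n) + inverse (real (Suc n))) * V + sqrt (E n)) / 2) \<longlonglongrightarrow> ((sqrt 0 + 0) * V + sqrt 0) / 2"
    by (intro tendsto_intros E LIMSEQ_inverse_real_of_nat) auto
  then show "(\<lambda>n. (\<delta> n * V + sqrt (E n)) / 2) \<longlonglongrightarrow> 0" by (simp add: \<delta>_def)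
qed

text \<open>Test functions vanish near both ends, so their Wronskian with a solution that is square
  integrable at one end is the integral, from that end, of a pairing that tends to 0. In the limit f
  has zero Wronskian with two independent solutions at almost every point and so vanishes.\<close>

lemma not_eigenvalue_closure:
  assumes 1: "real_solution \<kappa> c l a v w" and 2: "real_solution \<kappa> c l a v' w'"
    and V: "\<And>r. 0 < r \<Longrightarrow> \<exists>V. \<forall>p. 0 < p \<longrightarrow> p \<le> r \<longrightarrow> integral {p..r} (\<lambda>r. (v r)\<^sup>2 + (w r)\<^sup>2) \<le> V"
    and V': "\<And>r. 0 < r \<Longrightarrow> \<exists>V. \<forall>q\<ge>r. integral {r..q} (\<lambda>r. (v' r)\<^sup>2 + (w' r)\<^sup>2) \<le> V"
    and det: "\<And>r. 0 < r \<Longrightarrow> v r * w' r - w r * v' r \<noteq> 0"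
  shows "\<not> eigenvalue (dirac_op \<kappa> c a) (complex_of_real l)"
proof
  assume "eigenvalue (dirac_op \<kappa> c a) (complex_of_real l)"
  then obtain f g where fg: "(f, g) \<in> dirac_op \<kappa> c a" and nz: "\<not> (AE r in half_line. f r = 0)"
    and eig: "AE r in half_line. g r = complex_of_real l *s f r"
    unfolding eigenvalue_def by blast
  obtain \<phi> where \<phi>: "\<And>n. \<phi> n \<in> test_functions" and
    E: "(\<lambda>n. (L2_norm (\<lambda>r. dirac_expr \<kappa> c a (\<phi> n) r - complex_of_real l *s \<phi> n r))\<^sup>2) \<longlonglongrightarrow> 0" and
    lim: "AE r in half_line. (\<lambda>n. \<phi> n r) \<longlonglongrightarrow> f r"
    by (rule closure_eigenfunction_approx[OF fg eig]) blast
  have wl: "(\<lambda>n. wronskian (\<phi> n) v w r) \<longlonglongrightarrow> 0" if r: "0 < r" for r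
  proof -
    obtain V where V: "\<And>p. 0 < p \<Longrightarrow> p \<le> r \<Longrightarrow> integral {p..r} (\<lambda>r. (v r)\<^sup>2 + (w r)\<^sup>2) \<le> V"
      using V[OF r] by blast
    show ?thesis
    proof (rule tendsto_0_if_young_bound[OF _ E])
      fix n and \<delta> :: real assume \<delta>: "0 < \<delta>"
      obtain p q where pq: "0 < p" "p < q" "\<And>r. r < p \<or> q < r \<Longrightarrow> \<phi> n r = 0 \<and> vector_derivative (\<phi> n) (at r) = 0"
        using test_function_support[OF \<phi>] by metis
      \<comment> \<open>A point not beyond r and to the left of the support, where the Wronskian is
        0.\<close>
      have m: "0 < min (p / 2) r" "min (p / 2) r \<le> r" "min (p / 2) r < p" using pq r by auto
      have "wronskian (\<phi> n) v w (min (p / 2) r) = 0" using pq(3) m(3) by (simp add: wronskian_def)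
      with wronskian_difference_bound[OF \<phi> 1 m(1,2) \<delta> V[OF m(1,2)], of n]
      show "norm (wronskian (\<phi> n) v w r) \<le> (\<delta> * V +
          (L2_norm (\<lambda>r. dirac_expr \<kappa> c a (\<phi> n) r - complex_of_real l *s \<phi> n r))\<^sup>2 / \<delta>) / 2" by simp
    qed simp
  qed
  have wr: "(\<lambda>n. wronskian (\<phi> n) v' w' r) \<longlonglongrightarrow> 0" if r: "0 < r" for r
  proof -
    obtain V where V: "\<And>q. r \<le> q \<Longrightarrow> integral {r..q} (\<lambda>r. (v' r)\<^sup>2 + (w' r)\<^sup>2) \<le> V"
      using V'[OF r] by blast
    show ?thesis
    proof (rule tendsto_0_if_young_bound[OF _ E])
      fix n and \<delta> :: real assume \<delta>: "0 < \<delta>"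
      obtain p q where pq: "0 < p" "p < q" "\<And>r. r < p \<or> q < r \<Longrightarrow> \<phi> n r = 0 \<and> vector_derivative (\<phi> n) (at r) = 0"
        using test_function_support[OF \<phi>] by metis
      have m: "r \<le> max (q + 1) r" "q < max (q + 1) r" by auto
      have "wronskian (\<phi> n) v' w' (max (q + 1) r) = 0" using pq(3) m(2) by (simp add: wronskian_def)
      with wronskian_difference_bound[OF \<phi> 2 r m(1) \<delta> V[OF m(1)], of n]
      show "norm (wronskian (\<phi> n) v' w' r) \<le> (\<delta> * V +
          (L2_norm (\<lambda>r. dirac_expr \<kappa> c a (\<phi> n) r - complex_of_real l *s \<phi> n r))\<^sup>2 / \<delta>) / 2" by simp
    qed simp
  qed
  have "AE r in half_line. r \<in> {0<..}" by (rule AE_I2) (simp add: space_restrict_space)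
  with lim have "AE r in half_line. f r = 0"
  proof eventually_elim
    case (elim r)
    then have r: "0 < r" by simp
    have c: "(\<lambda>n. wronskian (\<phi> n) x y r) \<longlonglongrightarrow> wronskian f x y r" for x y
      unfolding wronskian_def by (intro tendsto_intros elim)
    have e1: "f r $ 1 * complex_of_real (w r) = f r $ 2 * complex_of_real (v r)"
      using LIMSEQ_unique[OF c wl[OF r]] by (simp add: wronskian_def)
    have e2: "f r $ 1 * complex_of_real (w' r) = f r $ 2 * complex_of_real (v' r)"
      using LIMSEQ_unique[OF c wr[OF r]] by (simp add: wronskian_def)
    have d: "complex_of_real (v r) * complex_of_real (w' r) - complex_of_real (w r) * complex_of_real (v' r) \<noteq> 0"
      using det[OF r] by (metis of_real_0 of_real_diff of_real_eq_iff of_real_mult)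
    have "f r $ 1 * (complex_of_real (v r) * complex_of_real (w' r) - complex_of_real (w r) * complex_of_real (v' r)) = 0"
      "f r $ 2 * (complex_of_real (v r) * complex_of_real (w' r) - complex_of_real (w r) * complex_of_real (v' r)) = 0"
      using e1 e2 by algebra+
    with d show "f r = 0" by (simp add: vec_eq_iff forall_2)
  qed
  with nz show False by simp
qed

section \<open>Smooth cut-offs of real solutions\<close>

text \<open>Derivatives are supplied by existential witnesses, so that sums, products and affine
  substitutions follow by induction. Only at the end is this converted to the iterated
  \<open>vector_derivative\<close> of \<open>smooth_fun\<close>.\<close>

primrec smooth_upto :: "nat \<Rightarrow> real set \<Rightarrow> (real \<Rightarrow> 'a::real_normed_vector) \<Rightarrow> bool" where
  "smooth_upto 0 U f = True"
| "smooth_upto (Suc k) U f =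
    (\<exists>f'. (\<forall>x\<in>U. (f has_vector_derivative f' x) (at x)) \<and> smooth_upto k U f')"

lemma smooth_upto_SucI:
  "(\<And>x. x \<in> U \<Longrightarrow> (f has_vector_derivative f' x) (at x)) \<Longrightarrow> smooth_upto k U f' \<Longrightarrow> smooth_upto (Suc k) U f"
  by auto

lemma smooth_upto_cong:
  assumes "open U" "smooth_upto k U f" "\<And>x. x \<in> U \<Longrightarrow> f x = g x"
  shows "smooth_upto k U g"
proof (cases k)
  case (Suc m)
  then obtain f' where f': "\<And>x. x \<in> U \<Longrightarrow> (f has_vector_derivative f' x) (at x)" "smooth_upto m U f'"
    using assms(2) by auto
  have "(g has_vector_derivative f' x) (at x)" if "x \<in> U" for x
    by (rule has_vector_derivative_transform_within_open[OF f'(1)[OF that] assms(1) that]) (rule assms(3))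
  then show ?thesis unfolding Suc using f'(2) by (rule smooth_upto_SucI)
qed simp

lemma smooth_upto_Suc_iff:
  assumes "open U"
  shows "smooth_upto (Suc k) U f \<longleftrightarrow>
    (\<forall>x\<in>U. f differentiable (at x)) \<and> smooth_upto k U (\<lambda>x. vector_derivative f (at x))"
proof
  assume "smooth_upto (Suc k) U f"
  then obtain f' where f': "\<And>x. x \<in> U \<Longrightarrow> (f has_vector_derivative f' x) (at x)" "smooth_upto k U f'"
    by auto
  then have "smooth_upto k U (\<lambda>x. vector_derivative f (at x))"
    using smooth_upto_cong[OF assms f'(2)] vector_derivative_at[OF f'(1)] by metis
  then show "(\<forall>x\<in>U. f differentiable (at x)) \<and> smooth_upto k U (\<lambda>x. vector_derivative f (at x))"
    using f'(1) differentiableI_vector by blast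
next
  assume "(\<forall>x\<in>U. f differentiable (at x)) \<and> smooth_upto k U (\<lambda>x. vector_derivative f (at x))"
  then show "smooth_upto (Suc k) U f"
    by (intro smooth_upto_SucI[where f'="\<lambda>x. vector_derivative f (at x)"]) (auto simp: vector_derivative_works)
qed

lemma smooth_upto_Suc_D: "smooth_upto (Suc k) U f \<Longrightarrow> smooth_upto k U f"
proof (induction k arbitrary: f)
  case (Suc k)
  then obtain f' where "\<And>x. x \<in> U \<Longrightarrow> (f has_vector_derivative f' x) (at x)" "smooth_upto (Suc k) U f'"
    by auto
  with Suc.IH[of f'] show ?case by (intro smooth_upto_SucI)
qed simp

lemma smooth_upto_Un:
  assumes "open U" "open V" "smooth_upto k U f" "smooth_upto k V f"
  shows "smooth_upto k (U \<union> V) f"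
  using assms(3,4)
proof (induction k arbitrary: f)
  case (Suc k)
  then show ?case
    unfolding smooth_upto_Suc_iff[OF assms(1)] smooth_upto_Suc_iff[OF assms(2)]
      smooth_upto_Suc_iff[OF open_Un[OF assms(1,2)]] by blast
qed simp

lemma smooth_upto_subset:
  assumes "V \<subseteq> U" "smooth_upto k U f" shows "smooth_upto k V f"
  using assms(2)
proof (induction k arbitrary: f)
  case (Suc k)
  then obtain f' where "\<And>x. x \<in> U \<Longrightarrow> (f has_vector_derivative f' x) (at x)" "smooth_upto k U f'"
    by auto
  with Suc.IH[of f'] assms(1) show ?case by (intro smooth_upto_SucI) auto
qed simp

lemma smooth_upto_const: "smooth_upto k U (\<lambda>x. c)"
proof (induction k arbitrary: c)
  case (Suc k)
  show ?case by (rule smooth_upto_SucI[where f'="\<lambda>_. 0"]) (auto intro!: derivative_eq_intros Suc)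
qed simp

lemma smooth_upto_add:
  "smooth_upto k U f \<Longrightarrow> smooth_upto k U g \<Longrightarrow> smooth_upto k U (\<lambda>x. f x + g x)"
proof (induction k arbitrary: f g)
  case (Suc k)
  from Suc.prems(1) obtain f' where f': "\<And>x. x \<in> U \<Longrightarrow> (f has_vector_derivative f' x) (at x)" "smooth_upto k U f'"
    by auto
  from Suc.prems(2) obtain g' where g': "\<And>x. x \<in> U \<Longrightarrow> (g has_vector_derivative g' x) (at x)" "smooth_upto k U g'"
    by auto
  note fg = f' g'
  show ?case
    by (rule smooth_upto_SucI[where f'="\<lambda>x. f' x + g' x"]) (auto intro!: has_vector_derivative_add fg Suc.IH)
qed simp

lemma smooth_upto_bilinear:
  assumes "bounded_bilinear b"
  shows "smooth_upto k U f \<Longrightarrow> smooth_upto k U g \<Longrightarrow> smooth_upto k U (\<lambda>x. b (f x) (g x))"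
proof (induction k arbitrary: f g)
  case (Suc k)
  from Suc.prems(1) obtain f' where f': "\<And>x. x \<in> U \<Longrightarrow> (f has_vector_derivative f' x) (at x)" "smooth_upto k U f'"
    by auto
  from Suc.prems(2) obtain g' where g': "\<And>x. x \<in> U \<Longrightarrow> (g has_vector_derivative g' x) (at x)" "smooth_upto k U g'"
    by auto
  note fg = f' g'
  show ?case
  proof (rule smooth_upto_SucI[where f'="\<lambda>x. b (f x) (g' x) + b (f' x) (g x)"])
    show "((\<lambda>x. b (f x) (g x)) has_vector_derivative b (f x) (g' x) + b (f' x) (g x)) (at x)" if "x \<in> U" for x
      by (rule bounded_bilinear.has_vector_derivative[OF assms fg(1)[OF that] fg(3)[OF that]])
    show "smooth_upto k U (\<lambda>x. b (f x) (g' x) + b (f' x) (g x))"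
      using smooth_upto_Suc_D[OF Suc.prems(1)] smooth_upto_Suc_D[OF Suc.prems(2)] fg
      by (intro smooth_upto_add Suc.IH)
  qed
qed simp

lemmas smooth_upto_mult = smooth_upto_bilinear[OF bounded_bilinear_mult]
lemmas smooth_upto_scaleR = smooth_upto_bilinear[OF bounded_bilinear_scaleR]

lemma smooth_upto_affine:
  "smooth_upto k UNIV f \<Longrightarrow> smooth_upto k UNIV (\<lambda>x. f (a * x + b))"
proof (induction k arbitrary: f)
  case (Suc k)
  then obtain f' where f': "\<And>x. (f has_vector_derivative f' x) (at x)" "smooth_upto k UNIV f'"
    by auto
  show ?case
  proof (rule smooth_upto_SucI[where f'="\<lambda>x. a *\<^sub>R f' (a * x + b)"])
    fix x
    have "((\<lambda>x. a * x + b) has_vector_derivative a) (at x)"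
      by (auto intro!: derivative_eq_intros simp flip: has_real_derivative_iff_has_vector_derivative)
    from vector_diff_chain_at[OF this f'(1)]
    show "((\<lambda>x. f (a * x + b)) has_vector_derivative a *\<^sub>R f' (a * x + b)) (at x)"
      by (simp add: o_def)
    show "smooth_upto k UNIV (\<lambda>x. a *\<^sub>R f' (a * x + b))"
      by (intro smooth_upto_scaleR smooth_upto_const Suc.IH f')
  qed
qed simp

lemma inverse_power_has_derivative:
  assumes "r \<noteq> 0"
  shows "((\<lambda>r::real. inverse r ^ m) has_real_derivative - real m * inverse r ^ (m + 1)) (at r)"
proof (cases m)
  case (Suc n)
  have "((\<lambda>r. inverse r ^ Suc n) has_real_derivative
      (1 + of_nat n) * (- (inverse r ^ Suc (Suc 0)) * inverse r ^ n)) (at r)"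
    by (rule DERIV_power_Suc[OF DERIV_inverse[OF assms]])
  then show ?thesis by (simp add: Suc algebra_simps)
qed simp

lemma smooth_upto_inverse_power: "smooth_upto k {0<..} (\<lambda>r::real. inverse r ^ m)"
proof (induction k arbitrary: m)
  case (Suc k)
  show ?case
  proof (rule smooth_upto_SucI[where f'="\<lambda>r. - real m * inverse r ^ (m + 1)"])
    fix r :: real assume "r \<in> {0<..}"
    then show "((\<lambda>r. inverse r ^ m) has_vector_derivative - real m * inverse r ^ (m + 1)) (at r)"
      unfolding has_real_derivative_iff_has_vector_derivative[symmetric]
      by (intro inverse_power_has_derivative) simp
  next
    show "smooth_upto k {0<..} (\<lambda>r. - real m * inverse r ^ (m + 1))"
      by (intro smooth_upto_mult smooth_upto_const Suc.IH)
  qed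
qed simp

lemma smooth_fun_if_smooth_upto:
  assumes "\<And>k. smooth_upto k UNIV \<phi>"
  shows "smooth_fun \<phi>"
proof -
  have *: "(((\<lambda>f t. vector_derivative f (at t)) ^^ n) \<phi>) differentiable (at r)"
    if "smooth_upto (Suc n) UNIV \<phi>" for n r and \<phi> :: spinor
    using that
  proof (induction n arbitrary: \<phi>)
    case 0
    then show ?case using smooth_upto_Suc_iff[of UNIV 0 \<phi>] by simp
  next
    case (Suc n)
    then have "smooth_upto (Suc n) UNIV (\<lambda>t. vector_derivative \<phi> (at t))"
      using smooth_upto_Suc_iff[of UNIV "Suc n" \<phi>] by blast
    from Suc.IH[OF this] show ?case unfolding funpow_Suc_right o_apply .
  qed
  show ?thesis unfolding smooth_fun_def using * assms by blast
qed

text \<open>The flat function e^(-1/x) and its multiples by powers of 1/x form a family closed under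
  differentiation, so one differentiability proof covers all orders.\<close>

definition bump :: "nat \<Rightarrow> real \<Rightarrow> real" where
  "bump m x = (if 0 < x then inverse x ^ m * exp (- inverse x) else 0)"

lemma bump_has_derivative:
  "(bump m has_real_derivative bump (m + 2) x - real m * bump (m + 1) x) (at x)"
proof -
  consider "x < 0" | "x = 0" | "0 < x" by linarith
  then show ?thesis
  proof cases
    case 1
    have "((\<lambda>x. 0) has_real_derivative bump (m + 2) x - real m * bump (m + 1) x) (at x)"
      using 1 by (simp add: bump_def)
    then show ?thesis
      by (rule has_field_derivative_transform_within_open[of _ _ _ "{..<0}"]) (use 1 in \<open>auto simp: bump_def\<close>)
  next
    case 3
    have e: "((\<lambda>x. exp (- inverse x)) has_real_derivative exp (- inverse x) * inverse x ^ 2) (at x)"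
      using 3 by (auto intro!: derivative_eq_intros simp: power2_eq_square)
    have "x \<noteq> 0" using 3 by simp
    have "((\<lambda>x. inverse x ^ m * exp (- inverse x)) has_real_derivative
        bump (m + 2) x - real m * bump (m + 1) x) (at x)"
      by (rule DERIV_cong[OF DERIV_mult[OF inverse_power_has_derivative[OF \<open>x \<noteq> 0\<close>] e]])
        (use 3 in \<open>simp add: bump_def power_add power2_eq_square algebra_simps\<close>)
    then show ?thesis
      by (rule has_field_derivative_transform_within_open[of _ _ _ "{0<..}"]) (use 3 in \<open>auto simp: bump_def\<close>)
  next
    case 2
    \<comment> \<open>From the right, with y = 1/h, the quotient is y^(m+1) e^(-y), which tends to
      0.\<close>
    have "((\<lambda>h. (bump m (0 + h) - bump m 0) / h) \<longlongrightarrow> 0) (at 0)"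
    proof (rule filterlim_split_at)
      have "\<forall>\<^sub>F h in at_left (0::real). 0 = (bump m (0 + h) - bump m 0) / h"
        by (auto simp: eventually_at_filter bump_def)
      then show "((\<lambda>h. (bump m (0 + h) - bump m 0) / h) \<longlongrightarrow> 0) (at_left 0)"
        by (rule Lim_transform_eventually[OF tendsto_const])
      have "((\<lambda>h::real. inverse h ^ Suc m / exp (inverse h)) \<longlongrightarrow> 0) (at_right 0)"
        by (rule filterlim_compose[OF tendsto_power_div_exp_0 filterlim_inverse_at_top_right])
      moreover have "\<forall>\<^sub>F h in at_right (0::real). inverse h ^ Suc m / exp (inverse h) = (bump m (0 + h) - bump m 0) / h"
        using eventually_at_right_less[of 0]
        by eventually_elim (simp add: bump_def exp_minus divide_inverse ac_simps)
      ultimately show "((\<lambda>h. (bump m (0 + h) - bump m 0) / h) \<longlongrightarrow> 0) (at_right 0)"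
        by (rule Lim_transform_eventually)
    qed
    then show ?thesis using 2 by (simp add: DERIV_def bump_def)
  qed
qed

lemma smooth_upto_bump: "smooth_upto k UNIV (bump m)"
proof (induction k arbitrary: m)
  case (Suc k)
  show ?case
  proof (rule smooth_upto_SucI[where f'="\<lambda>x. bump (m + 2) x + - real m * bump (m + 1) x"])
    show "(bump m has_vector_derivative bump (m + 2) x + - real m * bump (m + 1) x) (at x)" for x
      using bump_has_derivative[of m x] by (simp add: has_real_derivative_iff_has_vector_derivative)
    show "smooth_upto k UNIV (\<lambda>x. bump (m + 2) x + - real m * bump (m + 1) x)"
      by (intro smooth_upto_add smooth_upto_mult smooth_upto_const Suc.IH)
  qed
qed simp

text \<open>With y = 1/x the last two bounds are y^2 e^(-y) <= 2 and y e^(-y) <= 1; together they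
  produce the constant 3 in the estimate of \<open>cutoff_deriv\<close>.\<close>

lemma bump_bounds: "0 \<le> bump m x" "bump 0 x \<le> 1" "bump 2 x \<le> 2" "x * bump 2 x \<le> 1"
proof -
  show "0 \<le> bump m x" "bump 0 x \<le> 1" by (auto simp: bump_def)
  have "y\<^sup>2 * exp (- y) \<le> 2" if "0 < y" for y :: real
    using exp_lower_Taylor_quadratic[of y] that by (simp add: exp_minus divide_simps)
  then show "bump 2 x \<le> 2" by (auto simp: bump_def)
  have "y * exp (- y) \<le> 1" if "0 < y" for y :: real
  proof -
    have "y \<le> exp y" using exp_ge_add_one_self[of y] by linarith
    then show ?thesis by (simp add: exp_minus divide_simps)
  qed
  from this[of "inverse x"] have le: "inverse x * exp (- inverse x) \<le> 1" if "0 < x" using that by simp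
  have "x * bump 2 x = inverse x * exp (- inverse x)" if "0 < x"
    using that by (simp add: bump_def power2_eq_square flip: mult.assoc)
  with le show "x * bump 2 x \<le> 1" by (cases "0 < x") (simp, simp add: bump_def)
qed

text \<open>Supported in [1/(n+1), n+1]. It stays below 1 everywhere, but it converges to 1
  pointwise since e^(-1/x) tends to 1 as x grows, and dominated convergence asks for no
  more.\<close>

definition cutoff :: "nat \<Rightarrow> real \<Rightarrow> real" where
  "cutoff n r = bump 0 (real (Suc n) * r - 1) * bump 0 (real (Suc n) - r)"

definition cutoff_deriv :: "nat \<Rightarrow> real \<Rightarrow> real" where
  "cutoff_deriv n r = real (Suc n) * bump 2 (real (Suc n) * r - 1) * bump 0 (real (Suc n) - r)
     - bump 0 (real (Suc n) * r - 1) * bump 2 (real (Suc n) - r)"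

lemma cutoff_has_derivative: "(cutoff n has_real_derivative cutoff_deriv n r) (at r)"
proof -
  have b: "(bump 0 has_real_derivative bump 2 x) (at x)" for x using bump_has_derivative[of 0 x] by (simp add: numeral_2_eq_2)
  have 1: "((\<lambda>r. bump 0 (real (Suc n) * r - 1)) has_real_derivative bump 2 (real (Suc n) * r - 1) * real (Suc n)) (at r)"
    by (rule DERIV_chain2[OF b]) (auto intro!: derivative_eq_intros)
  have 2: "((\<lambda>r. bump 0 (real (Suc n) - r)) has_real_derivative bump 2 (real (Suc n) - r) * - 1) (at r)"
    by (rule DERIV_chain2[OF b]) (auto intro!: derivative_eq_intros)
  show ?thesis unfolding cutoff_def[abs_def] cutoff_deriv_def
    by (rule DERIV_cong[OF DERIV_mult[OF 1 2]]) (simp add: algebra_simps)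
qed

lemma smooth_upto_cutoff: "smooth_upto k UNIV (cutoff n)"
proof -
  have "smooth_upto k UNIV (\<lambda>r. bump 0 (real (Suc n) * r + - 1) * bump 0 (- 1 * r + real (Suc n)))"
    by (intro smooth_upto_mult smooth_upto_affine smooth_upto_bump)
  then show ?thesis by (simp add: cutoff_def[abs_def] algebra_simps)
qed

lemma cutoff_bounds: "0 \<le> cutoff n r" "cutoff n r \<le> 1"
  using bump_bounds(1,2) unfolding cutoff_def by (auto intro: mult_le_one)

text \<open>With x = (n+1)r - 1 the large factor n+1 equals (x+1)/r, so it is traded for 1/r
  uniformly in n.\<close>

lemma abs_cutoff_deriv_le:
  assumes r: "0 < r" shows "\<bar>cutoff_deriv n r\<bar> \<le> 3 / r + 2"
proof -
  let ?x = "real (Suc n) * r - 1"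
  have "real (Suc n) * bump 2 ?x = (?x * bump 2 ?x + bump 2 ?x) / r"
    using r by (simp add: field_simps)
  also have "\<dots> \<le> 3 / r"
    using bump_bounds(3,4)[of ?x] r by (intro divide_right_mono) auto
  finally have 1: "real (Suc n) * bump 2 ?x \<le> 3 / r" .
  have "real (Suc n) * bump 2 ?x * bump 0 (real (Suc n) - r) \<le> 3 / r * 1"
    using 1 bump_bounds r by (intro mult_mono) auto
  moreover have "bump 0 ?x * bump 2 (real (Suc n) - r) \<le> 1 * 2"
    using bump_bounds by (intro mult_mono) auto
  moreover have "0 \<le> real (Suc n) * bump 2 ?x * bump 0 (real (Suc n) - r)"
    "0 \<le> bump 0 ?x * bump 2 (real (Suc n) - r)"
    using bump_bounds(1) by (intro mult_nonneg_nonneg; simp)+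
  ultimately show ?thesis unfolding cutoff_deriv_def by linarith
qed

lemma cutoff_tendsto:
  assumes r: "0 < r"
  shows "(\<lambda>n. cutoff n r) \<longlonglongrightarrow> 1" "(\<lambda>n. cutoff_deriv n r) \<longlonglongrightarrow> 0"
proof -
  have "filterlim (\<lambda>n. real (Suc n) * r - 1) at_top sequentially" using r by real_asymp
  then have 1: "\<forall>\<^sub>F n in sequentially. 0 < real (Suc n) * r - 1"
    by (rule eventually_compose_filterlim[OF eventually_gt_at_top])
  have "filterlim (\<lambda>n. real (Suc n) - r) at_top sequentially" by real_asymp
  then have 2: "\<forall>\<^sub>F n in sequentially. 0 < real (Suc n) - r"
    by (rule eventually_compose_filterlim[OF eventually_gt_at_top])
  have "(\<lambda>n. exp (- inverse (real (Suc n) * r - 1)) * exp (- inverse (real (Suc n) - r))) \<longlonglongrightarrow> 1"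
    using r by real_asymp
  moreover have "\<forall>\<^sub>F n in sequentially. exp (- inverse (real (Suc n) * r - 1)) * exp (- inverse (real (Suc n) - r)) = cutoff n r"
    using 1 2 by eventually_elim (simp add: cutoff_def bump_def)
  ultimately show "(\<lambda>n. cutoff n r) \<longlonglongrightarrow> 1" by (rule Lim_transform_eventually)
  have "(\<lambda>n. real (Suc n) * (inverse (real (Suc n) * r - 1) ^ 2 * exp (- inverse (real (Suc n) * r - 1))) * exp (- inverse (real (Suc n) - r))
      - exp (- inverse (real (Suc n) * r - 1)) * (inverse (real (Suc n) - r) ^ 2 * exp (- inverse (real (Suc n) - r)))) \<longlonglongrightarrow> 0"
    using r by real_asymp
  moreover have "\<forall>\<^sub>F n in sequentially. real (Suc n) * (inverse (real (Suc n) * r - 1) ^ 2 * exp (- inverse (real (Suc n) * r - 1))) * exp (- inverse (real (Suc n) - r))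
      - exp (- inverse (real (Suc n) * r - 1)) * (inverse (real (Suc n) - r) ^ 2 * exp (- inverse (real (Suc n) - r))) = cutoff_deriv n r"
    using 1 2 by eventually_elim (simp add: cutoff_deriv_def bump_def)
  ultimately show "(\<lambda>n. cutoff_deriv n r) \<longlonglongrightarrow> 0" by (rule Lim_transform_eventually)
qed

text \<open>Bootstrapping: each derivative is a combination of the components with polynomials in
  1/r as coefficients.\<close>

lemma real_solution_smooth:
  assumes "real_solution \<kappa> c l a v w"
  shows "smooth_upto k {0<..} v \<and> smooth_upto k {0<..} w"
proof (induction k)
  case (Suc k)
  have 1: "smooth_upto k {0<..} (\<lambda>r. (- \<kappa> * inverse r ^ 1 + - a * inverse r ^ 2) * v r + ((1 + l) + - c * inverse r ^ 1) * w r)"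
    and 2: "smooth_upto k {0<..} (\<lambda>r. ((1 - l) + c * inverse r ^ 1) * v r + (\<kappa> * inverse r ^ 1 + a * inverse r ^ 2) * w r)"
    using Suc by (intro smooth_upto_add smooth_upto_mult smooth_upto_const smooth_upto_inverse_power; simp)+
  show ?case
    using assms unfolding real_solution_def
    by (intro conjI smooth_upto_SucI[OF _ 1] smooth_upto_SucI[OF _ 2])
      (auto simp: divide_inverse power_inverse algebra_simps simp flip: has_real_derivative_iff_has_vector_derivative)
qed simp

text \<open>The solution is controlled for r > 0 only; to the left of p the product vanishes, and
  the two open sets cover the line.\<close>

lemma cutoff_solution_test_function:
  assumes rs: "real_solution \<kappa> c l a v w"
  shows "(\<lambda>r. cutoff n r *\<^sub>R real_spinor v w r) \<in> test_functions" (is "?\<phi> \<in> _")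
proof -
  define p q where "p = 1 / real (Suc n)" and "q = real (Suc n)"
  have p: "0 < p" by (simp add: p_def)
  have out: "?\<phi> r = 0" if "r \<le> p \<or> q \<le> r" for r
    using that by (auto simp: cutoff_def bump_def field_simps p_def q_def)
  have sub: "closure {r. ?\<phi> r \<noteq> 0} \<subseteq> {p..q}"
  proof (rule closure_minimal)
    show "{r. ?\<phi> r \<noteq> 0} \<subseteq> {p..q}" using out by (metis (mono_tags, lifting) atLeastAtMost_iff linorder_le_cases mem_Collect_eq subsetI)
  qed simp
  have "compact (closure {r. ?\<phi> r \<noteq> 0})"
    using bounded_subset[OF bounded_closed_interval sub] by (simp add: compact_eq_bounded_closed)
  moreover have "closure {r. ?\<phi> r \<noteq> 0} \<subseteq> {0<..}"
    by (rule order_trans[OF sub]) (use p in auto)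
  moreover have "smooth_upto k UNIV ?\<phi>" for k
  proof -
    have vw: "smooth_upto k {0<..} v" "smooth_upto k {0<..} w" using real_solution_smooth[OF rs] by auto
    have "smooth_upto k {0<..} ?\<phi>"
      unfolding real_spinor_def
      by (intro smooth_upto_scaleR smooth_upto_add smooth_upto_const vw
          smooth_upto_subset[OF subset_UNIV smooth_upto_cutoff])
    moreover have "smooth_upto k {..<p} ?\<phi>"
    proof (rule smooth_upto_cong[OF _ smooth_upto_const[of _ _ 0]])
      show "0 = ?\<phi> r" if "r \<in> {..<p}" for r using out[of r] that by simp
    qed simp
    ultimately have "smooth_upto k ({0<..} \<union> {..<p}) ?\<phi>" by (intro smooth_upto_Un) auto
    moreover have "{0<..} \<union> {..<p} = UNIV" using p by auto
    ultimately show ?thesis by simp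
  qed
  ultimately show ?thesis by (simp add: test_functions_def smooth_fun_if_smooth_upto)
qed

section \<open>From truncated solutions to eigenfunctions of the closure\<close>

lemma L2_norm_tendsto_0:
  assumes h: "\<And>n. h n \<in> L2_space" and b: "\<And>n r. 0 < r \<Longrightarrow> (norm (h n r))\<^sup>2 \<le> C / (1 + r\<^sup>2)"
    and lim: "\<And>r. 0 < r \<Longrightarrow> (\<lambda>n. h n r) \<longlonglongrightarrow> 0"
  shows "(\<lambda>n. L2_norm (h n)) \<longlonglongrightarrow> 0"
proof -
  have pos: "AE r in half_line. 0 < r" by (rule AE_I2) (simp add: space_restrict_space)
  have "(\<lambda>n. LINT r|half_line. (norm (h n r))\<^sup>2) \<longlonglongrightarrow> (LINT r|half_line. 0)"
  proof (rule integral_dominated_convergence[OF _ _ integrable_inverse_1_plus_sq[of C]])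
    show "(\<lambda>r. (norm (h n r))\<^sup>2) \<in> borel_measurable half_line" for n
      using L2_spaceD(2)[OF h] by (rule borel_measurable_integrable)
    show "AE r in half_line. (\<lambda>n. (norm (h n r))\<^sup>2) \<longlonglongrightarrow> 0"
      using pos
    proof eventually_elim
      case (elim r)
      show ?case using tendsto_power[OF tendsto_norm_zero[OF lim[OF elim]], of 2] by simp
    qed
    show "AE r in half_line. norm ((norm (h n r))\<^sup>2) \<le> C / (1 + r\<^sup>2)" for n
      using pos by eventually_elim (use b in simp)
  qed simp
  then have "(\<lambda>n. sqrt (LINT r|half_line. (norm (h n r))\<^sup>2)) \<longlonglongrightarrow> sqrt 0"
    by (intro tendsto_real_sqrt) simp
  then show ?thesis by (simp add: L2_norm_def)
qed

lemma sq_le_if_decay: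
  fixes r x A :: real
  assumes r: "0 < r" and x: "0 \<le> x" "r \<le> 1 \<Longrightarrow> x \<le> A" "1 \<le> r \<Longrightarrow> x \<le> A / r" and A: "0 \<le> A"
  shows "x\<^sup>2 \<le> 2 * A\<^sup>2 / (1 + r\<^sup>2)"
proof (cases "r \<le> 1")
  case True
  have "x\<^sup>2 \<le> A\<^sup>2" using x(2)[OF True] x(1) by (rule power_mono)
  moreover have "1 + r\<^sup>2 \<le> 2" using True r by (simp add: power_le_one)
  ultimately have "x\<^sup>2 * (1 + r\<^sup>2) \<le> A\<^sup>2 * 2" by (rule mult_mono) auto
  then show ?thesis by (simp add: pos_le_divide_eq add_pos_nonneg)
next
  case False
  then have "x\<^sup>2 \<le> (A / r)\<^sup>2" using x by (intro power_mono) auto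
  then have "x\<^sup>2 * r\<^sup>2 \<le> A\<^sup>2" using r by (simp add: power_divide divide_simps)
  moreover have "x\<^sup>2 * 1 \<le> x\<^sup>2 * r\<^sup>2" using False by (intro mult_left_mono) auto
  ultimately have "x\<^sup>2 * (1 + r\<^sup>2) \<le> 2 * A\<^sup>2" by (simp add: algebra_simps)
  then show ?thesis by (simp add: pos_le_divide_eq add_pos_nonneg)
qed

lemma not_AE_half_line_eq_0:
  assumes "\<And>r. 0 < r \<Longrightarrow> f r \<noteq> 0"
  shows "\<not> (AE r in half_line. f r = 0)"
proof
  assume "AE r in half_line. f r = 0"
  moreover have "AE r in half_line. 0 < r" by (rule AE_I2) (simp add: space_restrict_space)
  ultimately have "AE r in half_line. False" by eventually_elim (use assms in blast)
  then have "emeasure half_line (space half_line) = 0"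
    by (simp add: eventually_False ae_filter_eq_bot_iff)
  then have "emeasure lebesgue {0::real<..} = 0"
    by (simp add: space_restrict_space emeasure_restrict_space)
  moreover have "emeasure lebesgue {0::real<..<1} \<le> emeasure lebesgue {0::real<..}"
    by (intro emeasure_mono) auto
  ultimately show False by simp
qed

text \<open>The truncated solutions are test functions and converge in the graph norm. The
  commutator with the cut-off is at most (3/r + 2)|u|, which the bound \<open>C * r\<close> near 0
  keeps bounded; dominated convergence does the rest.\<close>

lemma eigenvalue_closure:
  assumes rs: "real_solution \<kappa> c l a v w"
    and small: "\<And>r. 0 < r \<Longrightarrow> r \<le> 1 \<Longrightarrow> norm (real_spinor v w r) \<le> C * r"
    and large: "\<And>r. 1 \<le> r \<Longrightarrow> norm (real_spinor v w r) \<le> C / r\<^sup>2"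
    and nz: "\<And>r. 0 < r \<Longrightarrow> real_spinor v w r \<noteq> 0"
  shows "eigenvalue (dirac_op \<kappa> c a) (complex_of_real l)"
proof -
  let ?V = "real_spinor v w"
  let ?g = "\<lambda>r. complex_of_real l *s ?V r"
  let ?\<phi> = "\<lambda>n r. cutoff n r *\<^sub>R ?V r"
  have C: "0 \<le> C" using small[of 1] norm_ge_zero[of "?V 1"] by linarith
  have large': "norm (?V r) \<le> C / r" if "1 \<le> r" for r
  proof -
    have "C / r\<^sup>2 \<le> C / r" using that C by (intro divide_left_mono) (auto simp: power2_eq_square)
    with large[OF that] show ?thesis by simp
  qed
  have small': "norm (?V r) \<le> C" if "0 < r" "r \<le> 1" for r
    using small[OF that] mult_left_mono[OF that(2) C] by simp
  have V: "(norm (?V r))\<^sup>2 \<le> 2 * C\<^sup>2 / (1 + r\<^sup>2)" if "0 < r" for r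
    by (rule sq_le_if_decay[OF that]) (use that small' large' C in auto)
  have dV: "?V differentiable (at r)" if "0 < r" for r using real_solution_dirac_expr(2)[OF rs that] .
  have cV: "continuous_on {0<..} ?V"
    using dV by (meson continuous_at_imp_continuous_on differentiable_imp_continuous_within greaterThan_iff)
  have VL2: "?V \<in> L2_space" by (rule L2_spaceI[OF cV V])
  have gL2: "?g \<in> L2_space" by (rule L2_space_scale[OF VL2])
  have t: "?\<phi> n \<in> test_functions" for n by (rule cutoff_solution_test_function[OF rs])
  have \<phi>lim: "(\<lambda>n. L2_norm (\<lambda>r. ?\<phi> n r - ?V r)) \<longlonglongrightarrow> 0"
  proof (rule L2_norm_tendsto_0)
    show "(\<lambda>r. ?\<phi> n r - ?V r) \<in> L2_space" for n by (intro L2_space_diff test_function_L2[OF t] VL2)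
    fix r :: real assume r: "0 < r"
    show "(norm (?\<phi> n r - ?V r))\<^sup>2 \<le> 2 * C\<^sup>2 / (1 + r\<^sup>2)" for n
    proof -
      have "?\<phi> n r - ?V r = (cutoff n r - 1) *\<^sub>R ?V r" by (simp add: algebra_simps)
      then have "norm (?\<phi> n r - ?V r) = \<bar>cutoff n r - 1\<bar> * norm (?V r)" by simp
      also have "\<dots> \<le> 1 * norm (?V r)" using cutoff_bounds[of n r] by (intro mult_right_mono) auto
      finally have "(norm (?\<phi> n r - ?V r))\<^sup>2 \<le> (norm (?V r))\<^sup>2" by (intro power_mono) auto
      with V[OF r] show ?thesis by linarith
    qed
    have "(\<lambda>n. ?\<phi> n r - ?V r) \<longlonglongrightarrow> 1 *\<^sub>R ?V r - ?V r"
      by (intro tendsto_intros cutoff_tendsto[OF r])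
    then show "(\<lambda>n. ?\<phi> n r - ?V r) \<longlonglongrightarrow> 0" by simp
  qed
  \<comment> \<open>The image of the spinor under -i times the second Pauli matrix, through which
    the derivative of the cut-off enters.\<close>
  define rot where "rot = real_spinor (\<lambda>r. - w r) v"
  have nrot: "norm (rot r) = norm (?V r)" for r by (simp add: rot_def norm_real_spinor add.commute)
  have \<psi>: "dirac_expr \<kappa> c a (?\<phi> n) r - ?g r = ((cutoff n r - 1) * l) *\<^sub>R ?V r + cutoff_deriv n r *\<^sub>R rot r"
    if r: "0 < r" for n r
  proof -
    let ?D = "vector_derivative ?V (at r)"
    have D: "(?V has_vector_derivative ?D) (at r)" using dV[OF r] by (simp add: vector_derivative_works)
    have "(?\<phi> n has_vector_derivative cutoff n r *\<^sub>R ?D + cutoff_deriv n r *\<^sub>R ?V r) (at r)"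
      by (rule has_vector_derivative_scaleR[OF cutoff_has_derivative D])
    then have vd: "vector_derivative (?\<phi> n) (at r) = cutoff n r *\<^sub>R ?D + cutoff_deriv n r *\<^sub>R ?V r"
      by (rule vector_derivative_at)
    have sc: "(x *\<^sub>R u) $ i = complex_of_real x * u $ i" for x and u :: "complex ^ 2" and i
      by (simp add: vector_scaleR_component complex_eq_iff)
    have "dirac_expr \<kappa> c a (?\<phi> n) r = cutoff n r *\<^sub>R dirac_expr \<kappa> c a ?V r + cutoff_deriv n r *\<^sub>R rot r"
      unfolding vec_eq_iff forall_2 vector_add_component sc dirac_expr_components vd
      by (simp add: rot_def algebra_simps)
    also have "dirac_expr \<kappa> c a ?V r = ?g r" by (rule real_solution_dirac_expr(1)[OF rs r])
    finally show ?thesis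
      unfolding vec_eq_iff forall_2 vector_add_component vector_minus_component sc vector_smult_component
      by (simp add: algebra_simps)
  qed
  have \<psi>lim: "(\<lambda>n. L2_norm (\<lambda>r. dirac_expr \<kappa> c a (?\<phi> n) r - ?g r)) \<longlonglongrightarrow> 0"
  proof (rule L2_norm_tendsto_0)
    show "(\<lambda>r. dirac_expr \<kappa> c a (?\<phi> n) r - ?g r) \<in> L2_space" for n
      by (intro L2_space_diff test_function_L2[OF t] gL2)
    fix r :: real assume r: "0 < r"
    show "(norm (dirac_expr \<kappa> c a (?\<phi> n) r - ?g r))\<^sup>2 \<le> 2 * ((\<bar>l\<bar> + 5) * C)\<^sup>2 / (1 + r\<^sup>2)" for n
    proof (rule sq_le_if_decay[OF r])
      have "norm (dirac_expr \<kappa> c a (?\<phi> n) r - ?g r)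
          \<le> \<bar>(cutoff n r - 1) * l\<bar> * norm (?V r) + \<bar>cutoff_deriv n r\<bar> * norm (?V r)"
        unfolding \<psi>[OF r] by (rule order_trans[OF norm_triangle_ineq]) (simp add: nrot)
      also have "\<bar>(cutoff n r - 1) * l\<bar> \<le> 1 * \<bar>l\<bar>"
        using cutoff_bounds[of n r] unfolding abs_mult by (intro mult_right_mono) auto
      also have "\<bar>cutoff_deriv n r\<bar> \<le> 3 / r + 2" by (rule abs_cutoff_deriv_le[OF r])
      finally have b: "norm (dirac_expr \<kappa> c a (?\<phi> n) r - ?g r) \<le> (\<bar>l\<bar> + 3 / r + 2) * norm (?V r)"
        by (simp add: mult_right_mono algebra_simps)
      {
        assume r1: "r \<le> 1"
        have "(\<bar>l\<bar> + 3 / r + 2) * norm (?V r) \<le> (\<bar>l\<bar> + 3 / r + 2) * (C * r)"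
          using r small[OF r r1] by (intro mult_left_mono) auto
        also have "\<dots> = ((\<bar>l\<bar> + 2) * r + 3) * C" using r by (simp add: field_simps)
        also have "\<dots> \<le> ((\<bar>l\<bar> + 2) * 1 + 3) * C"
          using r1 C by (intro mult_right_mono add_mono mult_left_mono) auto
        finally show "norm (dirac_expr \<kappa> c a (?\<phi> n) r - ?g r) \<le> (\<bar>l\<bar> + 5) * C" using b by (simp add: algebra_simps)
      }
      {
        assume r1: "1 \<le> r"
        have "3 / r \<le> 3" using r1 by (simp add: divide_simps)
        then have "(\<bar>l\<bar> + 3 / r + 2) * norm (?V r) \<le> (\<bar>l\<bar> + 5) * (C / r)"
          using r large'[OF r1] by (intro mult_mono) auto
        then show "norm (dirac_expr \<kappa> c a (?\<phi> n) r - ?g r) \<le> (\<bar>l\<bar> + 5) * C / r" using b by simp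
      }
    qed (use C in auto)
    have "(\<lambda>n. ((cutoff n r - 1) * l) *\<^sub>R ?V r + cutoff_deriv n r *\<^sub>R rot r) \<longlonglongrightarrow> ((1 - 1) * l) *\<^sub>R ?V r + 0 *\<^sub>R rot r"
      by (intro tendsto_intros cutoff_tendsto[OF r])
    then show "(\<lambda>n. dirac_expr \<kappa> c a (?\<phi> n) r - ?g r) \<longlonglongrightarrow> 0" by (simp add: \<psi>[OF r])
  qed
  let ?T = "{(\<phi>, dirac_expr \<kappa> c a \<phi>) |\<phi>. \<phi> \<in> test_functions}"
  have T: "\<forall>n. (?\<phi> n, dirac_expr \<kappa> c a (?\<phi> n)) \<in> ?T" using t by blast
  have ex: "\<exists>\<phi> \<psi>. (\<forall>n::nat. (\<phi> n, \<psi> n) \<in> ?T) \<and>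
      (\<lambda>n. L2_norm (\<lambda>r. \<phi> n r - ?V r)) \<longlonglongrightarrow> 0 \<and> (\<lambda>n. L2_norm (\<lambda>r. \<psi> n r - ?g r)) \<longlonglongrightarrow> 0"
    by (rule exI[of _ ?\<phi>], rule exI[of _ "\<lambda>n. dirac_expr \<kappa> c a (?\<phi> n)"]) (intro conjI T \<phi>lim \<psi>lim)
  have "(?V, ?g) \<in> dirac_op \<kappa> c a"
    unfolding dirac_op_def closure_op_def
    by (rule CollectI, rule case_prodI, intro conjI VL2 gL2 ex)
  moreover have "\<not> (AE r in half_line. ?V r = 0)" by (rule not_AE_half_line_eq_0[OF nz])
  ultimately show ?thesis unfolding eigenvalue_def by auto
qed

section \<open>Absolutely continuous functions\<close>

lemma abs_continuous_on_intervalD: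
  assumes "abs_continuous_on_interval a b f" "0 < e"
  obtains d where "0 < d" "\<And>D. finite D \<Longrightarrow> (\<And>x y. (x, y) \<in> D \<Longrightarrow> a \<le> x \<and> x \<le> y \<and> y \<le> b) \<Longrightarrow>
    disjoint_family_on (\<lambda>(x, y). {x<..<y}) D \<Longrightarrow> (\<Sum>(x, y)\<in>D. y - x) < d \<Longrightarrow>
    (\<Sum>(x, y)\<in>D. norm (f y - f x)) < e"
proof -
  obtain d where d: "d > 0" "\<forall>D. finite D \<and> (\<forall>(x, y) \<in> D. a \<le> x \<and> x \<le> y \<and> y \<le> b) \<and>
        disjoint_family_on (\<lambda>(x, y). {x<..<y}) D \<and> (\<Sum>(x, y) \<in> D. y - x) < d
        \<longrightarrow> (\<Sum>(x, y) \<in> D. norm (f y - f x)) < e"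
    using assms unfolding abs_continuous_on_interval_def by meson
  show thesis
  proof (rule that[OF d(1)])
    fix D assume "finite D" "\<And>x y. (x, y) \<in> D \<Longrightarrow> a \<le> x \<and> x \<le> y \<and> y \<le> b"
      "disjoint_family_on (\<lambda>(x, y). {x<..<y}) D" "(\<Sum>(x, y)\<in>D. y - x) < d"
    then show "(\<Sum>(x, y)\<in>D. norm (f y - f x)) < e" by (intro d(2)[rule_format]) auto
  qed
qed

lemma abs_continuous_subinterval:
  assumes "abs_continuous_on_interval a b f" "a \<le> a'" "b' \<le> b"
  shows "abs_continuous_on_interval a' b' f"
  unfolding abs_continuous_on_interval_def
proof (intro allI impI)
  fix e :: real assume "0 < e"
  then obtain d where d: "0 < d" "\<And>D. finite D \<Longrightarrow> (\<And>x y. (x, y) \<in> D \<Longrightarrow> a \<le> x \<and> x \<le> y \<and> y \<le> b) \<Longrightarrow>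
    disjoint_family_on (\<lambda>(x, y). {x<..<y}) D \<Longrightarrow> (\<Sum>(x, y)\<in>D. y - x) < d \<Longrightarrow>
    (\<Sum>(x, y)\<in>D. norm (f y - f x)) < e"
    using abs_continuous_on_intervalD[OF assms(1)] by metis
  show "\<exists>d>0. \<forall>D. finite D \<and> (\<forall>(x, y)\<in>D. a' \<le> x \<and> x \<le> y \<and> y \<le> b') \<and>
      disjoint_family_on (\<lambda>(x, y). {x<..<y}) D \<and> (\<Sum>(x, y)\<in>D. y - x) < d \<longrightarrow>
      (\<Sum>(x, y)\<in>D. norm (f y - f x)) < e"
    using assms(2,3) by (intro exI[of _ d] conjI d(1) allI impI d(2)) fastforce+
qed

text \<open>Transfers absolute continuity from h to h minus a Lipschitz function, to Wronskians of
  h, and, with h constant, to Lipschitz functions.\<close>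

lemma abs_continuous_dominated:
  fixes f :: "real \<Rightarrow> 'a::real_normed_vector" and h :: "real \<Rightarrow> 'b::real_normed_vector"
  assumes h: "abs_continuous_on_interval a b h" and B: "0 \<le> B1" "0 \<le> B2"
    and le: "\<And>x y. a \<le> x \<Longrightarrow> x \<le> y \<Longrightarrow> y \<le> b \<Longrightarrow> norm (f y - f x) \<le> B1 * (y - x) + B2 * norm (h y - h x)"
  shows "abs_continuous_on_interval a b f"
  unfolding abs_continuous_on_interval_def
proof (intro allI impI)
  fix e :: real assume e: "0 < e"
  define e' where "e' = e / (2 * (B2 + 1))"
  have e': "0 < e'" using e B by (simp add: e'_def)
  obtain d where d: "0 < d" "\<And>D. finite D \<Longrightarrow> (\<And>x y. (x, y) \<in> D \<Longrightarrow> a \<le> x \<and> x \<le> y \<and> y \<le> b) \<Longrightarrow>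
    disjoint_family_on (\<lambda>(x, y). {x<..<y}) D \<Longrightarrow> (\<Sum>(x, y)\<in>D. y - x) < d \<Longrightarrow>
    (\<Sum>(x, y)\<in>D. norm (h y - h x)) < e'"
    by (rule abs_continuous_on_intervalD[OF h e']) blast
  define d' where "d' = min d (e / (2 * (B1 + 1)))"
  have d': "0 < d'" using d e B by (simp add: d'_def)
  show "\<exists>d>0. \<forall>D. finite D \<and> (\<forall>(x, y)\<in>D. a \<le> x \<and> x \<le> y \<and> y \<le> b) \<and>
      disjoint_family_on (\<lambda>(x, y). {x<..<y}) D \<and> (\<Sum>(x, y)\<in>D. y - x) < d \<longrightarrow>
      (\<Sum>(x, y)\<in>D. norm (f y - f x)) < e"
  proof (intro exI[of _ d'] conjI d' allI impI)
    fix D :: "(real \<times> real) set" assume D: "finite D \<and> (\<forall>(x, y)\<in>D. a \<le> x \<and> x \<le> y \<and> y \<le> b) \<and>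
      disjoint_family_on (\<lambda>(x, y). {x<..<y}) D \<and> (\<Sum>(x, y)\<in>D. y - x) < d'"
    have "(\<Sum>(x, y)\<in>D. norm (f y - f x)) \<le> (\<Sum>(x, y)\<in>D. B1 * (y - x) + B2 * norm (h y - h x))"
      using D le by (intro sum_mono) auto
    also have "\<dots> = B1 * (\<Sum>(x, y)\<in>D. y - x) + B2 * (\<Sum>(x, y)\<in>D. norm (h y - h x))"
      by (simp add: case_prod_unfold sum.distrib sum_distrib_left)
    also have "\<dots> \<le> B1 * (e / (2 * (B1 + 1))) + B2 * e'"
    proof -
      have "(\<Sum>(x, y)\<in>D. norm (h y - h x)) \<le> e'"
        using D by (intro less_imp_le d(2)) (auto simp: d'_def)
      moreover have "(\<Sum>(x, y)\<in>D. y - x) \<le> e / (2 * (B1 + 1))" using D by (auto simp: d'_def)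
      ultimately show ?thesis using B by (intro add_mono mult_left_mono) auto
    qed
    also have "\<dots> < e / 2 + e / 2"
      using e B by (intro add_strict_mono) (auto simp: e'_def field_simps)
    finally show "(\<Sum>(x, y)\<in>D. norm (f y - f x)) < e" by simp
  qed
qed

lemma abs_continuous_const: "abs_continuous_on_interval a b (\<lambda>_. k)"
  unfolding abs_continuous_on_interval_def by (auto simp: case_prod_unfold intro: exI[of _ 1])

lemma C1_lipschitz:
  fixes f :: "real \<Rightarrow> 'a::euclidean_space"
  assumes df: "\<And>x. a \<le> x \<Longrightarrow> x \<le> b \<Longrightarrow> (f has_vector_derivative f' x) (at x within {a..b})"
    and cf: "continuous_on {a..b} f'"
  obtains B where "0 \<le> B" "\<And>x y. a \<le> x \<Longrightarrow> x \<le> y \<Longrightarrow> y \<le> b \<Longrightarrow> norm (f y - f x) \<le> B * (y - x)"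
proof -
  have "bounded (f' ` {a..b})" using cf by (simp add: compact_continuous_image compact_imp_bounded)
  then obtain B where B: "\<And>x. a \<le> x \<Longrightarrow> x \<le> b \<Longrightarrow> norm (f' x) \<le> B"
    unfolding bounded_iff by (meson atLeastAtMost_iff imageI)
  have "norm (f y - f x) \<le> \<bar>B\<bar> * (y - x)" if xy: "a \<le> x" "x \<le> y" "y \<le> b" for x y
  proof -
    have "(f' has_integral (f y - f x)) {x..y}"
    proof (rule fundamental_theorem_of_calculus[OF xy(2)])
      show "(f has_vector_derivative f' z) (at z within {x..y})" if "z \<in> {x..y}" for z
        using df[of z] that xy by (auto intro: has_vector_derivative_within_subset)
    qed
    then have "integral {x..y} f' = f y - f x" by (rule integral_unique)
    moreover have "norm (integral {x..y} f') \<le> \<bar>B\<bar> * (y - x)"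
      using B xy by (intro integral_bound) (auto intro: continuous_on_subset[OF cf] order_trans[OF _ abs_ge_self])
    ultimately show ?thesis by simp
  qed
  with that[of "\<bar>B\<bar>"] show thesis by simp
qed

lemma abs_continuous_C1:
  fixes f :: "real \<Rightarrow> 'a::euclidean_space"
  assumes "\<And>x. a \<le> x \<Longrightarrow> x \<le> b \<Longrightarrow> (f has_vector_derivative f' x) (at x within {a..b})"
    and "continuous_on {a..b} f'"
  shows "abs_continuous_on_interval a b f"
proof -
  obtain B where B: "0 \<le> B" "\<And>x y. a \<le> x \<Longrightarrow> x \<le> y \<Longrightarrow> y \<le> b \<Longrightarrow> norm (f y - f x) \<le> B * (y - x)"
    by (rule C1_lipschitz[OF assms]) blast+
  show ?thesis
    by (rule abs_continuous_dominated[OF abs_continuous_const[of a b "0::real"] B(1) order_refl]) (use B(2) in simp)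
qed

lemma abs_continuous_imp_continuous_on:
  assumes "abs_continuous_on_interval a b f"
  shows "continuous_on {a..b} f"
  unfolding continuous_on_iff
proof (intro ballI allI impI)
  fix x e assume x: "x \<in> {a..b}" and e: "0 < (e::real)"
  obtain d where d: "0 < d" "\<And>D. finite D \<Longrightarrow> (\<And>x y. (x, y) \<in> D \<Longrightarrow> a \<le> x \<and> x \<le> y \<and> y \<le> b) \<Longrightarrow>
    disjoint_family_on (\<lambda>(x, y). {x<..<y}) D \<Longrightarrow> (\<Sum>(x, y)\<in>D. y - x) < d \<Longrightarrow>
    (\<Sum>(x, y)\<in>D. norm (f y - f x)) < e"
    by (rule abs_continuous_on_intervalD[OF assms e]) blast
  have *: "norm (f v - f u) < e" if "a \<le> u" "u \<le> v" "v \<le> b" "v - u < d" for u v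
    using d(2)[of "{(u, v)}"] that by (simp add: disjoint_family_on_def)
  show "\<exists>d>0. \<forall>x'\<in>{a..b}. dist x' x < d \<longrightarrow> dist (f x') (f x) < e"
  proof (intro exI[of _ d] conjI d(1) ballI impI)
    fix x' assume "x' \<in> {a..b}" "dist x' x < d"
    then show "dist (f x') (f x) < e"
      using *[of x x'] *[of x' x] x by (cases "x \<le> x'") (auto simp: dist_norm dist_real_def norm_minus_commute)
  qed
qed

text \<open>
  A fine tagged division is split according to whether the tags lie in the exceptional null set:
  there absolute continuity bounds the increments, elsewhere the vanishing derivative does.
\<close>

lemma abs_continuous_zero_derivative:
  fixes f :: "real \<Rightarrow> 'a::real_normed_vector"
  assumes ab: "a \<le> b" and AC: "abs_continuous_on_interval a b f" and N: "negligible N"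
    and der: "\<And>x. x \<in> {a..b} - N \<Longrightarrow> (f has_vector_derivative 0) (at x within {a..b})"
  shows "f b = f a"
proof -
  have main: "norm (f b - f a) \<le> e * (b - a) + e" if e: "0 < e" for e :: real
  proof -
    obtain d where d: "0 < d" "\<And>D. finite D \<Longrightarrow> (\<And>x y. (x, y) \<in> D \<Longrightarrow> a \<le> x \<and> x \<le> y \<and> y \<le> b) \<Longrightarrow>
      disjoint_family_on (\<lambda>(x, y). {x<..<y}) D \<Longrightarrow> (\<Sum>(x, y)\<in>D. y - x) < d \<Longrightarrow>
      (\<Sum>(x, y)\<in>D. norm (f y - f x)) < e"
      by (rule abs_continuous_on_intervalD[OF AC e]) blast
    have Ns: "N \<in> sets lebesgue" and N0: "emeasure lebesgue N = 0"
      using N by (auto simp: negligible_iff_null_sets)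
    \<comment> \<open>An open neighbourhood of the null set, of measure below the modulus d of
      absolute continuity.\<close>
    obtain U where U: "open U" "N \<subseteq> U" "U - N \<in> lmeasurable" "emeasure lebesgue (U - N) < ennreal d"
      using sets_lebesgue_outer_open[OF Ns d(1)] by metis
    have "emeasure lebesgue U \<le> emeasure lebesgue (U - N) + emeasure lebesgue N"
    proof -
      have "emeasure lebesgue U \<le> emeasure lebesgue ((U - N) \<union> N)"
        using U Ns by (intro emeasure_mono) (auto simp: fmeasurableD)
      also have "\<dots> \<le> emeasure lebesgue (U - N) + emeasure lebesgue N"
        using U Ns by (intro emeasure_subadditive) (auto simp: fmeasurableD)
      finally show ?thesis .
    qed
    then have mU: "emeasure lebesgue U < ennreal d" using U(4) N0 by simp
    \<comment> \<open>The gauge keeps intervals tagged in N inside U; elsewhere it is so fine that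
      the vanishing derivative bounds increments by e times the length.\<close>
    have "\<exists>\<delta>>0. (x \<in> N \<longrightarrow> ball x \<delta> \<subseteq> U) \<and>
        (x \<in> {a..b} - N \<longrightarrow> (\<forall>y\<in>{a..b}. dist y x < \<delta> \<longrightarrow> norm (f y - f x) \<le> e * \<bar>y - x\<bar>))" for x
    proof (cases "x \<in> N")
      case True
      then obtain \<delta> where "\<delta> > 0" "ball x \<delta> \<subseteq> U" using U openE by blast
      with True show ?thesis by blast
    next
      case False
      show ?thesis
      proof (cases "x \<in> {a..b}")
        case True
        then have "(f has_derivative (\<lambda>y. y *\<^sub>R 0)) (at x within {a..b})"
          using der[of x] False by (simp add: has_vector_derivative_def)
        then obtain \<delta> where "\<delta> > 0" "\<forall>y\<in>{a..b}. norm (y - x) < \<delta> \<longrightarrow> norm (f y - f x - (y - x) *\<^sub>R 0) \<le> e * norm (y - x)"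
          unfolding has_derivative_within_alt using e by blast
        then show ?thesis using False by (intro exI[of _ \<delta>]) (auto simp: dist_norm)
      qed (use False in \<open>auto intro: exI[of _ 1]\<close>)
    qed
    then obtain \<delta> where \<delta>: "\<And>x. 0 < \<delta> x" "\<And>x. x \<in> N \<Longrightarrow> ball x (\<delta> x) \<subseteq> U"
      "\<And>x y. x \<in> {a..b} - N \<Longrightarrow> y \<in> {a..b} \<Longrightarrow> dist y x < \<delta> x \<Longrightarrow> norm (f y - f x) \<le> e * \<bar>y - x\<bar>"
      by metis
    have "gauge (\<lambda>x. ball x (\<delta> x))" using \<delta>(1) by (simp add: gauge_ball_dependent)
    then obtain p where p: "p tagged_division_of {a..b}" and fine: "(\<lambda>x. ball x (\<delta> x)) fine p"
      by (rule fine_division_exists_real)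
    have fin: "finite p" using p by blast
    have K: "\<exists>u v. K = {u..v} \<and> u \<le> v \<and> u \<le> x \<and> x \<le> v \<and> a \<le> u \<and> v \<le> b \<and> K \<subseteq> ball x (\<delta> x)"
      if xK: "(x, K) \<in> p" for x K
    proof -
      obtain u v where K: "K = {u..v}" using tagged_division_ofD(4)[OF p xK] by auto
      have x: "x \<in> K" and "K \<subseteq> {a..b}" using tagged_division_ofD(2,3)[OF p xK] by auto
      moreover have "K \<subseteq> ball x (\<delta> x)" using fine xK unfolding fine_def by blast
      ultimately show ?thesis unfolding K by (intro exI[of _ u] exI[of _ v]) auto
    qed
    define pN where "pN = {(x, K) \<in> p. x \<in> N}"
    define pG where "pG = {(x, K) \<in> p. x \<notin> N}"
    have split: "p = pN \<union> pG" "pN \<inter> pG = {}" "finite pN" "finite pG"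
      using fin by (auto simp: pN_def pG_def intro: finite_subset[of _ p])
    let ?g = "\<lambda>(x, K). f (Sup K) - f (Inf K)"
    have "f b - f a = sum ?g p" by (rule additive_tagged_division_1[OF ab p, symmetric])
    also have "\<dots> = sum ?g pN + sum ?g pG"
      unfolding split(1) by (rule sum.union_disjoint) (use split in auto)
    finally have "norm (f b - f a) \<le> norm (sum ?g pN) + norm (sum ?g pG)"
      by (simp add: norm_triangle_ineq)
    also have "norm (sum ?g pG) \<le> e * (b - a)"
    proof -
      have "norm (sum ?g pG) \<le> (\<Sum>(x, K)\<in>pG. e * measure lborel K)"
      proof (rule sum_norm_le)
        fix q assume "q \<in> pG"
        then obtain x K where q: "q = (x, K)" "(x, K) \<in> p" "x \<notin> N" by (auto simp: pG_def)
        from K[OF q(2)] obtain u v where uv: "K = {u..v}" "u \<le> v" "u \<le> x" "x \<le> v" "a \<le> u" "v \<le> b" "K \<subseteq> ball x (\<delta> x)"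
          by blast
        have "u \<in> K" "v \<in> K" using uv by auto
        then have "dist u x < \<delta> x" "dist v x < \<delta> x" using uv(7) by (auto simp: dist_commute)
        then have "norm (f u - f x) \<le> e * \<bar>u - x\<bar>" "norm (f v - f x) \<le> e * \<bar>v - x\<bar>"
          using \<delta>(3)[of x u] \<delta>(3)[of x v] q uv by auto
        then have "norm (f v - f u) \<le> e * (v - x) + e * (x - u)"
          using norm_triangle_ineq4[of "f v - f x" "f u - f x"] uv by auto
        then show "norm (case q of (x, K) \<Rightarrow> f (Sup K) - f (Inf K)) \<le> (case q of (x, K) \<Rightarrow> e * measure lborel K)"
          using uv by (simp add: q algebra_simps)
      qed
      also have "\<dots> \<le> (\<Sum>(x, K)\<in>p. e * measure lborel K)"
        using split e fin by (intro sum_mono2) auto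
      also have "\<dots> = e * (\<Sum>(x, K)\<in>p. measure lborel K)" by (simp add: sum_distrib_left case_prod_unfold)
      also have "(\<Sum>(x, K)\<in>p. measure lborel K) = b - a"
        using additive_content_tagged_division[of p a b] p ab by simp
      finally show ?thesis .
    qed
    also have "norm (sum ?g pN) \<le> e"
    proof -
      define H where "H = (\<lambda>(x :: real, K :: real set). (Inf K, Sup K))"
      define D where "D = H ` pN"
      have HK: "\<exists>u v x. i = (u, v) \<and> u \<le> v \<and> a \<le> u \<and> v \<le> b \<and> {u..v} \<subseteq> U \<and> q = (x, {u..v})"
        if q: "q \<in> pN" "i = H q" for i q
      proof -
        obtain x K where xK: "q = (x, K)" "(x, K) \<in> p" "x \<in> N" using q(1) by (auto simp: pN_def)
        from K[OF xK(2)] obtain u v where uv: "K = {u..v}" "u \<le> v" "a \<le> u" "v \<le> b" "K \<subseteq> ball x (\<delta> x)"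
          by blast
        have "{u..v} \<subseteq> U" using uv \<delta>(2)[OF xK(3)] by blast
        then show ?thesis using uv xK q(2) by (auto simp: H_def)
      qed
      have disj: "{fst (H q)<..<snd (H q)} \<inter> {fst (H q')<..<snd (H q')} = {}"
        if qq': "q \<in> pN" "q' \<in> pN" "q \<noteq> q'" for q q'
      proof -
        obtain u v x u' v' x' where *: "H q = (u, v)" "q = (x, {u..v})" "H q' = (u', v')" "q' = (x', {u'..v'})"
          using HK[OF qq'(1) refl] HK[OF qq'(2) refl] by metis
        have "interior {u..v} \<inter> interior {u'..v'} = {}"
          using tagged_division_ofD(5)[OF p, of x "{u..v}" x' "{u'..v'}"] qq' * by (auto simp: pN_def)
        then show ?thesis unfolding *(1) *(3) by simp
      qed
      have finD: "finite D" using split(3) by (simp add: D_def)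
      have Dmem: "a \<le> u \<and> u \<le> v \<and> v \<le> b \<and> {u..v} \<subseteq> U" if "(u, v) \<in> D" for u v
        using that HK unfolding D_def by blast
      have disjD: "disjoint_family_on (\<lambda>(x, y). {x<..<y}) D"
        unfolding disjoint_family_on_def
      proof (intro ballI impI)
        fix i j assume "i \<in> D" "j \<in> D" "i \<noteq> j"
        then obtain q q' where "q \<in> pN" "q' \<in> pN" "i = H q" "j = H q'" "q \<noteq> q'" by (auto simp: D_def)
        with disj[of q q'] show "(case i of (x, y) \<Rightarrow> {x<..<y}) \<inter> (case j of (x, y) \<Rightarrow> {x<..<y}) = {}"
          by (simp add: case_prod_unfold)
      qed
      have "ennreal (\<Sum>(x, y)\<in>D. y - x) = (\<Sum>i\<in>D. emeasure lebesgue (case i of (x, y) \<Rightarrow> {x<..<y}))"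
        using Dmem by (subst sum_ennreal[symmetric]) (auto intro!: sum.cong)
      also have "\<dots> = emeasure lebesgue (\<Union>i\<in>D. case i of (x, y) \<Rightarrow> {x<..<y})"
        by (rule sum_emeasure) (use disjD finD in auto)
      also have "\<dots> \<le> emeasure lebesgue U"
        using Dmem U(1) by (intro emeasure_mono) (force simp: subset_iff, auto)
      also have "\<dots> < ennreal d" by (rule mU)
      finally have lt: "(\<Sum>(x, y)\<in>D. y - x) < d" using d(1) by (simp add: ennreal_less_iff sum_nonneg Dmem case_prod_unfold)
      have "norm (sum ?g pN) \<le> (\<Sum>q\<in>pN. norm (f (snd (H q)) - f (fst (H q))))"
        by (rule sum_norm_le) (auto simp: H_def)
      also have "\<dots> = (\<Sum>i\<in>D. norm (f (snd i) - f (fst i)))"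
        unfolding D_def
      \<comment> \<open>Different tagged pairs can share an interval only if it is degenerate, and
        then its increment is 0.\<close>
      proof (subst sum.reindex_nontrivial[OF split(3)])
        fix q q' assume q: "q \<in> pN" "q' \<in> pN" "q \<noteq> q'" "H q = H q'"
        obtain u v where uv: "H q = (u, v)" "u \<le> v" using HK[OF q(1) refl] by metis
        have "{fst (H q)<..<snd (H q)} = {}" using disj[OF q(1-3)] unfolding q(4)[symmetric] by simp
        then have "{u<..<v} = {}" unfolding uv(1) by simp
        then have "u = v" using uv(2) by simp
        then show "norm (f (snd (H q)) - f (fst (H q))) = 0" using uv by simp
      qed (simp add: o_def)
      also have "\<dots> = (\<Sum>(x, y)\<in>D. norm (f y - f x))" by (simp add: case_prod_unfold)
      also have "\<dots> < e" by (rule d(2)[OF finD _ disjD lt]) (use Dmem in auto)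
      finally show ?thesis by simp
    qed
    finally show ?thesis by simp
  qed
  have "norm (f b - f a) \<le> 0"
  proof (rule field_le_epsilon)
    fix e :: real assume e: "0 < e"
    \<comment> \<open>Scaling the slack by b - a + 1 makes the two contributions add up to
      e.\<close>
    define k where "k = b - a + 1"
    have k: "0 < k" "b - a = k - 1" using ab by (auto simp: k_def)
    have "norm (f b - f a) \<le> e / k * (k - 1) + e / k"
      unfolding k(2)[symmetric] by (rule main) (use e k in auto)
    also have "\<dots> = e" using k by (simp add: field_simps)
    finally show "norm (f b - f a) \<le> 0 + e" by simp
  qed
  then show ?thesis by simp
qed

text \<open>Subtracting the primitive of g leaves an absolutely continuous function whose derivative
  is 0 off a null set, hence a constant. An equation valid almost everywhere thus becomes classical
  where its right-hand side is continuous.\<close>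

lemma abs_continuous_has_vector_derivative:
  fixes h :: "real \<Rightarrow> 'a::euclidean_space"
  assumes AC: "abs_continuous_on_interval a b h" and g: "continuous_on {a..b} g" and N: "negligible N"
    and der: "\<And>x. x \<in> {a<..<b} - N \<Longrightarrow> (h has_vector_derivative g x) (at x)" and x: "a < x" "x < b"
  shows "(h has_vector_derivative g x) (at x)"
proof -
  define G where "G x = integral {a..x} g" for x
  have dG: "(G has_vector_derivative g x) (at x within {a..b})" if "a \<le> x" "x \<le> b" for x
    unfolding G_def using integral_has_vector_derivative[OF g] that by simp
  obtain B where B: "0 \<le> B" "\<And>x y. a \<le> x \<Longrightarrow> x \<le> y \<Longrightarrow> y \<le> b \<Longrightarrow> norm (G y - G x) \<le> B * (y - x)"
    by (rule C1_lipschitz[OF dG g]) blast+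
  have "abs_continuous_on_interval a b (\<lambda>x. h x - G x)"
  proof (rule abs_continuous_dominated[OF AC B(1), of 1])
    fix x y assume "a \<le> x" "x \<le> y" "y \<le> b"
    then have "norm (G y - G x) \<le> B * (y - x)" by (rule B(2))
    moreover have "norm (h y - G y - (h x - G x)) \<le> norm (h y - h x) + norm (G y - G x)"
      using norm_triangle_ineq4[of "h y - h x" "G y - G x"] by (simp add: algebra_simps)
    ultimately show "norm (h y - G y - (h x - G x)) \<le> B * (y - x) + 1 * norm (h y - h x)" by simp
  qed simp
  then have AC': "abs_continuous_on_interval a y (\<lambda>x. h x - G x)" if "y \<le> b" for y
    by (rule abs_continuous_subinterval) (use that in auto)
  have eq: "h y = h a + G y" if y: "y \<in> {a<..<b}" for y
  proof -
    have "h y - G y = h a - G a"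
    proof (rule abs_continuous_zero_derivative[OF _ AC', where N="N \<union> {a, y}"])
      show "negligible (N \<union> {a, y})" using N by (intro negligible_Un) auto
      fix z assume z: "z \<in> {a..y} - (N \<union> {a, y})"
      then have "(h has_vector_derivative g z) (at z within {a..y})"
        using der[of z] y by (auto intro: has_vector_derivative_at_within)
      moreover have "(G has_vector_derivative g z) (at z within {a..y})"
        using has_vector_derivative_within_subset[OF dG[of z], of "{a..y}"] z y by auto
      ultimately show "((\<lambda>x. h x - G x) has_vector_derivative 0) (at z within {a..y})"
        using has_vector_derivative_diff by fastforce
    qed (use y in auto)
    then show ?thesis by (simp add: G_def algebra_simps)
  qed
  have "(G has_vector_derivative g x) (at x)"
    using dG[of x] x at_within_Icc_at[of a x b] by simp
  then have "((\<lambda>x. h a + G x) has_vector_derivative g x) (at x)"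
    by (auto intro!: derivative_eq_intros)
  then show ?thesis
    by (rule has_vector_derivative_transform_within_open[of _ _ _ "{a<..<b}"]) (use x eq in auto)
qed

section \<open>Absolutely continuous solutions of the eigenvalue equation\<close>

lemma complex_scaleR_nth:
  "x *\<^sub>R z = complex_of_real x * z" "(x *\<^sub>R u) $ i = complex_of_real x * u $ i"
  for z :: complex and u :: "complex ^ 2"
  by (simp_all add: vector_scaleR_component complex_eq_iff)

text \<open>The coefficient matrix of the system is a combination of this map and the two that
  follow; as named bounded linear maps they fit the derivative and continuity rules.\<close>

definition spin_up :: "complex ^ 2 \<Rightarrow> complex ^ 2" where "spin_up u = vector [u $ 2, 0]"

definition spin_down :: "complex ^ 2 \<Rightarrow> complex ^ 2" where "spin_down u = vector [0, u $ 1]"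

definition spin_sign :: "complex ^ 2 \<Rightarrow> complex ^ 2" where "spin_sign u = vector [u $ 1, - u $ 2]"

lemma spin_nth [simp]:
  "spin_up u $ 1 = u $ 2" "spin_up u $ 2 = 0" "spin_down u $ 1 = 0" "spin_down u $ 2 = u $ 1"
  "spin_sign u $ 1 = u $ 1" "spin_sign u $ 2 = - u $ 2"
  by (simp_all add: spin_up_def spin_down_def spin_sign_def)

lemma bounded_linear_spin: "bounded_linear spin_up" "bounded_linear spin_down" "bounded_linear spin_sign"
  unfolding linear_conv_bounded_linear[symmetric]
  by (rule linearI; simp add: vec_eq_iff forall_2 complex_scaleR_nth)+

lemma finite_if_no_three_ordered:
  fixes S :: "'a::linorder set"
  assumes "\<And>a b c. a \<in> S \<Longrightarrow> b \<in> S \<Longrightarrow> c \<in> S \<Longrightarrow> a < b \<Longrightarrow> b < c \<Longrightarrow> False"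
  shows "finite S"
proof (rule ccontr)
  assume "infinite S"
  then obtain T where T: "T \<subseteq> S" "finite T" "card T = 3" using infinite_arbitrarily_large by blast
  define xs where "xs = sorted_list_of_set T"
  have xs: "length xs = 3" "set xs = T" "sorted_wrt (<) xs"
    using T by (simp_all add: xs_def)
  then have "xs ! 0 < xs ! 1" "xs ! 1 < xs ! 2" by (simp_all add: sorted_wrt_iff_nth_less)
  moreover have "xs ! i \<in> S" if "i < 3" for i using xs T that nth_mem by fastforce
  ultimately show False using assms[of "xs ! 0" "xs ! 1" "xs ! 2"] by simp
qed

lemma finite_real_roots:
  assumes "p \<noteq> (0 :: complex poly)" "\<And>r. r \<in> S \<Longrightarrow> poly p (complex_of_real r) = 0"
  shows "finite S"
proof -
  have "finite (complex_of_real -` {z. poly p z = 0})"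
    by (rule finite_vimageI[OF poly_roots_finite[OF assms(1)]]) (simp add: inj_on_def)
  then show ?thesis by (rule rev_finite_subset) (use assms(2) in auto)
qed

lemma poly_nonzero_if_coeff:
  "coeff p n = complex_of_real x * z \<Longrightarrow> x \<noteq> 0 \<Longrightarrow> z \<noteq> 0 \<Longrightarrow> p \<noteq> 0"
  by auto

section \<open>The coefficient matrix of the unperturbed first-order system\<close>

context coulomb_dirac
begin

text \<open>The vector A(r)u, where h' = A(r)h is the eigenvalue equation for a = 0 solved for the
  derivative.\<close>

definition dirac_rhs :: "real \<Rightarrow> real \<Rightarrow> complex ^ 2 \<Rightarrow> complex ^ 2" where
  "dirac_rhs l r u = (- (\<kappa> / r)) *\<^sub>R spin_sign u + (1 + l - c / r) *\<^sub>R spin_up u + (1 - l + c / r) *\<^sub>R spin_down u"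

text \<open>The vector A'(r)u for the matrix A of \<open>dirac_rhs\<close>.\<close>

definition dirac_rhs_deriv :: "real \<Rightarrow> complex ^ 2 \<Rightarrow> complex ^ 2" where
  "dirac_rhs_deriv r u = (\<kappa> / r\<^sup>2) *\<^sub>R spin_sign u + (c / r\<^sup>2) *\<^sub>R spin_up u + (- (c / r\<^sup>2)) *\<^sub>R spin_down u"

text \<open>Minus the determinant of the traceless matrix A(r), so that A(r)^2 is this scalar times
  the identity.\<close>

definition dirac_disc :: "real \<Rightarrow> real \<Rightarrow> real" where
  "dirac_disc l r = (\<kappa> / r)\<^sup>2 + (1 + l - c / r) * (1 - l + c / r)"

lemma dirac_expr_eigen_iff:
  "dirac_expr \<kappa> c 0 h r = complex_of_real l *s h r \<longleftrightarrow> vector_derivative h (at r) = dirac_rhs l r (h r)"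
proof -
  let ?D = "vector_derivative h (at r)"
  have 1: "dirac_expr \<kappa> c 0 h r $ 1 - (complex_of_real l *s h r) $ 1 = dirac_rhs l r (h r) $ 2 - ?D $ 2"
    by (simp add: dirac_expr_components dirac_rhs_def complex_scaleR_nth algebra_simps)
  have 2: "dirac_expr \<kappa> c 0 h r $ 2 - (complex_of_real l *s h r) $ 2 = ?D $ 1 - dirac_rhs l r (h r) $ 1"
    by (simp add: dirac_expr_components dirac_rhs_def complex_scaleR_nth algebra_simps)
  show ?thesis unfolding vec_eq_iff forall_2 using 1 2 by (metis eq_iff_diff_eq_0)
qed

lemma dirac_rhs_twice: "dirac_rhs l r (dirac_rhs l r u) = dirac_disc l r *\<^sub>R u"
  unfolding vec_eq_iff forall_2
  by (simp add: dirac_rhs_def dirac_disc_def complex_scaleR_nth algebra_simps power2_eq_square add_divide_distrib)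

lemma dirac_rhs_scaleR: "dirac_rhs l r (x *\<^sub>R u) = x *\<^sub>R dirac_rhs l r u"
  "dirac_rhs_deriv r (x *\<^sub>R u) = x *\<^sub>R dirac_rhs_deriv r u"
  unfolding vec_eq_iff forall_2
  by (simp_all add: dirac_rhs_def dirac_rhs_deriv_def complex_scaleR_nth algebra_simps)

lemma dirac_rhs_has_vector_derivative:
  assumes r: "0 < r" and h: "(h has_vector_derivative h') (at r)"
  shows "((\<lambda>r. dirac_rhs l r (h r)) has_vector_derivative dirac_rhs l r h' + dirac_rhs_deriv r (h r)) (at r)"
proof -
  have 1: "((\<lambda>r. - (\<kappa> / r)) has_real_derivative \<kappa> / r\<^sup>2) (at r)"
    and 2: "((\<lambda>r. 1 + l - c / r) has_real_derivative c / r\<^sup>2) (at r)"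
    and 3: "((\<lambda>r. 1 - l + c / r) has_real_derivative - (c / r\<^sup>2)) (at r)"
    using r by (auto intro!: derivative_eq_intros simp: power2_eq_square)
  note s = bounded_linear_spin[THEN bounded_linear.has_vector_derivative, OF h]
  have "((\<lambda>r. dirac_rhs l r (h r)) has_vector_derivative
      ((- (\<kappa> / r)) *\<^sub>R spin_sign h' + (\<kappa> / r\<^sup>2) *\<^sub>R spin_sign (h r)) +
      ((1 + l - c / r) *\<^sub>R spin_up h' + (c / r\<^sup>2) *\<^sub>R spin_up (h r)) +
      ((1 - l + c / r) *\<^sub>R spin_down h' + (- (c / r\<^sup>2)) *\<^sub>R spin_down (h r))) (at r)"
    unfolding dirac_rhs_def
    by (intro has_vector_derivative_add has_vector_derivative_scaleR 1 2 3 s)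
  then show ?thesis by (simp add: dirac_rhs_def dirac_rhs_deriv_def algebra_simps)
qed

lemma continuous_on_dirac_rhs:
  assumes "continuous_on S h" "S \<subseteq> {0<..}"
  shows "continuous_on S (\<lambda>r. dirac_rhs l r (h r))" "continuous_on S (\<lambda>r. dirac_rhs_deriv r (h r))"
    "continuous_on S (dirac_disc l)"
  unfolding dirac_rhs_def dirac_rhs_deriv_def dirac_disc_def
  using assms
  by (auto intro!: continuous_intros bounded_linear.continuous_on[OF bounded_linear_spin(1)]
      bounded_linear.continuous_on[OF bounded_linear_spin(2)] bounded_linear.continuous_on[OF bounded_linear_spin(3)])

text \<open>Multiplied by r^2 and r^3 the expressions become polynomials in r. Their leading
  coefficients are 1 - l^2 and, in the two components, (1 - l^2)(1 + l) and (1 - l^2)(1 - l) times a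
  component of d, with |l| < 1. The second expression is \<open>dirac_disc\<close> times the
  derivative that A h would have, if h' = A h, at a point where A h = d.\<close>

lemma finite_degenerate_points:
  assumes l: "\<bar>l\<bar> < 1"
  shows "finite {r. 0 < r \<and> dirac_disc l r = 0}"
    and "d \<noteq> 0 \<Longrightarrow> finite {r. 0 < r \<and> dirac_disc l r *\<^sub>R dirac_rhs l r d + dirac_rhs_deriv r (dirac_rhs l r d) = 0}"
proof -
  let ?o = complex_of_real
  define pD where "pD = [: ?o (\<kappa>\<^sup>2 - c\<^sup>2), ?o (2 * l * c), ?o (1 - l\<^sup>2) :]"
  have l2: "1 - l\<^sup>2 \<noteq> 0" "1 + l \<noteq> 0" "1 - l \<noteq> 0" using l by (auto simp: abs_square_less_1 power2_eq_1_iff)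
  have pD: "poly pD (?o r) = ?o (r\<^sup>2 * dirac_disc l r)" if "0 < r" for r
    using that by (simp add: pD_def dirac_disc_def field_simps power2_eq_square)
  show "finite {r. 0 < r \<and> dirac_disc l r = 0}"
  proof (rule finite_real_roots)
    have "coeff pD 2 = ?o (1 - l\<^sup>2) * 1" by (simp add: pD_def numeral_2_eq_2)
    then show "pD \<noteq> 0" by (rule poly_nonzero_if_coeff[OF _ l2(1)]) simp
    show "poly pD (?o r) = 0" if "r \<in> {r. 0 < r \<and> dirac_disc l r = 0}" for r using that pD by simp
  qed
  assume d: "d \<noteq> 0"
  define u1 where "u1 = [: - ?o \<kappa> * d $ 1 - ?o c * d $ 2, ?o (1 + l) * d $ 2 :]"
  define u2 where "u2 = [: ?o c * d $ 1 + ?o \<kappa> * d $ 2, ?o (1 - l) * d $ 1 :]"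
  have u: "poly u1 (?o r) = ?o r * dirac_rhs l r d $ 1" "poly u2 (?o r) = ?o r * dirac_rhs l r d $ 2" if "0 < r" for r
    using that by (simp_all add: u1_def u2_def dirac_rhs_def complex_scaleR_nth field_simps)
  define P1 where "P1 = pD * u1 + [: ?o \<kappa> :] * u1 + [: ?o c :] * u2"
  define P2 where "P2 = pD * u2 - [: ?o c :] * u1 - [: ?o \<kappa> :] * u2"
  let ?z = "\<lambda>r. dirac_disc l r *\<^sub>R dirac_rhs l r d + dirac_rhs_deriv r (dirac_rhs l r d)"
  have P: "poly P1 (?o r) = ?o r ^ 3 * ?z r $ 1" "poly P2 (?o r) = ?o r ^ 3 * ?z r $ 2" if r: "0 < r" for r
  proof -
    define U1 U2 where "U1 = dirac_rhs l r d $ 1" and "U2 = dirac_rhs l r d $ 2"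
    show "poly P1 (?o r) = ?o r ^ 3 * ?z r $ 1" "poly P2 (?o r) = ?o r ^ 3 * ?z r $ 2"
      using r unfolding P1_def P2_def poly_add poly_diff poly_mult u[OF r] pD[OF r] vector_add_component
        dirac_rhs_deriv_def complex_scaleR_nth spin_nth U1_def[symmetric] U2_def[symmetric]
      by (simp_all add: field_simps power2_eq_square power3_eq_cube)
  qed
  have c1: "coeff P1 3 = ?o ((1 - l\<^sup>2) * (1 + l)) * d $ 2" and c2: "coeff P2 3 = ?o ((1 - l\<^sup>2) * (1 - l)) * d $ 1"
    unfolding P1_def P2_def pD_def u1_def u2_def
    by (simp_all add: numeral_3_eq_3 algebra_simps)
  show "finite {r. 0 < r \<and> ?z r = 0}"
  proof (cases "d $ 2 = 0")
    case False
    show ?thesis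
    proof (rule finite_real_roots)
      show "P1 \<noteq> 0" by (rule poly_nonzero_if_coeff[OF c1]) (use l2 False in auto)
      fix r assume "r \<in> {r. 0 < r \<and> ?z r = 0}"
      then have r: "0 < r" and z: "?z r = 0" by blast+
      show "poly P1 (?o r) = 0" unfolding P(1)[OF r] z by simp
    qed
  next
    case True
    then have "d $ 1 \<noteq> 0" using d by (auto simp: vec_eq_iff forall_2)
    show ?thesis
    proof (rule finite_real_roots)
      show "P2 \<noteq> 0" by (rule poly_nonzero_if_coeff[OF c2]) (use l2 \<open>d $ 1 \<noteq> 0\<close> in auto)
      fix r assume "r \<in> {r. 0 < r \<and> ?z r = 0}"
      then have r: "0 < r" and z: "?z r = 0" by blast+
      show "poly P2 (?o r) = 0" unfolding P(2)[OF r] z by simp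
    qed
  qed
qed

text \<open>
  At a point \<open>r\<close> where \<open>h\<close> is not differentiable, \<open>vector_derivative h (at r)\<close> is a fixed junk value
  \<open>d\<close>, and the eigenvalue equation only says that \<open>dirac_rhs l r (h r) = d\<close>.  The following two
  lemmas show that this cannot happen on a set of positive measure unless \<open>h\<close> vanishes there:
  off the closed set \<open>Z\<close> of solutions of the latter equation, \<open>h\<close> is a classical solution, and for
  \<open>d \<noteq> 0\<close> some component of \<open>dirac_rhs l r (h r)\<close> is strictly monotone near a generic point of
  \<open>Z\<close>, so that \<open>Z\<close> is locally convex.
\<close>

lemma nondifferentiable_negligible:
  fixes h :: spinor
  assumes l: "\<bar>l\<bar> < 1" and ch: "continuous_on {0<..} h" and d: "d \<noteq> 0"
    and off: "\<And>r. 0 < r \<Longrightarrow> dirac_rhs l r (h r) \<noteq> d \<Longrightarrow> (h has_vector_derivative dirac_rhs l r (h r)) (at r)"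
  shows "negligible {r. 0 < r \<and> \<not> h differentiable (at r)}"
proof -
  let ?y = "\<lambda>r. dirac_rhs l r (h r)"
  let ?z = "\<lambda>r. dirac_disc l r *\<^sub>R h r + dirac_rhs_deriv r (h r)"
  let ?N = "{r. 0 < r \<and> \<not> h differentiable (at r)}"
  define B where "B = {r. 0 < r \<and> dirac_disc l r = 0} \<union>
    {r. 0 < r \<and> dirac_disc l r *\<^sub>R dirac_rhs l r d + dirac_rhs_deriv r (dirac_rhs l r d) = 0}"
  have finB: "finite B" using finite_degenerate_points[OF l] d by (simp add: B_def)
  note cy = continuous_on_dirac_rhs(1)[OF ch order_refl, of l]
  have cz: "continuous_on {0<..} ?z"
    by (rule continuous_on_add[OF continuous_on_scaleR[OF continuous_on_dirac_rhs(3)[OF ch order_refl] ch]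
          continuous_on_dirac_rhs(2)[OF ch order_refl]])
  have NZ: "?y r = d" if "r \<in> ?N" for r using that off[of r] differentiableI_vector by blast
  have hZ: "h r = inverse (dirac_disc l r) *\<^sub>R dirac_rhs l r d" if "?y r = d" "dirac_disc l r \<noteq> 0" for r
    using dirac_rhs_twice[of l r "h r"] that by simp
  have dy: "(?y has_vector_derivative ?z r) (at r)" if "0 < r" "?y r \<noteq> d" for r
    using dirac_rhs_has_vector_derivative[OF that(1) off[OF that], of l] by (simp add: dirac_rhs_twice)
  \<comment> \<open>Negligibility is a local property, and near each of its points the set will turn
    out to be finite.\<close>
  have "negligible (?N - B)"
  proof (rule iffD2[OF locally_negligible_alt], rule ballI)
    fix x assume x: "x \<in> ?N - B"
    then have xN: "x \<in> ?N" and xB: "x \<notin> B" by blast+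
    have x0: "0 < x" using xN by blast
    have yx: "?y x = d" by (rule NZ[OF xN])
    have Dx: "dirac_disc l x \<noteq> 0" using xB x0 unfolding B_def by blast
    have "?z x = inverse (dirac_disc l x) *\<^sub>R (dirac_disc l x *\<^sub>R dirac_rhs l x d + dirac_rhs_deriv x (dirac_rhs l x d))"
      unfolding hZ[OF yx Dx] dirac_rhs_scaleR by (simp add: scaleR_add_right)
    moreover have "dirac_disc l x *\<^sub>R dirac_rhs l x d + dirac_rhs_deriv x (dirac_rhs l x d) \<noteq> 0"
      using xB x0 unfolding B_def by blast
    ultimately have zx: "?z x \<noteq> 0" using Dx by (metis inverse_nonzero_iff_nonzero scaleR_eq_0_iff)
    \<comment> \<open>Pairing with \<zeta>, the value of \<open>?z\<close> at x, gives a direction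
      in which \<open>?y\<close> increases strictly near x wherever \<open>?y\<close> differs from
      d.\<close>
    define \<zeta> where "\<zeta> = ?z x"
    have "continuous (at x) (\<lambda>r. ?z r \<bullet> \<zeta>)" "continuous (at x) (dirac_disc l)"
      using cz continuous_on_dirac_rhs(3)[OF ch order_refl, of l] x0
      by (auto simp: continuous_on_eq_continuous_at intro!: continuous_intros)
    then have "((\<lambda>r. ?z r \<bullet> \<zeta>) \<longlongrightarrow> \<zeta> \<bullet> \<zeta>) (at x)" "(dirac_disc l \<longlongrightarrow> dirac_disc l x) (at x)"
      by (auto simp: continuous_at \<zeta>_def)
    moreover have "0 < \<zeta> \<bullet> \<zeta>" using zx by (simp add: \<zeta>_def)
    ultimately have "\<forall>\<^sub>F r in at x. 0 < ?z r \<bullet> \<zeta>" "\<forall>\<^sub>F r in at x. dirac_disc l r \<noteq> 0"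
      using order_tendstoD(1) tendsto_imp_eventually_ne[OF _ Dx] by blast+
    moreover have "\<forall>\<^sub>F r in at x. 0 < r" using x0 by (intro order_tendstoD(1)[OF tendsto_ident_at])
    ultimately have "\<forall>\<^sub>F r in at x. 0 < ?z r \<bullet> \<zeta> \<and> dirac_disc l r \<noteq> 0 \<and> 0 < r" by eventually_elim simp
    then obtain e where e: "0 < e" and e': "\<And>r. r \<noteq> x \<Longrightarrow> dist r x < e \<Longrightarrow> 0 < ?z r \<bullet> \<zeta> \<and> dirac_disc l r \<noteq> 0 \<and> 0 < r"
      unfolding eventually_at by auto
    define I where "I = {x - e<..<x + e}"
    have I: "0 < ?z r \<bullet> \<zeta>" "dirac_disc l r \<noteq> 0" "0 < r" if "r \<in> I" for r
      using e'[of r] that x0 Dx \<open>0 < \<zeta> \<bullet> \<zeta>\<close> by (cases "r = x"; auto simp: I_def dist_real_def \<zeta>_def)+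
    \<comment> \<open>Across a maximal gap between points with \<open>?y = d\<close> the pairing
      with \<zeta> would increase strictly, yet it has the same value at both ends.\<close>
    have convex: "?y \<gamma> = d" if "\<alpha> \<in> I" "\<omega> \<in> I" "\<alpha> < \<gamma>" "\<gamma> < \<omega>" "?y \<alpha> = d" "?y \<omega> = d" for \<alpha> \<omega> \<gamma>
    proof (rule ccontr)
      assume \<gamma>: "?y \<gamma> \<noteq> d"
      have subI: "{\<alpha>..\<omega>} \<subseteq> I" using that(1,2) by (auto simp: I_def)
      then have sub0: "{\<alpha>..\<omega>} \<subseteq> {0<..}" using I(3) by auto
      have closed: "closed {r \<in> {p..q}. ?y r = d}" if "{p..q} \<subseteq> {\<alpha>..\<omega>}" for p q
      proof (rule continuous_closed_preimage_constant[OF continuous_on_subset[OF cy] closed_atLeastAtMost])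
        show "{p..q} \<subseteq> {0<..}" using that sub0 by (rule order_trans)
      qed
      define A1 where "A1 = {r \<in> {\<alpha>..\<gamma>}. ?y r = d}"
      define A2 where "A2 = {r \<in> {\<gamma>..\<omega>}. ?y r = d}"
      define s where "s = Sup A1"
      define t where "t = Inf A2"
      have "\<alpha> \<in> A1" "\<omega> \<in> A2" using that(3-6) unfolding A1_def A2_def by simp_all
      then have ne: "A1 \<noteq> {}" "A2 \<noteq> {}" by auto
      have bdd: "bdd_above A1" "bdd_below A2" by (auto simp: A1_def A2_def intro!: bdd_aboveI bdd_belowI)
      have cl: "closed A1" "closed A2" unfolding A1_def A2_def by (rule closed; use that(3,4) in simp)+
      have s: "s \<in> A1" unfolding s_def by (rule closed_contains_Sup[OF ne(1) bdd(1) cl(1)])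
      have t: "t \<in> A2" unfolding t_def by (rule closed_contains_Inf[OF ne(2) bdd(2) cl(2)])
      have s\<gamma>: "s < \<gamma>" "\<alpha> \<le> s" and \<gamma>t: "\<gamma> < t" "t \<le> \<omega>"
        using s t \<gamma> by (auto simp: A1_def A2_def less_le)
      have gap: "?y r \<noteq> d" if "s < r" "r < t" for r
      proof
        assume "?y r = d"
        then have "r \<in> A1 \<or> r \<in> A2"
          using that s\<gamma> \<gamma>t unfolding A1_def A2_def by (cases "r \<le> \<gamma>") simp_all
        then consider "r \<in> A1" | "r \<in> A2" by blast
        then show False
        proof cases
          case 1
          then have "r \<le> s" unfolding s_def by (rule cSup_upper[OF _ bdd(1)])
          with that show False by simp
        next
          case 2
          then have "t \<le> r" unfolding t_def by (rule cInf_lower[OF _ bdd(2)])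
          with that show False by simp
        qed
      qed
      have "?y s \<bullet> \<zeta> < ?y t \<bullet> \<zeta>"
      proof (rule DERIV_pos_imp_increasing_open[where f="\<lambda>r. ?y r \<bullet> \<zeta>"])
        show "s < t" using s\<gamma> \<gamma>t by simp
        show "\<exists>D. ((\<lambda>r. ?y r \<bullet> \<zeta>) has_real_derivative D) (at r) \<and> 0 < D" if r: "s < r" "r < t" for r
        proof (intro exI conjI)
          have rI: "r \<in> I" using r s\<gamma> \<gamma>t subI by auto
          show "((\<lambda>r. ?y r \<bullet> \<zeta>) has_real_derivative ?z r \<bullet> \<zeta>) (at r)"
            unfolding has_real_derivative_iff_has_vector_derivative
            by (rule bounded_linear.has_vector_derivative[OF bounded_linear_inner_left dy[OF I(3)[OF rI] gap[OF r]]])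
          show "0 < ?z r \<bullet> \<zeta>" by (rule I(1)[OF rI])
        qed
        show "continuous_on {s..t} (\<lambda>r. ?y r \<bullet> \<zeta>)"
        proof (intro continuous_intros continuous_on_subset[OF cy])
          have "{s..t} \<subseteq> {\<alpha>..\<omega>}" using s\<gamma> \<gamma>t by auto
          then show "{s..t} \<subseteq> {0<..}" using sub0 by (rule order_trans)
        qed
      qed
      with s t show False by (simp add: A1_def A2_def)
    qed
    \<comment> \<open>Strictly between two points of this set \<open>?y = d\<close> throughout, so
      there h is the smooth function given by \<open>hZ\<close> and is differentiable.\<close>
    have "finite ((?N - B) \<inter> I)"
    proof (rule finite_if_no_three_ordered)
      fix p q r assume p: "p \<in> (?N - B) \<inter> I" and q: "q \<in> (?N - B) \<inter> I" and r: "r \<in> (?N - B) \<inter> I"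
        and pq: "p < q" "q < r"
      have pI: "p \<in> I" "r \<in> I" and yp: "?y p = d" "?y r = d" using p r NZ by blast+
      have y: "?y u = d" if "u \<in> {p<..<r}" for u
        by (rule convex[OF pI _ _ yp]) (use that in simp_all)
      have uI: "u \<in> I" if "u \<in> {p<..<r}" for u using that pI by (simp add: I_def)
      have q0: "0 < q" and Dq: "dirac_disc l q \<noteq> 0" using I[OF uI[of q]] pq by simp_all
      have "((\<lambda>r. dirac_rhs l r d) has_vector_derivative dirac_rhs l q 0 + dirac_rhs_deriv q d) (at q)"
        by (rule dirac_rhs_has_vector_derivative[OF q0]) simp
      then have "(\<lambda>r. dirac_rhs l r d) differentiable (at q)" by (rule differentiableI_vector)
      moreover have "(dirac_disc l) differentiable (at q)"
        unfolding dirac_disc_def[abs_def] using q0 by (intro derivative_intros) auto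
      ultimately have "(\<lambda>u. inverse (dirac_disc l u) *\<^sub>R dirac_rhs l u d) differentiable (at q)"
        using Dq by (intro differentiable_scaleR differentiable_inverse)
      then have "((\<lambda>u. inverse (dirac_disc l u) *\<^sub>R dirac_rhs l u d) has_vector_derivative
          vector_derivative (\<lambda>u. inverse (dirac_disc l u) *\<^sub>R dirac_rhs l u d) (at q)) (at q)"
        by (simp add: vector_derivative_works)
      from has_vector_derivative_transform_within_open[OF this open_greaterThanLessThan, of p r h]
      have "(h has_vector_derivative
          vector_derivative (\<lambda>u. inverse (dirac_disc l u) *\<^sub>R dirac_rhs l u d) (at q)) (at q)"
        using pq hZ[OF y I(2)[OF uI]] by simp
      then have "h differentiable (at q)" by (rule differentiableI_vector)
      with q show False by blast
    qed
    then have "negligible ((?N - B) \<inter> I)" by (rule negligible_finite)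
    moreover have "openin (top_of_set (?N - B)) ((?N - B) \<inter> I)" by (simp add: I_def openin_open_Int)
    moreover have "x \<in> (?N - B) \<inter> I" using x e by (simp add: I_def)
    ultimately show "\<exists>U. openin (top_of_set (?N - B)) U \<and> x \<in> U \<and> negligible U"
      by blast
  qed
  then have "negligible ((?N - B) \<union> B)" by (rule negligible_Un[OF _ negligible_finite[OF finB]])
  then show ?thesis by (rule negligible_subset) blast
qed

section \<open>Constancy of Wronskians for absolutely continuous eigenfunctions\<close>

lemma wronskian_has_vector_derivative_0:
  assumes rs: "real_solution \<kappa> c l 0 v w" and r: "0 < r"
    and h: "(h has_vector_derivative dirac_rhs l r (h r)) (at r)"
  shows "(wronskian h v w has_vector_derivative 0) (at r)"
proof -
  have "dirac_expr \<kappa> c 0 h r = complex_of_real l *s h r"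
    unfolding dirac_expr_eigen_iff by (rule vector_derivative_at[OF h])
  with wronskian_has_vector_derivative[OF rs r h] show ?thesis by simp
qed

lemma abs_continuous_wronskian:
  assumes rs: "real_solution \<kappa> c l a v w" and AC: "abs_continuous_on_interval p q h" and p: "0 < p"
  shows "abs_continuous_on_interval p q (wronskian h v w)"
proof -
  have ch: "continuous_on {p..q} h" by (rule abs_continuous_imp_continuous_on[OF AC])
  let ?v' = "\<lambda>r. - (\<kappa> / r + a / r\<^sup>2) * v r + (1 + l - c / r) * w r"
  let ?w' = "\<lambda>r. (1 - l + c / r) * v r + (\<kappa> / r + a / r\<^sup>2) * w r"
  have dv: "(v has_real_derivative ?v' r) (at r)" and dw: "(w has_real_derivative ?w' r) (at r)" if "p \<le> r" for r
    using rs p that unfolding real_solution_def by auto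
  have cv: "continuous_on {p..q} v" and cw: "continuous_on {p..q} w"
    using dv dw by (meson DERIV_continuous atLeastAtMost_iff continuous_at_imp_continuous_on)+
  have "continuous_on {p..q} ?v'" "continuous_on {p..q} ?w'"
    using p by (auto intro!: continuous_intros cv cw)
  note cvw' = this
  have wv: "(v has_vector_derivative ?v' r) (at r within {p..q})" if "p \<le> r" "r \<le> q" for r
    using has_field_derivative_at_within[OF dv[OF that(1)]] by (simp add: has_real_derivative_iff_has_vector_derivative)
  have ww: "(w has_vector_derivative ?w' r) (at r within {p..q})" if "p \<le> r" "r \<le> q" for r
    using has_field_derivative_at_within[OF dw[OF that(1)]] by (simp add: has_real_derivative_iff_has_vector_derivative)
  obtain Bv where Bv: "0 \<le> Bv" "\<And>x y. p \<le> x \<Longrightarrow> x \<le> y \<Longrightarrow> y \<le> q \<Longrightarrow> norm (v y - v x) \<le> Bv * (y - x)"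
    by (rule C1_lipschitz[OF wv cvw'(1)]) blast+
  obtain Bw where Bw: "0 \<le> Bw" "\<And>x y. p \<le> x \<Longrightarrow> x \<le> y \<Longrightarrow> y \<le> q \<Longrightarrow> norm (w y - w x) \<le> Bw * (y - x)"
    by (rule C1_lipschitz[OF ww cvw'(2)]) blast+
  have bd: "\<exists>B\<ge>0. \<forall>r. p \<le> r \<longrightarrow> r \<le> q \<longrightarrow> norm (f r) \<le> B" if "continuous_on {p..q} f"
    for f :: "real \<Rightarrow> 'z::real_normed_vector"
  proof -
    have "bounded (f ` {p..q})" using that by (simp add: compact_continuous_image compact_imp_bounded)
    then obtain B where "\<And>r. r \<in> {p..q} \<Longrightarrow> norm (f r) \<le> B" unfolding bounded_iff by blast
    then show ?thesis by (intro exI[of _ "\<bar>B\<bar>"]) (auto intro: order_trans[OF _ abs_ge_self])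
  qed
  obtain H where H: "0 \<le> H" "\<And>r. p \<le> r \<Longrightarrow> r \<le> q \<Longrightarrow> norm (h r) \<le> H" using bd[OF ch] by blast
  obtain V where V: "0 \<le> V" "\<And>r. p \<le> r \<Longrightarrow> r \<le> q \<Longrightarrow> norm (v r) \<le> V" using bd[OF cv] by blast
  obtain W where W: "0 \<le> W" "\<And>r. p \<le> r \<Longrightarrow> r \<le> q \<Longrightarrow> norm (w r) \<le> W" using bd[OF cw] by blast
  show ?thesis
  proof (rule abs_continuous_dominated[OF AC])
    show "0 \<le> H * Bw + H * Bv" "0 \<le> W + V" using Bv(1) Bw(1) H(1) V(1) W(1) by auto
    fix x y assume xy: "p \<le> x" "x \<le> y" "y \<le> q"
    have "wronskian h v w y - wronskian h v w x =
        (h y $ 1 * complex_of_real (w y - w x) + (h y - h x) $ 1 * complex_of_real (w x))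
        - (h y $ 2 * complex_of_real (v y - v x) + (h y - h x) $ 2 * complex_of_real (v x))"
      by (simp add: wronskian_def algebra_simps)
    also have "norm \<dots> \<le> (norm (h y $ 1) * \<bar>w y - w x\<bar> + norm ((h y - h x) $ 1) * \<bar>w x\<bar>)
        + (norm (h y $ 2) * \<bar>v y - v x\<bar> + norm ((h y - h x) $ 2) * \<bar>v x\<bar>)"
      by (intro order_trans[OF norm_triangle_ineq4] add_mono order_trans[OF norm_triangle_ineq])
        (auto simp: norm_mult simp flip: of_real_diff)
    also have "\<dots> \<le> (H * (Bw * (y - x)) + norm (h y - h x) * W) + (H * (Bv * (y - x)) + norm (h y - h x) * V)"
    proof -
      have y: "p \<le> y" and x: "x \<le> q" using xy by auto
      note nth = Finite_Cartesian_Product.norm_nth_le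
      have d: "0 \<le> y - x" using xy by simp
      show ?thesis
        using Bv(2)[OF xy] Bw(2)[OF xy] V(2)[OF xy(1) x] W(2)[OF xy(1) x] Bv(1) Bw(1) d H(1)
        by (intro add_mono mult_mono nth order_trans[OF nth H(2)[OF y xy(3)]]) auto
    qed
    finally show "norm (wronskian h v w y - wronskian h v w x)
        \<le> (H * Bw + H * Bv) * (y - x) + (W + V) * norm (h y - h x)"
      by (simp add: algebra_simps)
  qed
qed

lemma AE_half_line_negligible:
  assumes "AE r in half_line. P r"
  shows "negligible {r. 0 < r \<and> \<not> P r}"
proof -
  have "AE r in lebesgue. 0 < r \<longrightarrow> P r"
    using assms by (subst (asm) AE_restrict_space_iff) auto
  then obtain N where "N \<in> null_sets lebesgue" "{r \<in> space lebesgue. \<not> (0 < r \<longrightarrow> P r)} \<subseteq> N"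
    unfolding eventually_ae_filter by blast
  then have "negligible N" "{r. 0 < r \<and> \<not> P r} \<subseteq> N" by (auto simp: negligible_iff_null_sets)
  then show ?thesis by (rule negligible_subset)
qed

text \<open>Let d be the default value of \<open>vector_derivative\<close>. Points without
  derivative satisfy \<open>dirac_rhs l r (h r) = d\<close>. If d is nonzero,
  \<open>nondifferentiable_negligible\<close> disposes of them. If d = 0, then h or
  \<open>dirac_disc\<close> vanishes at such points, so away from zeros of h only finitely many
  remain; level sets of nonzero Wronskian values are then open and closed in the half-line.\<close>

lemma ac_eigenfunction_wronskian_constant:
  assumes l: "\<bar>l\<bar> < 1" and AC: "loc_abs_continuous h"
    and eig: "AE r in half_line. dirac_expr \<kappa> c 0 h r = complex_of_real l *s h r"
    and rs: "real_solution \<kappa> c l 0 v w"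
  obtains k where "\<And>r. 0 < r \<Longrightarrow> wronskian h v w r = k"
proof -
  let ?y = "\<lambda>r. dirac_rhs l r (h r)"
  let ?W = "wronskian h v w"
  \<comment> \<open>\<open>vector_derivative\<close> picks a derivative by choice; where none exists
    the predicate is false throughout, and the choice is this one fixed vector.\<close>
  define d where "d = (SOME D :: complex ^ 2. False)"
  define A where "A = {r. 0 < r \<and> vector_derivative h (at r) \<noteq> ?y r}"
  let ?N = "{r. 0 < r \<and> \<not> h differentiable (at r)}"
  have A: "negligible A"
    using AE_half_line_negligible[OF eig] by (simp add: A_def dirac_expr_eigen_iff)
  have AC': "abs_continuous_on_interval p q h" if "0 < p" "p \<le> q" for p q
    using AC that by (simp add: loc_abs_continuous_def)
  have ch: "continuous_on {0<..} h"
  proof (rule continuous_at_imp_continuous_on, rule ballI)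
    fix r :: real assume "r \<in> {0<..}"
    then have r: "0 < r" by simp
    have "continuous_on {r / 2..r + 1} h"
      by (rule abs_continuous_imp_continuous_on[OF AC']) (use r in auto)
    then show "isCont h r" by (rule continuous_on_interior) (use r in simp)
  qed
  note cy = continuous_on_dirac_rhs(1)[OF ch order_refl, of l]
  have junk: "vector_derivative h (at r) = d" if "r \<in> ?N" for r
  proof -
    have "\<not> (h has_vector_derivative D) (at r)" for D using that differentiableI_vector by blast
    then show ?thesis unfolding vector_derivative_def d_def by simp
  qed
  have good: "(h has_vector_derivative ?y r) (at r)" if "0 < r" "r \<notin> A" "r \<notin> ?N" for r
    using that by (auto simp: A_def vector_derivative_works)
  \<comment> \<open>Near r the continuous function \<open>?y\<close> avoids d, so points without
    derivative lie in the null set \<open>A\<close>, and h is a classical solution there.\<close>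
  have off: "(h has_vector_derivative ?y r) (at r)" if r: "0 < r" and "?y r \<noteq> d" for r
  proof -
    have "open ({0<..} \<inter> ?y -` (- {d}))"
      by (rule continuous_open_preimage[OF cy]) auto
    moreover have "r \<in> {0<..} \<inter> ?y -` (- {d})" using that by simp
    ultimately obtain e where e: "0 < e" "cball r e \<subseteq> {0<..} \<inter> ?y -` (- {d})"
      using open_contains_cball by blast
    then have sub: "{r - e..r + e} \<subseteq> {0<..} \<inter> ?y -` (- {d})" by (simp add: cball_eq_atLeastAtMost)
    show ?thesis
    proof (rule abs_continuous_has_vector_derivative[where a="r - e" and b="r + e" and N=A])
      have "r - e \<in> {r - e..r + e}" using e by simp
      then have "0 < r - e" using sub by blast
      then show "abs_continuous_on_interval (r - e) (r + e) h" by (rule AC') (use e in simp)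
      show "continuous_on {r - e..r + e} ?y" by (rule continuous_on_subset[OF cy]) (use sub in auto)
      show "(h has_vector_derivative ?y x) (at x)" if x: "x \<in> {r - e<..<r + e} - A" for x
      proof (rule good)
        have "x \<in> {r - e..r + e}" using x by auto
        then have x': "0 < x" "?y x \<noteq> d" using sub by auto
        then show "0 < x" by simp
        show "x \<notin> A" using x by simp
        show "x \<notin> ?N" using junk[of x] x x' by (auto simp: A_def)
      qed
    qed (use A e in auto)
  qed
  have const: "?W q = ?W p" if "0 < p" "p \<le> q" "negligible (?N \<inter> {p..q})" for p q
  proof (rule abs_continuous_zero_derivative[OF that(2) abs_continuous_wronskian[OF rs AC'[OF that(1,2)] that(1)]])
    show "negligible (A \<union> (?N \<inter> {p..q}))" using A that by (intro negligible_Un)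
    fix x assume x: "x \<in> {p..q} - (A \<union> (?N \<inter> {p..q}))"
    then have x0: "0 < x" using \<open>0 < p\<close> by simp
    have "(h has_vector_derivative ?y x) (at x)" by (rule good[OF x0]) (use x in auto)
    from wronskian_has_vector_derivative_0[OF rs x0 this]
    show "(?W has_vector_derivative 0) (at x within {p..q})" by (rule has_vector_derivative_at_within)
  qed
  show thesis
  proof (cases "d = 0")
    case False
    have "negligible ?N" by (rule nondifferentiable_negligible[OF l ch False off])
    then have "negligible (?N \<inter> {p..q})" for p q by (rule negligible_subset) blast
    then have neg: "negligible (?N \<inter> {p..q})" for p q .
    have "?W r = ?W 1" if r: "0 < r" for r
    proof (cases "r \<le> 1")
      case True
      show ?thesis using const[OF r True neg] by (rule sym)
    next
      case False
      then show ?thesis by (intro const neg) auto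
    qed
    with that show thesis by blast
  next
    case True
    have cW: "continuous_on {0<..} ?W"
    proof (rule continuous_at_imp_continuous_on, rule ballI)
      fix r :: real assume "r \<in> {0<..}"
      then have r: "0 < r" by simp
      have "continuous_on {r / 2..r + 1} ?W"
        by (rule abs_continuous_imp_continuous_on[OF abs_continuous_wronskian[OF rs AC']]) (use r in auto)
      then show "isCont ?W r" by (rule continuous_on_interior) (use r in simp)
    qed
    \<comment> \<open>A nonzero Wronskian keeps h away from 0 near r, so the constancy argument
      applies on a ball.\<close>
    have clopen: "openin (top_of_set {0<..}) {r \<in> {0<..}. ?W r = k}" if k: "k \<noteq> 0" for k
      unfolding openin_contains_ball
    proof (intro conjI ballI)
      fix r assume "r \<in> {r \<in> {0<..}. ?W r = k}"
      then have r: "0 < r" and Wr: "?W r = k" by auto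
      then have "h r \<noteq> 0" using k by (auto simp: wronskian_def)
      have "open ({0<..} \<inter> h -` (- {0}))" by (rule continuous_open_preimage[OF ch]) auto
      moreover have "r \<in> {0<..} \<inter> h -` (- {0})" using r \<open>h r \<noteq> 0\<close> by simp
      ultimately obtain e where e: "0 < e" "ball r e \<subseteq> {0<..} \<inter> h -` (- {0})"
        using open_contains_ball by blast
      have neg: "negligible (?N \<inter> ball r e)"
      proof (rule negligible_subset)
        show "negligible {r. 0 < r \<and> dirac_disc l r = 0}"
          by (rule negligible_finite[OF finite_degenerate_points(1)[OF l]])
        show "?N \<inter> ball r e \<subseteq> {r. 0 < r \<and> dirac_disc l r = 0}"
        proof
          fix x assume x: "x \<in> ?N \<inter> ball r e"
          then have "?y x = 0" using off[of x] True differentiableI_vector by blast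
          moreover have "dirac_rhs l x 0 = 0" using dirac_rhs_scaleR(1)[of l x 0 0] by simp
          ultimately have "dirac_disc l x *\<^sub>R h x = 0" using dirac_rhs_twice[of l x "h x"] by simp
          then show "x \<in> {r. 0 < r \<and> dirac_disc l r = 0}" using x e by auto
        qed
      qed
      have "?W x = k" if x: "x \<in> ball r e" for x
      proof -
        have sub: "{min r x..max r x} \<subseteq> ball r e" using x e by (auto simp: dist_real_def)
        then have "negligible (?N \<inter> {min r x..max r x})" by (intro negligible_subset[OF neg]) auto
        moreover have "0 < min r x" using x e r by auto
        ultimately have "?W (max r x) = ?W (min r x)" by (intro const) auto
        then show ?thesis using Wr by (cases "r \<le> x") auto
      qed
      then show "\<exists>e>0. ball r e \<inter> {0<..} \<subseteq> {r \<in> {0<..}. ?W r = k}" using e by (intro exI[of _ e]) auto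
    qed auto
    show thesis
    proof (cases "\<exists>r>0. ?W r \<noteq> 0")
      case True
      then obtain r where r: "0 < r" "?W r \<noteq> 0" by blast
      have cl: "closedin (top_of_set {0<..}) {x \<in> {0<..}. ?W x = ?W r}"
        by (rule continuous_closedin_preimage_constant[OF cW])
      have "connected {0::real<..}" by simp
      from this[unfolded connected_clopen, rule_format, OF conjI[OF clopen[OF r(2)] cl]]
      have "{x \<in> {0<..}. ?W x = ?W r} = {} \<or> {x \<in> {0<..}. ?W x = ?W r} = {0<..}" .
      then have "?W x = ?W r" if "0 < x" for x using r that by blast
      with that show thesis by blast
    qed (use that[of 0] in blast)
  qed
qed

end

section \<open>Eigenvalues and matching of the recessive solutions\<close>

lemma bounded_above_if_tendsto_at_bot:
  fixes f :: "real \<Rightarrow> real"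
  assumes f: "continuous_on UNIV f" and lim: "(f \<longlongrightarrow> K) at_bot"
  obtains C where "\<And>t. t \<le> t1 \<Longrightarrow> f t \<le> C"
proof -
  have "\<forall>\<^sub>F t in at_bot. f t < K + 1" by (rule order_tendstoD(2)[OF lim]) simp
  then obtain T where T: "\<And>t. t \<le> T \<Longrightarrow> f t < K + 1" unfolding eventually_at_bot_linorder by blast
  have "bdd_above (f ` {T..t1})"
    by (intro bounded_imp_bdd_above compact_imp_bounded compact_continuous_image continuous_on_subset[OF f]) auto
  then obtain B where B: "\<And>t. T \<le> t \<Longrightarrow> t \<le> t1 \<Longrightarrow> f t \<le> B"
    unfolding bdd_above_def by (meson atLeastAtMost_iff imageI)
  have "f t \<le> max (K + 1) B" if "t \<le> t1" for t
    using T[of t] B[of t] that by (cases "T \<le> t") auto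
  with that show thesis by blast
qed

lemma integral_inverse_sq_le:
  fixes r q :: real
  assumes "0 < r" "r \<le> q"
  shows "((\<lambda>x. inverse x ^ 2) has_integral (inverse r - inverse q)) {r..q}"
proof -
  have "((\<lambda>x. inverse x ^ 2) has_integral (- inverse q - - inverse r)) {r..q}"
  proof (rule fundamental_theorem_of_calculus[OF assms(2)])
    fix x assume "x \<in> {r..q}"
    then have "x \<noteq> 0" using assms by auto
    then have "((\<lambda>x. - inverse x) has_real_derivative inverse x ^ 2) (at x within {r..q})"
      by (auto intro!: derivative_eq_intros simp: power2_eq_square)
    then show "((\<lambda>x. - inverse x) has_vector_derivative inverse x ^ 2) (at x within {r..q})"
      by (simp add: has_real_derivative_iff_has_vector_derivative)
  qed
  then show ?thesis by simp
qed

lemma continuous_on_real_solution: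
  assumes "real_solution \<kappa> c l a v w" "0 < p"
  shows "continuous_on {p..q} v" "continuous_on {p..q} w"
  using assms unfolding real_solution_def
  by (meson DERIV_continuous atLeastAtMost_iff continuous_at_imp_continuous_on less_le_trans)+

context coulomb_dirac
begin

lemma polar_norm_sq: "(pcos X R r)\<^sup>2 + (psin X R r)\<^sup>2 = exp (2 * R (ln r))"
proof -
  have "(norm (real_spinor (pcos X R) (psin X R) r))\<^sup>2 = (exp (R (ln r)))\<^sup>2" by (simp add: norm_polar)
  then show ?thesis by (simp add: norm_complex2_sq exp_double)
qed

text \<open>Matching provides one solution that is recessive at both ends, whose truncations
  converge. Without it the two recessive solutions are independent, and an eigenfunction would have
  zero Wronskian with both.\<close>

lemma eigenvalue_iff_matching_neg:
  assumes a: "a < 0"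
    and p1: "polar_solution l a X R" and b1: "\<And>t. t \<le> T \<Longrightarrow> - \<beta> \<le> X t \<and> X t \<le> 0"
    and p2: "polar_solution l a X' R'" and b2: "\<And>t. T' \<le> t \<Longrightarrow> prufer_rate a t (X' t) \<le> - 2"
  shows "eigenvalue (dirac_op \<kappa> c a) (complex_of_real l) \<longleftrightarrow> (\<exists>n::int. X 0 - X' 0 = of_int n * pi)"
proof
  assume "\<exists>n::int. X 0 - X' 0 = of_int n * pi"
  then obtain n :: int where n: "X 0 - X' 0 = of_int n * pi" by blast
  obtain k where k: "\<And>t. R t = R' t + k" using polar_solution_matching[OF p1 p2 n] by metis
  obtain C where C: "\<And>t. t \<le> 0 \<Longrightarrow> R t \<le> C + t" using polar_growth_0[OF a p1 b1] by metis
  obtain C' where C': "\<And>t. 0 \<le> t \<Longrightarrow> R' t \<le> C' - 2 * t" using polar_growth_infinity[OF p2 b2] by metis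
  show "eigenvalue (dirac_op \<kappa> c a) (complex_of_real l)"
  proof (rule eigenvalue_closure[OF real_solution_polar[OF p1]])
    fix r :: real
    {
      assume r: "0 < r" "r \<le> 1"
      have "exp (R (ln r)) \<le> exp (C + ln r)" using C[of "ln r"] r by simp
      also have "\<dots> = exp C * r" using r by (simp add: exp_add)
      also have "\<dots> \<le> (exp C + exp (C' + k)) * r" using r by (intro mult_right_mono) auto
      finally show "norm (real_spinor (pcos X R) (psin X R) r) \<le> (exp C + exp (C' + k)) * r"
        unfolding norm_polar .
    }
    {
      assume r: "1 \<le> r"
      have "exp (R (ln r)) \<le> exp (C' + k - 2 * ln r)" using C'[of "ln r"] k[of "ln r"] r by simp
      also have "\<dots> = exp (C' + k) / r\<^sup>2" using r by (simp add: exp_diff exp_double)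
      also have "\<dots> \<le> (exp C + exp (C' + k)) / r\<^sup>2" by (intro divide_right_mono) auto
      finally show "norm (real_spinor (pcos X R) (psin X R) r) \<le> (exp C + exp (C' + k)) / r\<^sup>2"
        unfolding norm_polar .
    }
    show "real_spinor (pcos X R) (psin X R) r \<noteq> 0"
      using norm_polar[of X R r] by (metis exp_not_eq_zero norm_zero)
  qed
next
  assume ev: "eigenvalue (dirac_op \<kappa> c a) (complex_of_real l)"
  show "\<exists>n::int. X 0 - X' 0 = of_int n * pi"
  proof (rule ccontr)
    assume "\<nexists>n::int. X 0 - X' 0 = of_int n * pi"
    then have s: "sin (X 0 - X' 0) \<noteq> 0" by (metis sin_zero_iff_int2)
    note rs = real_solution_polar[OF p1] real_solution_polar[OF p2]
    have W1: "pcos X R 1 * psin X' R' 1 - psin X R 1 * pcos X' R' 1 \<noteq> 0"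
      unfolding polar_wronskian using s by simp
    have "\<not> eigenvalue (dirac_op \<kappa> c a) (complex_of_real l)"
    proof (rule not_eigenvalue_closure[OF rs])
      fix r :: real assume r: "0 < r"
      obtain C where C: "\<And>t. t \<le> ln r \<Longrightarrow> R t \<le> C + t" using polar_growth_0[OF a p1 b1] by metis
      obtain C' where C': "\<And>t. ln r \<le> t \<Longrightarrow> R' t \<le> C' - 2 * t" using polar_growth_infinity[OF p2 b2] by metis
      let ?B = "exp (2 * (C + ln r))"
      show "\<exists>V. \<forall>p. 0 < p \<longrightarrow> p \<le> r \<longrightarrow> integral {p..r} (\<lambda>r. (pcos X R r)\<^sup>2 + (psin X R r)\<^sup>2) \<le> V"
      proof (intro exI[of _ "?B * r"] allI impI)
        fix p assume p: "0 < p" "p \<le> r"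
        have "norm (integral {p..r} (\<lambda>r. (pcos X R r)\<^sup>2 + (psin X R r)\<^sup>2)) \<le> ?B * (r - p)"
        proof (rule integral_bound[OF p(2)])
          show "continuous_on {p..r} (\<lambda>r. (pcos X R r)\<^sup>2 + (psin X R r)\<^sup>2)"
            by (intro continuous_intros continuous_on_real_solution[OF rs(1) p(1)])
          fix x assume "x \<in> {p..r}"
          then have "ln x \<le> ln r" using p by simp
          then show "norm ((pcos X R x)\<^sup>2 + (psin X R x)\<^sup>2) \<le> ?B"
            using C[of "ln x"] unfolding polar_norm_sq by simp
        qed
        also have "\<dots> \<le> ?B * r" using p by (intro mult_left_mono) auto
        finally show "integral {p..r} (\<lambda>r. (pcos X R r)\<^sup>2 + (psin X R r)\<^sup>2) \<le> ?B * r" by simp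
      qed
      let ?D = "exp (2 * (C' - ln r))"
      show "\<exists>V. \<forall>q\<ge>r. integral {r..q} (\<lambda>r. (pcos X' R' r)\<^sup>2 + (psin X' R' r)\<^sup>2) \<le> V"
      proof (intro exI[of _ "?D * inverse r"] allI impI)
        fix q assume q: "r \<le> q"
        have I: "((\<lambda>x. ?D * inverse x ^ 2) has_integral ?D * (inverse r - inverse q)) {r..q}"
          by (rule has_integral_mult_right[OF integral_inverse_sq_le[OF r q]])
        have "norm (integral {r..q} (\<lambda>r. (pcos X' R' r)\<^sup>2 + (psin X' R' r)\<^sup>2)) \<le> integral {r..q} (\<lambda>x. ?D * inverse x ^ 2)"
        proof (rule integral_norm_bound_integral)
          show "(\<lambda>r. (pcos X' R' r)\<^sup>2 + (psin X' R' r)\<^sup>2) integrable_on {r..q}"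
            by (intro integrable_continuous_interval continuous_intros continuous_on_real_solution[OF rs(2) r])
          show "(\<lambda>x. ?D * inverse x ^ 2) integrable_on {r..q}" using I by blast
          fix x assume "x \<in> {r..q}"
          then have x: "0 < x" "ln r \<le> ln x" using r by auto
          \<comment> \<open>Of the four available powers of 1/x, two are spent on x >= r and two
            remain for integrability.\<close>
          have "exp (2 * R' (ln x)) \<le> exp (2 * (C' - ln r) + - 2 * ln x)" using C'[of "ln x"] x by simp
          also have "\<dots> = ?D * inverse x ^ 2" using x by (simp only: exp_add exp_minus mult_minus_left exp_double exp_ln power_inverse)
          finally show "norm ((pcos X' R' x)\<^sup>2 + (psin X' R' x)\<^sup>2) \<le> ?D * inverse x ^ 2"
            unfolding polar_norm_sq by simp
        qed
        also have "\<dots> = ?D * (inverse r - inverse q)" using I by (rule integral_unique)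
        also have "\<dots> \<le> ?D * inverse r" using r q by (intro mult_left_mono) auto
        finally show "integral {r..q} (\<lambda>r. (pcos X' R' r)\<^sup>2 + (psin X' R' r)\<^sup>2) \<le> ?D * inverse r" by simp
      qed
      show "pcos X R r * psin X' R' r - psin X R r * pcos X' R' r \<noteq> 0"
        using real_wronskian_constant[OF rs r zero_less_one] W1 by simp
    qed
    with ev show False by simp
  qed
qed

section \<open>Principal solutions and the boundary condition at the origin\<close>

lemma polar_asymptotic_bound_0:
  assumes p: "polar_solution l 0 X R" and band: "\<And>t. t \<le> T \<Longrightarrow> - \<beta> \<le> X t \<and> X t \<le> 0"
  obtains C where "\<And>t. t \<le> 0 \<Longrightarrow> R t \<le> C + exponent * t"
proof -
  obtain K where K: "((\<lambda>t. R t - exponent * t) \<longlongrightarrow> K) at_bot"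
    by (rule polar_asymptotics_0[OF p band]) blast+
  have "continuous_on UNIV R"
    using p unfolding polar_solution_def by (meson DERIV_continuous continuous_at_imp_continuous_on)
  then have "continuous_on UNIV (\<lambda>t. R t - exponent * t)" by (intro continuous_intros)
  then obtain C where "\<And>t. t \<le> 0 \<Longrightarrow> R t - exponent * t \<le> C"
    by (rule bounded_above_if_tendsto_at_bot[OF _ K]) blast
  with that show thesis by (metis add.commute diff_le_eq)
qed

text \<open>The constant in the asymptotics is e^K, with K the limit of
  \<open>R t - exponent * t\<close>.\<close>

lemma principal_solution_polar:
  assumes p: "polar_solution l 0 X R" and band: "\<And>t. t \<le> T \<Longrightarrow> - \<beta> \<le> X t \<and> X t \<le> 0"
  shows "principal_solution \<kappa> c l (real_spinor (pcos X R) (psin X R))"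
    and "real_valued (real_spinor (pcos X R) (psin X R))"
proof -
  show "real_valued (real_spinor (pcos X R) (psin X R))"
    unfolding real_valued_def forall_2 by simp
  note rs = real_solution_polar[OF p]
  obtain K where K: "((\<lambda>t. R t - exponent * t) \<longlongrightarrow> K) at_bot"
    by (rule polar_asymptotics_0[OF p band]) blast+
  have "((\<lambda>r. exp ((R (ln r) - exponent * ln r) - K)) \<longlongrightarrow> exp (K - K)) (at_right 0)"
    by (intro tendsto_intros filterlim_compose[OF K ln_at_0])
  moreover have "\<forall>\<^sub>F r in at_right 0. exp ((R (ln r) - exponent * ln r) - K) =
      norm (real_spinor (pcos X R) (psin X R) r) / (exp K * r powr sqrt (\<kappa>\<^sup>2 - c\<^sup>2))"
    using eventually_at_right_less[of 0]
    by eventually_elim (simp add: norm_polar exp_diff powr_def exponent_def mult.commute)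
  ultimately have "((\<lambda>r. norm (real_spinor (pcos X R) (psin X R) r) / (exp K * r powr sqrt (\<kappa>\<^sup>2 - c\<^sup>2))) \<longlongrightarrow> 1) (at_right 0)"
    using Lim_transform_eventually by fastforce
  then have "(\<lambda>r. norm (real_spinor (pcos X R) (psin X R) r)) \<sim>[at_right 0] (\<lambda>r. exp K * r powr sqrt (\<kappa>\<^sup>2 - c\<^sup>2))"
    by (rule asymp_equivI')
  then show "principal_solution \<kappa> c l (real_spinor (pcos X R) (psin X R))"
    unfolding principal_solution_def using real_solution_dirac_expr[OF rs] exp_gt_zero by blast
qed

text \<open>The band at the origin exists for every real l. This supplies principal solutions for
  the arbitrary spectral parameter in the boundary condition.\<close>

lemma left_polar_exists:
  obtains X R T where "polar_solution l 0 X R" "\<And>t. t \<le> T \<Longrightarrow> - \<beta> \<le> X t \<and> X t \<le> 0"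
proof -
  obtain T g where T: "T \<le> 0" "0 < g" and
    b: "\<And>l' a t. \<bar>l'\<bar> \<le> \<bar>l\<bar> \<Longrightarrow> a \<le> 0 \<Longrightarrow> t \<le> T \<Longrightarrow> 0 \<le> prufer l' a t (- \<beta>)"
    "\<And>l' a t. \<bar>l'\<bar> \<le> \<bar>l\<bar> \<Longrightarrow> a \<le> 0 \<Longrightarrow> t \<le> T \<Longrightarrow> prufer l' a t 0 \<le> 0"
    "\<And>a t x. a \<le> 0 \<Longrightarrow> t \<le> T \<Longrightarrow> - \<beta> \<le> x \<Longrightarrow> x \<le> 0 \<Longrightarrow>
      2 * (\<kappa> + a * exp (- t)) * cos (2 * x) - 2 * exp t * sin (2 * x) \<le> - g"
    by (rule left_band[of "\<bar>l\<bar>"]) blast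
  interpret lipschitz_ode "prufer l 0" "lip_prim l 0" "lip_const l 0" by (rule lipschitz_ode_prufer)
  have "- \<beta> \<le> 0" using band_angle_bounds by simp
  then obtain X where X: "solution X" "\<And>t. t \<le> T \<Longrightarrow> - \<beta> \<le> X t \<and> X t \<le> 0"
    using band_solution_exists[of T "- \<beta>" 0] b(1,2)[of l 0] by auto
  obtain R where "polar_solution l 0 X R"
    by (rule polar_solution_exists[of X l 0]) (use X(1) in \<open>auto simp: solution_def\<close>)
  with X(2) that show thesis by blast
qed

text \<open>
  \<open>P\<close> and \<open>Q\<close> are the components along the eigenvectors of the leading matrix at \<open>0\<close>, with
  eigenvalues \<open>\<plusminus> exponent\<close>.
\<close>

lemma real_solution_bound_0:
  assumes rs: "real_solution \<kappa> c l 0 v w"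
  obtains C where "0 < C" "\<And>r. 0 < r \<Longrightarrow> r \<le> 1 \<Longrightarrow> sqrt ((v r)\<^sup>2 + (w r)\<^sup>2) \<le> C * r powr - exponent"
proof -
  let ?s = exponent
  have s: "0 < ?s" "?s\<^sup>2 = \<kappa>\<^sup>2 - c\<^sup>2"
    using exponent_pos by (auto simp: exponent_def)
  define P where "P r = c * v r + (\<kappa> + ?s) * w r" for r
  define Q where "Q r = c * v r + (\<kappa> - ?s) * w r" for r
  define G where "G r = (P r)\<^sup>2 + (Q r)\<^sup>2" for r
  define e1 where "e1 r = c * (1 + l) * w r + (\<kappa> + ?s) * (1 - l) * v r" for r
  define e2 where "e2 r = c * (1 + l) * w r + (\<kappa> - ?s) * (1 - l) * v r" for r
  \<comment> \<open>\<open>m\<close> bounds the squared length of (v, w) by \<open>G\<close>: w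
    comes from P - Q = 2sw, and then v from P.\<close>
  define m where "m = 1 / (2 * ?s\<^sup>2) + (2 + 2 * (\<kappa> + ?s)\<^sup>2 * (1 / (2 * ?s\<^sup>2))) / c\<^sup>2"
  have sq2: "(x + y)\<^sup>2 \<le> 2 * x\<^sup>2 + 2 * y\<^sup>2" "(x - y)\<^sup>2 \<le> 2 * x\<^sup>2 + 2 * y\<^sup>2" for x y :: real
    using zero_le_power2[of "x - y"] zero_le_power2[of "x + y"] by (simp_all add: power2_sum power2_diff)
  have vw: "(v r)\<^sup>2 + (w r)\<^sup>2 \<le> m * G r" for r
  proof -
    have w: "(w r)\<^sup>2 \<le> 1 / (2 * ?s\<^sup>2) * G r"
    proof -
      have "P r - Q r = 2 * ?s * w r" by (simp add: P_def Q_def algebra_simps)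
      then have "(2 * ?s * w r)\<^sup>2 \<le> 2 * G r" using sq2(2)[of "P r" "Q r"] by (simp add: G_def)
      then show ?thesis using s(1) by (simp add: power_mult_distrib pos_le_divide_eq mult.commute)
    qed
    have "c * v r = P r - (\<kappa> + ?s) * w r" by (simp add: P_def)
    then have "(c * v r)\<^sup>2 \<le> 2 * (P r)\<^sup>2 + 2 * ((\<kappa> + ?s) * w r)\<^sup>2"
      by (simp only: sq2(2))
    also have "\<dots> \<le> 2 * G r + 2 * (\<kappa> + ?s)\<^sup>2 * (1 / (2 * ?s\<^sup>2) * G r)"
    proof (rule add_mono)
      show "2 * (P r)\<^sup>2 \<le> 2 * G r" by (simp add: G_def)
      have "0 \<le> 2 * (\<kappa> + ?s)\<^sup>2" by simp
      from mult_left_mono[OF w this]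
      show "2 * ((\<kappa> + ?s) * w r)\<^sup>2 \<le> 2 * (\<kappa> + ?s)\<^sup>2 * (1 / (2 * ?s\<^sup>2) * G r)"
        by (simp only: power_mult_distrib mult.assoc)
    qed
    also have "\<dots> = (2 + 2 * (\<kappa> + ?s)\<^sup>2 * (1 / (2 * ?s\<^sup>2))) * G r" by (simp add: algebra_simps)
    finally have "(v r)\<^sup>2 \<le> (2 + 2 * (\<kappa> + ?s)\<^sup>2 * (1 / (2 * ?s\<^sup>2))) / c\<^sup>2 * G r"
      using c0 by (simp add: power_mult_distrib pos_le_divide_eq mult.commute)
    with w show ?thesis unfolding m_def by (simp add: distrib_right)
  qed
  have m: "0 < m"
  proof -
    have "0 < 1 / (2 * ?s\<^sup>2)" using s(1) by simp
    moreover have "0 \<le> (2 + 2 * (\<kappa> + ?s)\<^sup>2 * (1 / (2 * ?s\<^sup>2))) / c\<^sup>2" by simp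
    ultimately show ?thesis unfolding m_def by (rule add_pos_nonneg)
  qed
  define n where "n = 4 * (c * (1 + l))\<^sup>2 + 2 * ((\<kappa> + ?s) * (1 - l))\<^sup>2 + 2 * ((\<kappa> - ?s) * (1 - l))\<^sup>2"
  have n: "0 \<le> n" by (simp add: n_def)
  have e: "(e1 r)\<^sup>2 + (e2 r)\<^sup>2 \<le> n * ((v r)\<^sup>2 + (w r)\<^sup>2)" for r
  proof -
    have "(e1 r)\<^sup>2 + (e2 r)\<^sup>2 \<le> (2 * (c * (1 + l) * w r)\<^sup>2 + 2 * ((\<kappa> + ?s) * (1 - l) * v r)\<^sup>2)
        + (2 * (c * (1 + l) * w r)\<^sup>2 + 2 * ((\<kappa> - ?s) * (1 - l) * v r)\<^sup>2)"
      unfolding e1_def e2_def by (intro add_mono sq2)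
    also have "\<dots> = 4 * (c * (1 + l))\<^sup>2 * (w r)\<^sup>2 + (2 * ((\<kappa> + ?s) * (1 - l))\<^sup>2 + 2 * ((\<kappa> - ?s) * (1 - l))\<^sup>2) * (v r)\<^sup>2"
      unfolding power_mult_distrib by (simp add: distrib_right)
    also have "\<dots> \<le> n * (w r)\<^sup>2 + n * (v r)\<^sup>2"
      unfolding n_def by (intro add_mono mult_right_mono) auto
    finally show ?thesis by (simp add: algebra_simps)
  qed
  \<comment> \<open>\<open>K\<close> absorbs the bounded coupling terms \<open>e1\<close> and
    \<open>e2\<close>, and the weight r^(2s) compensates for the component Q that grows toward 0. So
    \<Phi> is nondecreasing, and its value at 1 controls \<open>G\<close>.\<close>
  define K where "K = 1 + n * m"
  define \<Phi> where "\<Phi> r = G r * exp (2 * ?s * ln r + K * r)" for r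
  have mono: "\<Phi> r \<le> \<Phi> 1" if r: "0 < r" "r \<le> 1" for r
  proof (rule nondecreasing_if_deriv_nonneg[OF r(2)])
    fix x assume x: "r \<le> x" "x \<le> 1"
    then have x0: "0 < x" using r by simp
    have dv: "(v has_real_derivative - (\<kappa> / x) * v x + (1 + l - c / x) * w x) (at x)"
      and dw: "(w has_real_derivative (1 - l + c / x) * v x + (\<kappa> / x) * w x) (at x)"
      using rs x0 unfolding real_solution_def by auto
    have dP: "(P has_real_derivative ?s / x * P x + e1 x) (at x)"
    proof -
      have "(P has_real_derivative c * (- (\<kappa> / x) * v x + (1 + l - c / x) * w x)
          + (\<kappa> + ?s) * ((1 - l + c / x) * v x + (\<kappa> / x) * w x)) (at x)"
        unfolding P_def[abs_def] by (intro DERIV_add DERIV_cmult dv dw)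
      moreover have "c * (- (\<kappa> / x) * v x + (1 + l - c / x) * w x)
          + (\<kappa> + ?s) * ((1 - l + c / x) * v x + (\<kappa> / x) * w x)
          = (?s * c * v x + (\<kappa>\<^sup>2 - c\<^sup>2 + ?s * \<kappa>) * w x) / x + e1 x"
        using x0 by (simp add: e1_def field_simps power2_eq_square)
      moreover have "?s * c * v x + (\<kappa>\<^sup>2 - c\<^sup>2 + ?s * \<kappa>) * w x = ?s * P x"
        unfolding s(2)[symmetric] P_def by (simp add: algebra_simps power2_eq_square)
      ultimately show ?thesis by simp
    qed
    have dQ: "(Q has_real_derivative - (?s / x) * Q x + e2 x) (at x)"
    proof -
      have "(Q has_real_derivative c * (- (\<kappa> / x) * v x + (1 + l - c / x) * w x)
          + (\<kappa> - ?s) * ((1 - l + c / x) * v x + (\<kappa> / x) * w x)) (at x)"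
        unfolding Q_def[abs_def] by (intro DERIV_add DERIV_cmult dv dw)
      moreover have "c * (- (\<kappa> / x) * v x + (1 + l - c / x) * w x)
          + (\<kappa> - ?s) * ((1 - l + c / x) * v x + (\<kappa> / x) * w x)
          = (- ?s * c * v x + (\<kappa>\<^sup>2 - c\<^sup>2 - ?s * \<kappa>) * w x) / x + e2 x"
        using x0 by (simp add: e2_def field_simps power2_eq_square)
      moreover have "- ?s * c * v x + (\<kappa>\<^sup>2 - c\<^sup>2 - ?s * \<kappa>) * w x = - ?s * Q x"
        unfolding s(2)[symmetric] Q_def by (simp add: algebra_simps power2_eq_square)
      ultimately show ?thesis by simp
    qed
    let ?E = "exp (2 * ?s * ln x + K * x)"
    show "(\<Phi> has_real_derivative (2 * P x * (?s / x * P x + e1 x) + 2 * Q x * (- (?s / x) * Q x + e2 x)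
        + G x * (2 * ?s / x + K)) * ?E) (at x)"
    proof -
      have dG: "(G has_real_derivative 2 * P x * (?s / x * P x + e1 x) + 2 * Q x * (- (?s / x) * Q x + e2 x)) (at x)"
        unfolding G_def[abs_def] by (rule derivative_eq_intros dP dQ refl | simp)+
      have dE: "((\<lambda>x. exp (2 * ?s * ln x + K * x)) has_real_derivative ?E * (2 * ?s / x + K)) (at x)"
        using x0 by (auto intro!: derivative_eq_intros)
      show ?thesis unfolding \<Phi>_def[abs_def]
        by (rule DERIV_cong[OF DERIV_mult[OF dG dE]]) (simp add: algebra_simps)
    qed
    have "2 * P x * (?s / x * P x + e1 x) + 2 * Q x * (- (?s / x) * Q x + e2 x) + G x * (2 * ?s / x + K)
        = 4 * (?s / x) * (P x)\<^sup>2 + (K * G x + 2 * (P x * e1 x) + 2 * (Q x * e2 x))"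
      by (simp add: G_def algebra_simps power2_eq_square)
    moreover have "0 \<le> 4 * (?s / x) * (P x)\<^sup>2" using s x0 by simp
    moreover have "0 \<le> K * G x + 2 * (P x * e1 x) + 2 * (Q x * e2 x)"
    proof -
      have "0 \<le> (P x + e1 x)\<^sup>2 + (Q x + e2 x)\<^sup>2" by simp
      then have "- (2 * (P x * e1 x) + 2 * (Q x * e2 x)) \<le> G x + ((e1 x)\<^sup>2 + (e2 x)\<^sup>2)"
        by (simp add: power2_sum G_def)
      moreover have "(e1 x)\<^sup>2 + (e2 x)\<^sup>2 \<le> n * (m * G x)"
        using e[of x] mult_left_mono[OF vw[of x] n] by linarith
      ultimately show ?thesis by (simp add: K_def algebra_simps)
    qed
    ultimately show "0 \<le> (2 * P x * (?s / x * P x + e1 x) + 2 * Q x * (- (?s / x) * Q x + e2 x)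
        + G x * (2 * ?s / x + K)) * ?E"
      by (intro mult_nonneg_nonneg) auto
  qed
  define C where "C = sqrt (m * \<Phi> 1) + 1"
  have "0 \<le> G 1" by (simp add: G_def)
  then have \<Phi>1: "0 \<le> \<Phi> 1" by (simp add: \<Phi>_def)
  then have mP: "0 \<le> m * \<Phi> 1" using m by simp
  have "sqrt ((v r)\<^sup>2 + (w r)\<^sup>2) \<le> C * r powr - ?s" if r: "0 < r" "r \<le> 1" for r
  proof -
    have K0: "0 \<le> K" using n m by (simp add: K_def)
    have "G r * exp (2 * ?s * ln r) \<le> \<Phi> r"
      unfolding \<Phi>_def using r K0 by (intro mult_left_mono) (auto simp: G_def)
    also have "\<dots> \<le> \<Phi> 1" by (rule mono[OF r])
    finally have "G r \<le> \<Phi> 1 * exp (- (2 * ?s * ln r))" by (simp add: exp_minus divide_simps)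
    also have "exp (- (2 * ?s * ln r)) = (r powr - ?s)\<^sup>2"
      using r by (simp add: powr_def exp_double[symmetric] mult.assoc)
    finally have "(v r)\<^sup>2 + (w r)\<^sup>2 \<le> m * \<Phi> 1 * (r powr - ?s)\<^sup>2"
      using vw[of r] m by (smt (verit) mult_left_mono mult.assoc)
    then have "sqrt ((v r)\<^sup>2 + (w r)\<^sup>2) \<le> sqrt (m * \<Phi> 1 * (r powr - ?s)\<^sup>2)" by (rule real_sqrt_le_mono)
    also have "\<dots> = sqrt (m * \<Phi> 1) * r powr - ?s" using mP by (simp add: real_sqrt_mult)
    also have "\<dots> \<le> C * r powr - ?s" by (intro mult_right_mono) (auto simp: C_def)
    finally show ?thesis .
  qed
  moreover have "0 < C" using mP by (simp add: C_def add_nonneg_pos)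
  ultimately show thesis using that by blast
qed

lemma principal_real_solution:
  assumes p: "principal_solution \<kappa> c l u" and rv: "real_valued u"
  shows "real_solution \<kappa> c l 0 (\<lambda>r. Re (u r $ 1)) (\<lambda>r. Re (u r $ 2))"
    and "0 < r \<Longrightarrow> u r = real_spinor (\<lambda>r. Re (u r $ 1)) (\<lambda>r. Re (u r $ 2)) r"
proof -
  have re: "u r $ i = complex_of_real (Re (u r $ i))" if "0 < r" for r i
    using rv that unfolding real_valued_def by (simp add: complex_is_Real_iff complex_eq_iff)
  then show "0 < r \<Longrightarrow> u r = real_spinor (\<lambda>r. Re (u r $ 1)) (\<lambda>r. Re (u r $ 2)) r"
    unfolding vec_eq_iff forall_2 real_spinor_nth by blast
  show "real_solution \<kappa> c l 0 (\<lambda>r. Re (u r $ 1)) (\<lambda>r. Re (u r $ 2))"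
    unfolding real_solution_def
  proof (intro allI impI)
    fix r :: real assume r: "0 < r"
    have "u differentiable (at r)" "vector_derivative u (at r) = dirac_rhs l r (u r)"
      using p r unfolding principal_solution_def by (auto simp: dirac_expr_eigen_iff)
    then have "(u has_vector_derivative dirac_rhs l r (u r)) (at r)"
      using vector_derivative_works[of u "at r"] by simp
    then have "((\<lambda>r. Re (u r $ i)) has_real_derivative Re (dirac_rhs l r (u r) $ i)) (at r)" for i
      unfolding has_real_derivative_iff_has_vector_derivative
      by (intro bounded_linear.has_vector_derivative[OF bounded_linear_Re]
          bounded_linear.has_vector_derivative[OF bounded_linear_vec_nth])
    from this[of 1] this[of 2]
    show "((\<lambda>r. Re (u r $ 1)) has_real_derivative
        - (\<kappa> / r + 0 / r\<^sup>2) * Re (u r $ 1) + (1 + l - c / r) * Re (u r $ 2)) (at r) \<and>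
      ((\<lambda>r. Re (u r $ 2)) has_real_derivative
        (1 - l + c / r) * Re (u r $ 1) + (\<kappa> / r + 0 / r\<^sup>2) * Re (u r $ 2)) (at r)"
      by (simp add: dirac_rhs_def algebra_simps)
  qed
qed

text \<open>
  Principal solutions for different spectral parameters have the same asymptotic direction up to
  \<open>O(r)\<close>, which is negligible against the growth \<open>r powr (- exponent)\<close> of any other solution.  Hence
  a solution that is not recessive violates the boundary condition.
\<close>

lemma boundary_condition_fails:
  assumes p: "polar_solution l 0 X R" and band: "\<And>t. t \<le> T \<Longrightarrow> - \<beta> \<le> X t \<and> X t \<le> 0"
    and rs: "real_solution \<kappa> c l 0 v w"
    and D: "\<And>r. 0 < r \<Longrightarrow> pcos X R r * w r - psin X R r * v r = D" "D \<noteq> 0"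
    and u: "principal_solution \<kappa> c l' u" "real_valued u"
  shows "\<not> ((\<lambda>r. v r * Re (u r $ 2) - w r * Re (u r $ 1)) \<longlongrightarrow> 0) (at_right 0)"
proof
  assume lim: "((\<lambda>r. v r * Re (u r $ 2) - w r * Re (u r $ 1)) \<longlongrightarrow> 0) (at_right 0)"
  let ?s = exponent
  define U V where "U r = Re (u r $ 1)" and "V r = Re (u r $ 2)" for r
  note ru = principal_real_solution[OF u, folded U_def V_def]
  have nu: "norm (u r) = sqrt ((U r)\<^sup>2 + (V r)\<^sup>2)" if "0 < r" for r
    by (subst ru(2)[OF that]) (rule norm_real_spinor)
  obtain Cu where Cu: "0 < Cu" and asy: "(\<lambda>r. norm (u r)) \<sim>[at_right 0] (\<lambda>r. Cu * r powr ?s)"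
    using u(1) unfolding principal_solution_def exponent_def by blast
  have "((\<lambda>r. norm (u r) / (Cu * r powr ?s)) \<longlongrightarrow> 1) (at_right 0)"
  proof -
    have "\<forall>\<^sub>F r in at_right (0::real). norm (u r) \<noteq> 0 \<or> Cu * r powr ?s \<noteq> 0"
      using eventually_at_right_less[of 0] by eventually_elim (use Cu in simp)
    from asymp_equivD_strong[OF asy this] show ?thesis .
  qed
  then have ev: "\<forall>\<^sub>F r in at_right 0. 1 / 2 < norm (u r) / (Cu * r powr ?s)"
    "\<forall>\<^sub>F r in at_right 0. norm (u r) / (Cu * r powr ?s) < 2"
    by (rule order_tendstoD; simp)+
  obtain X' R' T' where p': "polar_solution l' 0 X' R'" and band': "\<And>t. t \<le> T' \<Longrightarrow> - \<beta> \<le> X' t \<and> X' t \<le> 0"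
    by (rule left_polar_exists[of l']) blast
  obtain C where C: "\<And>t. t \<le> 0 \<Longrightarrow> R t \<le> C + ?s * t"
    by (rule polar_asymptotic_bound_0[OF p band]) blast+
  obtain C' where C': "\<And>t. t \<le> 0 \<Longrightarrow> R' t \<le> C' + ?s * t"
    by (rule polar_asymptotic_bound_0[OF p' band']) blast+
  have \<rho>: "exp (R (ln r)) \<le> exp C * r powr ?s" if "0 < r" "r \<le> 1" for r
    using C[of "ln r"] that by (simp add: powr_def flip: exp_add)
  have \<rho>': "exp (R' (ln r)) \<le> exp C' * r powr ?s" if "0 < r" "r \<le> 1" for r
    using C'[of "ln r"] that by (simp add: powr_def flip: exp_add)
  have X: "\<And>t. (X has_real_derivative prufer l 0 t (X t)) (at t)"
    and X': "\<And>t. (X' has_real_derivative prufer l' 0 t (X' t)) (at t)"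
    using p p' unfolding polar_solution_def by auto
  obtain A T1 where A: "0 \<le> A" "\<And>t. t \<le> T1 \<Longrightarrow> \<bar>X t - \<theta>\<^sub>0\<bar> \<le> A * exp t"
    by (rule angle_near_limit[OF X band]) blast+
  obtain A' T1' where A': "0 \<le> A'" "\<And>t. t \<le> T1' \<Longrightarrow> \<bar>X' t - \<theta>\<^sub>0\<bar> \<le> A' * exp t"
    by (rule angle_near_limit[OF X' band']) blast+
  obtain E where E: "0 < E" "\<And>r. 0 < r \<Longrightarrow> r \<le> 1 \<Longrightarrow> sqrt ((v r)\<^sup>2 + (w r)\<^sup>2) \<le> E * r powr - ?s"
    by (rule real_solution_bound_0[OF rs]) blast
  have small: "\<bar>x\<bar> \<le> sqrt (x\<^sup>2 + y\<^sup>2)" "\<bar>y\<bar> \<le> sqrt (x\<^sup>2 + y\<^sup>2)" for x y :: real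
    using real_sqrt_le_mono[of "x\<^sup>2" "x\<^sup>2 + y\<^sup>2"] real_sqrt_le_mono[of "y\<^sup>2" "x\<^sup>2 + y\<^sup>2"] by auto
  \<comment> \<open>\<open>u\<close> is a multiple of the recessive polar solution.\<close>
  have par: "U r * sin (X' (ln r)) = V r * cos (X' (ln r))" if r: "0 < r" for r
  proof -
    \<comment> \<open>The Wronskian of two solutions of size r^s is O(r^(2s)); being constant, it is
      0.\<close>
    define k where "k = U 1 * psin X' R' 1 - V 1 * pcos X' R' 1"
    have k: "U r * psin X' R' r - V r * pcos X' R' r = k" if "0 < r" for r
      unfolding k_def by (rule real_wronskian_constant[OF ru(1) real_solution_polar[OF p'] that zero_less_one])
    have "((\<lambda>r. 4 * Cu * exp C' * (r powr ?s * r powr ?s)) \<longlongrightarrow> 4 * Cu * exp C' * (0 * 0)) (at_right 0)"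
    proof (intro tendsto_intros)
      have "\<forall>\<^sub>F r in at_right 0. 0 \<le> (r::real)" using eventually_at_right_less[of 0] by eventually_elim simp
      then show "((\<lambda>r. r powr ?s) \<longlongrightarrow> 0) (at_right 0)"
        by (rule tendsto_zero_powrI[OF tendsto_ident_at tendsto_const _ exponent_pos])
      then show "((\<lambda>r. r powr ?s) \<longlongrightarrow> 0) (at_right 0)" .
    qed
    moreover have "\<forall>\<^sub>F r in at_right 0. \<bar>k\<bar> \<le> 4 * Cu * exp C' * (r powr ?s * r powr ?s)"
      using ev(2) eventually_at_right_less[of 0] eventually_at_right_real[of 0 1, OF zero_less_one]
    proof eventually_elim
      case (elim r)
      have "0 < Cu * r powr ?s" using elim Cu by simp
      then have nle: "norm (u r) \<le> 2 * Cu * r powr ?s" using elim(1) by (simp only: pos_divide_less_eq mult.assoc less_imp_le)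
      have "\<bar>k\<bar> \<le> \<bar>U r\<bar> * \<bar>psin X' R' r\<bar> + \<bar>V r\<bar> * \<bar>pcos X' R' r\<bar>"
        unfolding k[OF elim(2), symmetric] by (rule order_trans[OF abs_triangle_ineq4]) (simp add: abs_mult)
      also have "\<dots> \<le> norm (u r) * exp (R' (ln r)) + norm (u r) * exp (R' (ln r))"
        unfolding nu[OF elim(2)] psin_def pcos_def abs_mult abs_exp_cancel
        by (intro add_mono mult_mono small mult_left_le) auto
      also have "\<dots> \<le> 2 * Cu * r powr ?s * (exp C' * r powr ?s) + 2 * Cu * r powr ?s * (exp C' * r powr ?s)"
        using nle \<rho>'[of r] elim Cu by (intro add_mono mult_mono) auto
      finally show ?case by (simp add: algebra_simps)
    qed
    ultimately have "\<bar>k\<bar> \<le> 4 * Cu * exp C' * (0 * 0)" by (rule tendsto_lowerbound) simp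
    then have "k = 0" by simp
    with k[OF r] show ?thesis by (simp add: pcos_def psin_def)
  qed
  \<comment> \<open>The signed length of (U, V) along the direction of angle
    \<open>X'\<close>.\<close>
  define \<sigma> where "\<sigma> r = U r * cos (X' (ln r)) + V r * sin (X' (ln r))" for r
  have UV: "U r = \<sigma> r * cos (X' (ln r))" "V r = \<sigma> r * sin (X' (ln r))" if r: "0 < r" for r
  proof -
    have sc: "cos (X' (ln r)) * cos (X' (ln r)) + sin (X' (ln r)) * sin (X' (ln r)) = 1"
      using sin_cos_squared_add2[of "X' (ln r)"] by (simp add: power2_eq_square)
    show "U r = \<sigma> r * cos (X' (ln r))" "V r = \<sigma> r * sin (X' (ln r))"
      using par[OF r] sc unfolding \<sigma>_def by algebra+
  qed
  have \<sigma>: "\<bar>\<sigma> r\<bar> = norm (u r)" if r: "0 < r" for r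
  proof -
    have "(U r)\<^sup>2 + (V r)\<^sup>2 = (\<sigma> r)\<^sup>2"
      unfolding UV[OF r] power_mult_distrib by (simp flip: distrib_left)
    then show ?thesis by (simp add: nu[OF r])
  qed
  define b where "b = \<bar>D\<bar> / exp C"
  have b: "0 < b" using D(2) by (simp add: b_def)
  have "((\<lambda>r. 2 * E * (A + A') * r) \<longlongrightarrow> 2 * E * (A + A') * 0) (at_right 0)" by (intro tendsto_intros)
  then have ev3: "\<forall>\<^sub>F r in at_right 0. 2 * E * (A + A') * r < b / 2"
    using b by (intro order_tendstoD(2)) auto
  have lnev: "\<forall>\<^sub>F r in at_right 0. ln r \<le> S" for S :: real
    using ln_at_0 unfolding filterlim_at_bot by blast
  \<comment> \<open>The Wronskian with u stays away from 0: |u| is of size r^s, while the part of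
    (v, w) transverse to the direction of u is at least of size r^(-s), because the Wronskian D with
    the recessive solution is nonzero.\<close>
  have "\<forall>\<^sub>F r in at_right 0. Cu / 2 * (b / 2) \<le> \<bar>v r * V r - w r * U r\<bar>"
    using ev(1) ev3 lnev[of T1] lnev[of T1'] eventually_at_right_less[of 0]
      eventually_at_right_real[of 0 1, OF zero_less_one]
  proof eventually_elim
    case (elim r)
    then have r: "0 < r" "r \<le> 1" by auto
    let ?p = "r powr ?s"
    have pp: "0 < ?p" "?p * r powr - ?s = 1" using r by (auto simp: powr_minus)
    let ?x = "X (ln r)" and ?x' = "X' (ln r)"
    have dx: "\<bar>?x - ?x'\<bar> \<le> (A + A') * r"
      using A(2)[of "ln r"] A'(2)[of "ln r"] elim r by (simp add: algebra_simps)
    have eq: "v r * V r - w r * U r = \<sigma> r * (v r * sin ?x' - w r * cos ?x')"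
      unfolding UV[OF r(1)] by (simp add: algebra_simps)
    have "D = - exp (R (ln r)) * (v r * sin ?x - w r * cos ?x)"
      using D(1)[OF r(1)] by (simp add: pcos_def psin_def algebra_simps)
    then have "\<bar>D\<bar> = exp (R (ln r)) * \<bar>v r * sin ?x - w r * cos ?x\<bar>" by (simp add: abs_mult)
    also have "\<dots> \<le> exp C * ?p * \<bar>v r * sin ?x - w r * cos ?x\<bar>"
      by (intro mult_right_mono \<rho> r) auto
    finally have 1: "b \<le> ?p * \<bar>v r * sin ?x - w r * cos ?x\<bar>"
      by (simp add: b_def divide_simps mult.commute mult.left_commute)
    \<comment> \<open>Replacing \<open>X\<close> by \<open>X'\<close> costs an O(r) change of
      direction times O(r^(-s)), which becomes O(r) after multiplication by r^s.\<close>
    have trig: "\<bar>sin ?x - sin ?x'\<bar> \<le> \<bar>?x - ?x'\<bar>" "\<bar>cos ?x - cos ?x'\<bar> \<le> \<bar>?x - ?x'\<bar>"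
      using abs_sin_double_diff_le[of "?x / 2" "?x' / 2"] abs_cos_double_diff_le[of "?x / 2" "?x' / 2"]
      by (simp_all add: abs_mult flip: diff_divide_distrib)
    have "\<bar>v r * (sin ?x - sin ?x') - w r * (cos ?x - cos ?x')\<bar>
        \<le> \<bar>v r\<bar> * \<bar>sin ?x - sin ?x'\<bar> + \<bar>w r\<bar> * \<bar>cos ?x - cos ?x'\<bar>"
      by (rule order_trans[OF abs_triangle_ineq4]) (simp add: abs_mult)
    also have "\<dots> \<le> (E * r powr - ?s) * ((A + A') * r) + (E * r powr - ?s) * ((A + A') * r)"
      using trig dx E(2)[OF r] order_trans[OF small(1) E(2)[OF r]] order_trans[OF small(2) E(2)[OF r]] E(1)
      by (intro add_mono mult_mono) auto
    also have "\<dots> = 2 * E * (A + A') * r * r powr - ?s" by (simp add: algebra_simps)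
    finally have "?p * \<bar>v r * (sin ?x - sin ?x') - w r * (cos ?x - cos ?x')\<bar>
        \<le> ?p * (2 * E * (A + A') * r * r powr - ?s)"
      using pp by (intro mult_left_mono) auto
    also have "\<dots> = 2 * E * (A + A') * r * (?p * r powr - ?s)" by (simp only: ac_simps)
    finally have 2: "?p * \<bar>v r * (sin ?x - sin ?x') - w r * (cos ?x - cos ?x')\<bar> \<le> b / 2"
      unfolding pp(2) using elim(2) by simp
    have "\<bar>v r * sin ?x - w r * cos ?x\<bar> \<le> \<bar>v r * sin ?x' - w r * cos ?x'\<bar>
        + \<bar>v r * (sin ?x - sin ?x') - w r * (cos ?x - cos ?x')\<bar>"
      by (rule order_trans[OF _ abs_triangle_ineq]) (simp add: algebra_simps)
    then have "?p * \<bar>v r * sin ?x - w r * cos ?x\<bar> \<le> ?p * \<bar>v r * sin ?x' - w r * cos ?x'\<bar>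
        + ?p * \<bar>v r * (sin ?x - sin ?x') - w r * (cos ?x - cos ?x')\<bar>"
      using pp(1) unfolding distrib_left[symmetric] by (intro mult_left_mono) auto
    with 1 2 have 3: "b / 2 \<le> ?p * \<bar>v r * sin ?x' - w r * cos ?x'\<bar>" by linarith
    have "Cu / 2 * ?p \<le> \<bar>\<sigma> r\<bar>" unfolding \<sigma>[OF r(1)] using elim(1) Cu pp(1) by (simp add: divide_simps mult.commute)
    then have "Cu / 2 * ?p * \<bar>v r * sin ?x' - w r * cos ?x'\<bar> \<le> \<bar>\<sigma> r\<bar> * \<bar>v r * sin ?x' - w r * cos ?x'\<bar>"
      by (rule mult_right_mono) simp
    moreover have "Cu / 2 * (b / 2) \<le> Cu / 2 * (?p * \<bar>v r * sin ?x' - w r * cos ?x'\<bar>)"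
      using 3 Cu by (intro mult_left_mono) auto
    ultimately show ?case unfolding eq abs_mult by (simp only: mult.assoc)
  qed
  moreover have "((\<lambda>r. \<bar>v r * V r - w r * U r\<bar>) \<longlongrightarrow> 0) (at_right 0)"
    using lim tendsto_rabs_zero unfolding U_def V_def by blast
  ultimately have "Cu / 2 * (b / 2) \<le> 0" by (intro tendsto_lowerbound) auto
  moreover have "0 < Cu / 2 * (b / 2)" using Cu b by simp
  ultimately show False by linarith
qed

section \<open>Eigenvalues of the distinguished realisation\<close>

lemma real_solution_loc_abs_continuous:
  assumes rs: "real_solution \<kappa> c l 0 v w"
  shows "loc_abs_continuous (real_spinor v w)" and "continuous_on {0<..} (real_spinor v w)"
proof -
  have D: "(real_spinor v w has_vector_derivative dirac_rhs l r (real_spinor v w r)) (at r)" if "0 < r" for r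
    using real_solution_dirac_expr[OF rs that]
    by (simp add: dirac_expr_eigen_iff vector_derivative_works[symmetric])
      (metis vector_derivative_works)
  then show c: "continuous_on {0<..} (real_spinor v w)"
    by (meson continuous_at_imp_continuous_on greaterThan_iff has_vector_derivative_continuous)
  show "loc_abs_continuous (real_spinor v w)"
    unfolding loc_abs_continuous_def
  proof (intro allI impI)
    fix p q :: real assume pq: "0 < p \<and> p \<le> q"
    show "abs_continuous_on_interval p q (real_spinor v w)"
    proof (rule abs_continuous_C1)
      show "(real_spinor v w has_vector_derivative dirac_rhs l r (real_spinor v w r)) (at r within {p..q})"
        if "p \<le> r" "r \<le> q" for r
        by (rule has_vector_derivative_at_within[OF D]) (use pq that in simp)
      show "continuous_on {p..q} (\<lambda>r. dirac_rhs l r (real_spinor v w r))"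
        by (rule continuous_on_subset[OF continuous_on_dirac_rhs(1)[OF c order_refl]]) (use pq in auto)
    qed
  qed
qed

text \<open>The recessive solution is itself principal, so it can serve as \<open>u\<close> in the
  boundary condition, whose Wronskian is then identically 0.\<close>

lemma eigenvalue_dist_if_matching:
  assumes p1: "polar_solution l 0 X R" and b1: "\<And>t. t \<le> T \<Longrightarrow> - \<beta> \<le> X t \<and> X t \<le> 0"
    and p2: "polar_solution l 0 X' R'" and b2: "\<And>t. T' \<le> t \<Longrightarrow> prufer_rate 0 t (X' t) \<le> - 2"
    and n: "X 0 - X' 0 = of_int n * pi"
  shows "eigenvalue (dirac_op_dist \<kappa> c) (complex_of_real l)"
proof -
  obtain k where k: "\<And>t. R t = R' t + k" using polar_solution_matching[OF p1 p2 n] by metis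
  obtain C where C: "\<And>t. t \<le> 0 \<Longrightarrow> R t \<le> C + exponent * t"
    by (rule polar_asymptotic_bound_0[OF p1 b1]) blast+
  obtain C' where C': "\<And>t. 0 \<le> t \<Longrightarrow> R' t \<le> C' - 2 * t" using polar_growth_infinity[OF p2 b2] by metis
  note rs = real_solution_polar[OF p1]
  let ?V = "real_spinor (pcos X R) (psin X R)"
  let ?A = "exp C + exp (C' + k)"
  note c = real_solution_loc_abs_continuous[OF rs]
  have V: "?V \<in> L2_space"
  proof (rule L2_spaceI[OF c(2)])
    fix r :: real assume r: "0 < r"
    show "(norm (?V r))\<^sup>2 \<le> 2 * ?A\<^sup>2 / (1 + r\<^sup>2)"
    proof (rule sq_le_if_decay[OF r])
      assume r1: "r \<le> 1"
      have "exponent * ln r \<le> 0" using exponent_pos r r1 by (simp add: mult_le_0_iff)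
      then have "R (ln r) \<le> C" using C[of "ln r"] r r1 by simp
      then have "exp (R (ln r)) \<le> exp C" by simp
      then show "norm (?V r) \<le> ?A" unfolding norm_polar using exp_gt_zero[of "C' + k"] by linarith
    next
      assume r1: "1 \<le> r"
      then have "0 \<le> ln r" by simp
      then have "R (ln r) \<le> (C' + k) - ln r" using C'[of "ln r"] k[of "ln r"] by simp
      then have "exp (R (ln r)) \<le> exp (C' + k - ln r)" by simp
      also have "\<dots> = exp (C' + k) / r" using r by (simp add: exp_diff)
      also have "\<dots> \<le> ?A / r" using r by (intro divide_right_mono) auto
      finally show "norm (?V r) \<le> ?A / r" unfolding norm_polar .
    qed (auto intro: add_nonneg_nonneg)
  qed
  have AE: "AE r in half_line. complex_of_real l *s ?V r = dirac_expr \<kappa> c 0 ?V r"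
    by (rule AE_I2) (simp add: space_restrict_space real_solution_dirac_expr(1)[OF rs])
  have lim: "((\<lambda>r. ?V r $ 1 * ?V r $ 2 - ?V r $ 2 * ?V r $ 1) \<longlongrightarrow> 0) (at_right 0)"
    by (simp add: mult.commute)
  have "(?V, \<lambda>r. complex_of_real l *s ?V r) \<in> dirac_op_dist \<kappa> c"
    unfolding dirac_op_dist_def
    using V L2_space_scale[OF V] c(1) AE lim principal_solution_polar[OF p1 b1]
    by (intro CollectI case_prodI conjI exI[of _ ?V]) (auto intro!: exI[of _ l] exI[of _ ?V])
  moreover have "\<not> (AE r in half_line. ?V r = 0)"
    by (rule not_AE_half_line_eq_0) (metis exp_not_eq_zero norm_polar norm_zero)
  ultimately show ?thesis unfolding eigenvalue_def by auto
qed

text \<open>Square integrability forces an eigenfunction to be a multiple of the solution recessive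
  at infinity. Without matching that solution is not recessive at 0, and the boundary condition
  excludes it.\<close>

lemma matching_if_eigenvalue_dist:
  assumes l: "\<bar>l\<bar> < 1"
    and p1: "polar_solution l 0 X R" and b1: "\<And>t. t \<le> T \<Longrightarrow> - \<beta> \<le> X t \<and> X t \<le> 0"
    and p2: "polar_solution l 0 X' R'" and b2: "\<And>t. T' \<le> t \<Longrightarrow> prufer_rate 0 t (X' t) \<le> - 2"
    and ev: "eigenvalue (dirac_op_dist \<kappa> c) (complex_of_real l)"
  shows "\<exists>n::int. X 0 - X' 0 = of_int n * pi"
proof (rule ccontr)
  assume "\<nexists>n::int. X 0 - X' 0 = of_int n * pi"
  then have s: "sin (X 0 - X' 0) \<noteq> 0" by (metis sin_zero_iff_int2)
  note rs = real_solution_polar[OF p1] real_solution_polar[OF p2]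
  let ?v = "pcos X R" and ?w = "psin X R" and ?v' = "pcos X' R'" and ?w' = "psin X' R'"
  define D where "D = ?v 1 * ?w' 1 - ?w 1 * ?v' 1"
  have D0: "D \<noteq> 0" unfolding D_def polar_wronskian using s by simp
  have D: "?v r * ?w' r - ?w r * ?v' r = D" if "0 < r" for r
    unfolding D_def by (rule real_wronskian_constant[OF rs that zero_less_one])
  obtain f g where fg: "(f, g) \<in> dirac_op_dist \<kappa> c" and nz: "\<not> (AE r in half_line. f r = 0)"
    and gl: "AE r in half_line. g r = complex_of_real l *s f r"
    using ev unfolding eigenvalue_def by blast
  obtain h l' u where f: "f \<in> L2_space" and fh: "AE r in half_line. f r = h r" and AC: "loc_abs_continuous h"
    and gh: "AE r in half_line. g r = dirac_expr \<kappa> c 0 h r"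
    and u: "principal_solution \<kappa> c l' u" "real_valued u"
    and lim: "((\<lambda>r. h r $ 1 * u r $ 2 - h r $ 2 * u r $ 1) \<longlongrightarrow> 0) (at_right 0)"
    using fg unfolding dirac_op_dist_def by blast
  have eig: "AE r in half_line. dirac_expr \<kappa> c 0 h r = complex_of_real l *s h r"
    using gl fh gh by eventually_elim simp
  obtain k1 where k1: "\<And>r. 0 < r \<Longrightarrow> wronskian h ?v ?w r = k1"
    by (rule ac_eigenfunction_wronskian_constant[OF l AC eig rs(1)]) blast
  obtain k2 where k2: "\<And>r. 0 < r \<Longrightarrow> wronskian h ?v' ?w' r = k2"
    by (rule ac_eigenfunction_wronskian_constant[OF l AC eig rs(2)]) blast
  have ch: "continuous_on {0<..} h"
  proof (rule continuous_at_imp_continuous_on, rule ballI)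
    fix r :: real assume "r \<in> {0<..}"
    then have r: "0 < r" by simp
    have "continuous_on {r / 2..r + 1} h"
      by (rule abs_continuous_imp_continuous_on) (use AC r in \<open>simp add: loc_abs_continuous_def\<close>)
    then show "isCont h r" by (rule continuous_on_interior) (use r in simp)
  qed
  have hL2: "h \<in> L2_space"
  proof -
    have m: "h \<in> borel_measurable half_line" by (rule continuous_imp_measurable_on_sets_lebesgue[OF ch]) simp
    have "integrable half_line (\<lambda>r. (norm (h r))\<^sup>2)"
    proof (rule integrable_cong_AE_imp[OF L2_spaceD(2)[OF f]])
      show "(\<lambda>r. (norm (h r))\<^sup>2) \<in> borel_measurable half_line" using m by measurable
      show "AE r in half_line. (norm (f r))\<^sup>2 = (norm (h r))\<^sup>2" using fh by eventually_elim simp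
    qed
    with m show ?thesis by (simp add: L2_space_def)
  qed
  \<comment> \<open>The solution recessive at infinity is bounded on [1, \<infinity>), so a nonzero
    constant Wronskian with it would keep |h| away from 0 there.\<close>
  have "k2 = 0"
  proof (rule ccontr)
    assume k0: "k2 \<noteq> 0"
    obtain C where C: "\<And>t. 0 \<le> t \<Longrightarrow> R' t \<le> C - 2 * t" using polar_growth_infinity[OF p2 b2] by metis
    define m where "m = (norm k2 / (2 * exp C))\<^sup>2"
    have m: "0 < m" using k0 by (simp add: m_def)
    have lower: "m \<le> (norm (h r))\<^sup>2" if r: "1 \<le> r" for r
    proof -
      have "0 \<le> ln r" using r by simp
      then have "R' (ln r) \<le> C" using C[of "ln r"] by linarith
      then have e: "exp (R' (ln r)) \<le> exp C" by simp
      have "exp (R' (ln r)) * \<bar>cos (X' (ln r))\<bar> \<le> exp C * 1" "exp (R' (ln r)) * \<bar>sin (X' (ln r))\<bar> \<le> exp C * 1"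
        by (intro mult_mono e abs_cos_le_one abs_sin_le_one; simp)+
      then have b: "\<bar>?v' r\<bar> \<le> exp C" "\<bar>?w' r\<bar> \<le> exp C"
        by (simp_all add: pcos_def psin_def abs_mult)
      have "norm k2 \<le> norm (h r $ 1) * \<bar>?w' r\<bar> + norm (h r $ 2) * \<bar>?v' r\<bar>"
      proof -
        have "0 < r" using r by linarith
        from k2[OF this] have "k2 = h r $ 1 * complex_of_real (?w' r) - h r $ 2 * complex_of_real (?v' r)"
          by (simp only: wronskian_def)
        then have "norm k2 \<le> norm (h r $ 1 * complex_of_real (?w' r)) + norm (h r $ 2 * complex_of_real (?v' r))"
          by (simp only: norm_triangle_ineq4)
        then show ?thesis by (simp only: norm_mult norm_of_real)
      qed
      also have "\<dots> \<le> norm (h r) * exp C + norm (h r) * exp C"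
        using b by (intro add_mono mult_mono Finite_Cartesian_Product.norm_nth_le) auto
      finally have "norm k2 / (2 * exp C) \<le> norm (h r)" by (simp add: divide_simps mult_ac)
      then show ?thesis unfolding m_def by (intro power_mono) auto
    qed
    \<comment> \<open>With this length the lower bound m(q - 1) exceeds the squared norm by
      m.\<close>
    define q where "q = 2 + (L2_norm h)\<^sup>2 / m"
    have q: "1 \<le> q" using m by (simp add: q_def add_increasing2)
    have "m * (q - 1) = integral {1..q} (\<lambda>_. m)" using q by simp
    also have "\<dots> \<le> integral {1..q} (\<lambda>r. (norm (h r))\<^sup>2)"
      by (rule integral_le) (use integral_interval_le_L2_norm(2)[OF hL2] lower in auto)
    also have "\<dots> \<le> (L2_norm h)\<^sup>2" by (rule integral_interval_le_L2_norm(1)[OF hL2]) simp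
    finally have "m + (L2_norm h)\<^sup>2 \<le> (L2_norm h)\<^sup>2" using m by (simp add: q_def algebra_simps)
    with m show False by simp
  qed
  let ?o = complex_of_real
  \<comment> \<open>Cramer's rule for the two Wronskians of h.\<close>
  have h: "h r $ 1 * ?o D = - k1 * ?o (?v' r)" "h r $ 2 * ?o D = - k1 * ?o (?w' r)" if r: "0 < r" for r
  proof -
    have e1: "h r $ 1 * ?o (?w r) - h r $ 2 * ?o (?v r) = k1" using k1[OF r] by (simp add: wronskian_def)
    have e2: "h r $ 1 * ?o (?w' r) - h r $ 2 * ?o (?v' r) = 0" using k2[OF r] \<open>k2 = 0\<close> by (simp add: wronskian_def)
    have Dr: "?o D = ?o (?v r) * ?o (?w' r) - ?o (?w r) * ?o (?v' r)" using D[OF r] by (metis of_real_diff of_real_mult)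
    have e: "h r $ 1 * ?o (?w' r) = h r $ 2 * ?o (?v' r)" "h r $ 1 * ?o (?w r) = k1 + h r $ 2 * ?o (?v r)"
      using e1 e2 by (simp_all only: diff_eq_eq add_0_left)
    have "h r $ 1 * ?o D = ?o (?v r) * (h r $ 1 * ?o (?w' r)) - ?o (?v' r) * (h r $ 1 * ?o (?w r))"
      by (simp only: Dr right_diff_distrib mult_ac)
    also have "\<dots> = - k1 * ?o (?v' r)" by (simp only: e) (simp add: algebra_simps)
    finally show "h r $ 1 * ?o D = - k1 * ?o (?v' r)" .
    have "h r $ 2 * ?o D = ?o (?w' r) * (h r $ 2 * ?o (?v r)) - ?o (?w r) * (h r $ 2 * ?o (?v' r))"
      by (simp only: Dr right_diff_distrib mult_ac)
    also have "\<dots> = ?o (?w' r) * (h r $ 2 * ?o (?v r)) - ?o (?w' r) * (h r $ 1 * ?o (?w r))"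
      by (simp only: e(1)[symmetric]) (simp only: mult_ac)
    also have "\<dots> = - k1 * ?o (?w' r)" by (simp only: e) (simp add: algebra_simps)
    finally show "h r $ 2 * ?o D = - k1 * ?o (?w' r)" .
  qed
  have "k1 \<noteq> 0"
  proof
    assume "k1 = 0"
    then have "h r = 0" if "0 < r" for r using h[OF that] D0 by (simp add: vec_eq_iff forall_2)
    moreover have "AE r in half_line. 0 < r" by (rule AE_I2) (simp add: space_restrict_space)
    ultimately have "AE r in half_line. f r = 0" using fh by (auto elim: eventually_elim2)
    with nz show False by simp
  qed
  have "((\<lambda>r. norm (h r $ 1 * u r $ 2 - h r $ 2 * u r $ 1) * (\<bar>D\<bar> / norm k1)) \<longlongrightarrow> norm (0::complex) * (\<bar>D\<bar> / norm k1)) (at_right 0)"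
    by (intro tendsto_intros lim)
  moreover have "\<forall>\<^sub>F r in at_right 0. norm (h r $ 1 * u r $ 2 - h r $ 2 * u r $ 1) * (\<bar>D\<bar> / norm k1)
      = \<bar>?v' r * Re (u r $ 2) - ?w' r * Re (u r $ 1)\<bar>"
    using eventually_at_right_less[of 0]
  proof eventually_elim
    case (elim r)
    have ur: "u r $ 1 = ?o (Re (u r $ 1))" "u r $ 2 = ?o (Re (u r $ 2))"
      using principal_real_solution(2)[OF u elim] by (metis real_spinor_nth(1), metis real_spinor_nth(2))
    have "(h r $ 1 * u r $ 2 - h r $ 2 * u r $ 1) * ?o D = - k1 * ?o (?v' r * Re (u r $ 2) - ?w' r * Re (u r $ 1))"
    proof -
      have "(h r $ 1 * u r $ 2 - h r $ 2 * u r $ 1) * ?o D = (h r $ 1 * ?o D) * u r $ 2 - (h r $ 2 * ?o D) * u r $ 1"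
        by (simp add: algebra_simps)
      also have "\<dots> = - k1 * ?o (?v' r) * u r $ 2 - - k1 * ?o (?w' r) * u r $ 1" unfolding h[OF elim] ..
      also have "\<dots> = - k1 * (?o (?v' r) * ?o (Re (u r $ 2)) - ?o (?w' r) * ?o (Re (u r $ 1)))"
        by (simp only: ur[symmetric]) (simp only: algebra_simps)
      finally show ?thesis by (simp only: of_real_mult of_real_diff)
    qed
    then have "norm (h r $ 1 * u r $ 2 - h r $ 2 * u r $ 1) * \<bar>D\<bar> = norm k1 * \<bar>?v' r * Re (u r $ 2) - ?w' r * Re (u r $ 1)\<bar>"
      by (metis norm_minus_cancel norm_mult norm_of_real)
    then show ?case using \<open>k1 \<noteq> 0\<close> by (simp add: field_simps)
  qed
  ultimately have "((\<lambda>r. \<bar>?v' r * Re (u r $ 2) - ?w' r * Re (u r $ 1)\<bar>) \<longlongrightarrow> norm (0::complex) * (\<bar>D\<bar> / norm k1)) (at_right 0)"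
    by (rule Lim_transform_eventually)
  then have "((\<lambda>r. ?v' r * Re (u r $ 2) - ?w' r * Re (u r $ 1)) \<longlongrightarrow> 0) (at_right 0)"
    by (simp add: tendsto_rabs_zero_iff)
  moreover have "\<not> ((\<lambda>r. ?v' r * Re (u r $ 2) - ?w' r * Re (u r $ 1)) \<longlongrightarrow> 0) (at_right 0)"
    by (rule boundary_condition_fails[OF p1 b1 rs(2) D D0 u])
  ultimately show False by simp
qed

subsection \<open>The essential spectrum\<close>

text \<open>The square of the negative part of a parabola with minimum -1/4, living on [n, 2n]. The
  domain of \<open>dirac_op_dist\<close> admits absolutely continuous functions, so a C^1 profile
  will do.\<close>

definition plateau :: "real \<Rightarrow> real \<Rightarrow> real" where
  "plateau n r = (min ((r - n) * (r - 2 * n) / n\<^sup>2) 0)\<^sup>2"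

definition plateau_deriv :: "real \<Rightarrow> real \<Rightarrow> real" where
  "plateau_deriv n r = 2 * min ((r - n) * (r - 2 * n) / n\<^sup>2) 0 * ((2 * r - 3 * n) / n\<^sup>2)"

lemma plateau_has_derivative: "(plateau n has_real_derivative plateau_deriv n r) (at r)"
  unfolding plateau_def[abs_def] plateau_deriv_def
proof (rule DERIV_chain2[OF has_real_derivative_negative_part_squared])
  show "((\<lambda>r. (r - n) * (r - 2 * n) / n\<^sup>2) has_real_derivative (2 * r - 3 * n) / n\<^sup>2) (at r)"
  proof (rule DERIV_cdivide)
    show "((\<lambda>r. (r - n) * (r - 2 * n)) has_real_derivative 2 * r - 3 * n) (at r)"
      by (auto intro!: derivative_eq_intros)
  qed
qed

text \<open>The number 9/256 is the square of 3/16, the depth of the parabola at 5n/4 and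
  7n/4.\<close>

lemma plateau_bounds:
  assumes n: "1 \<le> n"
  shows "r < n \<or> 2 * n < r \<Longrightarrow> plateau n r = 0 \<and> plateau_deriv n r = 0"
    and "0 \<le> plateau n r" "plateau n r \<le> 1"
    and "\<bar>plateau_deriv n r\<bar> \<le> 1 / n"
    and "5 / 4 * n \<le> r \<Longrightarrow> r \<le> 7 / 4 * n \<Longrightarrow> 9 / 256 \<le> plateau n r"
proof -
  define q where "q = (r - n) * (r - 2 * n) / n\<^sup>2"
  have n2: "0 < n\<^sup>2" "0 < n" using n by auto
  have P: "plateau n r = (min q 0)\<^sup>2" "plateau_deriv n r = 2 * min q 0 * ((2 * r - 3 * n) / n\<^sup>2)"
    by (simp_all add: plateau_def plateau_deriv_def q_def)
  have out: "0 \<le> q" if "r < n \<or> 2 * n < r"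
  proof -
    have "0 \<le> (r - n) * (r - 2 * n)" using that n by (auto simp: zero_le_mult_iff)
    then show ?thesis using n2 by (simp add: q_def)
  qed
  show "r < n \<or> 2 * n < r \<Longrightarrow> plateau n r = 0 \<and> plateau_deriv n r = 0" using out by (simp add: P)
  have "0 \<le> (2 * r - 3 * n)\<^sup>2" by simp
  then have "- (n\<^sup>2 / 4) \<le> (r - n) * (r - 2 * n)" by (simp add: power2_eq_square algebra_simps)
  then have q: "- (1 / 4) \<le> q" using n2 by (simp add: q_def divide_simps)
  show "0 \<le> plateau n r" by (simp add: P)
  have m: "\<bar>min q 0\<bar> \<le> 1 / 4" using q by (auto simp: min_def)
  then have "\<bar>min q 0\<bar>\<^sup>2 \<le> 1\<^sup>2" by (intro power_mono) auto
  then show "plateau n r \<le> 1" by (simp add: P)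
  show "\<bar>plateau_deriv n r\<bar> \<le> 1 / n"
  proof (cases "r < n \<or> 2 * n < r")
    case True
    then show ?thesis using out n2 by (simp add: P)
  next
    case False
    then have "\<bar>2 * r - 3 * n\<bar> \<le> n" by auto
    then have "\<bar>(2 * r - 3 * n) / n\<^sup>2\<bar> \<le> n / n\<^sup>2" using n2 by (simp add: divide_right_mono)
    then have "2 * \<bar>min q 0\<bar> * \<bar>(2 * r - 3 * n) / n\<^sup>2\<bar> \<le> 2 * (1 / 4) * (n / n\<^sup>2)"
      using m n2 by (intro mult_mono) auto
    also have "\<dots> \<le> 1 / n" using n2 by (simp add: power2_eq_square divide_simps)
    finally show ?thesis by (simp add: P abs_mult)
  qed
  assume r: "5 / 4 * n \<le> r" "r \<le> 7 / 4 * n"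
  have "(r - n) * (2 * n - r) \<ge> 3 / 16 * n\<^sup>2"
  proof -
    have "0 \<le> (r - 5 / 4 * n) * (7 / 4 * n - r)" using r by simp
    then show ?thesis by (simp add: power2_eq_square algebra_simps)
  qed
  then have "q \<le> - (3 / 16)" using n2 by (simp add: q_def divide_simps algebra_simps)
  then have "(3 / 16)\<^sup>2 \<le> (- min q 0)\<^sup>2" by (intro power_mono) auto
  then show "9 / 256 \<le> plateau n r" by (simp add: P power2_eq_square)
qed

text \<open>A singular sequence: an oscillating solution of the free system, with k^2 = \<mu>^2 - 1,
  cut off to [n, 2n]. Its squared norm is at least of order n, while (H - \<mu>)f has squared norm
  O(1/n), since the Coulomb terms and the slope of the cut-off are O(1/n). It vanishes near 0, so
  the boundary condition holds.\<close>

lemma essential_spectrum: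
  assumes \<mu>: "1 < \<bar>\<mu>\<bar>"
  shows "complex_of_real \<mu> \<in> spectrum (dirac_op_dist \<kappa> c)"
proof (rule ccontr)
  assume "complex_of_real \<mu> \<notin> spectrum (dirac_op_dist \<kappa> c)"
  then obtain C where C: "\<And>f g. (f, g) \<in> dirac_op_dist \<kappa> c \<Longrightarrow>
      L2_norm f \<le> C * L2_norm (\<lambda>r. g r - complex_of_real \<mu> *s f r)"
    unfolding spectrum_def resolvent_set_def by blast
  have \<mu>2: "1 < \<mu>\<^sup>2" using \<mu> by (metis abs_ge_zero one_less_power power2_abs pos2)
  define k where "k = sqrt (\<mu>\<^sup>2 - 1)"
  have k: "0 < k" "k\<^sup>2 = \<mu>\<^sup>2 - 1" using \<mu>2 by (auto simp: k_def)
  \<comment> \<open>Since |\<mu>| > 1, neither 1 + \<mu> nor k vanishes, and the squared length of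
    the wave is at least m.\<close>
  define m where "m = min ((1 + \<mu>)\<^sup>2) (k\<^sup>2)"
  have m: "0 < m" using k(1) \<mu> by (auto simp: m_def)
  define M where "M = \<bar>1 + \<mu>\<bar> + k"
  have M: "0 \<le> M" using k by (simp add: M_def)
  define u1 u2 where "u1 r = (1 + \<mu>) * cos (k * r)" and "u2 r = - k * sin (k * r)" for r
  have u_upper: "norm (real_spinor u1 u2 r) \<le> M" for r
  proof -
    have "norm (real_spinor u1 u2 r) \<le> \<bar>u1 r\<bar> + \<bar>u2 r\<bar>"
      unfolding norm_real_spinor by (rule sqrt_sum_squares_le_sum_abs)
    also have "\<dots> \<le> \<bar>1 + \<mu>\<bar> * 1 + k * 1"
      unfolding u1_def u2_def abs_mult using k by (intro add_mono mult_mono) auto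
    finally show ?thesis by (simp add: M_def)
  qed
  have u_lower: "m \<le> (norm (real_spinor u1 u2 r))\<^sup>2" for r
  proof -
    have "m = m * (cos (k * r))\<^sup>2 + m * (sin (k * r))\<^sup>2" by (simp flip: distrib_left)
    also have "\<dots> \<le> (1 + \<mu>)\<^sup>2 * (cos (k * r))\<^sup>2 + k\<^sup>2 * (sin (k * r))\<^sup>2"
      by (intro add_mono mult_right_mono) (auto simp: m_def)
    also have "\<dots> = (norm (real_spinor u1 u2 r))\<^sup>2"
      by (simp add: norm_real_spinor u1_def u2_def power_mult_distrib)
    finally show ?thesis .
  qed
  have main: "(9 / 256)\<^sup>2 * m * n / 2 \<le> C\<^sup>2 * (((1 + \<bar>\<kappa>\<bar> + \<bar>c\<bar>) * M)\<^sup>2 / n)" if n: "1 \<le> n" for n :: real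
  proof -
    let ?K = "(1 + \<bar>\<kappa>\<bar> + \<bar>c\<bar>) * M"
    define f where "f = real_spinor (\<lambda>r. plateau n r * u1 r) (\<lambda>r. plateau n r * u2 r)"
    define e where "e = real_spinor (\<lambda>r. - plateau_deriv n r * u2 r + plateau n r * (\<kappa> / r * u2 r + c / r * u1 r))
      (\<lambda>r. plateau_deriv n r * u1 r + plateau n r * (\<kappa> / r * u1 r + c / r * u2 r))"
    have n0: "0 < n" using n by simp
    note pd = plateau_has_derivative
    have cP: "continuous_on S (plateau n)" "continuous_on S (plateau_deriv n)" for S
      unfolding plateau_def plateau_deriv_def using n0 by (auto intro!: continuous_intros)
    have du1: "(u1 has_real_derivative (1 + \<mu>) * u2 r) (at r)" for r
      unfolding u1_def[abs_def] u2_def by (auto intro!: derivative_eq_intros)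
    have du2: "(u2 has_real_derivative (1 - \<mu>) * u1 r) (at r)" for r
    proof -
      have "(u2 has_real_derivative - k\<^sup>2 * cos (k * r)) (at r)"
        unfolding u2_def[abs_def] by (auto intro!: derivative_eq_intros simp: power2_eq_square)
      then show ?thesis unfolding k(2) u1_def by (simp add: power2_eq_square algebra_simps)
    qed
    have cu: "continuous_on S u1" "continuous_on S u2" for S
      unfolding u1_def u2_def by (auto intro!: continuous_intros)
    define f' where "f' = real_spinor (\<lambda>r. plateau_deriv n r * u1 r + plateau n r * ((1 + \<mu>) * u2 r))
      (\<lambda>r. plateau_deriv n r * u2 r + plateau n r * ((1 - \<mu>) * u1 r))"
    have df: "(f has_vector_derivative f' r) (at r)" for r
      unfolding f_def f'_def real_spinor_def[of "\<lambda>r. plateau_deriv n r * u1 r + plateau n r * ((1 + \<mu>) * u2 r)"]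
      by (rule real_spinor_has_vector_derivative; rule DERIV_cong[OF DERIV_mult[OF pd]], rule du1 du2, simp add: algebra_simps)
    have eq: "dirac_expr \<kappa> c 0 f r - complex_of_real \<mu> *s f r = e r" if "0 < r" for r
      unfolding vec_eq_iff forall_2 vector_minus_component dirac_expr_components vector_derivative_at[OF df]
      using that by (simp add: f_def f'_def e_def algebra_simps)
    have cf: "continuous_on {0<..} f" and cf': "continuous_on {0<..} f'" and ce: "continuous_on {0<..} e"
      unfolding f_def f'_def e_def real_spinor_def by (auto intro!: continuous_intros cP cu)
    have out: "f r = 0" "e r = 0" if "r < n \<or> 2 * n < r" for r
      using plateau_bounds(1)[OF n that] by (simp_all add: f_def e_def real_spinor_def)
    have fL2: "f \<in> L2_space" by (rule L2_spaceI_compact_support[OF cf n0]) (use out in blast)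
    have eL2: "e \<in> L2_space" by (rule L2_spaceI_compact_support[OF ce n0]) (use out in blast)
    define g where "g = (\<lambda>r. e r - (- complex_of_real \<mu>) *s f r)"
    have gL2: "g \<in> L2_space" unfolding g_def by (intro L2_space_diff L2_space_scale eL2 fL2)
    have g: "g r = dirac_expr \<kappa> c 0 f r" if "0 < r" for r
      unfolding g_def eq[OF that, symmetric] by (simp add: vec_eq_iff)
    have ge: "g r - complex_of_real \<mu> *s f r = e r" for r by (simp add: g_def vec_eq_iff)
    obtain X R T where p: "polar_solution 0 0 X R" and band: "\<And>t. t \<le> T \<Longrightarrow> - \<beta> \<le> X t \<and> X t \<le> 0"
      by (rule left_polar_exists[of 0]) blast
    let ?V = "real_spinor (pcos X R) (psin X R)"
    have AC: "loc_abs_continuous f"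
      unfolding loc_abs_continuous_def
    proof (intro allI impI)
      fix a b :: real assume ab: "0 < a \<and> a \<le> b"
      show "abs_continuous_on_interval a b f"
        by (rule abs_continuous_C1[OF has_vector_derivative_at_within[OF df]])
          (rule continuous_on_subset[OF cf'], use ab in auto)
    qed
    have AE: "AE r in half_line. g r = dirac_expr \<kappa> c 0 f r"
      by (rule AE_I2) (simp add: space_restrict_space g)
    have "\<forall>\<^sub>F r in at_right 0. (0::complex) = f r $ 1 * ?V r $ 2 - f r $ 2 * ?V r $ 1"
      using eventually_at_right_real[of 0 n, OF n0] by eventually_elim (simp add: out)
    then have lim: "((\<lambda>r. f r $ 1 * ?V r $ 2 - f r $ 2 * ?V r $ 1) \<longlongrightarrow> 0) (at_right 0)"
      by (rule Lim_transform_eventually[OF tendsto_const])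
    have ex: "\<exists>l u. principal_solution \<kappa> c l u \<and> real_valued u \<and>
           ((\<lambda>r. f r $ 1 * u r $ 2 - f r $ 2 * u r $ 1) \<longlongrightarrow> 0) (at_right 0)"
      using principal_solution_polar[OF p band] lim by blast
    have "(f, g) \<in> dirac_op_dist \<kappa> c"
      unfolding dirac_op_dist_def
      by (rule CollectI, rule case_prodI, intro conjI fL2 gL2, rule exI[of _ f], intro conjI AC AE ex) simp
    from C[OF this] have "L2_norm f \<le> C * L2_norm e" unfolding ge .
    then have le: "(L2_norm f)\<^sup>2 \<le> C\<^sup>2 * (L2_norm e)\<^sup>2"
      using power_mono[OF _ L2_norm_nonneg, of f "C * L2_norm e" 2] by (simp add: power_mult_distrib)
    have "(9 / 256)\<^sup>2 * m * n / 2 = integral {5 / 4 * n..7 / 4 * n} (\<lambda>_. (9 / 256)\<^sup>2 * m)"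
      using n0 by simp
    also have "\<dots> \<le> integral {5 / 4 * n..7 / 4 * n} (\<lambda>r. (norm (f r))\<^sup>2)"
    proof (rule integral_le)
      show "(\<lambda>_. (9 / 256)\<^sup>2 * m) integrable_on {5 / 4 * n..7 / 4 * n}" by (rule integrable_const_ivl)
      show "(\<lambda>r. (norm (f r))\<^sup>2) integrable_on {5 / 4 * n..7 / 4 * n}"
        by (rule integral_interval_le_L2_norm(2)[OF fL2]) (use n0 in simp)
      fix r assume r: "r \<in> {5 / 4 * n..7 / 4 * n}"
      have "f r = plateau n r *\<^sub>R real_spinor u1 u2 r"
        by (simp add: f_def real_spinor_def scaleR_add_right)
      then have "(norm (f r))\<^sup>2 = (plateau n r)\<^sup>2 * (norm (real_spinor u1 u2 r))\<^sup>2"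
        by (simp add: power_mult_distrib)
      moreover have "(9 / 256)\<^sup>2 * m \<le> (plateau n r)\<^sup>2 * (norm (real_spinor u1 u2 r))\<^sup>2"
        using plateau_bounds(5)[OF n, of r] r u_lower[of r] m by (intro mult_mono power_mono) auto
      ultimately show "(9 / 256)\<^sup>2 * m \<le> (norm (f r))\<^sup>2" by simp
    qed
    also have "\<dots> \<le> (L2_norm f)\<^sup>2"
      by (rule integral_interval_le_L2_norm(1)[OF fL2]) (use n0 in simp)
    also have "\<dots> \<le> C\<^sup>2 * (L2_norm e)\<^sup>2" by (rule le)
    also have "\<dots> \<le> C\<^sup>2 * (?K\<^sup>2 / n)"
    proof (rule mult_left_mono)
      have sets: "{n..2 * n} \<in> sets half_line" using n0 by (auto simp: sets_restrict_space_iff)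
      have meas: "emeasure half_line {n..2 * n} = ennreal n"
        using n0 by (subst emeasure_restrict_space) auto
      have "(L2_norm e)\<^sup>2 \<le> (LINT r|half_line. (?K / n)\<^sup>2 * indicator {n..2 * n} r)"
        unfolding L2_norm_sq
      proof (rule integral_mono_AE[OF L2_spaceD(2)[OF eL2]])
        show "integrable half_line (\<lambda>r. (?K / n)\<^sup>2 * indicator {n..2 * n} r)"
          using sets meas by (intro integrable_mult_right integrable_real_indicator) auto
        have "(norm (e r))\<^sup>2 \<le> (?K / n)\<^sup>2 * indicator {n..2 * n} r" if r: "0 < r" for r
        proof (cases "r \<in> {n..2 * n}")
          case True
          have sw: "norm (real_spinor (\<lambda>r. - u2 r) u1 r) = norm (real_spinor u1 u2 r)"
            "norm (real_spinor u2 u1 r) = norm (real_spinor u1 u2 r)"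
            by (simp_all add: norm_real_spinor add.commute)
          have "e r = plateau_deriv n r *\<^sub>R real_spinor (\<lambda>r. - u2 r) u1 r
              + (plateau n r * (\<kappa> / r)) *\<^sub>R real_spinor u2 u1 r + (plateau n r * (c / r)) *\<^sub>R real_spinor u1 u2 r"
            unfolding e_def real_spinor_def by (simp add: algebra_simps)
          then have "norm (e r) \<le> norm (plateau_deriv n r *\<^sub>R real_spinor (\<lambda>r. - u2 r) u1 r)
              + norm ((plateau n r * (\<kappa> / r)) *\<^sub>R real_spinor u2 u1 r) + norm ((plateau n r * (c / r)) *\<^sub>R real_spinor u1 u2 r)"
            by (simp only:) (rule order_trans[OF norm_triangle_ineq add_right_mono[OF norm_triangle_ineq]])
          also have "\<dots> = \<bar>plateau_deriv n r\<bar> * norm (real_spinor u1 u2 r)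
              + \<bar>plateau n r * (\<kappa> / r)\<bar> * norm (real_spinor u1 u2 r) + \<bar>plateau n r * (c / r)\<bar> * norm (real_spinor u1 u2 r)"
            by (simp only: norm_scaleR sw)
          also have "\<dots> \<le> 1 / n * M + (\<bar>\<kappa>\<bar> / n) * M + (\<bar>c\<bar> / n) * M"
          proof -
            have "\<bar>plateau n r * (x / r)\<bar> \<le> \<bar>x\<bar> / n" for x
            proof -
              have "\<bar>x\<bar> / r \<le> \<bar>x\<bar> / n" using True n0 by (intro divide_left_mono) auto
              then have "plateau n r * (\<bar>x\<bar> / r) \<le> 1 * (\<bar>x\<bar> / n)"
                using plateau_bounds(2,3)[OF n, of r] r by (intro mult_mono) auto
              then show ?thesis using plateau_bounds(2)[OF n, of r] r by (simp add: abs_mult)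
            qed
            then show ?thesis
              using plateau_bounds(4)[OF n, of r] u_upper[of r] n0 by (intro add_mono mult_mono) auto
          qed
          also have "\<dots> = ?K / n" by (simp add: add_divide_distrib algebra_simps)
          finally have "(norm (e r))\<^sup>2 \<le> (?K / n)\<^sup>2" by (intro power_mono) auto
          with True show ?thesis by simp
        next
          case False
          then show ?thesis using out(2)[of r] by auto
        qed
        then show "AE r in half_line. (norm (e r))\<^sup>2 \<le> (?K / n)\<^sup>2 * indicator {n..2 * n} r"
          by (intro AE_I2) (simp add: space_restrict_space)
      qed
      also have "\<dots> = (?K / n)\<^sup>2 * n"
      proof -
        have "{n..2 * n} \<inter> space half_line = {n..2 * n}" using n0 by (auto simp: space_restrict_space)
        then have "(LINT r|half_line. indicator {n..2 * n} r) = n" using n0 meas by (simp add: measure_def)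
        then show ?thesis by simp
      qed
      also have "\<dots> = ?K\<^sup>2 / n" using n0 by (simp add: power_divide power2_eq_square)
      finally show "(L2_norm e)\<^sup>2 \<le> ?K\<^sup>2 / n" .
    qed simp
    finally show ?thesis .
  qed
  define A where "A = (9 / 256)\<^sup>2 * m / 2"
  define B where "B = C\<^sup>2 * ((1 + \<bar>\<kappa>\<bar> + \<bar>c\<bar>) * M)\<^sup>2"
  have A: "0 < A" using m by (simp add: A_def)
  have B: "0 \<le> B" by (simp add: B_def)
  have AB: "A * n \<le> B" if n: "1 \<le> n" for n :: real
  proof -
    have "A * n \<le> B / n" using main[OF n] by (simp add: A_def B_def)
    also have "\<dots> \<le> B" using n B by (simp add: divide_le_eq mult_le_cancel_left1)
    finally show ?thesis .
  qed
  \<comment> \<open>Any n above B/A contradicts the linear bound; the 1 added also secures n >=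
    1.\<close>
  have "A * (B / A + 1) \<le> B" using A B by (intro AB) simp
  then show False using A by (simp add: distrib_left)
qed

text \<open>An eigenfunction violates the norm estimate in \<open>resolvent_set\<close>.\<close>

lemma eigenvalue_in_spectrum:
  assumes "eigenvalue (dirac_op_dist \<kappa> c) z"
  shows "z \<in> spectrum (dirac_op_dist \<kappa> c)"
proof (rule ccontr)
  assume "z \<notin> spectrum (dirac_op_dist \<kappa> c)"
  then obtain C where C: "\<And>f g. (f, g) \<in> dirac_op_dist \<kappa> c \<Longrightarrow> L2_norm f \<le> C * L2_norm (\<lambda>r. g r - z *s f r)"
    unfolding spectrum_def resolvent_set_def by blast
  obtain f g where fg: "(f, g) \<in> dirac_op_dist \<kappa> c" and nz: "\<not> (AE r in half_line. f r = 0)"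
    and gz: "AE r in half_line. g r = z *s f r"
    using assms unfolding eigenvalue_def by blast
  have f: "f \<in> L2_space" using fg by (simp add: dirac_op_dist_def)
  have "(LINT r|half_line. (norm (g r - z *s f r))\<^sup>2) = 0"
    by (rule integral_eq_zero_AE) (use gz in eventually_elim, simp)
  then have "L2_norm (\<lambda>r. g r - z *s f r) = 0" by (simp add: L2_norm_def)
  then have "(L2_norm f)\<^sup>2 = 0" using C[OF fg] L2_norm_nonneg[of f] by simp
  then have "AE r in half_line. (norm (f r))\<^sup>2 = 0"
    unfolding L2_norm_sq using integral_nonneg_eq_0_iff_AE[OF L2_spaceD(2)[OF f]] by simp
  then have "AE r in half_line. f r = 0" by eventually_elim simp
  with nz show False by simp
qed

end

text \<open>Isolation places the two end values at a = 0 strictly inside the intervals adjacent to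
  the multiple of pi attained at \<open>l\<^sub>0\<close> or, if none is attained, inside one common
  interval. Strict inequalities survive small a; monotonicity and the intermediate value theorem
  then count the crossings. Continuity in a enters at the two end points alone, so no uniformity in
  l is involved.\<close>

lemma matching_count_stable:
  fixes \<Theta> :: "real \<Rightarrow> real \<Rightarrow> real" and p l\<^sub>0 q :: real
  defines "E a l \<equiv> \<exists>n::int. \<Theta> l a = of_int n * pi"
  assumes pq: "p < l\<^sub>0" "l\<^sub>0 < q"
    and dec: "\<And>l l' a. p \<le> l \<Longrightarrow> l < l' \<Longrightarrow> l' \<le> q \<Longrightarrow> -1 \<le> a \<Longrightarrow> a \<le> 0 \<Longrightarrow> \<Theta> l' a < \<Theta> l a"
    and cont: "\<And>a. -1 \<le> a \<Longrightarrow> a \<le> 0 \<Longrightarrow> continuous_on {p..q} (\<lambda>l. \<Theta> l a)"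
    and lim: "\<And>l e. l \<in> {p, q} \<Longrightarrow> 0 < e \<Longrightarrow> \<exists>d>0. \<forall>a. - d < a \<longrightarrow> -1 \<le> a \<longrightarrow> a \<le> 0 \<longrightarrow> \<bar>\<Theta> l 0 - \<Theta> l a\<bar> < e"
    and iso: "\<And>l. p \<le> l \<Longrightarrow> l \<le> q \<Longrightarrow> l \<noteq> l\<^sub>0 \<Longrightarrow> \<not> E 0 l"
  shows "\<exists>\<delta>>0. \<forall>a\<in>{-\<delta><..<0}. -1 \<le> a \<and> (E 0 l\<^sub>0 \<longrightarrow> (\<exists>!l. l \<in> {p<..<q} \<and> E a l)) \<and>
    (\<not> E 0 l\<^sub>0 \<longrightarrow> \<not> (\<exists>l. l \<in> {p<..<q} \<and> E a l))"
proof -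
  have ivt: "\<exists>l\<ge>p'. l \<le> q' \<and> \<Theta> l a = y" if "\<Theta> q' a \<le> y" "y \<le> \<Theta> p' a" "p \<le> p'" "p' \<le> q'" "q' \<le> q" "-1 \<le> a" "a \<le> 0"
    for p' q' y a
    by (rule IVT2'[of "\<lambda>l. \<Theta> l a"]) (use that in \<open>auto intro: continuous_on_subset[OF cont]\<close>)
  have close: "\<exists>\<delta>>0. \<forall>a\<in>{-\<delta><..<0}. -1 \<le> a \<and> x < \<Theta> q a \<and> \<Theta> p a < y" if xy: "x < \<Theta> q 0" "\<Theta> p 0 < y" for x y
  proof -
    obtain d1 where d1: "0 < d1" "\<And>a. - d1 < a \<Longrightarrow> -1 \<le> a \<Longrightarrow> a \<le> 0 \<Longrightarrow> \<bar>\<Theta> q 0 - \<Theta> q a\<bar> < \<Theta> q 0 - x"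
      using lim[of q "\<Theta> q 0 - x"] xy by auto
    obtain d2 where d2: "0 < d2" "\<And>a. - d2 < a \<Longrightarrow> -1 \<le> a \<Longrightarrow> a \<le> 0 \<Longrightarrow> \<bar>\<Theta> p 0 - \<Theta> p a\<bar> < y - \<Theta> p 0"
      using lim[of p "y - \<Theta> p 0"] xy by auto
    show ?thesis
    proof (intro exI[of _ "min 1 (min d1 d2)"] conjI ballI)
      fix a assume a: "a \<in> {- min 1 (min d1 d2)<..<0}"
      then have b: "- d1 < a" "- d2 < a" "-1 \<le> a" "a \<le> 0" by (auto simp: min_def split: if_splits)
      show "-1 \<le> a" by (rule b)
      show "x < \<Theta> q a" using d1(2)[OF b(1,3,4)] by linarith
      show "\<Theta> p a < y" using d2(2)[OF b(2-4)] by linarith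
    qed (use d1 d2 in auto)
  qed
  have int_less: "m < n" if "of_int m * pi < of_int n * pi" for m n :: int using that by simp
  show ?thesis
  proof (cases "E 0 l\<^sub>0")
    case True
    then obtain k :: int where k: "\<Theta> l\<^sub>0 0 = of_int k * pi" unfolding E_def by blast
    \<comment> \<open>Otherwise the next multiple of pi would be attained between p and
      \<open>l\<^sub>0\<close>, against isolation.\<close>
    have above: "\<Theta> p 0 < of_int (k + 1) * pi"
    proof (rule ccontr)
      assume "\<not> \<Theta> p 0 < of_int (k + 1) * pi"
      moreover have "of_int k * pi \<le> of_int (k + 1) * pi" by simp
      ultimately obtain l where l: "p \<le> l" "l \<le> l\<^sub>0" "\<Theta> l 0 = of_int (k + 1) * pi"
        using ivt[of l\<^sub>0 0 "of_int (k + 1) * pi" p] pq k by auto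
      have "E 0 l" using l(3) unfolding E_def by blast
      moreover have "l \<noteq> l\<^sub>0" using k l(3) by auto
      ultimately show False using iso[of l] l pq by auto
    qed
    have below: "of_int (k - 1) * pi < \<Theta> q 0"
    proof (rule ccontr)
      assume "\<not> of_int (k - 1) * pi < \<Theta> q 0"
      moreover have "of_int (k - 1) * pi \<le> of_int k * pi" by simp
      ultimately obtain l where l: "l\<^sub>0 \<le> l" "l \<le> q" "\<Theta> l 0 = of_int (k - 1) * pi"
        using ivt[of q 0 "of_int (k - 1) * pi" l\<^sub>0] pq k by auto
      have "E 0 l" using l(3) unfolding E_def by blast
      moreover have "l \<noteq> l\<^sub>0" using k l(3) by auto
      ultimately show False using iso[of l] l pq by auto
    qed
    have "\<Theta> q 0 < of_int k * pi" "of_int k * pi < \<Theta> p 0"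
      using dec[of l\<^sub>0 q 0] dec[of p l\<^sub>0 0] pq k by auto
    from close[OF below above] obtain \<delta>1 where
      \<delta>1: "\<delta>1 > 0" "\<And>a. a \<in> {-\<delta>1<..<0} \<Longrightarrow> -1 \<le> a \<and> of_int (k - 1) * pi < \<Theta> q a \<and> \<Theta> p a < of_int (k + 1) * pi"
      by blast
    obtain e1 where e1: "0 < e1" "\<And>a. - e1 < a \<Longrightarrow> -1 \<le> a \<Longrightarrow> a \<le> 0 \<Longrightarrow> \<bar>\<Theta> q 0 - \<Theta> q a\<bar> < of_int k * pi - \<Theta> q 0"
      using lim[of q "of_int k * pi - \<Theta> q 0"] \<open>\<Theta> q 0 < of_int k * pi\<close> by auto
    obtain e2 where e2: "0 < e2" "\<And>a. - e2 < a \<Longrightarrow> -1 \<le> a \<Longrightarrow> a \<le> 0 \<Longrightarrow> \<bar>\<Theta> p 0 - \<Theta> p a\<bar> < \<Theta> p 0 - of_int k * pi"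
      using lim[of p "\<Theta> p 0 - of_int k * pi"] \<open>of_int k * pi < \<Theta> p 0\<close> by auto
    show ?thesis
    proof (intro exI[of _ "min \<delta>1 (min e1 e2)"] conjI ballI impI)
      show "0 < min \<delta>1 (min e1 e2)" using \<delta>1 e1 e2 by simp
      fix a assume a: "a \<in> {- min \<delta>1 (min e1 e2)<..<0}"
      then have m: "a \<in> {-\<delta>1<..<0}" "- e1 < a" "- e2 < a" by (auto simp: min_def split: if_splits)
      have b: "-1 \<le> a" "of_int (k - 1) * pi < \<Theta> q a" "\<Theta> p a < of_int (k + 1) * pi" using \<delta>1(2)[OF m(1)] by blast+
      show "-1 \<le> a" by (rule b)
      have "a \<le> 0" using a by simp
      then have c: "\<Theta> q a < of_int k * pi" "of_int k * pi < \<Theta> p a"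
        using e1(2)[OF m(2) b(1)] e2(2)[OF m(3) b(1)] by linarith+
      then obtain l where l: "p \<le> l" "l \<le> q" "\<Theta> l a = of_int k * pi"
        using ivt[of q a "of_int k * pi" p] pq a b(1) by auto
      have lin: "l \<in> {p<..<q}" using l c by (auto simp: less_le)
      show "\<exists>!l. l \<in> {p<..<q} \<and> E a l"
      proof (rule ex1I[of _ l])
        show "l \<in> {p<..<q} \<and> E a l" using lin l unfolding E_def by blast
        fix l' assume l': "l' \<in> {p<..<q} \<and> E a l'"
        then obtain n :: int where n: "\<Theta> l' a = of_int n * pi" unfolding E_def by blast
        have "\<Theta> q a < \<Theta> l' a" "\<Theta> l' a < \<Theta> p a" using dec[of l' q a] dec[of p l' a] l' a b(1) by auto
        then have "of_int (k - 1) * pi < of_int n * pi" "of_int n * pi < of_int (k + 1) * pi" using b n by linarith+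
        then have "k - 1 < n" "n < k + 1" using int_less by blast+
        then have "\<Theta> l' a = \<Theta> l a" using n l by simp
        then show "l' = l" using dec[of l l' a] dec[of l' l a] l' lin a b(1) by (cases l l' rule: linorder_cases) auto
      qed
    qed (use True in auto)
  next
    case False
    \<comment> \<open>All values on [p, q] lie between the same two consecutive multiples of pi; the
      floor finds these from the value at q.\<close>
    define k where "k = \<lfloor>\<Theta> q 0 / pi\<rfloor>"
    have noE: "\<not> E 0 l" if "p \<le> l" "l \<le> q" for l using iso[of l] False that by blast
    have "of_int k * pi \<le> \<Theta> q 0" "\<Theta> q 0 < of_int (k + 1) * pi"
      using floor_correct[of "\<Theta> q 0 / pi"] unfolding k_def
      by (simp_all only: pos_le_divide_eq[OF pi_gt_zero] pos_divide_less_eq[OF pi_gt_zero] of_int_add of_int_1)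
    moreover have "\<Theta> q 0 \<noteq> of_int k * pi" using noE[of q] pq unfolding E_def by auto
    ultimately have k: "of_int k * pi < \<Theta> q 0" "\<Theta> q 0 < of_int (k + 1) * pi" by auto
    have "\<Theta> p 0 < of_int (k + 1) * pi"
    proof (rule ccontr)
      assume "\<not> \<Theta> p 0 < of_int (k + 1) * pi"
      then obtain l where "p \<le> l" "l \<le> q" "\<Theta> l 0 = of_int (k + 1) * pi"
        using ivt[of q 0 "of_int (k + 1) * pi" p] pq k by auto
      then show False using noE[of l] unfolding E_def by blast
    qed
    from close[OF k(1) this] obtain \<delta> where \<delta>: "\<delta> > 0"
      "\<And>a. a \<in> {-\<delta><..<0} \<Longrightarrow> -1 \<le> a \<and> of_int k * pi < \<Theta> q a \<and> \<Theta> p a < of_int (k + 1) * pi" by blast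
    show ?thesis
    proof (intro exI[of _ \<delta>] conjI ballI impI notI)
      fix a assume a: "a \<in> {- \<delta><..<0}"
      note b = \<delta>(2)[OF a]
      show "-1 \<le> a" using b by simp
      assume "\<exists>l. l \<in> {p<..<q} \<and> E a l"
      then obtain l and n :: int where l: "l \<in> {p<..<q}" and n: "\<Theta> l a = of_int n * pi" unfolding E_def by blast
      have "\<Theta> q a < \<Theta> l a" "\<Theta> l a < \<Theta> p a" using dec[of l q a] dec[of p l a] l a b by auto
      then have "of_int k * pi < of_int n * pi" "of_int n * pi < of_int (k + 1) * pi" using b n by linarith+
      then have "k < n" "n < k + 1" using int_less by blast+
      then show False by simp
    qed (use \<delta> False in auto)
  qed
qed

theorem theorem1p1:
  fixes \<kappa> :: int and c l\<^sub>0 \<epsilon> :: real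
  assumes "\<kappa> < 0"
    and "real_of_int \<kappa> < c" and "c < 0"
    and "0 < \<epsilon>"
    and "\<epsilon> < 1 / 2 * infdist (complex_of_real l\<^sub>0)
                (spectrum (dirac_op_dist \<kappa> c) - {complex_of_real l\<^sub>0})"
  shows "\<exists>\<delta>>0. \<forall>a \<in> {-\<delta><..<0}.
      (eigenvalue (dirac_op_dist \<kappa> c) l\<^sub>0 \<longrightarrow>
         (\<exists>!l::real. l \<in> {l\<^sub>0 - \<epsilon><..<l\<^sub>0 + \<epsilon>} \<and> eigenvalue (dirac_op \<kappa> c a) l)) \<and>
      (\<not> eigenvalue (dirac_op_dist \<kappa> c) l\<^sub>0 \<longrightarrow>
         \<not> (\<exists>l::real. l \<in> {l\<^sub>0 - \<epsilon><..<l\<^sub>0 + \<epsilon>} \<and> eigenvalue (dirac_op \<kappa> c a) l))"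
proof -
  interpret coulomb_dirac "real_of_int \<kappa>" c by standard (use assms(1-3) in auto)
  let ?S = "spectrum (dirac_op_dist \<kappa> c)"
  have far: "2 * \<epsilon> < \<bar>l - l\<^sub>0\<bar>" if "complex_of_real l \<in> ?S" "l \<noteq> l\<^sub>0" for l
  proof -
    have "infdist (complex_of_real l\<^sub>0) (?S - {complex_of_real l\<^sub>0}) \<le> dist (complex_of_real l\<^sub>0) (complex_of_real l)"
      by (rule infdist_le) (use that in simp)
    also have "\<dots> = \<bar>l - l\<^sub>0\<bar>" by (simp add: dist_norm abs_minus_commute flip: of_real_diff)
    finally show ?thesis using assms(5) by simp
  qed
  define L where "L = \<bar>l\<^sub>0\<bar> + \<epsilon>"
  have L: "0 \<le> L" "L < 1"
  proof -
    show "0 \<le> L" using assms(4) by (simp add: L_def)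
    show "L < 1"
    proof (rule ccontr)
      assume "\<not> L < 1"
      \<comment> \<open>The point at distance exactly 2\<epsilon> from \<open>l\<^sub>0\<close>, on
        the side away from 0. If L were at least 1, its modulus would exceed 1 and it would lie in
        the spectrum, although all other spectral points are farther than 2\<epsilon> away.\<close>
      define \<mu> where "\<mu> = (if 0 \<le> l\<^sub>0 then l\<^sub>0 + 2 * \<epsilon> else l\<^sub>0 - 2 * \<epsilon>)"
      have "1 < \<bar>\<mu>\<bar>" using \<open>\<not> L < 1\<close> assms(4) by (auto simp: \<mu>_def L_def)
      then have "2 * \<epsilon> < \<bar>\<mu> - l\<^sub>0\<bar>" using assms(4) by (intro far essential_spectrum) (auto simp: \<mu>_def)
      then show False using assms(4) by (auto simp: \<mu>_def split: if_splits)
    qed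
  qed
  obtain XL XR T where
    XL: "\<And>l a t. \<bar>l\<bar> \<le> L \<Longrightarrow> -1 \<le> a \<Longrightarrow> a \<le> 0 \<Longrightarrow> (XL l a has_real_derivative prufer l a t (XL l a t)) (at t)"
    and XR: "\<And>l a t. \<bar>l\<bar> \<le> L \<Longrightarrow> -1 \<le> a \<Longrightarrow> a \<le> 0 \<Longrightarrow> (XR l a has_real_derivative prufer l a t (XR l a t)) (at t)"
    and bL: "\<And>l a t. \<bar>l\<bar> \<le> L \<Longrightarrow> -1 \<le> a \<Longrightarrow> a \<le> 0 \<Longrightarrow> t \<le> - T \<Longrightarrow> - band_angle \<le> XL l a t \<and> XL l a t \<le> 0"
    and bR: "\<And>l a t. \<bar>l\<bar> \<le> L \<Longrightarrow> -1 \<le> a \<Longrightarrow> a \<le> 0 \<Longrightarrow> T \<le> t \<Longrightarrow> prufer_rate a t (XR l a t) \<le> - 2"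
    and dec: "\<And>l l' a. \<bar>l\<bar> \<le> L \<Longrightarrow> \<bar>l'\<bar> \<le> L \<Longrightarrow> -1 \<le> a \<Longrightarrow> a \<le> 0 \<Longrightarrow> l < l' \<Longrightarrow>
      XL l' a 0 - XR l' a 0 < XL l a 0 - XR l a 0"
    and cont: "\<And>l a e. \<bar>l\<bar> \<le> L \<Longrightarrow> -1 \<le> a \<Longrightarrow> a \<le> 0 \<Longrightarrow> 0 < e \<Longrightarrow>
      \<exists>d>0. \<forall>l' a'. \<bar>l'\<bar> \<le> L \<longrightarrow> -1 \<le> a' \<longrightarrow> a' \<le> 0 \<longrightarrow> \<bar>l - l'\<bar> + \<bar>a - a'\<bar> < d \<longrightarrow>
        \<bar>(XL l a 0 - XR l a 0) - (XL l' a' 0 - XR l' a' 0)\<bar> < e"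
    by (rule prufer_angles[OF L]) blast
  define \<Theta> where "\<Theta> l a = XL l a 0 - XR l a 0" for l a
  define E where "E a l \<longleftrightarrow> (\<exists>n::int. \<Theta> l a = of_int n * pi)" for a l
  have neg: "eigenvalue (dirac_op \<kappa> c a) (complex_of_real l) \<longleftrightarrow> E a l"
    if la: "\<bar>l\<bar> \<le> L" "-1 \<le> a" "a < 0" for l a
  proof -
    have a: "a \<le> 0" using la by simp
    obtain R where R: "polar_solution l a (XL l a) R" by (rule polar_solution_exists[OF XL[OF la(1,2) a]])
    obtain R' where R': "polar_solution l a (XR l a) R'" by (rule polar_solution_exists[OF XR[OF la(1,2) a]])
    show ?thesis unfolding E_def \<Theta>_def
      by (rule eigenvalue_iff_matching_neg[OF la(3) R bL[OF la(1,2) a] R' bR[OF la(1,2) a]])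
  qed
  have zero: "eigenvalue (dirac_op_dist \<kappa> c) (complex_of_real l) \<longleftrightarrow> E 0 l"
    if l: "\<bar>l\<bar> \<le> L" for l
  proof -
    have a: "-1 \<le> (0::real)" "(0::real) \<le> 0" by auto
    obtain R where R: "polar_solution l 0 (XL l 0) R" by (rule polar_solution_exists[OF XL[OF l a]])
    obtain R' where R': "polar_solution l 0 (XR l 0) R'" by (rule polar_solution_exists[OF XR[OF l a]])
    have l1: "\<bar>l\<bar> < 1" using l L by simp
    show ?thesis unfolding E_def \<Theta>_def
      using eigenvalue_dist_if_matching[OF R bL[OF l a] R' bR[OF l a]]
        matching_if_eigenvalue_dist[OF l1 R bL[OF l a] R' bR[OF l a]] by blast
  qed
  have lL: "\<bar>l\<bar> \<le> L" if "l\<^sub>0 - \<epsilon> \<le> l" "l \<le> l\<^sub>0 + \<epsilon>" for l using that by (auto simp: L_def)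
  have "\<exists>\<delta>>0. \<forall>a\<in>{-\<delta><..<0}. -1 \<le> a \<and>
    (E 0 l\<^sub>0 \<longrightarrow> (\<exists>!l. l \<in> {l\<^sub>0 - \<epsilon><..<l\<^sub>0 + \<epsilon>} \<and> E a l)) \<and>
    (\<not> E 0 l\<^sub>0 \<longrightarrow> \<not> (\<exists>l. l \<in> {l\<^sub>0 - \<epsilon><..<l\<^sub>0 + \<epsilon>} \<and> E a l))"
    unfolding E_def
  proof (rule matching_count_stable)
    show "l\<^sub>0 - \<epsilon> < l\<^sub>0" "l\<^sub>0 < l\<^sub>0 + \<epsilon>" using assms(4) by auto
    show "\<Theta> l' a < \<Theta> l a" if "l\<^sub>0 - \<epsilon> \<le> l" "l < l'" "l' \<le> l\<^sub>0 + \<epsilon>" "-1 \<le> a" "a \<le> 0" for l l' a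
      unfolding \<Theta>_def by (rule dec) (use that lL in auto)
    show "continuous_on {l\<^sub>0 - \<epsilon>..l\<^sub>0 + \<epsilon>} (\<lambda>l. \<Theta> l a)" if a: "-1 \<le> a" "a \<le> 0" for a
      unfolding continuous_on_iff
    proof (intro ballI allI impI)
      fix l e assume l: "l \<in> {l\<^sub>0 - \<epsilon>..l\<^sub>0 + \<epsilon>}" and e: "0 < (e::real)"
      then have "\<bar>l\<bar> \<le> L" using lL by simp
      from cont[OF this a e] obtain d where d: "d > 0" "\<And>l'. \<bar>l'\<bar> \<le> L \<Longrightarrow> \<bar>l - l'\<bar> < d \<Longrightarrow> \<bar>\<Theta> l a - \<Theta> l' a\<bar> < e"
        unfolding \<Theta>_def using a by force
      show "\<exists>d>0. \<forall>x'\<in>{l\<^sub>0 - \<epsilon>..l\<^sub>0 + \<epsilon>}. dist x' l < d \<longrightarrow> dist (\<Theta> x' a) (\<Theta> l a) < e"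
        using d lL by (intro exI[of _ d]) (auto simp: dist_real_def abs_minus_commute)
    qed
    show "\<exists>d>0. \<forall>a. - d < a \<longrightarrow> -1 \<le> a \<longrightarrow> a \<le> 0 \<longrightarrow> \<bar>\<Theta> l 0 - \<Theta> l a\<bar> < e"
      if l: "l \<in> {l\<^sub>0 - \<epsilon>, l\<^sub>0 + \<epsilon>}" and e: "0 < e" for l e
    proof -
      have lL': "\<bar>l\<bar> \<le> L" using l lL assms(4) by auto
      from cont[OF lL', of 0 e] e obtain d where d: "d > 0"
        "\<And>l' a'. \<bar>l'\<bar> \<le> L \<Longrightarrow> -1 \<le> a' \<Longrightarrow> a' \<le> 0 \<Longrightarrow> \<bar>l - l'\<bar> + \<bar>0 - a'\<bar> < d \<Longrightarrow> \<bar>\<Theta> l 0 - \<Theta> l' a'\<bar> < e"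
        unfolding \<Theta>_def by auto
      show ?thesis using d(1) d(2)[OF lL'] by (intro exI[of _ d]) auto
    qed
    show "\<not> (\<exists>n::int. \<Theta> l 0 = of_int n * pi)" if l: "l\<^sub>0 - \<epsilon> \<le> l" "l \<le> l\<^sub>0 + \<epsilon>" "l \<noteq> l\<^sub>0" for l
    proof
      assume "\<exists>n::int. \<Theta> l 0 = of_int n * pi"
      then have "E 0 l" unfolding E_def .
      then have "complex_of_real l \<in> ?S" using zero[OF lL[OF l(1,2)]] by (intro eigenvalue_in_spectrum) blast
      from far[OF this l(3)] l assms(4) show False by auto
    qed
  qed
  then obtain \<delta> where \<delta>: "\<delta> > 0" and main: "\<forall>a\<in>{-\<delta><..<0}. -1 \<le> a \<and>
    (E 0 l\<^sub>0 \<longrightarrow> (\<exists>!l. l \<in> {l\<^sub>0 - \<epsilon><..<l\<^sub>0 + \<epsilon>} \<and> E a l)) \<and>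
    (\<not> E 0 l\<^sub>0 \<longrightarrow> \<not> (\<exists>l. l \<in> {l\<^sub>0 - \<epsilon><..<l\<^sub>0 + \<epsilon>} \<and> E a l))"
    by (elim exE conjE) (rule that)
  have "\<bar>l\<^sub>0\<bar> \<le> L" using assms(4) by (simp add: L_def)
  note zero0 = zero[OF this]
  show ?thesis
  proof (intro exI[of _ \<delta>] conjI \<delta> ballI)
    fix a assume a: "a \<in> {-\<delta><..<0}"
    note M = bspec[OF main a]
    \<comment> \<open>The bound -1 <= a carried along in \<open>main\<close> puts a into the range
      where the angles were constructed.\<close>
    have eq: "l \<in> {l\<^sub>0 - \<epsilon><..<l\<^sub>0 + \<epsilon>} \<and> eigenvalue (dirac_op \<kappa> c a) (complex_of_real l)
        \<longleftrightarrow> l \<in> {l\<^sub>0 - \<epsilon><..<l\<^sub>0 + \<epsilon>} \<and> E a l" for l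
      using neg[of l a] lL[of l] conjunct1[OF M] a by auto
    show "eigenvalue (dirac_op_dist \<kappa> c) l\<^sub>0 \<longrightarrow>
         (\<exists>!l::real. l \<in> {l\<^sub>0 - \<epsilon><..<l\<^sub>0 + \<epsilon>} \<and> eigenvalue (dirac_op \<kappa> c a) l)"
      unfolding eq zero0 using M by blast
    show "\<not> eigenvalue (dirac_op_dist \<kappa> c) l\<^sub>0 \<longrightarrow>
         \<not> (\<exists>l::real. l \<in> {l\<^sub>0 - \<epsilon><..<l\<^sub>0 + \<epsilon>} \<and> eigenvalue (dirac_op \<kappa> c a) l)"
      unfolding eq zero0 using M by blast
  qed
qed

end
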